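(* Let $N\ge1$ be an integer and let $\theta=\arg\nu$. (i) Suppose $|\theta|<\frac{\pi}{2}$, and put $c(\theta)=|\csc(2\theta)|$ if $\frac{\pi}{4}<|\theta|<\frac{\pi}{2}$ and $c(\theta)=1$ if $|\theta|\le\frac{\pi}{4}$. Then $$\left|R_N^{(Y')}(\nu)\right|\le\frac{d_N(\nu)}{2\pi}c(\theta)\ \text{ if }N\equiv0\bmod3;\qquad\left|R_N^{(Y')}(\nu)\right|\le\frac{d_N(\nu)+d_{N+2}(\nu)}{2\pi}c(\theta)\ \text{ if }N\equiv1\bmod3;$$ $$\left|R_N^{(Y')}(\nu)\right|\le\frac{d_{N+1}(\nu)}{2\pi}c(\theta)\ \text{ if }N\equiv2\bmod3.$$ (ii) Suppose $\nu>0$. Then there are numbers $0<\Xi_1,\Xi_2,\Xi_3<1$ depending on $\nu$ and $N$ such that $$(-1)^{N+1}R_N^{(Y')}(\nu)=\frac{d_N(\nu)}{2\pi}\Xi_1-\frac{d_{N+1}(\nu)}{2\pi}\Xi_2\ \text{ if }N\equiv0\bmod3;\qquad(-1)^{N+1}R_N^{(Y')}(\nu)=\frac{d_N(\nu)}{2\pi}\Xi_1+\frac{d_{N+2}(\nu)}{2\pi}\Xi_3\ \text{ if }N\equiv1\bmod3;$$ $$(-1)^NR_N^{(Y')}(\nu)=\frac{d_{N+1}(\nu)}{2\pi}\Xi_2-\frac{d_{N+2}(\nu)}{2\pi}\Xi_3\ \text{ if }N\equiv2\bmod3.$$ In particular, for $\nu>0$, $$Y'_\nu(\nu)>\frac{3^{\frac23}\Gamma\left(\frac23\right)}{2^{\frac13}\pi\nu^{\frac23}}.$$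 (iii) Suppose $\frac{\pi}{4}<|\theta|<\pi$. Let $\varphi^\ast,\varphi^{\ast\ast},\varphi^{\ast\ast\ast}$ be the unique solutions in the interval $I_\theta$ of $$(2N+8)\cos(3\varphi^\ast-2\theta)=(2N-4)\cos(\varphi^\ast-2\theta),$$ $$(2N+10)\cos(3\varphi^{\ast\ast}-2\theta)=(2N-2)\cos(\varphi^{\ast\ast}-2\theta),$$ $$(2N+12)\cos(3\varphi^{\ast\ast\ast}-2\theta)=2N\cos(\varphi^{\ast\ast\ast}-2\theta).$$ Then $$\left|R_N^{(Y')}(\nu)\right|\le\frac{|\csc(2(\theta-\varphi^\ast))|}{\cos^{\frac{2N+2}{3}}\varphi^\ast}\frac{d_N(\nu)}{2\pi}\quad\text{if }N\equiv0\bmod3;$$ $$\left|R_N^{(Y')}(\nu)\right|\le\frac{|\csc(2(\theta-\varphi^\ast))|}{\cos^{\frac{2N+2}{3}}\varphi^\ast}\frac{d_N(\nu)}{2\pi}+\frac{|\csc(2(\theta-\varphi^{\ast\ast\ast}))|}{\cos^{\frac{2N+6}{3}}\varphi^{\ast\ast\ast}}\frac{d_{N+2}(\nu)}{2\pi}\quad\text{if }N\equiv1\bmod3;$$ $$\left|R_N^{(Y')}(\nu)\right|\le\frac{|\csc(2(\theta-\varphi^{\ast\ast}))|}{\cos^{\frac{2N+4}{3}}\varphi^{\ast\ast}}\frac{d_{N+1}(\nu)}{2\pi}\quad\text{if }N\equiv2\bmod3.$$ (iv) Suppose $\frac{\pi}{4}<|\theta|\le\frac{\pi}{2}$ and $N\ge4$.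 Then $$\left|R_N^{(Y')}(\nu)\right|\le\frac12\sqrt{\tfrac e3\left(2N+\tfrac{13}2\right)}\frac{d_N(\nu)}{2\pi}\quad\text{if }N\equiv0\bmod3;$$ $$\left|R_N^{(Y')}(\nu)\right|\le\frac12\sqrt{\tfrac e3\left(2N+\tfrac{13}2\right)}\frac{d_N(\nu)}{2\pi}+\frac12\sqrt{\tfrac e3\left(2N+\tfrac{21}2\right)}\frac{d_{N+2}(\nu)}{2\pi}\quad\text{if }N\equiv1\bmod3;$$ $$\left|R_N^{(Y')}(\nu)\right|\le\frac12\sqrt{\tfrac e3\left(2N+\tfrac{17}2\right)}\frac{d_{N+1}(\nu)}{2\pi}\quad\text{if }N\equiv2\bmod3.$$
   Context: $\nu\ne0$ is a complex number with $|\arg\nu|<\pi$, powers $\nu^{k/3}$ being principal. $Y_\nu'(\nu)$ is the derivative of the Bessel function of the second kind $Y_\nu(z)$ with respect to $z$ evaluated at $z=\nu$. The remainder $R_N^{(Y')}(\nu)$ is defined by $$Y'_\nu(\nu)=\frac{2}{3\pi}\sum_{n=0}^{N-1}6^{\frac{2n+2}{3}}D_{2n+1}(0)\sin^2\left(\frac{(2n+2)\pi}{3}\right)\frac{\Gamma\left(\frac{2n+2}{3}\right)}{\nu^{\frac{2n+2}{3}}}+R_N^{(Y')}(\nu),$$ where $D_n(0)=\frac{1}{n!}\left[\frac{d^n}{dt^n}\left(\sinh t\left(\frac16\frac{t^3}{\sinh t-t}\right)^{\frac{n+1}{3}}\right)\right]_{t=0}$ (branch of the power equal to $1$ at $t=0$).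 Notation: $$d_n(\nu)=6^{\frac{2n+2}{3}}|D_{2n+1}(0)|\frac{\Gamma\left(\frac{2n+2}{3}\right)}{|\nu|^{\frac{2n+2}{3}}}.$$ The interval $I_\theta$ is: $\left(-\frac{\pi}{2}+\theta,\frac{\pi}{2}\right)$ if $\frac{3\pi}{4}\le\theta<\pi$; $\left(-\frac{\pi}{2}+\theta,-\frac{\pi}{4}+\theta\right)$ if $\frac{\pi}{2}\le\theta<\frac{3\pi}{4}$; $\left(0,-\frac{\pi}{4}+\theta\right)$ if $\frac{\pi}{4}<\theta<\frac{\pi}{2}$; $\left(-\frac{\pi}{2},\frac{\pi}{2}+\theta\right)$ if $-\pi<\theta\le-\frac{3\pi}{4}$; $\left(\frac{\pi}{4}+\theta,\frac{\pi}{2}+\theta\right)$ if $-\frac{3\pi}{4}<\theta\le-\frac{\pi}{2}$; $\left(\frac{\pi}{4}+\theta,0\right)$ if $-\frac{\pi}{2}<\theta<-\frac{\pi}{4}$. *)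

theory Defs
  imports "HOL-Complex_Analysis.Complex_Analysis"
begin

text \<open>
  Bessel functions of complex order and argument, principal branch (cut along the
  nonpositive real axis). At integer orders the second kind is the limit in the order.
\<close>

definition bessel_J :: "complex \<Rightarrow> complex \<Rightarrow> complex" where
  "bessel_J \<mu> z =
     (z / 2) powr \<mu> * (\<Sum>k. (-1) ^ k * (z / 2) ^ (2 * k) * rGamma (\<mu> + of_nat k + 1) / fact k)"

definition bessel_Y_nonint :: "complex \<Rightarrow> complex \<Rightarrow> complex" where
  "bessel_Y_nonint \<mu> z =
     (bessel_J \<mu> z * cos (of_real pi * \<mu>) - bessel_J (- \<mu>) z) / sin (of_real pi * \<mu>)"

definition bessel_Y :: "complex \<Rightarrow> complex \<Rightarrow> complex" where
  "bessel_Y \<mu> z =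
     (if \<mu> \<in> \<int> then Lim (at \<mu>) (\<lambda>\<mu>'. bessel_Y_nonint \<mu>' z) else bessel_Y_nonint \<mu> z)"

text \<open>\<open>bessel_Y' \<nu>\<close> is \<open>Y'\<^sub>\<nu>(\<nu>)\<close>: the derivative is in the argument, at fixed order.\<close>

definition bessel_Y' :: "complex \<Rightarrow> complex" where
  "bessel_Y' \<nu> = deriv (\<lambda>z. bessel_Y \<nu> z) \<nu>"

text \<open>
  The base of the power has a removable singularity at \<open>t = 0\<close> with value 1, and it is close
  to 1 for small \<open>t\<close>, so that the principal power is the branch equal to 1 at \<open>t = 0\<close>.
\<close>

definition D_base :: "complex \<Rightarrow> complex" where
  "D_base t = (if t = 0 then 1 else 1 / 6 * (t ^ 3 / (sinh t - t)))"

definition D0 :: "nat \<Rightarrow> complex" where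
  "D0 n = 1 / fact n * (deriv ^^ n) (\<lambda>t. sinh t * D_base t powr ((of_nat n + 1) / 3)) 0"

definition remainder_Y' :: "nat \<Rightarrow> complex \<Rightarrow> complex" where
  "remainder_Y' N \<nu> = bessel_Y' \<nu> - 2 / (3 * of_real pi) *
     (\<Sum>n<N. of_real (6 powr ((2 * real n + 2) / 3)) * D0 (2 * n + 1)
            * of_real ((sin ((2 * real n + 2) * pi / 3))\<^sup>2)
            * of_real (Gamma ((2 * real n + 2) / 3)) / \<nu> powr ((2 * of_nat n + 2) / 3))"

definition d_coeff :: "nat \<Rightarrow> complex \<Rightarrow> real" where
  "d_coeff n \<nu> = 6 powr ((2 * real n + 2) / 3) * cmod (D0 (2 * n + 1))
     * (Gamma ((2 * real n + 2) / 3) / cmod \<nu> powr ((2 * real n + 2) / 3))"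

definition csc :: "real \<Rightarrow> real" where
  "csc x = 1 / sin x"

definition c_factor :: "real \<Rightarrow> real" where
  "c_factor \<theta> = (if pi / 4 < \<bar>\<theta>\<bar> \<and> \<bar>\<theta>\<bar> < pi / 2 then \<bar>csc (2 * \<theta>)\<bar> else 1)"

text \<open>Only used for \<open>pi / 4 < \<bar>\<theta>\<bar> < pi\<close>; the final branch is a dummy value.\<close>

definition I_interval :: "real \<Rightarrow> real set" where
  "I_interval \<theta> =
     (if 3 * pi / 4 \<le> \<theta> \<and> \<theta> < pi then {- pi / 2 + \<theta> <..< pi / 2}
      else if pi / 2 \<le> \<theta> \<and> \<theta> < 3 * pi / 4 then {- pi / 2 + \<theta> <..< - pi / 4 + \<theta>}
      else if pi / 4 < \<theta> \<and> \<theta> < pi / 2 then {0 <..< - pi / 4 + \<theta>}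
      else if - pi < \<theta> \<and> \<theta> \<le> - 3 * pi / 4 then {- pi / 2 <..< pi / 2 + \<theta>}
      else if - 3 * pi / 4 < \<theta> \<and> \<theta> \<le> - pi / 2 then {pi / 4 + \<theta> <..< pi / 2 + \<theta>}
      else if - pi / 2 < \<theta> \<and> \<theta> < - pi / 4 then {pi / 4 + \<theta> <..< 0}
      else {})"

definition is_phi1 :: "nat \<Rightarrow> real \<Rightarrow> real \<Rightarrow> bool" where
  "is_phi1 N \<theta> \<phi> \<longleftrightarrow> \<phi> \<in> I_interval \<theta> \<and>
     (2 * real N + 8) * cos (3 * \<phi> - 2 * \<theta>) = (2 * real N - 4) * cos (\<phi> - 2 * \<theta>)"

definition is_phi2 :: "nat \<Rightarrow> real \<Rightarrow> real \<Rightarrow> bool" where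
  "is_phi2 N \<theta> \<phi> \<longleftrightarrow> \<phi> \<in> I_interval \<theta> \<and>
     (2 * real N + 10) * cos (3 * \<phi> - 2 * \<theta>) = (2 * real N - 2) * cos (\<phi> - 2 * \<theta>)"

definition is_phi3 :: "nat \<Rightarrow> real \<Rightarrow> real \<Rightarrow> bool" where
  "is_phi3 N \<theta> \<phi> \<longleftrightarrow> \<phi> \<in> I_interval \<theta> \<and>
     (2 * real N + 12) * cos (3 * \<phi> - 2 * \<theta>) = 2 * real N * cos (\<phi> - 2 * \<theta>)"

end

theory Submission
  imports Defs "HOL-Real_Asymp.Real_Asymp"
begin

text \<open>
  By the Schlaefli integral, \<open>Y'\<^sub>\<nu>(\<nu>)\<close> for \<open>\<nu> > 0\<close> is a combination of the values at \<open>\<zeta> = ln \<nu>\<close> and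
  \<open>\<zeta> = ln \<nu> \<plusminus> \<i> \<pi>\<close> of the entire function \<open>P(\<zeta>)\<close> that continues the saddle point integral
  \<open>\<integral> sinh t exp (- e\<^sup>\<zeta> (sinh t - t)) dt\<close>. On the lines \<open>Im \<zeta> = \<plusminus> 3 \<pi> / 2\<close> the imaginary part of \<open>P\<close> is a
  Laplace transform \<open>h\<close> of a positive function along the curve through the next saddle point
  \<open>\<minusplus> 2 \<pi> \<i>\<close>, and Cauchy's formula in the strip between the lines turns this into a dispersion relation
  for \<open>P\<close>. Comparing its geometric expansion with Watson's lemma expresses the coefficients \<open>D\<^sub>n(0)\<close>
  by moments of \<open>h\<close>, and the remainder becomes \<open>\<integral> h(c n) x\<^sup>N\<^sup>+\<^sup>1 p(x) / (1 + x\<^sup>3) dn / n\<close> with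
  \<open>x = (n / \<mu>)\<^bsup>2/3\<^esup>\<close>, \<open>\<nu> = c \<mu>\<close> and \<open>p\<close> one of \<open>1 - x\<close>, \<open>1 + x\<^sup>2\<close>, \<open>x (x - 1)\<close>. For \<open>\<nu> > 0\<close> positivity of
  \<open>h\<close> gives (ii). Analytic continuation in \<open>c\<close> and \<open>\<mu>\<close> with \<open>arg c = \<phi>\<close>, \<open>arg \<mu> = \<theta> - \<phi>\<close> and
  \<open>\<bar>h(z)\<bar> \<le> h(Re z)\<close> give the other bounds, for every admissible rotation \<open>\<phi>\<close>.
\<close>

text \<open>Since sinh t - t vanishes to third order at t = 0, the saddle there is degenerate and
  the expansion runs in powers of \<nu>^(-2/3). The strip of the dispersion relation is exactly as
  wide as the period 3 pi i of e^(2 \<zeta> / 3): its two edges have the same image, so only the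
  jump of P enters. Under the same map the points ln \<nu> and ln \<nu> \<plusminus> i pi become
  \<nu>^(2/3) times the three cube roots of unity. Adding the three simple fractions gives the
  denominator 1 + x^3; this is the source of the dependence on N mod 3 and of the coefficients sin^2
  that vanish for n = 2 mod 3. No steepest descent path from the origin is followed: in the strip it
  is enough that P is O(1 + e^(- Re \<zeta>)). The other obstacle is the integers. There
  \<open>bessel_Y\<close> is defined by a limit in the order, and analyticity of Y'_\<nu>(\<nu>) is
  shown only off the integers. The continuation takes place outside the countable set of parameters
  that produce an integer \<nu>, which leaves the domain connected. Positive \<nu>, integers
  included, are treated directly.\<close>

abbreviation integrable_Ioi :: "(real \<Rightarrow> 'a::{banach,second_countable_topology}) \<Rightarrow> bool" where
  "integrable_Ioi \<equiv> set_integrable lborel {0<..}"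

abbreviation expo :: "nat \<Rightarrow> real" where
  "expo m \<equiv> (2 * real m + 2) / 3"

abbreviation expo_pred :: "nat \<Rightarrow> real" where
  "expo_pred m \<equiv> (2 * real m - 1) / 3"

text \<open>A majorant of the integrand alone is enough: Cauchy's estimate on discs of radius r / 4
  bounds the derivative on the ball of half the radius, hence also the difference quotients there,
  and dominated convergence applies.\<close>

lemma param_integral_holomorphic:
  fixes f :: "complex \<Rightarrow> 'a \<Rightarrow> complex"
  assumes hol: "\<And>t. t \<in> space M \<Longrightarrow> (\<lambda>z. f z t) holomorphic_on ball z0 r"
    and meas: "\<And>z. z \<in> ball z0 r \<Longrightarrow> f z \<in> borel_measurable M"
    and r: "r > 0" and g: "integrable M g"
    and bnd: "\<And>z t. z \<in> ball z0 r \<Longrightarrow> t \<in> space M \<Longrightarrow> cmod (f z t) \<le> g t"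
  shows "((\<lambda>z. \<integral>t. f z t \<partial>M) has_field_derivative (\<integral>t. deriv (\<lambda>z. f z t) z0 \<partial>M)) (at z0)"
    and "integrable M (\<lambda>t. deriv (\<lambda>z. f z t) z0)"
proof -
  have z0: "z0 \<in> ball z0 r" using r by auto
  have int: "integrable M (f z)" if "z \<in> ball z0 r" for z
    by (rule Bochner_Integration.integrable_bound[OF g meas[OF that]])
      (use bnd[OF that] in \<open>auto intro!: AE_I2 intro: order_trans[OF _ abs_ge_self]\<close>)
  have dbnd: "cmod (deriv (\<lambda>z. f z t) z) \<le> g t / (r/4)"
    if "t \<in> space M" "z \<in> ball z0 (r/2)" for t z
  proof -
    have sub: "cball z (r/4) \<subseteq> ball z0 r"
    proof
      fix x assume "x \<in> cball z (r/4)"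
      hence "dist z x \<le> r/4" by simp
      moreover have "dist z0 z < r/2" using that by simp
      moreover have "dist z0 x \<le> dist z0 z + dist z x" by (rule dist_triangle)
      ultimately show "x \<in> ball z0 r" using r by simp
    qed
    have h: "(\<lambda>z. f z t) holomorphic_on ball z (r/4)"
      using hol[OF that(1)] by (rule holomorphic_on_subset) (use sub ball_subset_cball in blast)
    have c: "continuous_on (cball z (r/4)) (\<lambda>z. f z t)"
      using hol[OF that(1)] sub holomorphic_on_imp_continuous_on holomorphic_on_subset by blast
    have "cmod ((deriv ^^ 1) (\<lambda>z. f z t) z) \<le> fact 1 * g t / (r/4) ^ 1"
      by (rule Cauchy_inequality[OF h c]) (use r sub that bnd in \<open>auto simp: dist_norm norm_minus_commute subset_iff\<close>)
    thus ?thesis by simp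
  qed
  define q where "q z t = (f z t - f z0 t) / (z - z0)" for z t
  have qb: "cmod (q z t) \<le> 4 / r * g t" if "t \<in> space M" "z \<in> ball z0 (r/2)" "z \<noteq> z0" for z t
  proof -
    have "cmod (f z t - f z0 t) \<le> (g t / (r/4)) * cmod (z - z0)"
    proof (rule field_differentiable_bound[where S = "ball z0 (r/2)" and f' = "deriv (\<lambda>z. f z t)"])
      fix y assume y: "y \<in> ball z0 (r/2)"
      have "y \<in> ball z0 r" using y r by auto
      hence "((\<lambda>z. f z t) has_field_derivative deriv (\<lambda>z. f z t) y) (at y)"
        using hol[OF that(1)] holomorphic_derivI open_ball by blast
      thus "((\<lambda>z. f z t) has_field_derivative deriv (\<lambda>z. f z t) y) (at y within ball z0 (r/2))"
        using has_field_derivative_at_within by blast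
    qed (use that r dbnd in auto)
    thus ?thesis using that(3) r
      by (simp add: q_def norm_divide field_simps)
  qed
  have lim: "((\<lambda>z. q z t) \<longlongrightarrow> deriv (\<lambda>z. f z t) z0) (at z0)" if "t \<in> space M" for t
    using holomorphic_derivI[OF hol[OF that] open_ball z0] by (simp add: q_def has_field_derivative_iff)
  have *: "integrable M (\<lambda>t. deriv (\<lambda>z. f z t) z0) \<and>
     ((\<lambda>n. \<integral>t. q (X n) t \<partial>M) \<longlonglongrightarrow> (\<integral>t. deriv (\<lambda>z. f z t) z0 \<partial>M))"
    if X: "\<And>n. X n \<in> ball z0 (r/2)" "\<And>n. X n \<noteq> z0" "X \<longlonglongrightarrow> z0" for X :: "nat \<Rightarrow> complex"
  proof -
    have qm: "q (X n) \<in> borel_measurable M" for n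
    proof -
      have "X n \<in> ball z0 r" using X(1)[of n] r by auto
      thus ?thesis unfolding q_def using meas[OF z0] meas[of "X n"] by measurable
    qed
    have tl: "(\<lambda>n. q (X n) t) \<longlonglongrightarrow> deriv (\<lambda>z. f z t) z0" if "t \<in> space M" for t
      using lim[OF that] X by (auto intro!: tendsto_compose_at simp: filterlim_at
          intro: tendsto_compose_eventually filterlim_compose[of "\<lambda>z. q z t"])
    have dm: "(\<lambda>t. deriv (\<lambda>z. f z t) z0) \<in> borel_measurable M"
      by (rule borel_measurable_LIMSEQ_metric[OF qm tl])
    have gi: "integrable M (\<lambda>t. 4 / r * g t)" using g by simp
    have al: "AE t in M. (\<lambda>n. q (X n) t) \<longlonglongrightarrow> deriv (\<lambda>z. f z t) z0"
      using tl by auto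
    have ab: "AE t in M. cmod (q (X n) t) \<le> 4 / r * g t" for n
      using qb X by auto
    show ?thesis
      using integrable_dominated_convergence[OF dm qm gi al ab] integral_dominated_convergence[OF dm qm gi al ab]
      by simp
  qed
  \<comment> \<open>One admissible sequence yields the integrability of the derivative, since the
    limit function does not depend on the sequence.\<close>
  have "\<exists>X :: nat \<Rightarrow> complex. (\<forall>n. X n \<in> ball z0 (r/2)) \<and> (\<forall>n. X n \<noteq> z0) \<and> X \<longlonglongrightarrow> z0"
  proof (intro exI conjI allI)
    define X where "X n = z0 + of_real (r / (2 * real (n+2)))" for n :: nat
    show "X n \<in> ball z0 (r/2)" for n
    proof -
      have "cmod (complex_of_real (r / (2 * real (n+2)))) = r / (2 * real (n+2))"
        using r by (subst norm_of_real) simp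
      thus ?thesis using r by (simp add: X_def dist_norm del: of_real_divide) (simp add: field_simps add_pos_nonneg)
    qed
    show "X n \<noteq> z0" for n using r unfolding X_def by (simp del: of_real_divide)
    have "(\<lambda>n. r / (2 * real (n+2))) \<longlonglongrightarrow> 0" by real_asymp
    hence "(\<lambda>n. z0 + complex_of_real (r / (2 * real (n+2)))) \<longlonglongrightarrow> z0 + of_real 0"
      by (intro tendsto_intros)
    thus "X \<longlonglongrightarrow> z0" unfolding X_def by simp
  qed
  thus int': "integrable M (\<lambda>t. deriv (\<lambda>z. f z t) z0)" using * by blast
  show "((\<lambda>z. \<integral>t. f z t \<partial>M) has_field_derivative (\<integral>t. deriv (\<lambda>z. f z t) z0 \<partial>M)) (at z0)"
    unfolding has_field_derivative_iff
  proof (rule tendsto_at_iff_sequentially[THEN iffD2], intro allI impI)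
    fix X :: "nat \<Rightarrow> complex" assume X: "\<forall>i. X i \<in> UNIV - {z0}" "X \<longlonglongrightarrow> z0"
    obtain N where N: "\<And>n. n \<ge> N \<Longrightarrow> X n \<in> ball z0 (r/2)"
      using X(2) r by (metis LIMSEQ_iff half_gt_zero mem_ball dist_norm dist_commute)
    have "((\<lambda>n. \<integral>t. q (X (n + N)) t \<partial>M) \<longlonglongrightarrow> (\<integral>t. deriv (\<lambda>z. f z t) z0 \<partial>M))"
      using *[of "\<lambda>n. X (n + N)"] N X LIMSEQ_ignore_initial_segment[OF X(2)] by auto
    moreover have "(\<integral>t. q (X (n + N)) t \<partial>M) = ((\<integral>t. f (X (n + N)) t \<partial>M) - (\<integral>t. f z0 t \<partial>M)) / (X (n + N) - z0)" for n
    proof -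
      have "X (n + N) \<in> ball z0 r" using N[of "n+N"] r by auto
      thus ?thesis unfolding q_def using int int[OF z0] by simp
    qed
    ultimately have "(\<lambda>n. ((\<integral>t. f (X (n + N)) t \<partial>M) - (\<integral>t. f z0 t \<partial>M)) / (X (n + N) - z0)) \<longlonglongrightarrow> (\<integral>t. deriv (\<lambda>z. f z t) z0 \<partial>M)"
      by simp
    hence "(\<lambda>n. ((\<integral>t. f (X n) t \<partial>M) - (\<integral>t. f z0 t \<partial>M)) / (X n - z0)) \<longlonglongrightarrow> (\<integral>t. deriv (\<lambda>z. f z t) z0 \<partial>M)"
      by (rule LIMSEQ_offset)
    thus "((\<lambda>z. ((\<integral>t. f z t \<partial>M) - (\<integral>t. f z0 t \<partial>M)) / (z - z0)) \<circ> X) \<longlonglongrightarrow> (\<integral>t. deriv (\<lambda>z. f z t) z0 \<partial>M)"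
      by (simp add: o_def)
  qed
qed

lemma set_integral_FTC_at_top:
  fixes F f :: "real \<Rightarrow> complex"
  assumes cont: "continuous_on {a..} F"
    and der: "\<And>x. x > a \<Longrightarrow> (F has_vector_derivative f x) (at x)"
    and int: "set_integrable lborel {a..} f"
  shows "(F \<longlongrightarrow> F a + (LBINT x:{a..}. f x)) at_top"
proof -
  have "((\<lambda>b. LBINT x:{a..b}. f x) \<longlongrightarrow> (LBINT x:{a..}. f x)) at_top"
    by (rule tendsto_set_lebesgue_integral_at_top[OF _ int]) auto
  hence "((\<lambda>b. F a + (LBINT x:{a..b}. f x)) \<longlongrightarrow> F a + (LBINT x:{a..}. f x)) at_top"
    by (intro tendsto_intros)
  thus ?thesis
  proof (rule Lim_transform_eventually)
    show "\<forall>\<^sub>F b in at_top. F a + (LBINT x:{a..b}. f x) = F b"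
      using eventually_ge_at_top[of a]
    proof eventually_elim
      case (elim b)
      have i: "set_integrable lborel {a..b} f" by (rule set_integrable_subset[OF int]) auto
      have "(f has_integral (F b - F a)) {a..b}"
        by (rule fundamental_theorem_of_calculus_interior[OF elim])
          (use der in \<open>auto intro: continuous_on_subset[OF cont]\<close>)
      thus ?case using set_borel_integral_eq_integral(2)[OF i] by (simp add: integral_unique)
    qed
  qed
qed

subsection \<open>The saddle point integral\<close>

definition phase :: "complex \<Rightarrow> complex" where
  "phase t = sinh t - t"

definition kern :: "complex \<Rightarrow> complex \<Rightarrow> complex" where
  "kern \<nu> t = sinh t * exp (- (\<nu> * phase t))"

text \<open>The kernel is entire in t, so this is its antiderivative vanishing at 0. Deforming a
  contour amounts to comparing values of \<open>prim\<close> at two points.\<close>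

definition prim :: "complex \<Rightarrow> complex \<Rightarrow> complex" where
  "prim \<nu> t = contour_integral (linepath 0 t) (kern \<nu>)"

text \<open>The integral of the kernel from 0 to infinity, ending along the horizontal line Im t = -
  Im \<zeta>. Starting this line at - \<zeta> makes the leading part of the exponent, exp \<zeta>
  exp (s - \<zeta>) / 2 = exp s / 2, independent of \<zeta>; the decay is therefore locally uniform
  in \<zeta> and the function is entire. Values of \<zeta> that differ by 2 pi i give the same
  kernel but end in different valleys of it, which is why \<zeta> and not exp \<zeta> is the
  variable.\<close>

definition saddle_int :: "complex \<Rightarrow> complex" where
  "saddle_int \<zeta> = prim (exp \<zeta>) (- \<zeta>) + (LBINT s:{0..}. kern (exp \<zeta>) (of_real s - \<zeta>))"

abbreviation horiz :: "complex \<Rightarrow> real \<Rightarrow> complex" where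
  "horiz \<zeta> x \<equiv> of_real x - \<i> * of_real (Im \<zeta>)"

lemma sinh_holomorphic: "f holomorphic_on A \<Longrightarrow> (\<lambda>z. sinh (f z :: complex)) holomorphic_on A"
  unfolding sinh_field_def by (intro holomorphic_intros) auto

lemma phase_holomorphic: "f holomorphic_on A \<Longrightarrow> (\<lambda>z. phase (f z)) holomorphic_on A"
  unfolding phase_def by (intro holomorphic_intros sinh_holomorphic)

lemma kern_holomorphic:
  "f holomorphic_on A \<Longrightarrow> g holomorphic_on A \<Longrightarrow> (\<lambda>z. kern (f z) (g z)) holomorphic_on A"
  unfolding kern_def by (intro holomorphic_intros sinh_holomorphic phase_holomorphic)

lemma prim_eq_diff:
  assumes "\<And>t. (F has_field_derivative kern \<nu> t) (at t)"
  shows "prim \<nu> t = F t - F 0"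
proof -
  have "(kern \<nu> has_contour_integral (F (pathfinish (linepath 0 t)) - F (pathstart (linepath 0 t)))) (linepath 0 t)"
  proof (rule contour_integral_primitive[where S = UNIV])
    show "valid_path (linepath 0 t)" by (rule valid_path_linepath)
  qed (use assms in auto)
  thus ?thesis unfolding prim_def by (simp add: contour_integral_unique)
qed

lemma kern_primitive_exists: "\<exists>F. \<forall>t. (F has_field_derivative kern \<nu> t) (at t)"
  using holomorphic_convex_primitive'[of UNIV "kern \<nu>"] kern_holomorphic[of "\<lambda>_. \<nu>" UNIV "\<lambda>x. x"]
  by (auto simp: holomorphic_on_const holomorphic_on_id holomorphic_on_ident)

lemma prim_deriv: "(prim \<nu> has_field_derivative kern \<nu> t) (at t)"
proof -
  obtain F where F: "\<And>t. (F has_field_derivative kern \<nu> t) (at t)"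
    using kern_primitive_exists by blast
  have "prim \<nu> = (\<lambda>t. F t - F 0)" using prim_eq_diff[OF F] by auto
  thus ?thesis using F by (auto intro!: derivative_eq_intros)
qed

lemma prim_0 [simp]: "prim \<nu> 0 = 0"
  by (simp add: prim_def)

lemma prim_of_real_deriv:
  "(f has_vector_derivative f') (at x) \<Longrightarrow>
   ((\<lambda>x. prim \<nu> (f x)) has_vector_derivative kern \<nu> (f x) * f') (at x)"
  using field_vector_diff_chain_at[OF _ prim_deriv, of f f' x \<nu>] by (simp add: o_def mult.commute)

lemma continuous_on_prim [continuous_intros]:
  "continuous_on A f \<Longrightarrow> continuous_on A (\<lambda>x. prim \<nu> (f x))"
  by (rule continuous_on_compose2[of UNIV "prim \<nu>"])
    (auto intro!: continuous_at_imp_continuous_on DERIV_isCont[OF prim_deriv])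

lemma kern_cnj: "kern (cnj \<nu>) (cnj t) = cnj (kern \<nu> t)"
  by (simp add: kern_def phase_def sinh_field_def exp_cnj)

lemma prim_cnj: "prim (cnj \<nu>) (cnj t) = cnj (prim \<nu> t)"
proof -
  have "((cnj \<circ> prim \<nu> \<circ> cnj) has_field_derivative kern (cnj \<nu>) t) (at t)" for t
    using has_field_derivative_cnj_cnj[OF prim_deriv, of \<nu> t] kern_cnj[of \<nu> "cnj t"] by simp
  from prim_eq_diff[OF this] show ?thesis by simp
qed

lemma norm_sinh_le: "cmod (sinh t) \<le> cosh (Re t)"
proof -
  have "cmod (exp t - exp (-t)) \<le> cmod (exp t) + cmod (exp (-t))"
    by (rule norm_triangle_ineq4)
  thus ?thesis by (simp add: sinh_field_def cosh_field_def norm_divide)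
qed

lemma kern_shifted_bound:
  assumes "cmod \<zeta> \<le> K" "s \<ge> (0::real)"
  shows "cmod (kern (exp \<zeta>) (of_real s - \<zeta>))
    \<le> exp (K + exp (2*K) / 2 + exp K * K + (exp K + 2)^2) * exp (- s)"
proof -
  have K: "K \<ge> 0" using assms(1) norm_ge_zero order_trans by blast
  have Re: "\<bar>Re \<zeta>\<bar> \<le> K" using assms(1) abs_Re_le_cmod order_trans by blast
  have 1: "cmod (sinh (of_real s - \<zeta>)) \<le> exp (s + K)"
  proof -
    have "cosh (s - Re \<zeta>) \<le> exp (s + K)"
    proof -
      have avg: "a \<le> c \<Longrightarrow> b \<le> c \<Longrightarrow> (a + b) / 2 \<le> c" for a b c :: real by simp
      have "exp (s - Re \<zeta>) \<le> exp (s + K)" "exp (- (s - Re \<zeta>)) \<le> exp (s + K)"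
        using Re assms(2) by auto
      hence "(exp (s - Re \<zeta>) + exp (- (s - Re \<zeta>))) / 2 \<le> exp (s + K)" by (rule avg)
      thus ?thesis unfolding cosh_field_def .
    qed
    thus ?thesis using norm_sinh_le[of "of_real s - \<zeta>"] by simp
  qed
  have 2: "exp \<zeta> * phase (of_real s - \<zeta>) = (exp (of_real s) - exp (2 * \<zeta> - of_real s)) / 2 - exp \<zeta> * (of_real s - \<zeta>)"
    by (simp add: phase_def sinh_field_def algebra_simps flip: exp_add)
  have a: "Re (exp (2 * \<zeta> - of_real s)) \<le> exp (2*K)"
  proof -
    have "Re (exp (2 * \<zeta> - of_real s)) \<le> cmod (exp (2 * \<zeta> - of_real s))" by (rule complex_Re_le_cmod)
    also have "\<dots> \<le> exp (2*K)" using Re assms(2) by simp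
    finally show ?thesis .
  qed
  have b: "Re (exp \<zeta> * (of_real s - \<zeta>)) \<le> exp K * (s + K)"
  proof -
    have "Re (exp \<zeta> * (of_real s - \<zeta>)) \<le> cmod (exp \<zeta>) * cmod (of_real s - \<zeta>)"
      by (metis complex_Re_le_cmod norm_mult)
    also have "\<dots> \<le> exp K * (s + K)"
    proof (intro mult_mono)
      have "cmod (of_real s - \<zeta>) \<le> cmod (of_real s) + cmod \<zeta>" by (rule norm_triangle_ineq4)
      thus "cmod (of_real s - \<zeta>) \<le> s + K" using assms by simp
    qed (use Re assms in auto)
    finally show ?thesis .
  qed
  have "Re (- (exp \<zeta> * phase (of_real s - \<zeta>))) \<le> - exp s / 2 + exp (2*K) / 2 + exp K * (s + K)"
  proof -
    have gen: "- ((E - x) / 2 - y) \<le> - E / 2 + a / 2 + b" if "x \<le> a" "y \<le> b" for E x y a b :: real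
      using that by (simp add: field_simps)
    have "Re (- (exp \<zeta> * phase (of_real s - \<zeta>))) = - ((exp s - Re (exp (2 * \<zeta> - of_real s))) / 2 - Re (exp \<zeta> * (of_real s - \<zeta>)))"
      unfolding 2 by (simp add: exp_of_real)
    thus ?thesis using gen[OF a b] by simp
  qed
  hence 3: "cmod (exp (- (exp \<zeta> * phase (of_real s - \<zeta>)))) \<le> exp (- exp s / 2 + exp (2*K) / 2 + exp K * (s + K))"
    by simp
  \<comment> \<open>The quadratic lower bound of exp s absorbs all terms linear in s. The 2 in
    \<open>exp K + 2\<close> covers the s from the factor sinh and one more s, which is left over as
    the decay exp (- s).\<close>
  have "s^2 / 2 \<le> exp s" using exp_lower_Taylor_quadratic[OF assms(2)] assms(2) by simp
  moreover have "(exp K + 2) * s - s^2/4 \<le> (exp K + 2)^2"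
  proof -
    have "0 \<le> (s / 2 - (exp K + 2))^2" by simp
    thus ?thesis by (simp add: power2_eq_square algebra_simps)
  qed
  ultimately have 4: "(s + K) + (- exp s / 2 + exp (2*K) / 2 + exp K * (s + K))
      \<le> (K + exp (2*K) / 2 + exp K * K + (exp K + 2)^2) - s"
    by (simp add: algebra_simps)
  have "cmod (kern (exp \<zeta>) (of_real s - \<zeta>)) \<le> exp (s + K) * exp (- exp s / 2 + exp (2*K) / 2 + exp K * (s + K))"
    unfolding kern_def norm_mult by (intro mult_mono 1 3) auto
  also have "\<dots> \<le> exp ((K + exp (2*K) / 2 + exp K * K + (exp K + 2)^2) - s)"
    unfolding exp_add[symmetric] using 4 by simp
  also have "\<dots> = exp (K + exp (2*K) / 2 + exp K * K + (exp K + 2)^2) * exp (- s)"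
    by (simp only: diff_conv_add_uminus exp_add)
  finally show ?thesis .
qed

lemma set_integrable_exp_neg:
  assumes "c > (0::real)"
  shows "set_integrable lborel {a..} (\<lambda>x. exp (- (c * x)))"
proof -
  have "((\<lambda>x. exp (- c * x)) has_integral exp (- c * a) / c) {a..}"
    by (rule has_integral_exp_minus_to_infinity[OF assms])
  hence "(\<lambda>x. exp (- c * x)) absolutely_integrable_on {a..}"
    by (intro nonnegative_absolutely_integrable_1) (auto simp: has_integral_integrable_integral)
  thus ?thesis
    unfolding set_integrable_def by (subst (asm) integrable_completion) (auto simp: )
qed

lemma set_integrable_continuous_bound:
  fixes f :: "real \<Rightarrow> complex"
  assumes "continuous_on {a..} f" "set_integrable lborel {a..} g"
    and "\<And>x. x \<ge> a \<Longrightarrow> cmod (f x) \<le> g x"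
  shows "set_integrable lborel {a..} f"
  by (rule set_integrable_bound[OF assms(2)])
    (use assms(1,3) in \<open>auto intro!: AE_I2 intro: order_trans[OF _ abs_ge_self] simp: set_borel_measurable_def borel_measurable_continuous_on_indicator\<close>)

lemma continuous_on_kern [continuous_intros]:
  "continuous_on A f \<Longrightarrow> continuous_on A g \<Longrightarrow> continuous_on A (\<lambda>x. kern (f x) (g x))"
  unfolding kern_def phase_def sinh_field_def by (intro continuous_intros) auto

lemma kern_shifted_integrable:
  "set_integrable lborel {0..} (\<lambda>s. kern (exp \<zeta>) (of_real s - \<zeta>))"
proof (rule set_integrable_continuous_bound)
  show "set_integrable lborel {0..} (\<lambda>s. exp (cmod \<zeta> + exp (2*cmod \<zeta>) / 2 + exp (cmod \<zeta>) * cmod \<zeta> + (exp (cmod \<zeta>) + 2)^2) * exp (- s))"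
    using set_integrable_exp_neg[of 1 0] by (intro set_integrable_mult_right) auto
qed (use kern_shifted_bound in \<open>auto intro!: continuous_intros\<close>)

lemma saddle_int_lim0: "((\<lambda>X. prim (exp \<zeta>) (of_real X - \<zeta>)) \<longlongrightarrow> saddle_int \<zeta>) at_top"
proof -
  have "((\<lambda>X. prim (exp \<zeta>) (of_real X - \<zeta>)) \<longlongrightarrow> prim (exp \<zeta>) (of_real 0 - \<zeta>) +
      (LBINT s:{0..}. kern (exp \<zeta>) (of_real s - \<zeta>))) at_top"
  proof (rule set_integral_FTC_at_top)
    fix x :: real
    have "((\<lambda>X. complex_of_real X - \<zeta>) has_vector_derivative 1) (at x)"
      by (auto intro!: derivative_eq_intros)
    from prim_of_real_deriv[OF this]
    show "((\<lambda>X. prim (exp \<zeta>) (of_real X - \<zeta>)) has_vector_derivative kern (exp \<zeta>) (of_real x - \<zeta>)) (at x)"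
      by simp
  qed (auto intro!: continuous_intros kern_shifted_integrable)
  thus ?thesis by (simp add: saddle_int_def)
qed

lemma saddle_int_lim: "((\<lambda>X. prim (exp \<zeta>) (horiz \<zeta> X)) \<longlongrightarrow> saddle_int \<zeta>) at_top"
proof -
  have "filterlim (\<lambda>X. X + Re \<zeta>) at_top at_top" by real_asymp
  from filterlim_compose[OF saddle_int_lim0[of \<zeta>] this] show ?thesis
  proof (rule Lim_transform_eventually)
    have *: "complex_of_real (X + Re \<zeta>) - \<zeta> = horiz \<zeta> X" for X
      by (simp add: complex_eq_iff)
    show "\<forall>\<^sub>F X in at_top. prim (exp \<zeta>) (complex_of_real (X + Re \<zeta>) - \<zeta>) = prim (exp \<zeta>) (horiz \<zeta> X)"
      unfolding * by simp
  qed
qed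

lemma saddle_int_cnj: "saddle_int (cnj \<zeta>) = cnj (saddle_int \<zeta>)"
proof -
  have "((\<lambda>X. cnj (prim (exp \<zeta>) (horiz \<zeta> X))) \<longlongrightarrow> cnj (saddle_int \<zeta>)) at_top"
    by (intro tendsto_intros saddle_int_lim)
  hence "((\<lambda>X. prim (exp (cnj \<zeta>)) (of_real X - \<i> * of_real (Im (cnj \<zeta>)))) \<longlongrightarrow> cnj (saddle_int \<zeta>)) at_top"
    unfolding prim_cnj[symmetric] by (simp add: exp_cnj)
  thus ?thesis using saddle_int_lim[of "cnj \<zeta>"] tendsto_unique trivial_limit_at_top_linorder by blast
qed

lemma saddle_int_eq_horizontal:
  assumes "set_integrable lborel {a..} (\<lambda>x. kern (exp \<zeta>) (horiz \<zeta> x))"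
  shows "saddle_int \<zeta> = prim (exp \<zeta>) (horiz \<zeta> a) +
     (LBINT x:{a..}. kern (exp \<zeta>) (horiz \<zeta> x))"
proof -
  have "((\<lambda>X. prim (exp \<zeta>) (horiz \<zeta> X)) \<longlongrightarrow> prim (exp \<zeta>) (horiz \<zeta> a) +
     (LBINT x:{a..}. kern (exp \<zeta>) (horiz \<zeta> x))) at_top"
  proof (rule set_integral_FTC_at_top[OF _ _ assms])
    fix x :: real
    have "((\<lambda>X. horiz \<zeta> X) has_vector_derivative 1) (at x)"
      by (auto intro!: derivative_eq_intros)
    from prim_of_real_deriv[OF this]
    show "((\<lambda>X. prim (exp \<zeta>) (horiz \<zeta> X)) has_vector_derivative kern (exp \<zeta>) (horiz \<zeta> x)) (at x)"
      by simp
  qed (auto intro!: continuous_intros)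
  thus ?thesis using saddle_int_lim[of \<zeta>] tendsto_unique trivial_limit_at_top_linorder by blast
qed

lemma saddle_int_holomorphic: "saddle_int holomorphic_on UNIV"
proof -
  have 1: "(\<lambda>\<zeta>. prim (exp \<zeta>) (- \<zeta>)) holomorphic_on UNIV"
  proof -
    have "prim (exp \<zeta>) (- \<zeta>) = integral (cbox 0 1) (\<lambda>u. - \<zeta> * kern (exp \<zeta>) (of_real u * - \<zeta>))" for \<zeta>
      by (simp add: prim_def contour_integral_integral linepath_def vector_derivative_linepath_within mult.commute scaleR_conv_of_real)
    moreover have "(\<lambda>\<zeta>. integral (cbox 0 1) (\<lambda>u. - \<zeta> * kern (exp \<zeta>) (of_real (u::real) * - \<zeta>))) holomorphic_on UNIV"
    proof (rule leibniz_rule_holomorphic)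
      \<comment> \<open>Only the continuity of this derivative matters, so it stays as the chain
        rule produces it.\<close>
      define fx where "fx = (\<lambda>\<zeta> (u::real). - kern (exp \<zeta>) (of_real u * - \<zeta>) + - \<zeta> * 
         (cosh (of_real u * - \<zeta>) * - of_real u * exp (- (exp \<zeta> * phase (of_real u * - \<zeta>)))
          + sinh (of_real u * - \<zeta>) * (exp (- (exp \<zeta> * phase (of_real u * - \<zeta>))) *
             - (exp \<zeta> * phase (of_real u * - \<zeta>) + exp \<zeta> * (cosh (of_real u * - \<zeta>) * - of_real u + of_real u)))))"
      show "((\<lambda>x. - x * kern (exp x) (complex_of_real t * - x)) has_field_derivative fx x t) (at x within UNIV)" for x t
        unfolding kern_def phase_def fx_def
        by (auto intro!: derivative_eq_intros simp: algebra_simps)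
      show "continuous_on (UNIV \<times> cbox 0 1) (\<lambda>(x, t). fx x t)"
        unfolding fx_def split_def kern_def phase_def sinh_field_def cosh_field_def by (intro continuous_intros) auto
    qed (auto intro!: integrable_continuous_interval continuous_intros simp: cbox_interval)
    ultimately show ?thesis by simp
  qed
  have 2: "((\<lambda>\<zeta>. LBINT s:{0..}. kern (exp \<zeta>) (of_real s - \<zeta>)) field_differentiable at \<zeta>0)" for \<zeta>0
  proof -
    define K where "K = cmod \<zeta>0 + 1"
    have "((\<lambda>\<zeta>. \<integral>s. indicator {0..} s *\<^sub>R kern (exp \<zeta>) (of_real s - \<zeta>) \<partial>lborel) has_field_derivative
       (\<integral>s. deriv (\<lambda>\<zeta>. indicator {0..} s *\<^sub>R kern (exp \<zeta>) (of_real s - \<zeta>)) \<zeta>0 \<partial>lborel)) (at \<zeta>0)"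
    proof (rule param_integral_holomorphic)
      show "(\<lambda>\<zeta>. indicat_real {0..} s *\<^sub>R kern (exp \<zeta>) (of_real s - \<zeta>)) holomorphic_on ball \<zeta>0 1" for s
        unfolding scaleR_conv_of_real by (intro holomorphic_intros kern_holomorphic)
      show "(\<lambda>s. indicat_real {0..} s *\<^sub>R kern (exp \<zeta>) (of_real s - \<zeta>)) \<in> borel_measurable lborel" for \<zeta>
        using kern_shifted_integrable[of \<zeta>] by (simp add: set_integrable_def)
      show "integrable lborel (\<lambda>s. indicator {0..} s *\<^sub>R (exp (K + exp (2*K) / 2 + exp K * K + (exp K + 2)^2) * exp (- s)))"
        using set_integrable_exp_neg[of 1 0] unfolding set_integrable_def[symmetric]
        by (intro set_integrable_mult_right) auto
      show "cmod (indicator {0..} s *\<^sub>R kern (exp \<zeta>) (of_real s - \<zeta>)) \<le> indicator {0..} s *\<^sub>R (exp (K + exp (2*K) / 2 + exp K * K + (exp K + 2)^2) * exp (- s))"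
        if "\<zeta> \<in> ball \<zeta>0 1" for \<zeta> s
      proof -
        have "cmod \<zeta> \<le> K" using that norm_triangle_ineq2[of \<zeta> \<zeta>0] by (simp add: K_def dist_norm norm_minus_commute)
        thus ?thesis using kern_shifted_bound by (auto simp: indicator_def)
      qed
    qed auto
    thus ?thesis unfolding set_lebesgue_integral_def field_differentiable_def by blast
  qed
  have "(\<lambda>\<zeta>. LBINT s:{0..}. kern (exp \<zeta>) (of_real s - \<zeta>)) holomorphic_on UNIV"
    using 2 by (simp add: holomorphic_on_def)
  thus ?thesis using 1 unfolding saddle_int_def[abs_def] by (intro holomorphic_intros)
qed

text \<open>Nonnegativity turns the existence of the limit of F into integrability, so no majorant
  has to be supplied. The derivative is asked for only on the open half-line, because the formulas
  along the curve degenerate to 0 / 0 at its starting point.\<close>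

lemma set_integral_FTC_nonneg:
  fixes F f :: "real \<Rightarrow> real"
  assumes cont: "continuous_on {a..} F" and fc: "continuous_on {a<..} f"
    and der: "\<And>x. x > a \<Longrightarrow> (F has_real_derivative f x) (at x)"
    and nn: "\<And>x. x > a \<Longrightarrow> f x \<ge> 0"
    and lim: "(F \<longlongrightarrow> T) at_top"
  shows "set_integrable lborel {a<..} f" "(LBINT x:{a<..}. f x) = T - F a"
proof -
  have "(F \<longlongrightarrow> F a) (at a within {a..})"
    using cont by (simp add: continuous_on)
  hence r: "(F \<longlongrightarrow> F a) (at_right a)"
    by (rule tendsto_within_subset) auto
  have isc: "isCont f x" if "ereal a < ereal x" for x
    using fc that by (simp add: continuous_on_eq_continuous_at)
  have ein: "einterval (ereal a) \<infinity> = {a<..}" by (auto simp: einterval_def)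
  have l1: "((F \<circ> real_of_ereal) \<longlongrightarrow> F a) (at_right (ereal a))"
    using r by (simp add: ereal_tendsto_simps1 o_def tendsto_compose_filtermap
        flip: at_right_ereal filtermap_filtermap) (simp add: filterlim_def filtermap_filtermap at_right_ereal o_def)
  have l2: "((F \<circ> real_of_ereal) \<longlongrightarrow> T) (at_left \<infinity>)"
    using lim by (simp add: ereal_tendsto_simps1)
  have "set_integrable lborel (einterval a \<infinity>) f" "(LBINT x=a..\<infinity>. f x) = T - F a"
    by (rule interval_integral_FTC_nonneg[where F = F];
        use der nn isc l1 l2 in \<open>auto intro!: AE_I2\<close>)+
  thus "set_integrable lborel {a<..} f" "(LBINT x:{a<..}. f x) = T - F a"
    by (simp_all add: ein interval_lebesgue_integral_def)
qed

lemma set_integrable_Ici_iff: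
  fixes f :: "real \<Rightarrow> 'b::euclidean_space"
  shows "set_integrable lborel {a..} f \<longleftrightarrow> set_integrable lborel {a<..} f"
proof
  assume "set_integrable lborel {a<..} f"
  moreover have "set_integrable lborel {a} f"
  proof -
    have "(\<lambda>x. indicator {a} x *\<^sub>R f x) = (\<lambda>x. indicator {a} x *\<^sub>R f a)"
      by (auto simp: indicator_def)
    thus ?thesis unfolding set_integrable_def by simp
  qed
  ultimately have "set_integrable lborel ({a<..} \<union> {a}) f"
    by (intro set_integrable_Un) auto
  moreover have "{a<..} \<union> {a} = {a..}" by auto
  ultimately show "set_integrable lborel {a..} f" by simp
qed (rule set_integrable_subset, auto)

lemma set_integral_Ici_eq:
  fixes f :: "real \<Rightarrow> 'b::euclidean_space"
  shows "(LBINT x:{a..}. f x) = (LBINT x:{a<..}. f x)"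
proof -
  have "integral\<^sup>L lborel (\<lambda>x. indicator {a..} x *\<^sub>R f x) = integral\<^sup>L lborel (\<lambda>x. indicator {a<..} x *\<^sub>R f x)"
  proof (cases "integrable lborel (\<lambda>x. indicator {a<..} x *\<^sub>R f x)")
    case True
    hence "integrable lborel (\<lambda>x. indicator {a..} x *\<^sub>R f x)"
      using set_integrable_Ici_iff[of a f] by (simp add: set_integrable_def)
    with True show ?thesis
      by (intro integral_cong_AE) (use AE_lborel_singleton[of a] in \<open>auto elim!: eventually_mono simp: indicator_def\<close>)
  next
    case False
    hence "\<not> integrable lborel (\<lambda>x. indicator {a..} x *\<^sub>R f x)"
      using set_integrable_Ici_iff[of a f] by (simp add: set_integrable_def)
    with False show ?thesis by (simp add: not_integrable_integral_eq)
  qed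
  thus ?thesis by (simp add: set_lebesgue_integral_def)
qed

section \<open>Bounds for the saddle point integral in the closed strip\<close>

lemma cosh_exp_sinh_integral:
  assumes c: "c > (0::real)"
  shows "set_integrable lborel {a..} (\<lambda>x. cosh x * exp (- (c * sinh x)))"
    and "(LBINT x:{a..}. cosh x * exp (- (c * sinh x))) = exp (- (c * sinh a)) / c"
proof -
  have "((\<lambda>x. - exp (- (c * sinh x)) / c) \<longlongrightarrow> 0) at_top"
    using c unfolding sinh_field_def by real_asymp
  hence "set_integrable lborel {a<..} (\<lambda>x. cosh x * exp (- (c * sinh x)))"
     "(LBINT x:{a<..}. cosh x * exp (- (c * sinh x))) = 0 - (- exp (- (c * sinh a)) / c)"
    using c by (intro set_integral_FTC_nonneg[where F = "\<lambda>x. - exp (- (c * sinh x)) / c"] continuous_intros;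
        force intro!: continuous_intros derivative_eq_intros simp: cosh_real_nonneg)+
  thus "set_integrable lborel {a..} (\<lambda>x. cosh x * exp (- (c * sinh x)))"
    "(LBINT x:{a..}. cosh x * exp (- (c * sinh x))) = exp (- (c * sinh a)) / c"
    by (simp_all add: set_integrable_Ici_iff set_integral_Ici_eq)
qed

text \<open>This grouping isolates the behaviour for large x: the term with
  \<open>cos (\<alpha> - y)\<close> dominates and the exponentially small one is nonnegative
  wherever it is used. \<open>Re_cis_phase'\<close> is the same quantity grouped by the signs of cos
  \<alpha> and sin \<alpha>.\<close>

lemma Re_cis_phase:
  "Re (cis \<alpha> * phase (of_real x - \<i> * of_real y)) =
     sinh x * cos (\<alpha> - y) + exp (- x) * sin \<alpha> * sin y - x * cos \<alpha> - y * sin \<alpha>"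
proof -
  have "sinh (of_real x - \<i> * of_real y) = Complex (sinh x * cos y) (- (cosh x * sin y))"
    by (simp add: complex_eq_iff sinh_field_def cosh_field_def Re_exp Im_exp field_simps)
  moreover have "cosh x = sinh x + exp (- x)"
    by (simp add: sinh_field_def cosh_field_def field_simps)
  ultimately show ?thesis
    by (simp add: phase_def cos_diff algebra_simps)
qed

lemma exp_times_phase: "Re (exp \<zeta> * phase t) = exp (Re \<zeta>) * Re (cis (Im \<zeta>) * phase t)"
  by (simp add: exp_eq_polar algebra_simps)

lemma kern_bound:
  assumes "Re (cis (Im \<zeta>) * phase t) \<ge> c"
  shows "cmod (kern (exp \<zeta>) t) \<le> cosh (Re t) * exp (- (exp (Re \<zeta>) * c))"
proof -
  have "cmod (exp (- (exp \<zeta> * phase t))) \<le> exp (- (exp (Re \<zeta>) * c))"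
  proof -
    have "exp (Re \<zeta>) * c \<le> Re (exp \<zeta> * phase t)"
      unfolding exp_times_phase using assms by (intro mult_left_mono) auto
    thus ?thesis by (simp del: times_complex.sel)
  qed
  thus ?thesis unfolding kern_def norm_mult by (intro mult_mono norm_sinh_le) auto
qed

lemma prim_segment_bound:
  assumes "\<And>t. t \<in> closed_segment a b \<Longrightarrow> cmod (kern \<nu> t) \<le> B"
  shows "cmod (prim \<nu> b - prim \<nu> a) \<le> B * cmod (b - a)"
  by (rule field_differentiable_bound[where S = "closed_segment a b" and f' = "kern \<nu>"])
    (use assms in \<open>auto intro: has_field_derivative_at_within[OF prim_deriv]\<close>)

text \<open>As long as the exponent has nonpositive real part along the segment, the exponential is
  at most 1 whatever the size of exp (Re \<zeta>). The bound is therefore uniform in Re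
  \<zeta>.\<close>

lemma prim_phase_segment_bound:
  assumes "\<And>u. 0 \<le> u \<Longrightarrow> u \<le> 1 \<Longrightarrow> Re (cis (Im \<zeta>) * phase ((1 - of_real u) * a + of_real u * b)) \<ge> 0"
    and "0 \<le> Re a" "Re a \<le> X" "0 \<le> Re b" "Re b \<le> X"
  shows "cmod (prim (exp \<zeta>) b - prim (exp \<zeta>) a) \<le> cosh X * cmod (b - a)"
proof (rule prim_segment_bound)
  fix t assume "t \<in> closed_segment a b"
  then obtain u where u: "0 \<le> u" "u \<le> 1" "t = (1 - u) *\<^sub>R a + u *\<^sub>R b"
    by (auto simp: closed_segment_def)
  have "t = (1 - of_real u) * a + of_real u * b" by (simp add: u scaleR_conv_of_real)
  hence "cmod (kern (exp \<zeta>) t) \<le> cosh (Re t) * exp (- (exp (Re \<zeta>) * 0))"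
    using assms(1)[OF u(1,2)] by (intro kern_bound) simp
  moreover have "cosh (Re t) \<le> cosh X"
  proof -
    have "(1 - u) * Re a + u * Re b \<le> (1 - u) * X + u * X" "0 \<le> (1 - u) * Re a + u * Re b"
      using u(1,2) assms(2-5) by (auto intro!: add_mono mult_left_mono)
    hence "0 \<le> Re t" "Re t \<le> X" unfolding u(3) by (simp_all add: algebra_simps)
    thus ?thesis by (subst cosh_real_nonneg_le_iff) auto
  qed
  ultimately show "cmod (kern (exp \<zeta>) t) \<le> cosh X" by simp
qed

text \<open>The tail is compared with an exact derivative. Its contribution
  \<open>2 / exp (Re \<zeta>)\<close> is the only part of the final bound that is not constant, and
  it grows only to the left.\<close>

lemma saddle_int_tail_bound:
  assumes "\<And>x. x \<ge> a \<Longrightarrow> Re (cis (Im \<zeta>) * phase (horiz \<zeta> x)) \<ge> sinh x / 2" and "a \<ge> 0"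
  shows "cmod (saddle_int \<zeta>) \<le> cmod (prim (exp \<zeta>) (horiz \<zeta> a)) + 2 / exp (Re \<zeta>)"
proof -
  define c where "c = exp (Re \<zeta>) / 2"
  have c: "c > 0" by (simp add: c_def)
  have b: "cmod (kern (exp \<zeta>) (horiz \<zeta> x)) \<le> cosh x * exp (- (c * sinh x))" if "x \<ge> a" for x
    using kern_bound[OF assms(1)[OF that]] by (simp add: c_def)
  have i: "set_integrable lborel {a..} (\<lambda>x. kern (exp \<zeta>) (horiz \<zeta> x))"
    by (rule set_integrable_continuous_bound[OF _ cosh_exp_sinh_integral(1)[OF c] b]) (auto intro!: continuous_intros)
  have "cmod (LBINT x:{a..}. kern (exp \<zeta>) (horiz \<zeta> x))
     \<le> (LBINT x:{a..}. cmod (kern (exp \<zeta>) (horiz \<zeta> x)))"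
    by (rule set_integral_norm_bound[OF i])
  also have "\<dots> \<le> (LBINT x:{a..}. cosh x * exp (- (c * sinh x)))"
    by (rule set_integral_mono[OF set_integrable_norm[OF i] cosh_exp_sinh_integral(1)[OF c]]) (use b in auto)
  also have "\<dots> \<le> 1 / c" unfolding cosh_exp_sinh_integral(2)[OF c] using c assms(2)
    by (intro divide_right_mono) auto
  also have "\<dots> = 2 / exp (Re \<zeta>)" by (simp add: c_def)
  finally show ?thesis unfolding saddle_int_eq_horizontal[OF i] by (intro norm_triangle_le) auto
qed

lemma Re_cis_phase':
  "Re (cis \<alpha> * phase (of_real x - \<i> * of_real y)) =
     cos \<alpha> * (sinh x * cos y - x) + sin \<alpha> * (cosh x * sin y - y)"
proof -
  have "cosh x = sinh x + exp (- x)"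
    by (simp add: sinh_field_def cosh_field_def field_simps)
  thus ?thesis unfolding Re_cis_phase by (simp add: cos_diff algebra_simps)
qed

lemma sinh_ge_self: "x \<le> sinh x" if "0 \<le> (x::real)"
proof -
  have "sinh 0 - 0 \<le> sinh x - x"
    by (rule DERIV_nonneg_imp_nondecreasing[OF that])
      (auto intro!: exI derivative_eq_intros simp: cosh_real_ge_1)
  thus ?thesis by simp
qed

lemma sinh_4_ge: "(19::real) \<le> sinh 4"
proof -
  have "(5/2::real) \<le> exp 1" using exp_lower_Taylor_quadratic[of "1::real"] by simp
  hence "(5/2::real)^4 \<le> exp 1 ^ 4" by (rule power_mono) simp
  moreover have "exp (4::real) = exp 1 ^ 4" using exp_of_nat_mult[of 4 "1::real"] by simp
  ultimately have "(39::real) \<le> exp 4" by (simp add: power4_eq_xxxx)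
  moreover have "exp (-4) \<le> (1::real)" by simp
  moreover have "19 \<le> (a - b) / 2" if "39 \<le> a" "b \<le> 1" for a b :: real using that by simp
  ultimately show ?thesis unfolding sinh_field_def by blast
qed

text \<open>In the tail estimates one half of sinh x has to pay for x |cos \<alpha>| and for y sin
  \<alpha>; from x = 4 on it does.\<close>

lemma sinh_ge_linear: "2 * x + pi \<le> sinh x" if "4 \<le> (x::real)"
proof -
  have "sinh 4 - 2 * 4 \<le> sinh x - 2 * x"
  proof (rule DERIV_nonneg_imp_nondecreasing[OF that])
    fix y :: real assume "4 \<le> y" "y \<le> x"
    have "sinh y \<le> cosh y" by (simp add: sinh_le_cosh_real)
    moreover have "4 \<le> sinh y" using sinh_ge_self[of y] \<open>4 \<le> y\<close> by linarith
    ultimately have "0 \<le> cosh y - 2" by linarith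
    thus "\<exists>d. ((\<lambda>x. sinh x - 2 * x) has_real_derivative d) (at y) \<and> 0 \<le> d"
      by (auto intro!: exI derivative_eq_intros)
  qed
  thus ?thesis using sinh_4_ge pi_less_4 by linarith
qed

lemma sin_ge_half: "x / 2 \<le> sin x" if "0 \<le> (x::real)" "x \<le> pi / 2"
proof (cases "x \<le> pi/3")
  case True
  have "sin 0 - 0 / 2 \<le> sin x - x / 2"
  proof (rule DERIV_nonneg_imp_nondecreasing[OF that(1)])
    fix y :: real assume "0 \<le> y" "y \<le> x"
    hence "cos (pi/3) \<le> cos y" using True by (intro cos_monotone_0_pi_le) auto
    thus "\<exists>d. ((\<lambda>x. sin x - x / 2) has_real_derivative d) (at y) \<and> 0 \<le> d"
      by (auto intro!: exI derivative_eq_intros simp: cos_60)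
  qed
  thus ?thesis by simp
next
  case False
  have "sin (pi/3) \<le> sin x" using False that by (intro sin_monotone_2pi_le) auto
  moreover have "sin (pi/3) = sqrt 3 / 2" by (rule sin_60)
  moreover have "(17/10::real) \<le> sqrt 3" by (rule real_le_rsqrt) (simp add: power2_eq_square)
  moreover have "pi < 16/5" using pi_approx by simp
  ultimately show ?thesis using that by simp
qed

text \<open>These are the signs of the two brackets of \<open>Re_cis_phase'\<close> on the diagonal
  y = x. For cos \<alpha> \<le> 0 \<le> sin \<alpha> they make the diagonal an admissible way out of
  0, whereas on both coordinate axes the exponent has the wrong sign near 0.\<close>

lemma sin_cosh_ge: "x \<le> cosh x * sin x" and cos_sinh_le: "sinh x * cos x \<le> x"
  if "0 \<le> (x::real)" "x \<le> pi / 2"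
proof -
  have s: "0 \<le> sin y" "0 \<le> cos y" "0 \<le> sinh y" "0 \<le> cosh y" if "0 \<le> y" "y \<le> x" for y
    using that \<open>x \<le> pi/2\<close> by (auto intro: sin_ge_zero cos_ge_zero simp: cosh_real_nonneg)
  have 1: "0 \<le> sinh y * sin y + cosh y * cos y - 1" if "0 \<le> y" "y \<le> x" for y
  proof -
    have "sinh 0 * sin 0 + cosh 0 * cos 0 - 1 \<le> sinh y * sin y + cosh y * cos y - 1"
    proof (rule DERIV_nonneg_imp_nondecreasing[OF that(1)])
      fix z assume z: "0 \<le> z" "z \<le> y"
      show "\<exists>d. ((\<lambda>y. sinh y * sin y + cosh y * cos y - 1) has_real_derivative d) (at z) \<and> 0 \<le> d"
        by (rule exI[of _ "2 * sinh z * cos z"], rule conjI, (auto intro!: derivative_eq_intros)[1])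
          (use s[of z] z that in simp)
    qed
    thus ?thesis by simp
  qed
  have 2: "cosh y * cos y - sinh y * sin y - 1 \<le> 0" if "0 \<le> y" "y \<le> x" for y
  proof -
    have "cosh y * cos y - sinh y * sin y - 1 \<le> cosh 0 * cos 0 - sinh 0 * sin 0 - 1"
    proof (rule DERIV_nonpos_imp_nonincreasing[OF that(1)])
      fix z assume z: "0 \<le> z" "z \<le> y"
      show "\<exists>d. ((\<lambda>y. cosh y * cos y - sinh y * sin y - 1) has_real_derivative d) (at z) \<and> d \<le> 0"
        by (rule exI[of _ "- 2 * cosh z * sin z"], rule conjI, (auto intro!: derivative_eq_intros)[1])
          (use s[of z] z that in simp)
    qed
    thus ?thesis by simp
  qed
  have "cosh 0 * sin 0 - 0 \<le> cosh x * sin x - x"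
  proof (rule DERIV_nonneg_imp_nondecreasing[OF that(1)])
    fix y assume y: "0 \<le> y" "y \<le> x"
    show "\<exists>d. ((\<lambda>x. cosh x * sin x - x) has_real_derivative d) (at y) \<and> 0 \<le> d"
      by (rule exI[of _ "sinh y * sin y + cosh y * cos y - 1"], rule conjI, (auto intro!: derivative_eq_intros)[1])
        (use 1 y in simp)
  qed
  thus "x \<le> cosh x * sin x" by simp
  have "sinh x * cos x - x \<le> sinh 0 * cos 0 - 0"
  proof (rule DERIV_nonpos_imp_nonincreasing[OF that(1)])
    fix y assume y: "0 \<le> y" "y \<le> x"
    show "\<exists>d. ((\<lambda>x. sinh x * cos x - x) has_real_derivative d) (at y) \<and> d \<le> 0"
      by (rule exI[of _ "cosh y * cos y - sinh y * sin y - 1"], rule conjI, (auto intro!: derivative_eq_intros)[1])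
        (use 2 y in simp)
  qed
  thus "sinh x * cos x \<le> x" by simp
qed

lemma prim_phase_segment_bound':
  assumes "\<And>u. 0 \<le> u \<Longrightarrow> u \<le> 1 \<Longrightarrow> Re (cis (Im \<zeta>) * phase (of_real ((1 - u) * a + u * b) - \<i> * of_real ((1 - u) * c + u * d))) \<ge> 0"
    and "0 \<le> a" "a \<le> 4" "0 \<le> b" "b \<le> 4" "\<bar>d - c\<bar> \<le> 6"
  shows "cmod (prim (exp \<zeta>) (of_real b - \<i> * of_real d)) \<le> cmod (prim (exp \<zeta>) (of_real a - \<i> * of_real c)) + 10 * cosh 4"
proof -
  have "cmod (prim (exp \<zeta>) (of_real b - \<i> * of_real d) - prim (exp \<zeta>) (of_real a - \<i> * of_real c))
    \<le> cosh 4 * cmod ((of_real b - \<i> * of_real d) - (of_real a - \<i> * of_real c))"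
  proof (rule prim_phase_segment_bound)
    fix u :: real assume u: "0 \<le> u" "u \<le> 1"
    have "(1 - of_real u) * (of_real a - \<i> * of_real c) + of_real u * (of_real b - \<i> * of_real d) =
      (of_real ((1 - u) * a + u * b) - \<i> * of_real ((1 - u) * c + u * d) :: complex)"
      by (simp add: algebra_simps)
    thus "0 \<le> Re (cis (Im \<zeta>) * phase ((1 - of_real u) * (of_real a - \<i> * of_real c) + of_real u * (of_real b - \<i> * of_real d)))"
      using assms(1)[OF u] by simp
  qed (use assms in auto)
  also have "cmod ((of_real b - \<i> * of_real d) - (of_real a - \<i> * of_real c)) \<le> \<bar>b - a\<bar> + \<bar>d - c\<bar>"
    using cmod_le[of "(of_real b - \<i> * of_real d) - (of_real a - \<i> * of_real c)"] by (simp add: abs_minus_commute)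
  also have "\<dots> \<le> 10" using assms(2-6) by auto
  finally have "cmod (prim (exp \<zeta>) (of_real b - \<i> * of_real d) - prim (exp \<zeta>) (of_real a - \<i> * of_real c)) \<le> 10 * cosh 4"
    by (simp add: cosh_real_nonneg mult.commute)
  thus ?thesis
    using norm_triangle_sub[of "prim (exp \<zeta>) (of_real b - \<i> * of_real d)" "prim (exp \<zeta>) (of_real a - \<i> * of_real c)"]
    by linarith
qed

lemma le30: "0 + 10 * C \<le> 30 * C" "0 + 10 * C + 10 * C \<le> 30 * C"
    "0 + 10 * C + 10 * C + 10 * C \<le> 30 * C" if "0 \<le> C" for C :: real
  using that by simp_all

text \<open>The path goes from 0 to 4 on the real axis, where cos \<alpha> (sinh x - x) is
  nonnegative, down to 4 - i \<alpha>, and on along the horizontal ray.\<close>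

lemma saddle_int_bound1:
  assumes "0 \<le> Im \<zeta>" "Im \<zeta> \<le> pi / 2"
  shows "cmod (saddle_int \<zeta>) \<le> 30 * cosh 4 + 2 / exp (Re \<zeta>)"
proof -
  define \<alpha> where "\<alpha> = Im \<zeta>"
  have \<alpha>: "0 \<le> \<alpha>" "\<alpha> \<le> pi / 2" using assms by (simp_all add: \<alpha>_def)
  have sc: "0 \<le> sin \<alpha>" "0 \<le> cos \<alpha>" using \<alpha> by (auto intro: sin_ge_zero cos_ge_zero)
  have e: "0 \<le> exp (- x) * sin \<alpha> * sin y" if "0 \<le> y" "y \<le> \<alpha>" for x y
    using sc(1) sin_ge_zero[of y] that \<alpha> by (intro mult_nonneg_nonneg) auto
  have s1: "cmod (prim (exp \<zeta>) (of_real 4 - \<i> * of_real 0)) \<le> cmod (prim (exp \<zeta>) (of_real 0 - \<i> * of_real 0)) + 10 * cosh 4"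
  proof (rule prim_phase_segment_bound')
    fix u :: real assume u: "0 \<le> u" "u \<le> 1"
    show "0 \<le> Re (cis (Im \<zeta>) * phase (of_real ((1 - u) * 0 + u * 4) - \<i> * of_real ((1 - u) * 0 + u * 0)))"
      unfolding Re_cis_phase' \<alpha>_def[symmetric] using sc u sinh_ge_self[of "u * 4"] by simp
  qed auto
  have s2: "cmod (prim (exp \<zeta>) (of_real 4 - \<i> * of_real \<alpha>)) \<le> cmod (prim (exp \<zeta>) (of_real 4 - \<i> * of_real 0)) + 10 * cosh 4"
  proof (rule prim_phase_segment_bound')
    fix u :: real assume u: "0 \<le> u" "u \<le> 1"
    define y where "y = u * \<alpha>"
    have y: "0 \<le> y" "y \<le> \<alpha>" using u \<alpha> by (auto simp: y_def mult_left_le_one_le)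
    have 1: "cos \<alpha> \<le> cos (\<alpha> - y)" using y \<alpha> by (intro cos_monotone_0_pi_le) auto
    \<comment> \<open>On the vertical segment both negative terms are measured in units of cos
      (\<alpha> - y): y sin \<alpha> costs at most 2 and 4 cos \<alpha> at most 4 of them, while
      sinh 4 supplies at least 19.\<close>
    have "sin y * sin \<alpha> \<le> cos (\<alpha> - y)" 
      using y \<alpha> sc by (simp add: cos_diff cos_ge_zero mult.commute)
    moreover have "y / 2 * sin \<alpha> \<le> sin y * sin \<alpha>"
      using sin_ge_half[of y] y \<alpha> sc by (intro mult_right_mono) auto
    ultimately have 2: "y * sin \<alpha> \<le> 2 * cos (\<alpha> - y)" by simp
    have "19 * cos (\<alpha> - y) \<le> sinh 4 * cos (\<alpha> - y)"
      using sinh_4_ge 1 sc by (intro mult_right_mono) auto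
    hence "0 \<le> Re (cis \<alpha> * phase (of_real 4 - \<i> * of_real y))"
      unfolding Re_cis_phase using 1 2 e[OF y, of 4] sc by linarith
    thus "0 \<le> Re (cis (Im \<zeta>) * phase (of_real ((1 - u) * 4 + u * 4) - \<i> * of_real ((1 - u) * 0 + u * \<alpha>)))"
      by (simp add: \<alpha>_def[symmetric] y_def algebra_simps)
  qed (use \<alpha> pi_less_4 in auto)
  have t: "cmod (saddle_int \<zeta>) \<le> cmod (prim (exp \<zeta>) (horiz \<zeta> 4)) + 2 / exp (Re \<zeta>)"
  proof (rule saddle_int_tail_bound)
    fix x :: real assume x: "4 \<le> x"
    have "x * cos \<alpha> \<le> x * 1" using x by (intro mult_left_mono) auto
    moreover have "\<alpha> * sin \<alpha> \<le> pi / 2 * 1" using \<alpha> by (intro mult_mono) (auto simp: sc)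
    ultimately show "sinh x / 2 \<le> Re (cis (Im \<zeta>) * phase (horiz \<zeta> x))"
      unfolding Re_cis_phase \<alpha>_def[symmetric] using sinh_ge_linear[OF x] e[of \<alpha> x] \<alpha> by simp
  qed auto
  have "cmod (saddle_int \<zeta>) \<le> ((0 + 10 * cosh 4) + 10 * cosh 4) + 2 / exp (Re \<zeta>)"
    by (rule order_trans[OF t add_right_mono[OF order_trans[OF s2[unfolded \<alpha>_def] add_right_mono[OF order_trans[OF s1]]]]]) simp
  also have "\<dots> \<le> 30 * cosh 4 + 2 / exp (Re \<zeta>)"
    using le30[OF cosh_real_nonneg] by (intro add_right_mono) simp
  finally show ?thesis .
qed

text \<open>Here cos \<alpha> \<le> 0, so the path leaves 0 along the diagonal to (pi / 2) (1 - i),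
  continues horizontally to abscissa 4 and descends there to the level - \<alpha>.\<close>

lemma saddle_int_bound2:
  assumes "pi / 2 \<le> Im \<zeta>" "Im \<zeta> \<le> pi"
  shows "cmod (saddle_int \<zeta>) \<le> 30 * cosh 4 + 2 / exp (Re \<zeta>)"
proof -
  define \<alpha> where "\<alpha> = Im \<zeta>"
  have \<alpha>: "pi / 2 \<le> \<alpha>" "\<alpha> \<le> pi" using assms by (simp_all add: \<alpha>_def)
  have sc: "0 \<le> sin \<alpha>" "cos \<alpha> \<le> 0"
    using \<alpha> cos_monotone_0_pi_le[of "pi/2" \<alpha>] by (auto intro: sin_ge_zero)
  have e: "0 \<le> exp (- x) * sin \<alpha> * sin y" if "0 \<le> y" "y \<le> \<alpha>" for x y
    using sc(1) sin_ge_zero[of y] that \<alpha> by (intro mult_nonneg_nonneg) auto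
  have s1: "cmod (prim (exp \<zeta>) (of_real (pi/2) - \<i> * of_real (pi/2))) \<le> cmod (prim (exp \<zeta>) (of_real 0 - \<i> * of_real 0)) + 10 * cosh 4"
  proof (rule prim_phase_segment_bound')
    fix u :: real assume u: "0 \<le> u" "u \<le> 1"
    define x where "x = u * (pi / 2)"
    have x: "0 \<le> x" "x \<le> pi / 2" unfolding x_def using u by (auto simp: mult_le_cancel_right1)
    have "0 \<le> cos \<alpha> * (sinh x * cos x - x)"
      using sc cos_sinh_le[OF x] by (intro mult_nonpos_nonpos) auto
    moreover have "0 \<le> sin \<alpha> * (cosh x * sin x - x)"
      using sc sin_cosh_ge[OF x] by (intro mult_nonneg_nonneg) auto
    ultimately have "0 \<le> Re (cis \<alpha> * phase (of_real x - \<i> * of_real x))"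
      unfolding Re_cis_phase' by simp
    thus "0 \<le> Re (cis (Im \<zeta>) * phase (of_real ((1 - u) * 0 + u * (pi / 2)) - \<i> * of_real ((1 - u) * 0 + u * (pi / 2))))"
      by (simp add: \<alpha>_def x_def)
  qed (use pi_less_4 in auto)
  have s2: "cmod (prim (exp \<zeta>) (of_real 4 - \<i> * of_real (pi/2))) \<le> cmod (prim (exp \<zeta>) (of_real (pi/2) - \<i> * of_real (pi/2))) + 10 * cosh 4"
  proof (rule prim_phase_segment_bound')
    fix u :: real assume u: "0 \<le> u" "u \<le> 1"
    define x where "x = (1 - u) * (pi / 2) + u * 4"
    have "(1 - u) * (pi / 2) + u * (pi/2) \<le> x"
      unfolding x_def using u pi_less_4 by (intro add_left_mono mult_left_mono) auto
    moreover have "(1 - u) * (pi / 2) + u * (pi/2) = pi / 2" by (metis add.commute diff_add_cancel distrib_right mult_1)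
    ultimately have x: "pi / 2 \<le> x" by simp
    have "pi / 2 \<le> cosh x" using x sinh_ge_self[of x] sinh_le_cosh_real[of x] pi_gt_zero by linarith
    hence "0 \<le> sin \<alpha> * (cosh x - pi / 2)" using sc by simp
    moreover have "cos \<alpha> * x \<le> 0" using sc x pi_gt_zero by (intro mult_nonpos_nonneg) linarith+
    ultimately have *: "0 \<le> Re (cis \<alpha> * phase (of_real x - \<i> * of_real (pi / 2)))"
      unfolding Re_cis_phase' by simp
    show "0 \<le> Re (cis (Im \<zeta>) * phase (of_real ((1 - u) * (pi / 2) + u * 4) - \<i> * of_real ((1 - u) * (pi/2) + u * (pi / 2))))"
    proof -
      have "(1 - u) * (pi / 2) + u * (pi/2) = pi / 2"
        by (metis add.commute diff_add_cancel distrib_right mult_1)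
      thus ?thesis using * by (simp only: \<alpha>_def x_def)
    qed
  qed (use pi_less_4 in auto)
  have s3: "cmod (prim (exp \<zeta>) (of_real 4 - \<i> * of_real \<alpha>)) \<le> cmod (prim (exp \<zeta>) (of_real 4 - \<i> * of_real (pi/2))) + 10 * cosh 4"
  proof (rule prim_phase_segment_bound')
    fix u :: real assume u: "0 \<le> u" "u \<le> 1"
    define y where "y = (1 - u) * (pi / 2) + u * \<alpha>"
    have "(1 - u) * (pi / 2) + u * (pi/2) \<le> y" "y \<le> (1 - u) * \<alpha> + u * \<alpha>"
      unfolding y_def using u \<alpha> by (intro add_mono mult_left_mono; simp)+
    moreover have "(1 - u) * (pi / 2) + u * (pi/2) = pi / 2" "(1 - u) * \<alpha> + u * \<alpha> = \<alpha>"
      by (metis add.commute diff_add_cancel distrib_right mult_1)+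
    ultimately have y: "pi / 2 \<le> y" "y \<le> \<alpha>" by simp_all
    have "cos (\<alpha> - pi / 2) \<le> cos (\<alpha> - y)" using y \<alpha> by (intro cos_monotone_0_pi_le) auto
    hence 1: "sin \<alpha> \<le> cos (\<alpha> - y)" by (simp add: cos_diff)
    have 2: "19 * cos (\<alpha> - y) \<le> sinh 4 * cos (\<alpha> - y)"
      using sinh_4_ge 1 sc by (intro mult_right_mono) auto
    have "y * sin \<alpha> \<le> 4 * sin \<alpha>" using y \<alpha> sc pi_less_4 by (intro mult_right_mono) auto
    hence "0 \<le> Re (cis \<alpha> * phase (of_real 4 - \<i> * of_real y))"
      unfolding Re_cis_phase using 1 2 e[of y 4] y pi_gt_zero sc by linarith
    thus "0 \<le> Re (cis (Im \<zeta>) * phase (of_real ((1 - u) * 4 + u * 4) - \<i> * of_real ((1 - u) * (pi/2) + u * \<alpha>)))"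
      unfolding \<alpha>_def y_def by (simp add: algebra_simps)
  qed (use \<alpha> pi_less_4 in auto)
  have t: "cmod (saddle_int \<zeta>) \<le> cmod (prim (exp \<zeta>) (horiz \<zeta> 4)) + 2 / exp (Re \<zeta>)"
  proof (rule saddle_int_tail_bound)
    fix x :: real assume x: "4 \<le> x"
    have "0 \<le> - (x * cos \<alpha>)" using x sc by (simp add: mult_nonneg_nonpos)
    moreover have "\<alpha> * sin \<alpha> \<le> pi * 1" using \<alpha> by (intro mult_mono) (auto simp: sc)
    ultimately show "sinh x / 2 \<le> Re (cis (Im \<zeta>) * phase (horiz \<zeta> x))"
      unfolding Re_cis_phase \<alpha>_def[symmetric]
      using sinh_ge_linear[OF x] e[of \<alpha> x] \<alpha> x pi_less_4 by simp
  qed auto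
  have "cmod (saddle_int \<zeta>) \<le> (((0 + 10 * cosh 4) + 10 * cosh 4) + 10 * cosh 4) + 2 / exp (Re \<zeta>)"
    by (rule order_trans[OF t add_right_mono[OF order_trans[OF s3[unfolded \<alpha>_def] add_right_mono[OF order_trans[OF s2 add_right_mono[OF order_trans[OF s1]]]]]]]) simp
  also have "\<dots> \<le> 30 * cosh 4 + 2 / exp (Re \<zeta>)"
    using le30[OF cosh_real_nonneg] by (intro add_right_mono) simp
  finally show ?thesis .
qed

text \<open>Now sin \<alpha> and cos \<alpha> are both nonpositive. The imaginary axis is admissible
  because sin y \<le> y, and on the horizontal ray every term has the right sign already from x = 0
  on.\<close>

lemma saddle_int_bound3:
  assumes "pi \<le> Im \<zeta>" "Im \<zeta> \<le> 3 * pi / 2"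
  shows "cmod (saddle_int \<zeta>) \<le> 30 * cosh 4 + 2 / exp (Re \<zeta>)"
proof -
  define \<alpha> where "\<alpha> = Im \<zeta>"
  have \<alpha>: "pi \<le> \<alpha>" "\<alpha> \<le> 3 * pi / 2" using assms by (simp_all add: \<alpha>_def)
  have "0 \<le> sin (\<alpha> - pi)" "0 \<le> cos (\<alpha> - pi)"
    using \<alpha> pi_gt_zero by (intro sin_ge_zero cos_ge_zero; linarith)+
  hence sc: "sin \<alpha> \<le> 0" "cos \<alpha> \<le> 0"
    using sin_periodic_pi[of "\<alpha> - pi"] cos_periodic_pi[of "\<alpha> - pi"]
    by (simp_all only: diff_add_cancel neg_le_0_iff_le)
  have s1: "cmod (prim (exp \<zeta>) (of_real 0 - \<i> * of_real \<alpha>)) \<le> cmod (prim (exp \<zeta>) (of_real 0 - \<i> * of_real 0)) + 10 * cosh 4"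
  proof (rule prim_phase_segment_bound')
    fix u :: real assume u: "0 \<le> u" "u \<le> 1"
    have "0 \<le> sin \<alpha> * (sin (u * \<alpha>) - u * \<alpha>)"
      using sc u \<alpha> pi_gt_zero by (intro mult_nonpos_nonpos) (auto simp: sin_x_le_x)
    thus "0 \<le> Re (cis (Im \<zeta>) * phase (of_real ((1 - u) * 0 + u * 0) - \<i> * of_real ((1 - u) * 0 + u * \<alpha>)))"
      unfolding Re_cis_phase' \<alpha>_def[symmetric] by simp
  qed (use \<alpha> pi_less_4 in auto)
  have t: "cmod (saddle_int \<zeta>) \<le> cmod (prim (exp \<zeta>) (horiz \<zeta> 0)) + 2 / exp (Re \<zeta>)"
  proof (rule saddle_int_tail_bound)
    fix x :: real assume x: "0 \<le> x"
    have "0 \<le> - (x * cos \<alpha>)" using x sc by (simp add: mult_nonneg_nonpos)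
    moreover have "0 \<le> - (\<alpha> * sin \<alpha>)" using \<alpha> sc pi_gt_zero by (simp add: mult_nonneg_nonpos)
    moreover have "0 \<le> exp (- x) * (sin \<alpha> * sin \<alpha>)" by (intro mult_nonneg_nonneg zero_le_square) auto
    moreover have "0 \<le> sinh x" using x by simp
    ultimately show "sinh x / 2 \<le> Re (cis (Im \<zeta>) * phase (horiz \<zeta> x))"
      unfolding Re_cis_phase \<alpha>_def[symmetric] by (simp add: mult.assoc)
  qed auto
  have "cmod (saddle_int \<zeta>) \<le> (0 + 10 * cosh 4) + 2 / exp (Re \<zeta>)"
    using s1 t unfolding \<alpha>_def by simp
  also have "\<dots> \<le> 30 * cosh 4 + 2 / exp (Re \<zeta>)"
    using le30[OF cosh_real_nonneg] by (intro add_right_mono) simp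
  finally show ?thesis .
qed

text \<open>At most three segments occur, each of length at most 10 with kernel at most cosh 4; this
  is the constant 30 cosh 4. The lower half of the strip follows by conjugation.\<close>

lemma saddle_int_bound:
  assumes "\<bar>Im \<zeta>\<bar> \<le> 3 * pi / 2"
  shows "cmod (saddle_int \<zeta>) \<le> 30 * cosh 4 + 2 / exp (Re \<zeta>)"
proof (cases "Im \<zeta> \<ge> 0")
  case True
  thus ?thesis
    using assms saddle_int_bound1[of \<zeta>] saddle_int_bound2[of \<zeta>] saddle_int_bound3[of \<zeta>] by linarith
next
  case False
  have im: "Im (cnj \<zeta>) = - Im \<zeta>" by simp
  consider "0 \<le> Im (cnj \<zeta>)" "Im (cnj \<zeta>) \<le> pi / 2" | "pi / 2 \<le> Im (cnj \<zeta>)" "Im (cnj \<zeta>) \<le> pi"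
    | "pi \<le> Im (cnj \<zeta>)" "Im (cnj \<zeta>) \<le> 3 * pi / 2"
    using assms False unfolding im by linarith
  hence "cmod (saddle_int (cnj \<zeta>)) \<le> 30 * cosh 4 + 2 / exp (Re (cnj \<zeta>))"
    by cases (auto intro: saddle_int_bound1 saddle_int_bound2 saddle_int_bound3 simp del: cnj.sel)
  thus ?thesis by (simp add: saddle_int_cnj)
qed

subsection \<open>The curve through the next saddle point\<close>

text \<open>
  The curve \<open>cut_pt\<close> is where \<open>sinh t - t\<close> is purely imaginary, equal to \<open>\<i> cut_s x\<close>; the value
  of \<open>sinc_hyp\<close> at \<open>0\<close> makes it start at \<open>- 2 \<pi> \<i>\<close>.
\<close>

definition sinc_hyp :: "real \<Rightarrow> real" where
  "sinc_hyp x = (if x = 0 then 1 else x / sinh x)"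

definition cut_y :: "real \<Rightarrow> real" where
  "cut_y x = 2 * pi - arccos (sinc_hyp x)"

abbreviation cut_pt :: "real \<Rightarrow> complex" where
  "cut_pt x \<equiv> of_real x - \<i> * of_real (cut_y x)"

text \<open>The imaginary part of cosh along the curve. Since sinh t dt is the differential of cosh
  t, its derivative \<open>cut_dq\<close> is the density that appears when the kernel is integrated
  along the curve.\<close>

definition cut_q :: "real \<Rightarrow> real" where
  "cut_q x = sqrt ((sinh x)\<^sup>2 - x\<^sup>2)"

definition cut_dq :: "real \<Rightarrow> real" where
  "cut_dq x = (sinh x * cosh x - x) / cut_q x"

definition cut_s :: "real \<Rightarrow> real" where
  "cut_s x = cut_y x + cosh x / sinh x * cut_q x"

lemma sinh_gt_self: "x < sinh x" if "0 < (x::real)"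
proof -
  have "sinh 0 - 0 < sinh x - x"
  proof (rule DERIV_pos_imp_increasing_open[OF that])
    fix y assume "0 < y" "y < x"
    thus "\<exists>d. ((\<lambda>x. sinh x - x) has_real_derivative d) (at y) \<and> 0 < d"
      using cosh_real_strict_mono[of 0 y] by (auto intro!: exI derivative_eq_intros)
  qed (auto intro!: continuous_intros)
  thus ?thesis by simp
qed

lemma sinc_hyp_bounds: "0 < sinc_hyp x" "sinc_hyp x < 1" if "0 < x"
  using sinh_gt_self[OF that] that by (auto simp: sinc_hyp_def)

lemma sinc_hyp_le_1: "sinc_hyp x \<le> 1" and sinc_hyp_nonneg: "0 \<le> sinc_hyp x" if "0 \<le> x"
  using sinc_hyp_bounds[of x] that by (cases "x = 0"; simp add: sinc_hyp_def)+

lemma continuous_on_sinc_hyp: "continuous_on {0..} sinc_hyp"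
proof -
  have "((\<lambda>x. x / sinh x) \<longlongrightarrow> 1) (at (0::real))"
    unfolding sinh_field_def by real_asymp
  hence 0: "isCont sinc_hyp 0"
    unfolding isCont_def sinc_hyp_def
    by (simp, rule Lim_transform_eventually) (auto simp: eventually_at_filter)
  have "isCont sinc_hyp x" if "x \<noteq> 0" for x
  proof -
    have "isCont (\<lambda>x. x / sinh x) x" using that by (intro continuous_intros) auto
    moreover have "eventually (\<lambda>x. sinc_hyp x = x / sinh x) (nhds x)"
      using t1_space_nhds[OF that] by eventually_elim (auto simp: sinc_hyp_def)
    ultimately show ?thesis using isCont_cong[of sinc_hyp "\<lambda>x. x / sinh x" x] by simp
  qed
  with 0 show ?thesis by (metis continuous_at_imp_continuous_on)
qed

lemma continuous_on_cut_y: "continuous_on {0..} cut_y"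
  unfolding cut_y_def
  by (intro continuous_intros continuous_on_arccos continuous_on_sinc_hyp)
    (use sinc_hyp_nonneg sinc_hyp_le_1 in \<open>fastforce simp: abs_le_iff\<close>)

lemma cut_y_bounds: "3 * pi / 2 \<le> cut_y x" "cut_y x \<le> 2 * pi" if "0 \<le> x"
  using arccos_le_pi2[of "sinc_hyp x"] arccos_lbound[of "sinc_hyp x"] sinc_hyp_le_1[OF that] sinc_hyp_nonneg[OF that]
  by (auto simp: cut_y_def)

lemma cut_q_pos: "0 < cut_q x" if "0 < x"
proof -
  have "x\<^sup>2 < (sinh x)\<^sup>2" using sinh_gt_self[OF that] that by (intro power_strict_mono) auto
  thus ?thesis by (simp add: cut_q_def)
qed

lemma cos_cut_y: "cos (cut_y x) = x / sinh x" and sin_cut_y: "sin (cut_y x) = - cut_q x / sinh x" if "0 < x"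
proof -
  have b: "-1 \<le> sinc_hyp x" "sinc_hyp x \<le> 1" using sinc_hyp_bounds[OF that] by auto
  have e: "sinc_hyp x = x / sinh x" using that by (simp add: sinc_hyp_def)
  show "cos (cut_y x) = x / sinh x" using b by (simp add: cut_y_def cos_diff e)
  have "sin (cut_y x) = - sin (arccos (sinc_hyp x))" by (simp add: cut_y_def sin_diff)
  also have "sin (arccos (sinc_hyp x)) = sqrt (1 - (sinc_hyp x)\<^sup>2)"
    using b by (intro sin_arccos) auto
  also have "1 - (sinc_hyp x)\<^sup>2 = ((sinh x)\<^sup>2 - x\<^sup>2) / (sinh x)\<^sup>2"
    using that by (simp add: e field_simps)
  also have "sqrt \<dots> = cut_q x / sinh x"
    using that by (simp add: cut_q_def real_sqrt_divide)
  finally show "sin (cut_y x) = - cut_q x / sinh x" by simp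
qed

lemma cut_q_deriv: "(cut_q has_real_derivative cut_dq x) (at x)" if "0 < x"
proof -
  have "0 < (sinh x)\<^sup>2 - x\<^sup>2" using cut_q_pos[OF that] by (simp add: cut_q_def)
  thus ?thesis unfolding cut_q_def[abs_def] cut_dq_def
    by (auto intro!: derivative_eq_intros simp: field_simps)
qed

lemma cut_dq_pos: "0 < cut_dq x" if "0 < x"
proof -
  have "x * 1 < sinh x * cosh x"
    using sinh_gt_self[OF that] cosh_real_ge_1[of x] that by (intro mult_less_le_imp_less) auto
  thus ?thesis using cut_q_pos[OF that] by (simp add: cut_dq_def)
qed

lemma continuous_on_cut_q: "continuous_on A cut_q"
  unfolding cut_q_def[abs_def] by (intro continuous_intros)

lemma continuous_on_cut_dq: "continuous_on {0<..} cut_dq"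
  unfolding cut_dq_def[abs_def]
  by (intro continuous_intros continuous_on_cut_q) (use cut_q_pos in force)

lemma continuous_on_cut_s: "continuous_on {0<..} cut_s"
  unfolding cut_s_def[abs_def]
  by (intro continuous_intros continuous_on_cut_q continuous_on_subset[OF continuous_on_cut_y]) auto

text \<open>The additive form is what counts: \<open>cut_q\<close> becomes the variable of
  integration in \<open>cut_hr_le\<close>, and the constant provides the exponential decay.\<close>

lemma cut_s_ge: "pi + cut_q x \<le> cut_s x" if "0 < x"
proof -
  have "1 \<le> cosh x / sinh x" using that by (simp add: sinh_le_cosh_real)
  hence "1 * cut_q x \<le> cosh x / sinh x * cut_q x" using cut_q_pos[OF that] by (intro mult_right_mono) auto
  thus ?thesis using cut_y_bounds[of x] that unfolding cut_s_def by simp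
qed

lemma phase_cut: "phase (cut_pt x) = \<i> * of_real (cut_s x)" if "0 < x"
proof -
  have "Re (cis 0 * phase (cut_pt x)) = 0"
    unfolding Re_cis_phase' using that by (simp add: cos_cut_y)
  moreover have "Re (cis (-(pi/2)) * phase (cut_pt x)) = cut_s x"
    unfolding Re_cis_phase' using that by (simp add: sin_cut_y cut_s_def)
  ultimately show ?thesis by (simp add: complex_eq_iff)
qed

text \<open>The derivative of \<open>cut_y\<close> never has to be simplified: differentiating cosh
  along the curve and comparing its imaginary part with the derivative of \<open>cut_q\<close> gives
  the product at once.\<close>

lemma Im_sinh_cut_deriv:
  assumes "0 < x"
  obtains d where "(cut_y has_real_derivative d) (at x)"
    "Im (sinh (cut_pt x) * (1 - \<i> * of_real d)) = cut_dq x"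
proof -
  have "0 < x / sinh x" "x / sinh x < 1" using sinc_hyp_bounds[OF assms] assms by (auto simp: sinc_hyp_def)
  hence b: "-1 < x / sinh x" "x / sinh x < 1" by linarith+
  have "((\<lambda>x. 2 * pi - arccos (x / sinh x)) has_real_derivative
     - ((1 * sinh x - x * cosh x) / (sinh x * sinh x) * inverse (- sqrt (1 - (x / sinh x)\<^sup>2)))) (at x)"
    by (rule derivative_eq_intros DERIV_arccos refl | use b assms in force)+
      
  note dy = this
  have ev: "eventually (\<lambda>x. 2 * pi - arccos (x / sinh x) = cut_y x) (nhds x)"
  proof (rule eventually_mono[OF eventually_nhds_in_open[of "{0<..}" x]])
    show "2 * pi - arccos (y / sinh y) = cut_y y" if "y \<in> {0<..}" for y
      using that unfolding cut_y_def sinc_hyp_def by simp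
  qed (use assms in auto)
  obtain d where d: "(cut_y has_real_derivative d) (at x)"
    using dy unfolding DERIV_cong_ev[OF refl ev refl] ..
  have Imc: "Im (cosh (cut_pt x)) = cut_q x" if "0 < x" for x
  proof -
    have "Im (cosh (cut_pt x)) = - sinh x * sin (cut_y x)"
      by (simp add: cosh_field_def sinh_field_def Im_exp field_simps)
    thus ?thesis using that by (simp add: sin_cut_y)
  qed
  have "((\<lambda>x. cut_pt x) has_vector_derivative (1 - \<i> * of_real d)) (at x)"
    using d by (auto intro!: derivative_eq_intros has_vector_derivative_of_real simp: has_real_derivative_iff_has_vector_derivative)
  hence "((cosh \<circ> (\<lambda>x. cut_pt x)) has_vector_derivative
     (1 - \<i> * of_real d) * sinh (cut_pt x)) (at x)"
    by (rule field_vector_diff_chain_at) (auto intro!: derivative_eq_intros)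
  hence "((\<lambda>x. Im (cosh (cut_pt x))) has_real_derivative
     Im ((1 - \<i> * of_real d) * sinh (cut_pt x))) (at x)"
    unfolding has_real_derivative_iff_has_vector_derivative o_def
    by (rule bounded_linear.has_vector_derivative[OF bounded_linear_Im])
  note dc = this
  have ev': "eventually (\<lambda>x. Im (cosh (cut_pt x)) = cut_q x) (nhds x)"
  proof (rule eventually_mono[OF eventually_nhds_in_open[of "{0<..}" x]])
    show "Im (cosh (cut_pt y)) = cut_q y" if "y \<in> {0<..}" for y
      using that Imc by blast
  qed (use assms in auto)
  have "(cut_q has_real_derivative
     Im ((1 - \<i> * of_real d) * sinh (cut_pt x))) (at x)"
    using dc unfolding DERIV_cong_ev[OF refl ev' refl] .
  with cut_q_deriv[OF assms] have "Im ((1 - \<i> * of_real d) * sinh (cut_pt x)) = cut_dq x"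
    using DERIV_unique by blast
  thus ?thesis using that[OF d] by (simp add: mult.commute)
qed

text \<open>For Im \<zeta> = 3 pi / 2 the number exp \<zeta> is - i times a positive number, and on
  the imaginary axis the kernel times dt is then real. Hence the way from 0 to the start of the
  curve does not contribute to the imaginary part.\<close>

lemma prim_imaginary_axis_real: "Im (prim (- (\<i> * of_real n)) (- (\<i> * of_real y))) = 0"
proof -
  have d: "((\<lambda>y. Im (prim (- (\<i> * of_real n)) (- (\<i> * of_real y)))) has_real_derivative 0) (at y)" for y
  proof -
    have "((\<lambda>y. prim (- (\<i> * of_real n)) (- (\<i> * of_real y))) has_vector_derivative
       kern (- (\<i> * of_real n)) (- (\<i> * of_real y)) * (- \<i>)) (at y)"
      by (rule prim_of_real_deriv) (auto intro!: derivative_eq_intros)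
    moreover have "kern (- (\<i> * of_real n)) (- (\<i> * of_real y)) * (- \<i>) = of_real (- sin y * exp (- (n * (y - sin y))))"
    proof -
      have "sinh (- (\<i> * of_real y)) = - \<i> * of_real (sin y)"
        by (simp add: sinh_field_def complex_eq_iff Re_exp Im_exp)
      thus ?thesis by (simp add: kern_def phase_def exp_of_real[symmetric] algebra_simps)
    qed
    ultimately show ?thesis
      unfolding has_real_derivative_iff_has_vector_derivative
      using bounded_linear.has_vector_derivative[OF bounded_linear_Im] by fastforce
  qed
  have "Im (prim (- (\<i> * of_real n)) (- (\<i> * of_real y))) = Im (prim (- (\<i> * of_real n)) (- (\<i> * of_real 0)))"
    by (rule DERIV_const_ratio_const2[of _ _ _ 0] DERIV_isconst_all) (use d in auto)
  thus ?thesis by simp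
qed

text \<open>The curve and the horizontal line in the definition of \<open>saddle_int\<close> end in
  the same valley: on the vertical segment joining them at abscissa x the kernel is at most cosh x
  exp (- n cosh x / 2).\<close>

lemma Im_prim_cut_lim:
  assumes z: "Im \<zeta> = 3 * pi / 2"
  shows "((\<lambda>x. Im (prim (exp \<zeta>) (cut_pt x))) \<longlongrightarrow> Im (saddle_int \<zeta>)) at_top"
proof -
  define n where "n = exp (Re \<zeta>)"
  have n: "n > 0" by (simp add: n_def)
  have c32: "cos (3 * pi / 2) = 0" "sin (3 * pi / 2) = -1"
    using cos_periodic_pi[of "pi/2"] sin_periodic_pi[of "pi/2"] by (simp_all add: field_simps)
  have "((\<lambda>x. prim (exp \<zeta>) (cut_pt x) - prim (exp \<zeta>) (horiz \<zeta> x)) \<longlongrightarrow> 0) at_top"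
  proof (rule Lim_null_comparison)
    show "((\<lambda>x. cosh x * exp (- (n * (cosh x / 2))) * pi) \<longlongrightarrow> 0) at_top"
    proof -
      have "((\<lambda>t. t * exp (- (n * (t / 2))) * pi) \<longlongrightarrow> 0) at_top" using n by real_asymp
      moreover have "filterlim (cosh :: real \<Rightarrow> real) at_top at_top" by (rule cosh_real_at_top)
      ultimately show ?thesis by (rule filterlim_compose)
    qed
    show "\<forall>\<^sub>F x in at_top. cmod (prim (exp \<zeta>) (cut_pt x) - prim (exp \<zeta>) (horiz \<zeta> x))
       \<le> cosh x * exp (- (n * (cosh x / 2))) * pi"
      using eventually_ge_at_top[of 4]
    proof eventually_elim
      case (elim x)
      \<comment> \<open>This puts \<open>cut_y x\<close> below 5 pi / 3, which keeps - sin y at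
        least 1 / 2 on the whole segment.\<close>
      have "sinc_hyp x \<le> 1 / 2"
      proof -
        have "0 < sinh x" using elim by simp
        moreover have "2 * x \<le> sinh x" using sinh_ge_linear[OF elim] pi_gt_zero by linarith
        ultimately show ?thesis using elim by (simp add: sinc_hyp_def field_simps)
      qed
      hence "arccos (1 / 2) \<le> arccos (sinc_hyp x)"
        using sinc_hyp_nonneg[of x] elim by (intro arccos_le_arccos) auto
      moreover have "arccos (1/2) = pi / 3"
        using arccos_cos[of "pi/3"] pi_gt_zero by (simp add: cos_60)
      ultimately have yb: "3 * pi / 2 \<le> cut_y x" "cut_y x \<le> 2 * pi - pi / 3"
        using cut_y_bounds[of x] elim by (auto simp: cut_y_def)
      have "cmod (prim (exp \<zeta>) (cut_pt x) - prim (exp \<zeta>) (horiz \<zeta> x))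
        \<le> (cosh x * exp (- (n * (cosh x / 2)))) * cmod ((cut_pt x) - (horiz \<zeta> x))"
      proof (rule prim_segment_bound)
        fix t assume "t \<in> closed_segment (horiz \<zeta> x) (cut_pt x)"
        then obtain u where u: "0 \<le> u" "u \<le> 1"
          "t = (1 - u) *\<^sub>R (horiz \<zeta> x) + u *\<^sub>R (cut_pt x)"
          by (auto simp: closed_segment_def)
        define y where "y = (1 - u) * Im \<zeta> + u * cut_y x"
        have t: "t = of_real x - \<i> * of_real y"
          by (simp add: u(3) y_def complex_eq_iff algebra_simps)
        have y: "3 * pi / 2 \<le> y" "y \<le> 2 * pi - pi / 3"
        proof -
          have "u * (3 * pi / 2) \<le> u * cut_y x" "u * cut_y x \<le> u * (2 * pi - pi / 3)"
            using u yb by (intro mult_left_mono; simp)+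
          moreover have "(1 - u) * (3 * pi / 2) \<le> (1 - u) * (2 * pi - pi / 3)"
            using u pi_gt_zero by (intro mult_left_mono) auto
          moreover have "(1 - u) * (3 * pi / 2) + u * (3 * pi / 2) = 3 * pi / 2"
            "(1 - u) * (2 * pi - pi / 3) + u * (2 * pi - pi / 3) = 2 * pi - pi / 3"
            by (metis add.commute diff_add_cancel distrib_right mult_1)+
          ultimately show "3 * pi / 2 \<le> y" "y \<le> 2 * pi - pi / 3" unfolding y_def z by linarith+
        qed
        have "cos (pi / 3) \<le> cos (y - 3 * pi / 2)"
          using y pi_gt_zero by (intro cos_monotone_0_pi_le) linarith+
        hence "1 / 2 \<le> - sin y" by (simp add: cos_60 cos_diff c32)
        hence "cosh x * (1 / 2) \<le> cosh x * - sin y" by (intro mult_left_mono) auto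
        hence "cosh x / 2 \<le> Re (cis (Im \<zeta>) * phase t)"
          unfolding t Re_cis_phase' z c32 using y pi_gt_zero by simp
        from kern_bound[OF this] show "cmod (kern (exp \<zeta>) t) \<le> cosh x * exp (- (n * (cosh x / 2)))"
          by (simp add: t n_def)
      qed
      also have "\<dots> \<le> cosh x * exp (- (n * (cosh x / 2))) * pi"
      proof (rule mult_left_mono)
        have "(cut_pt x) - (horiz \<zeta> x) = - \<i> * of_real (cut_y x - Im \<zeta>)"
          by (simp add: algebra_simps)
        hence "cmod ((cut_pt x) - (horiz \<zeta> x)) = \<bar>cut_y x - Im \<zeta>\<bar>"
          by (simp only: norm_mult norm_of_real norm_minus_cancel norm_ii mult_1)
        thus "cmod ((cut_pt x) - (horiz \<zeta> x)) \<le> pi"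
          using yb pi_gt_zero z by linarith
      qed simp
      finally show ?case .
    qed
  qed
  from tendsto_add[OF this saddle_int_lim[of \<zeta>]]
  have "((\<lambda>x. prim (exp \<zeta>) (cut_pt x)) \<longlongrightarrow> saddle_int \<zeta>) at_top" by simp
  thus ?thesis by (rule tendsto_Im)
qed

text \<open>On the curve exp \<zeta> times the phase is (- i n) (i s) = n s, a real number, so the
  imaginary part falls entirely on sinh t dt. Positivity of \<open>cut_dq\<close> supplies the
  integrability.\<close>

lemma Im_saddle_int_cut:
  assumes z: "Im \<zeta> = 3 * pi / 2"
  shows "integrable_Ioi (\<lambda>x. exp (- (exp (Re \<zeta>) * cut_s x)) * cut_dq x)"
    and "Im (saddle_int \<zeta>) = (LBINT x:{0<..}. exp (- (exp (Re \<zeta>) * cut_s x)) * cut_dq x)"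
proof -
  define n where "n = exp (Re \<zeta>)"
  have c32: "cos (3 * pi / 2) = 0" "sin (3 * pi / 2) = -1"
    using cos_periodic_pi[of "pi/2"] sin_periodic_pi[of "pi/2"] by (simp_all add: field_simps)
  have e: "exp \<zeta> = - (\<i> * of_real n)"
    by (simp add: exp_eq_polar z c32 n_def complex_eq_iff)
  have "continuous_on {0..} (\<lambda>x. Im (prim (exp \<zeta>) (cut_pt x)))"
    by (intro continuous_intros continuous_on_cut_y)
  moreover have "continuous_on {0<..} (\<lambda>x. exp (- (n * cut_s x)) * cut_dq x)"
    by (intro continuous_intros continuous_on_cut_s continuous_on_cut_dq)
  moreover have "((\<lambda>x. Im (prim (exp \<zeta>) (cut_pt x))) has_real_derivative exp (- (n * cut_s x)) * cut_dq x) (at x)"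
    if x: "x > 0" for x
  proof -
    obtain d where d: "(cut_y has_real_derivative d) (at x)"
      "Im (sinh (cut_pt x) * (1 - \<i> * of_real d)) = cut_dq x"
      using Im_sinh_cut_deriv[OF x] .
    have "((\<lambda>x. cut_pt x) has_vector_derivative (1 - \<i> * of_real d)) (at x)"
      using d(1) by (auto intro!: derivative_eq_intros has_vector_derivative_of_real simp: has_real_derivative_iff_has_vector_derivative)
    from bounded_linear.has_vector_derivative[OF bounded_linear_Im prim_of_real_deriv[OF this, of "exp \<zeta>"]]
    have "((\<lambda>x. Im (prim (exp \<zeta>) (cut_pt x))) has_real_derivative
       Im (kern (exp \<zeta>) (cut_pt x) * (1 - \<i> * of_real d))) (at x)"
      unfolding has_real_derivative_iff_has_vector_derivative .
    moreover have "kern (exp \<zeta>) (cut_pt x) =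
       of_real (exp (- (n * cut_s x))) * sinh (cut_pt x)"
    proof -
      have "- (- (\<i> * of_real n) * (\<i> * of_real (cut_s x))) = of_real (- (n * cut_s x))"
        by (simp add: complex_eq_iff)
      thus ?thesis unfolding kern_def phase_cut[OF x] e by (simp only: exp_of_real mult.commute)
    qed
    moreover have "Im (of_real r * a * b) = r * Im (a * b)" for r a b
      by (simp add: algebra_simps)
    ultimately show ?thesis using d(2) by (simp only:)
  qed
  moreover have "0 \<le> exp (- (n * cut_s x)) * cut_dq x" if "x > 0" for x
    using cut_dq_pos[OF that] by simp
  ultimately have *: "integrable_Ioi (\<lambda>x. exp (- (n * cut_s x)) * cut_dq x)"
    "(LBINT x:{0<..}. exp (- (n * cut_s x)) * cut_dq x) = Im (saddle_int \<zeta>) - Im (prim (exp \<zeta>) (cut_pt 0))"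
    using set_integral_FTC_nonneg[OF _ _ _ _ Im_prim_cut_lim[OF z]] by blast+
  moreover have "Im (prim (exp \<zeta>) (cut_pt 0)) = 0"
    unfolding e using prim_imaginary_axis_real[of n "cut_y 0"] by simp
  ultimately show "integrable_Ioi (\<lambda>x. exp (- (exp (Re \<zeta>) * cut_s x)) * cut_dq x)"
    "Im (saddle_int \<zeta>) = (LBINT x:{0<..}. exp (- (exp (Re \<zeta>) * cut_s x)) * cut_dq x)"
    by (simp_all add: n_def)
qed

section \<open>The Laplace transform along the curve\<close>

definition cut_h :: "complex \<Rightarrow> complex" where
  "cut_h z = 2 * (LBINT x:{0<..}. exp (- (z * of_real (cut_s x))) * of_real (cut_dq x))"

definition cut_hr :: "real \<Rightarrow> real" where
  "cut_hr n = 2 * (LBINT x:{0<..}. exp (- (n * cut_s x)) * cut_dq x)"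

lemma set_integral_pos:
  fixes f :: "real \<Rightarrow> real"
  assumes i: "integrable_Ioi f" and pos: "\<And>x. x > 0 \<Longrightarrow> 0 < f x"
  shows "0 < (LBINT x:{0<..}. f x)"
proof -
  have nn: "0 \<le> indicator {0<..} x *\<^sub>R f x" for x
    using pos[of x] by (simp add: indicator_def less_imp_le)
  have "(LBINT x:{0<..}. f x) \<noteq> 0"
  proof
    assume "(LBINT x:{0<..}. f x) = 0"
    hence "AE x in lborel. indicator {0<..} x *\<^sub>R f x = 0"
      using i nn unfolding set_lebesgue_integral_def set_integrable_def
      by (subst (asm) integral_nonneg_eq_0_iff_AE) auto
    hence "AE x in lborel. x \<notin> {0<..<1::real}"
    proof eventually_elim
      case (elim x)
      thus ?case using pos[of x] by (auto simp: indicator_def)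
    qed
    hence "emeasure lborel {0<..<1::real} = 0"
      by (subst (asm) AE_iff_measurable[of "{0<..<1}"]) auto
    moreover have "emeasure lborel {0<..<1::real} = ennreal (1 - 0)" by (rule emeasure_lborel_Ioo) simp
    ultimately have "ennreal (1 - 0) = 0" by (rule trans[OF sym, rotated])
    thus False by simp
  qed
  moreover have "0 \<le> (LBINT x:{0<..}. f x)"
    unfolding set_lebesgue_integral_def using nn by (intro Bochner_Integration.integral_nonneg) auto
  ultimately show ?thesis by linarith
qed

lemma cut_hr_integrable: "integrable_Ioi (\<lambda>x. exp (- (n * cut_s x)) * cut_dq x)" if "n > 0"
  using Im_saddle_int_cut(1)[of "Complex (ln n) (3 * pi / 2)"] that by simp

text \<open>The values on the two edges are conjugate, so the jump is 2 i times the imaginary part;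
  this is the factor 2 in \<open>cut_h\<close> and \<open>cut_hr\<close>.\<close>

lemma saddle_int_jump:
  "saddle_int (Complex \<xi> (3 * pi / 2)) - saddle_int (Complex \<xi> (- (3 * pi / 2))) = \<i> * of_real (cut_hr (exp \<xi>))"
proof -
  have "Complex \<xi> (- (3 * pi / 2)) = cnj (Complex \<xi> (3 * pi / 2))" by (simp add: complex_eq_iff)
  thus ?thesis
    using Im_saddle_int_cut(2)[of "Complex \<xi> (3 * pi / 2)"]
    by (simp only: saddle_int_cnj) (simp add: complex_eq_iff cut_hr_def)
qed

lemma cut_hr_pos: "0 < cut_hr n" if "n > 0"
  unfolding cut_hr_def using set_integral_pos[OF cut_hr_integrable[OF that]] cut_dq_pos by simp

lemma cut_h_of_real: "cut_h (of_real n) = of_real (cut_hr n)"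
proof -
  have "(LBINT x:{0<..}. exp (- (complex_of_real n * of_real (cut_s x))) * of_real (cut_dq x))
     = (LBINT x:{0<..}. of_real (exp (- (n * cut_s x)) * cut_dq x))"
    by (intro arg_cong[of _ _ "set_lebesgue_integral lborel {0<..}"]) (simp flip: exp_of_real)
  thus ?thesis unfolding cut_h_def cut_hr_def by (simp only: set_integral_complex_of_real) simp
qed

lemma set_integrable_continuous_bound_Ioi:
  fixes f :: "real \<Rightarrow> complex"
  assumes "continuous_on {a<..} f" "set_integrable lborel {a<..} g"
    and "\<And>x. x > a \<Longrightarrow> cmod (f x) \<le> g x"
  shows "set_integrable lborel {a<..} f"
  by (rule set_integrable_bound[OF assms(2)])
    (use assms(1,3) in \<open>auto intro!: AE_I2 intro: order_trans[OF _ abs_ge_self] simp: set_borel_measurable_def borel_measurable_continuous_on_indicator\<close>)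

lemma cut_h_integrand_norm:
  "x > 0 \<Longrightarrow> cmod (exp (- (z * of_real (cut_s x))) * of_real (cut_dq x)) = exp (- (Re z * cut_s x)) * cut_dq x"
  using cut_dq_pos[of x] by (simp add: norm_mult)

lemma cut_h_integrable:
  "integrable_Ioi (\<lambda>x. exp (- (z * of_real (cut_s x))) * of_real (cut_dq x))" if "Re z > 0"
proof (rule set_integrable_continuous_bound_Ioi[OF _ cut_hr_integrable[OF that]])
  show "continuous_on {0<..} (\<lambda>x. exp (- (z * of_real (cut_s x))) * of_real (cut_dq x))"
    by (intro continuous_intros continuous_on_cut_s continuous_on_cut_dq)
qed (simp add: cut_h_integrand_norm)

lemma norm_cut_h_le: "cmod (cut_h z) \<le> cut_hr (Re z)" if "Re z > 0"
proof -
  have "cmod (LBINT x:{0<..}. exp (- (z * of_real (cut_s x))) * of_real (cut_dq x))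
    \<le> (LBINT x:{0<..}. cmod (exp (- (z * of_real (cut_s x))) * of_real (cut_dq x)))"
    by (rule set_integral_norm_bound[OF cut_h_integrable[OF that]])
  also have "\<dots> = (LBINT x:{0<..}. exp (- (Re z * cut_s x)) * cut_dq x)"
    by (rule set_lebesgue_integral_cong) (use cut_h_integrand_norm[of _ z] in auto)
  finally show ?thesis by (simp add: cut_h_def cut_hr_def norm_mult)
qed

lemma cut_q_0: "cut_q 0 = 0"
  by (simp add: cut_q_def)

text \<open>With \<open>cut_s x\<close> replaced by its lower bound pi + q the integral is
  elementary in the variable q = \<open>cut_q x\<close>. The factor 1 / n is the worst that can
  happen at n = 0.\<close>

lemma cut_hr_le: "cut_hr n \<le> 2 * exp (- (pi * n)) / n" if n: "n > 0"
proof -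
  have "filterlim cut_q at_top at_top"
  proof -
    have "filterlim (\<lambda>x::real. x) at_top at_top" by (rule filterlim_ident)
    moreover have "\<forall>\<^sub>F x in at_top. x \<le> cut_q x"
      using eventually_ge_at_top[of 4]
    proof eventually_elim
      case (elim x)
      have "2 * x \<le> sinh x" using sinh_ge_linear[OF elim] pi_gt_zero by linarith
      hence "(2 * x)\<^sup>2 \<le> (sinh x)\<^sup>2" using elim by (intro power_mono) auto
      moreover have "0 \<le> x\<^sup>2" by simp
      moreover have "(2 * x)\<^sup>2 = 4 * x\<^sup>2" by (simp add: power_mult_distrib)
      ultimately have "x\<^sup>2 \<le> (sinh x)\<^sup>2 - x\<^sup>2" by linarith
      thus ?case unfolding cut_q_def by (rule real_le_rsqrt)
    qed
    ultimately show ?thesis by (rule filterlim_at_top_mono)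
  qed
  moreover have "((\<lambda>t. - (exp (- (n * (pi + t))) / n)) \<longlongrightarrow> 0) at_top" using n by real_asymp
  ultimately have l: "((\<lambda>x. - (exp (- (n * (pi + cut_q x))) / n)) \<longlongrightarrow> 0) at_top"
    by (rule filterlim_compose[rotated])
  have c1: "continuous_on {0..} (\<lambda>x. - (exp (- (n * (pi + cut_q x))) / n))"
    using n by (intro continuous_intros continuous_on_cut_q) auto
  have c2: "continuous_on {0<..} (\<lambda>x. exp (- (n * (pi + cut_q x))) * cut_dq x)"
    by (intro continuous_intros continuous_on_cut_q continuous_on_cut_dq)
  have c3: "((\<lambda>x. - (exp (- (n * (pi + cut_q x))) / n)) has_real_derivative exp (- (n * (pi + cut_q x))) * cut_dq x) (at x)"
    if "0 < x" for x
    using n by (auto intro!: derivative_eq_intros cut_q_deriv[OF that])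
  have c4: "0 \<le> exp (- (n * (pi + cut_q x))) * cut_dq x" if "0 < x" for x
    using cut_dq_pos[OF that] by simp
  note F = set_integral_FTC_nonneg[OF c1 c2 c3 c4 l]
  have "(LBINT x:{0<..}. exp (- (n * cut_s x)) * cut_dq x) \<le> (LBINT x:{0<..}. exp (- (n * (pi + cut_q x))) * cut_dq x)"
  proof (rule set_integral_mono[OF cut_hr_integrable[OF n] F(1)])
    fix x :: real assume "x \<in> {0<..}"
    hence "x > 0" by simp
    thus "exp (- (n * cut_s x)) * cut_dq x \<le> exp (- (n * (pi + cut_q x))) * cut_dq x"
      using cut_s_ge[of x] cut_dq_pos[of x] n by (intro mult_right_mono) (simp_all add: less_imp_le)
  qed
  also have "\<dots> = exp (- (pi * n)) / n" 
    using F(2) cut_q_0 by (simp only: minus_minus add_0_right diff_0 mult.commute[of n pi])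
  finally show ?thesis by (simp add: cut_hr_def)
qed

lemma cut_s_nonneg: "0 \<le> cut_s x" if "0 < x"
  using cut_s_ge[OF that] cut_q_pos[OF that] pi_gt_zero by linarith

lemma cut_hr_antimono: "cut_hr b \<le> cut_hr a" if "0 < a" "a \<le> b"
proof -
  have "(LBINT x:{0<..}. exp (- (b * cut_s x)) * cut_dq x) \<le> (LBINT x:{0<..}. exp (- (a * cut_s x)) * cut_dq x)"
  proof (rule set_integral_mono)
    fix x :: real assume x: "x \<in> {0<..}"
    have "0 \<le> cut_s x" using cut_s_nonneg x by simp
    thus "exp (- (b * cut_s x)) * cut_dq x \<le> exp (- (a * cut_s x)) * cut_dq x"
      using that cut_dq_pos[of x] x by (intro mult_right_mono) (auto intro: mult_right_mono)
  qed (use that in \<open>auto intro: cut_hr_integrable\<close>)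
  thus ?thesis by (simp add: cut_hr_def)
qed

lemma cut_h_field_differentiable: "cut_h field_differentiable (at z)" if "Re z > 0"
proof -
  define r where "r = Re z / 2"
  have r: "r > 0" using that by (simp add: r_def)
  have re: "r \<le> Re w" if "w \<in> ball z r" for w
  proof -
    have "\<bar>Re (z - w)\<bar> \<le> cmod (z - w)" by (rule abs_Re_le_cmod)
    thus ?thesis using that by (simp add: dist_norm r_def)
  qed
  have "((\<lambda>z. \<integral>x. indicator {0<..} x *\<^sub>R (exp (- (z * of_real (cut_s x))) * of_real (cut_dq x)) \<partial>lborel) has_field_derivative
     (\<integral>x. deriv (\<lambda>z. indicator {0<..} x *\<^sub>R (exp (- (z * of_real (cut_s x))) * of_real (cut_dq x))) z \<partial>lborel)) (at z)"
  proof (rule param_integral_holomorphic[OF _ _ r])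
    show "(\<lambda>z. indicat_real {0<..} x *\<^sub>R (exp (- (z * of_real (cut_s x))) * complex_of_real (cut_dq x))) holomorphic_on ball z r" for x
      unfolding scaleR_conv_of_real by (intro holomorphic_intros)
    show "(\<lambda>x. indicat_real {0<..} x *\<^sub>R (exp (- (w * of_real (cut_s x))) * complex_of_real (cut_dq x))) \<in> borel_measurable lborel"
      if "w \<in> ball z r" for w
      using cut_h_integrable[of w] re[OF that] r by (simp add: set_integrable_def)
    show "integrable lborel (\<lambda>x. indicator {0<..} x *\<^sub>R (exp (- (r * cut_s x)) * cut_dq x))"
      using cut_hr_integrable[OF r] by (simp add: set_integrable_def)
    show "cmod (indicator {0<..} x *\<^sub>R (exp (- (w * of_real (cut_s x))) * of_real (cut_dq x)))
       \<le> indicator {0<..} x *\<^sub>R (exp (- (r * cut_s x)) * cut_dq x)" if "w \<in> ball z r" for w x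
    proof (cases "x > 0")
      case True
      have "0 \<le> cut_s x" by (rule cut_s_nonneg[OF True])
      hence "exp (- (Re w * cut_s x)) * cut_dq x \<le> exp (- (r * cut_s x)) * cut_dq x"
        using re[OF that] cut_dq_pos[OF True] by (intro mult_right_mono) (auto intro: mult_right_mono)
      thus ?thesis using True by (simp add: cut_h_integrand_norm)
    qed simp
  qed
  hence "(\<lambda>z. LBINT x:{0<..}. exp (- (z * of_real (cut_s x))) * of_real (cut_dq x)) field_differentiable (at z)"
    unfolding set_lebesgue_integral_def field_differentiable_def by blast
  thus ?thesis unfolding cut_h_def[abs_def] by (intro derivative_intros)
qed

lemma cut_h_holomorphic: "f holomorphic_on A \<Longrightarrow> (\<And>z. z \<in> A \<Longrightarrow> Re (f z) > 0) \<Longrightarrow> (\<lambda>z. cut_h (f z)) holomorphic_on A"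
proof -
  assume f: "f holomorphic_on A" and re: "\<And>z. z \<in> A \<Longrightarrow> Re (f z) > 0"
  have "cut_h holomorphic_on {z. Re z > 0}"
    unfolding holomorphic_on_def
    by (auto intro: field_differentiable_at_within[OF cut_h_field_differentiable])
  from holomorphic_on_compose_gen[OF f this] show ?thesis using re by (auto simp: o_def)
qed

lemma continuous_on_cut_h:
  assumes "continuous_on A f" "\<And>z. z \<in> A \<Longrightarrow> Re (f z) > 0"
  shows "continuous_on A (\<lambda>z. cut_h (f z))"
proof (rule continuous_on_compose2[OF _ assms(1)])
  show "continuous_on {z. Re z > 0} cut_h"
    by (rule holomorphic_on_imp_continuous_on[OF cut_h_holomorphic]) (auto intro: holomorphic_on_ident)
qed (use assms(2) in blast)

lemma powr_exp_integrable:
  assumes "p > (0::real)" "a > (0::real)"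
  shows "integrable_Ioi (\<lambda>n. n powr (p - 1) * exp (- (a * n)))"
proof -
  have "(\<lambda>t. cmod (complex_of_real t powr (of_real p - 1) / of_real (exp (a * t)))) absolutely_integrable_on {0<..}"
    using absolutely_integrable_Gamma_integral[of "of_real p" a] assms
    by (intro absolutely_integrable_norm[unfolded o_def]) auto
  also have "?this \<longleftrightarrow> (\<lambda>n. n powr (p - 1) * exp (- (a * n))) absolutely_integrable_on {0<..}"
  proof (rule set_integrable_cong[OF refl refl])
    fix t :: real assume "t \<in> {0<..}"
    thus "cmod (complex_of_real t powr (of_real p - 1) / of_real (exp (a * t))) = t powr (p - 1) * exp (- (a * t))"
      by (simp add: norm_divide norm_powr_real_powr exp_minus field_simps)
  qed
  finally show ?thesis unfolding set_integrable_def
    by (subst (asm) integrable_completion) auto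
qed

text \<open>The transform decays exponentially at infinity and is at most of order 1 / n at 0, so
  every factor of size n^p with p > 0 makes the product integrable.\<close>

lemma cut_h_times_integrable:
  assumes c: "Re c > 0" and \<phi>: "continuous_on {0<..} \<phi>" and p: "p > 0"
    and b: "\<And>n. n > 0 \<Longrightarrow> cmod (\<phi> n) \<le> C * n powr p"
  shows "integrable_Ioi (\<lambda>n. cut_h (c * of_real n) * \<phi> n)"
proof (rule set_integrable_continuous_bound_Ioi)
  show "continuous_on {0<..} (\<lambda>n. cut_h (c * of_real n) * \<phi> n)"
    by (intro continuous_intros continuous_on_cut_h \<phi>) (use c in auto)
  show "integrable_Ioi (\<lambda>n. 2 * C / Re c * (n powr (p - 1) * exp (- (pi * Re c * n))))"
    using c p by (intro set_integrable_mult_right powr_exp_integrable) auto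
  show "cmod (cut_h (c * of_real n) * \<phi> n) \<le> 2 * C / Re c * (n powr (p - 1) * exp (- (pi * Re c * n)))" if n: "n > 0" for n
  proof -
    have rc: "Re (c * of_real n) = Re c * n" by simp
    have "cmod (cut_h (c * of_real n)) \<le> 2 * exp (- (pi * (Re c * n))) / (Re c * n)"
      using norm_cut_h_le[of "c * of_real n"] cut_hr_le[of "Re c * n"] c n unfolding rc by simp
    hence "cmod (cut_h (c * of_real n) * \<phi> n) \<le> (2 * exp (- (pi * (Re c * n))) / (Re c * n)) * (C * n powr p)"
      unfolding norm_mult using b[OF n] c n by (intro mult_mono) auto
    also have "\<dots> = 2 * C / Re c * (n powr (p - 1) * exp (- (pi * Re c * n)))"
      using n by (simp add: powr_diff field_simps)
    finally show ?thesis .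
  qed
qed

subsection \<open>The dispersion relation\<close>

text \<open>
  \<open>cbrt2 z\<close> is \<open>(e\<^sup>z)\<^bsup>2/3\<^esup>\<close>, which maps the strip \<open>\<bar>Im z\<bar> < 3 \<pi> / 2\<close> onto the slit plane. The kernel
  has three poles so that the sides of the contour at infinity vanish; the resulting second divided
  difference determines \<open>P\<close> times \<open>cbrt2\<close> up to a function that is affine in \<open>cbrt2\<close>.
\<close>

definition cbrt2 :: "complex \<Rightarrow> complex" where
  "cbrt2 z = exp (2 * z / 3)"

definition strip_kernel :: "complex \<Rightarrow> complex \<Rightarrow> complex \<Rightarrow> complex \<Rightarrow> complex" where
  "strip_kernel a b c z = 2 / 3 * (cbrt2 z)\<^sup>2 / ((cbrt2 z - cbrt2 a) * (cbrt2 z - cbrt2 b) * (cbrt2 z - cbrt2 c))"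

definition divided_diff :: "(complex \<Rightarrow> complex) \<Rightarrow> complex \<Rightarrow> complex \<Rightarrow> complex \<Rightarrow> complex" where
  "divided_diff f a b c =
     f a * cbrt2 a / ((cbrt2 a - cbrt2 b) * (cbrt2 a - cbrt2 c)) +
     f b * cbrt2 b / ((cbrt2 b - cbrt2 a) * (cbrt2 b - cbrt2 c)) +
     f c * cbrt2 c / ((cbrt2 c - cbrt2 a) * (cbrt2 c - cbrt2 b))"

lemma cbrt2_inj: "cbrt2 z = cbrt2 w \<Longrightarrow> \<bar>Im z - Im w\<bar> < 3 * pi \<Longrightarrow> z = w"
proof -
  assume e: "cbrt2 z = cbrt2 w" and i: "\<bar>Im z - Im w\<bar> < 3 * pi"
  from e obtain n :: int where n: "2 * z / 3 = 2 * w / 3 + (of_int (2 * n) * pi) * \<i>"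
    unfolding cbrt2_def exp_eq by auto
  hence "2 * z = 2 * (w + 3 * of_int n * pi * \<i>)" by (simp add: field_simps)
  hence "z = w + 3 * of_int n * pi * \<i>" by (simp only: mult_cancel_left) simp
  hence z: "Re z = Re w" "Im z = Im w + 3 * of_int n * pi" by simp_all
  have "\<bar>3 * real_of_int n * pi\<bar> < 3 * pi" using i z(2) by simp
  hence "\<bar>real_of_int n\<bar> < 1" by (simp add: abs_mult)
  hence "n = 0" by linarith
  thus "z = w" using z by (simp add: complex_eq_iff)
qed

lemma cbrt2_nonzero [simp]: "cbrt2 z \<noteq> 0" by (simp add: cbrt2_def)

lemma cbrt2_deriv: "(cbrt2 has_field_derivative 2 / 3 * cbrt2 z) (at z)"
  unfolding cbrt2_def[abs_def] by (auto intro!: derivative_eq_intros)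

lemma cbrt2_holomorphic: "f holomorphic_on A \<Longrightarrow> (\<lambda>z. cbrt2 (f z)) holomorphic_on A"
  unfolding cbrt2_def by (intro holomorphic_intros) auto

lemma norm_cbrt2: "cmod (cbrt2 z) = exp (2 * Re z / 3)"
  by (simp add: cbrt2_def)

lemma cbrt2_edge: "cbrt2 (Complex x (3 * pi / 2)) = - of_real (exp (2 * x / 3))"
  "cbrt2 (Complex x (- (3 * pi / 2))) = - of_real (exp (2 * x / 3))"
  by (simp_all add: cbrt2_def exp_eq_polar complex_eq_iff)

text \<open>In the variable X = \<open>cbrt2 z\<close> one has dX = (2/3) X dz, so
  \<open>strip_kernel a b c z\<close> dz is X dX / ((X - A) (X - B) (X - C)). The residue is a
  Lagrange interpolation weight, and its factor A makes P times \<open>cbrt2\<close>, not P, the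
  interpolated function.\<close>

lemma residue_strip:
  fixes a b c :: complex
  assumes d: "a \<noteq> b" "a \<noteq> c"
    and im: "\<bar>Im a\<bar> < 3 * pi / 2" "\<bar>Im b\<bar> < 3 * pi / 2" "\<bar>Im c\<bar> < 3 * pi / 2"
    and P: "P holomorphic_on UNIV"
    and S: "open S" "a \<in> S" and K: "(\<lambda>z. P z * strip_kernel a b c z) holomorphic_on S - {a}"
  shows "residue (\<lambda>z. P z * strip_kernel a b c z) a = P a * cbrt2 a / ((cbrt2 a - cbrt2 b) * (cbrt2 a - cbrt2 c))"
proof (rule residue_simple'[OF S K])
  have ne: "cbrt2 a \<noteq> cbrt2 b" "cbrt2 a \<noteq> cbrt2 c"
  proof -
    have "\<bar>Im a - Im b\<bar> < 3 * pi" "\<bar>Im a - Im c\<bar> < 3 * pi" using im by linarith+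
    thus "cbrt2 a \<noteq> cbrt2 b" "cbrt2 a \<noteq> cbrt2 c"
      using cbrt2_inj d by blast+
  qed
  have "((\<lambda>w. (cbrt2 w - cbrt2 a) / (w - a)) \<longlongrightarrow> 2 / 3 * cbrt2 a) (at a)"
    using cbrt2_deriv[of a] by (simp add: has_field_derivative_iff)
  hence 1: "((\<lambda>w. inverse ((cbrt2 w - cbrt2 a) / (w - a))) \<longlongrightarrow> inverse (2 / 3 * cbrt2 a)) (at a)"
    by (rule tendsto_inverse) simp
  have cP: "(P \<longlongrightarrow> P a) (at a)"
    using P by (metis UNIV_I continuous_on_eq_continuous_within holomorphic_on_imp_continuous_on continuous_within)
  have cX: "(cbrt2 \<longlongrightarrow> cbrt2 a) (at a)"
    using DERIV_isCont[OF cbrt2_deriv] by (simp add: isCont_def)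
  have "((\<lambda>w. P w * (2 / 3 * (cbrt2 w)\<^sup>2) / ((cbrt2 w - cbrt2 b) * (cbrt2 w - cbrt2 c)) * inverse ((cbrt2 w - cbrt2 a) / (w - a)))
    \<longlongrightarrow> P a * (2 / 3 * (cbrt2 a)\<^sup>2) / ((cbrt2 a - cbrt2 b) * (cbrt2 a - cbrt2 c)) * inverse (2 / 3 * cbrt2 a)) (at a)"
    using ne by (intro tendsto_intros cP cX 1) auto
  hence *: "((\<lambda>w. P w * strip_kernel a b c w * (w - a)) \<longlongrightarrow> P a * (2 / 3 * (cbrt2 a)\<^sup>2) / ((cbrt2 a - cbrt2 b) * (cbrt2 a - cbrt2 c)) * inverse (2 / 3 * cbrt2 a)) (at a)"
    by (rule Lim_transform_eventually) (simp add: strip_kernel_def divide_simps mult_ac)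
  show "((\<lambda>w. P w * strip_kernel a b c w * (w - a)) \<longlongrightarrow> P a * cbrt2 a / ((cbrt2 a - cbrt2 b) * (cbrt2 a - cbrt2 c))) (at a)"
  proof -
    have "p * (2 / 3 * x\<^sup>2) / d * inverse (2 / 3 * x) = p * x / d" if "x \<noteq> 0" for p x d :: complex
      using that by (simp add: power2_eq_square)
    from this[OF cbrt2_nonzero] * show ?thesis by (simp only:)
  qed
qed

lemma strip_residue_theorem:
  fixes a b c :: complex
  assumes d: "a \<noteq> b" "a \<noteq> c" "b \<noteq> c"
    and im: "\<bar>Im a\<bar> < 3 * pi / 2" "\<bar>Im b\<bar> < 3 * pi / 2" "\<bar>Im c\<bar> < 3 * pi / 2"
    and re: "\<bar>Re a\<bar> < L" "\<bar>Re b\<bar> < L" "\<bar>Re c\<bar> < L"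
    and P: "P holomorphic_on UNIV"
  shows "contour_integral (rectpath (Complex (-L) (- (3 * pi / 2))) (Complex L (3 * pi / 2))) (\<lambda>z. P z * strip_kernel a b c z)
     = 2 * pi * \<i> * divided_diff P a b c"
    and "continuous_on (path_image (rectpath (Complex (-L) (- (3 * pi / 2))) (Complex L (3 * pi / 2)))) (\<lambda>z. P z * strip_kernel a b c z)"
proof -
  let ?F = "\<lambda>z. P z * strip_kernel a b c z"
  let ?R = "rectpath (Complex (-L) (- (3 * pi / 2))) (Complex L (3 * pi / 2))"
  \<comment> \<open>The rectangle touches the edges of the strip, so the residue theorem is applied
    in a wider one. The excess \<delta> is chosen so that its points differ from the three poles by
    less than the period 3 pi in the imaginary part; no further poles enter.\<close>
  define m where "m = max \<bar>Im a\<bar> (max \<bar>Im b\<bar> \<bar>Im c\<bar>)"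
  define \<delta> where "\<delta> = 3 * pi / 2 - m"
  have m: "\<bar>Im a\<bar> \<le> m" "\<bar>Im b\<bar> \<le> m" "\<bar>Im c\<bar> \<le> m" "m < 3 * pi / 2"
    using im unfolding m_def by (simp_all only: max_less_iff_conj le_max_iff_disj order_refl simp_thms)
  define S where "S = {z. \<bar>Im z\<bar> < 3 * pi / 2 + \<delta>}"
  have inj: "z = w" if "cbrt2 z = cbrt2 w" "z \<in> S" "\<bar>Im w\<bar> \<le> m" for z w
  proof (rule cbrt2_inj[OF that(1)])
    have "\<bar>Im z\<bar> < 3 * pi / 2 + \<delta>" using that(2) by (simp add: S_def)
    thus "\<bar>Im z - Im w\<bar> < 3 * pi" using that(3) unfolding \<delta>_def by linarith
  qed
  have S1: "open S"
    unfolding S_def by (intro open_Collect_less continuous_intros)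
  have "S = {z. Im z < 3 * pi / 2 + \<delta>} \<inter> {z. Im z > - (3 * pi / 2 + \<delta>)}" by (auto simp: S_def)
  hence S2: "connected S"
    by (simp add: convex_connected convex_Int convex_halfspace_Im_lt convex_halfspace_Im_gt)
  have hol: "?F holomorphic_on S - {a, b, c}"
    unfolding strip_kernel_def
    by (intro holomorphic_intros cbrt2_holomorphic holomorphic_on_subset[OF P]) (use inj m in auto)
  have L: "L > 0" using re by linarith
  have box: "z \<in> box (Complex (-L) (- (3 * pi / 2))) (Complex L (3 * pi / 2))" if "z \<in> {a, b, c}" for z
    using that im re by (auto simp: in_box_complex_iff)
  have sub: "path_image ?R \<subseteq> S - {a, b, c}"
  proof -
    have "path_image ?R \<subseteq> cbox (Complex (-L) (- (3 * pi / 2))) (Complex L (3 * pi / 2))"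
      using L by (intro path_image_rectpath_subset_cbox) auto
    also have "\<dots> \<subseteq> S" using m by (auto simp: S_def in_cbox_complex_iff \<delta>_def)
    finally have "path_image ?R \<subseteq> S" .
    moreover have "path_image ?R \<inter> box (Complex (-L) (- (3 * pi / 2))) (Complex L (3 * pi / 2)) = {}"
      using L by (intro path_image_rectpath_inter_box) auto
    ultimately show ?thesis using box by blast
  qed
  show "continuous_on (path_image ?R) ?F"
    using holomorphic_on_imp_continuous_on[OF hol] sub continuous_on_subset by blast
  have mem: "a \<in> S" "b \<in> S" "c \<in> S" using im m by (auto simp: S_def \<delta>_def)
  have ra: "residue ?F a = P a * cbrt2 a / ((cbrt2 a - cbrt2 b) * (cbrt2 a - cbrt2 c))"
    by (rule residue_strip[where S = "S - {b, c}"])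
      (use d im P mem S1 in \<open>auto intro!: open_Diff holomorphic_on_subset[OF hol]\<close>)
  have rb: "residue (\<lambda>z. P z * strip_kernel b a c z) b = P b * cbrt2 b / ((cbrt2 b - cbrt2 a) * (cbrt2 b - cbrt2 c))"
  proof -
    have "(\<lambda>z. P z * strip_kernel b a c z) = ?F"
      by (auto simp: strip_kernel_def mult_ac)
    thus ?thesis
      by (intro residue_strip[where S = "S - {a, c}"])
        (use d im P mem S1 in \<open>auto intro!: open_Diff holomorphic_on_subset[OF hol]\<close>)
  qed
  have rc: "residue (\<lambda>z. P z * strip_kernel c a b z) c = P c * cbrt2 c / ((cbrt2 c - cbrt2 a) * (cbrt2 c - cbrt2 b))"
  proof -
    have "(\<lambda>z. P z * strip_kernel c a b z) = ?F"
      by (auto simp: strip_kernel_def mult_ac)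
    thus ?thesis
      by (intro residue_strip[where S = "S - {a, b}"])
        (use d im P mem S1 in \<open>auto intro!: open_Diff holomorphic_on_subset[OF hol]\<close>)
  qed
  have eqs: "(\<lambda>z. P z * strip_kernel b a c z) = ?F"
    "(\<lambda>z. P z * strip_kernel c a b z) = ?F"
    by (auto simp: strip_kernel_def mult_ac)
  have "contour_integral ?R ?F = 2 * pi * \<i> *
    (\<Sum>p\<in>{a, b, c}. winding_number ?R p * residue ?F p)"
  proof (rule Residue_theorem[OF S1 S2 _ hol])
    show "\<forall>z. z \<notin> S \<longrightarrow> winding_number ?R z = 0"
    proof (intro allI impI)
      fix z assume "z \<notin> S"
      thus "winding_number ?R z = 0"
        using L m by (intro winding_number_rectpath_outside) (auto simp: S_def \<delta>_def in_cbox_complex_iff)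
    qed
  qed (use sub in auto)
  also have "(\<Sum>p\<in>{a, b, c}. winding_number ?R p * residue ?F p)
    = (\<Sum>p\<in>{a, b, c}. residue ?F p)"
    by (intro sum.cong refl) (simp add: winding_number_rectpath[OF box])
  also have "\<dots> = divided_diff P a b c"
    using d ra rb[unfolded eqs] rc[unfolded eqs] by (simp add: divided_diff_def)
  finally show "contour_integral ?R ?F = 2 * pi * \<i> * divided_diff P a b c" .
qed

text \<open>At the right end the kernel is O(1 / |X|) and \<open>saddle_int\<close> is bounded. At
  the left end, at distance L, \<open>norm_strip_kernel_le'\<close> gives |X|^2 = exp (- 4 L / 3),
  which outweighs the growth exp L of \<open>saddle_int\<close>. The second power in the numerator
  serves the left side, the number of poles the right one.\<close>

lemma norm_strip_kernel_le:
  assumes "2 * cmod (cbrt2 a) \<le> cmod (cbrt2 z)" "2 * cmod (cbrt2 b) \<le> cmod (cbrt2 z)" "2 * cmod (cbrt2 c) \<le> cmod (cbrt2 z)"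
  shows "cmod (strip_kernel a b c z) \<le> 16 / 3 / cmod (cbrt2 z)"
proof -
  have h: "cmod (cbrt2 z) / 2 \<le> cmod (cbrt2 z - cbrt2 w)" if "2 * cmod (cbrt2 w) \<le> cmod (cbrt2 z)" for w
    using norm_triangle_ineq2[of "cbrt2 z" "cbrt2 w"] that by linarith
  define r where "r = cmod (cbrt2 z)"
  have r: "r > 0" by (simp add: r_def)
  have "(r / 2) * (r / 2) * (r / 2) \<le> cmod (cbrt2 z - cbrt2 a) * cmod (cbrt2 z - cbrt2 b) * cmod (cbrt2 z - cbrt2 c)"
    using h[OF assms(1)] h[OF assms(2)] h[OF assms(3)] r unfolding r_def[symmetric]
    by (intro mult_mono) auto
  hence "cmod (strip_kernel a b c z) \<le> (2 / 3 * r\<^sup>2) / ((r / 2) * (r / 2) * (r / 2))"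
    unfolding strip_kernel_def norm_divide norm_mult norm_power r_def[symmetric]
    using r by (intro frac_le) auto
  also have "\<dots> = 16 / 3 / r" using r by (simp add: power2_eq_square field_simps)
  finally show ?thesis by (simp add: r_def)
qed

lemma norm_strip_kernel_le':
  assumes "2 * cmod (cbrt2 z) \<le> cmod (cbrt2 a)" "2 * cmod (cbrt2 z) \<le> cmod (cbrt2 b)" "2 * cmod (cbrt2 z) \<le> cmod (cbrt2 c)"
  shows "cmod (strip_kernel a b c z) \<le> 16 / 3 * (cmod (cbrt2 z))\<^sup>2 / (cmod (cbrt2 a) * cmod (cbrt2 b) * cmod (cbrt2 c))"
proof -
  have h: "cmod (cbrt2 w) / 2 \<le> cmod (cbrt2 z - cbrt2 w)" if "2 * cmod (cbrt2 z) \<le> cmod (cbrt2 w)" for w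
    using norm_triangle_ineq2[of "cbrt2 w" "cbrt2 z"] that by (simp add: norm_minus_commute)
  have "(cmod (cbrt2 a) / 2) * (cmod (cbrt2 b) / 2) * (cmod (cbrt2 c) / 2)
      \<le> cmod (cbrt2 z - cbrt2 a) * cmod (cbrt2 z - cbrt2 b) * cmod (cbrt2 z - cbrt2 c)"
    by (intro mult_mono h assms) auto
  hence "cmod (strip_kernel a b c z) \<le> (2 / 3 * (cmod (cbrt2 z))\<^sup>2) / ((cmod (cbrt2 a) / 2) * (cmod (cbrt2 b) / 2) * (cmod (cbrt2 c) / 2))"
    unfolding strip_kernel_def norm_divide norm_mult norm_power
    by (intro frac_le) auto
  thus ?thesis by (simp add: field_simps)
qed

text \<open>The power n^(1/3) is X^2 = n^(4/3) from the numerator of \<open>strip_kernel\<close>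
  times dx = dn / n. The plus signs come from X = - n^(2/3) on the edges.\<close>

definition disp_kernel :: "complex \<Rightarrow> complex \<Rightarrow> complex \<Rightarrow> real \<Rightarrow> complex" where
  "disp_kernel a b c n = of_real (n powr (1/3)) /
     ((of_real (n powr (2/3)) + cbrt2 a) * (of_real (n powr (2/3)) + cbrt2 b) * (of_real (n powr (2/3)) + cbrt2 c))"

lemma cbrt2_slit:
  assumes "\<bar>Im a\<bar> < 3 * pi / 2" "y \<ge> (0::real)"
  shows "of_real y + cbrt2 a \<noteq> 0"
proof
  assume e: "of_real y + cbrt2 a = 0"
  hence y: "y > 0" using assms(2) by (cases "y = 0") auto
  define x where "x = 3 / 2 * ln y"
  have "cbrt2 a = cbrt2 (Complex x (3 * pi / 2))"
    using e y by (simp add: cbrt2_edge x_def eq_neg_iff_add_eq_0 add.commute)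
  hence "a = Complex x (3 * pi / 2)" by (rule cbrt2_inj) (use assms in auto)
  thus False using assms(1) by simp
qed

lemma cut_slit_lower_bound:
  assumes "\<bar>Im a\<bar> < 3 * pi / 2"
  obtains \<delta> where "\<delta> > 0" "\<And>y. y \<ge> (0::real) \<Longrightarrow> \<delta> \<le> cmod (of_real y + cbrt2 a)"
proof -
  have "closed (of_real ` {0::real..} :: complex set)"
  proof -
    have "(of_real ` {0::real..} :: complex set) = {z. Im z = 0 \<and> 0 \<le> Re z}"
      by (auto simp: image_iff complex_eq_iff intro!: bexI[of _ "Re _"])
    thus ?thesis
      by (simp add: closed_Collect_conj closed_Collect_eq closed_Collect_le continuous_intros)
  qed
  moreover have "- cbrt2 a \<notin> of_real ` {0::real..}"
  proof
    assume "- cbrt2 a \<in> of_real ` {0::real..}"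
    then obtain y where y: "y \<ge> 0" "- cbrt2 a = of_real y" by auto
    have "of_real y + cbrt2 a = 0" unfolding y(2)[symmetric] by simp
    thus False using cbrt2_slit[OF assms y(1)] by simp
  qed
  ultimately have "\<exists>d>0. \<forall>z\<in>of_real ` {0::real..}. d \<le> dist (- cbrt2 a) z" by (rule separate_point_closed)
  then obtain d where d: "d > 0" "\<forall>z\<in>of_real ` {0::real..}. d \<le> dist (- cbrt2 a) z" by blast
  show ?thesis
  proof (rule that[OF d(1)])
    fix y :: real assume "y \<ge> 0"
    hence "d \<le> dist (- cbrt2 a) (of_real y)" using d(2) by blast
    also have "dist (- cbrt2 a) (of_real y) = cmod (of_real y + cbrt2 a)"
      by (metis add.commute diff_minus_eq_add dist_commute dist_norm)
    finally show "d \<le> cmod (of_real y + cbrt2 a)" .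
  qed
qed

lemma continuous_on_powr_pos: "continuous_on {0<..} (\<lambda>n::real. n powr p)"
  by (intro continuous_intros) auto

lemma disp_kernel_integrable:
  assumes im: "\<bar>Im a\<bar> < 3 * pi / 2" "\<bar>Im b\<bar> < 3 * pi / 2" "\<bar>Im c\<bar> < 3 * pi / 2"
  shows "integrable_Ioi (\<lambda>n. cut_h (of_real n) * disp_kernel a b c n)"
    and "continuous_on {0<..} (disp_kernel a b c)"
proof -
  show cont: "continuous_on {0<..} (disp_kernel a b c)"
    unfolding disp_kernel_def[abs_def]
    by (intro continuous_intros continuous_on_powr_pos) (use cbrt2_slit im in auto)
  obtain da where da: "da > 0" "\<And>y. y \<ge> 0 \<Longrightarrow> da \<le> cmod (of_real y + cbrt2 a)"
    using cut_slit_lower_bound[OF im(1)] by blast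
  obtain db where db: "db > 0" "\<And>y. y \<ge> 0 \<Longrightarrow> db \<le> cmod (of_real y + cbrt2 b)"
    using cut_slit_lower_bound[OF im(2)] by blast
  obtain dc where dc: "dc > 0" "\<And>y. y \<ge> 0 \<Longrightarrow> dc \<le> cmod (of_real y + cbrt2 c)"
    using cut_slit_lower_bound[OF im(3)] by blast
  have "cmod (disp_kernel a b c n) \<le> 1 / (da * db * dc) * n powr (1/3)" if "n > 0" for n
  proof -
    have "da * db * dc \<le> cmod (of_real (n powr (2/3)) + cbrt2 a) * cmod (of_real (n powr (2/3)) + cbrt2 b) * cmod (of_real (n powr (2/3)) + cbrt2 c)"
      using da db dc by (intro mult_mono) auto
    hence "n powr (1/3) / (cmod (of_real (n powr (2/3)) + cbrt2 a) * cmod (of_real (n powr (2/3)) + cbrt2 b) * cmod (of_real (n powr (2/3)) + cbrt2 c)) \<le> n powr (1/3) / (da * db * dc)"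
      using da(1) db(1) dc(1) cbrt2_slit[OF im(1), of "n powr (2/3)"] cbrt2_slit[OF im(2), of "n powr (2/3)"]
        cbrt2_slit[OF im(3), of "n powr (2/3)"]
      by (intro divide_left_mono mult_pos_pos) auto
    thus ?thesis by (simp add: disp_kernel_def norm_divide norm_mult)
  qed
  from cut_h_times_integrable[OF _ cont _ this, of 1]
  show "integrable_Ioi (\<lambda>n. cut_h (of_real n) * disp_kernel a b c n)" by simp
qed

text \<open>The kernel depends on z only through \<open>cbrt2\<close>, which agrees on the two
  edges, so the difference is carried by \<open>saddle_int\<close> alone. The separate factor
  \<open>exp x\<close> is the dn of the later substitution n = exp x.\<close>

lemma strip_edge_difference:
  "saddle_int (Complex x (- (3 * pi / 2))) * strip_kernel a b c (Complex x (- (3 * pi / 2)))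
   - saddle_int (Complex x (3 * pi / 2)) * strip_kernel a b c (Complex x (3 * pi / 2))
   = (2 * \<i> / 3) * (of_real (exp x) * (cut_h (of_real (exp x)) * disp_kernel a b c (exp x)))"
proof -
  define y where "y = complex_of_real (exp (2 * x / 3))"
  define D where "D = (y + cbrt2 a) * (y + cbrt2 b) * (y + cbrt2 c)"
  have "(- y - cbrt2 a) * (- y - cbrt2 b) * (- y - cbrt2 c) = - D"
    unfolding D_def by (simp add: algebra_simps)
  hence k: "strip_kernel a b c (Complex x (3 * pi / 2)) = - (2 / 3 * y\<^sup>2 / D)"
    "strip_kernel a b c (Complex x (- (3 * pi / 2))) = - (2 / 3 * y\<^sup>2 / D)"
    unfolding strip_kernel_def cbrt2_edge y_def[symmetric] by simp_all
  have p: "exp x powr (1/3) = exp (x / 3)" "exp x powr (2/3) = exp (2 * x / 3)"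
    by (simp_all add: powr_def)
  have d: "disp_kernel a b c (exp x) = of_real (exp (x / 3)) / D"
    unfolding disp_kernel_def p D_def y_def by simp
  have y2: "y\<^sup>2 = of_real (exp x) * of_real (exp (x / 3))"
    unfolding y_def power2_eq_square of_real_mult[symmetric] exp_add[symmetric] by simp
  have s: "saddle_int (Complex x (3 * pi / 2)) = saddle_int (Complex x (- (3 * pi / 2))) + \<i> * cut_h (of_real (exp x))"
    using saddle_int_jump[of x] unfolding cut_h_of_real by (simp add: algebra_simps)
  have alg: "p * - K - (p + q) * - K = q * K" for p q K :: complex
    by (simp add: algebra_simps)
  show ?thesis unfolding k d y2 s alg by simp
qed

lemma contour_integral_linepath_same_Im:
  assumes "a < (b::real)"
  shows "contour_integral (linepath (Complex a c) (Complex b c)) f = integral {a..b} (\<lambda>x. f (Complex x c))"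
proof -
  have "contour_integral (linepath (Complex a c) (Complex b c)) f =
      contour_integral (linepath (of_real a) (of_real b)) (\<lambda>z. f (z + \<i> * of_real c))"
    by (simp add: contour_integral_integral linepath_def complex_eq_iff)
      (simp add: Complex_eq algebra_simps scaleR_conv_of_real)
  also have "\<dots> = integral {a..b} (\<lambda>x. f (Complex x c))"
    using assms by (simp add: contour_integral_linepath_Reals_eq Complex_eq)
  finally show ?thesis .
qed

lemma contour_integral_rectpath_split:
  assumes "continuous_on (path_image (rectpath (Complex (-L) (-c)) (Complex L c))) F" "L > 0" "c > 0"
  shows "contour_integral (rectpath (Complex (-L) (-c)) (Complex L c)) F =
    integral {-L..L} (\<lambda>x. F (Complex x (-c)) - F (Complex x c)) +
    contour_integral (linepath (Complex L (-c)) (Complex L c)) F -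
    contour_integral (linepath (Complex (-L) (-c)) (Complex (-L) c)) F"
proof -
  let ?a = "Complex (-L) (-c)" and ?b = "Complex L (-c)" and ?d = "Complex L c" and ?e = "Complex (-L) c"
  have pim: "path_image (rectpath ?a ?d) = closed_segment ?a ?b \<union> closed_segment ?b ?d \<union> closed_segment ?d ?e \<union> closed_segment ?e ?a"
    by (simp add: rectpath_def Let_def path_image_join Un_assoc)
  have co: "continuous_on (closed_segment ?a ?b) F" "continuous_on (closed_segment ?b ?d) F"
    "continuous_on (closed_segment ?d ?e) F" "continuous_on (closed_segment ?e ?a) F"
    using assms(1) unfolding pim by (auto intro: continuous_on_subset)
  note ci = co[THEN contour_integrable_continuous_linepath]
  have "contour_integral (rectpath ?a ?d) F = contour_integral (linepath ?a ?b) F +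
      (contour_integral (linepath ?b ?d) F + (contour_integral (linepath ?d ?e) F + contour_integral (linepath ?e ?a) F))"
    using ci by (simp add: rectpath_def Let_def contour_integrable_joinI)
  also have "contour_integral (linepath ?e ?a) F = - contour_integral (linepath ?a ?e) F"
    by (rule contour_integral_reverse_linepath[OF co(4)])
  also have "contour_integral (linepath ?d ?e) F = - contour_integral (linepath ?e ?d) F"
    by (rule contour_integral_reverse_linepath[OF co(3)])
  also have "contour_integral (linepath ?a ?b) F = integral {-L..L} (\<lambda>x. F (Complex x (-c)))"
    using assms(2) by (intro contour_integral_linepath_same_Im) auto
  also have "contour_integral (linepath ?e ?d) F = integral {-L..L} (\<lambda>x. F (Complex x c))"
    using assms(2) by (intro contour_integral_linepath_same_Im) auto
  finally have *: "contour_integral (rectpath ?a ?d) F = integral {-L..L} (\<lambda>x. F (Complex x (-c))) +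
    (contour_integral (linepath ?b ?d) F + (- integral {-L..L} (\<lambda>x. F (Complex x c)) + - contour_integral (linepath ?a ?e) F))" .
  have seg: "Complex x c \<in> closed_segment ?d ?e" "Complex x (-c) \<in> closed_segment ?a ?b" if "x \<in> {-L..L}" for x
    using that by (auto simp: closed_segment_same_Im closed_segment_eq_real_ivl)
  have "continuous_on {-L..L} (\<lambda>x. F (Complex x c))"
    by (rule continuous_on_compose2[OF co(3)]) (use seg(1) in \<open>auto intro!: continuous_intros simp: Complex_eq\<close>)
  moreover have "continuous_on {-L..L} (\<lambda>x. F (Complex x (-c)))"
    by (rule continuous_on_compose2[OF co(1)]) (use seg(2) in \<open>auto intro!: continuous_intros simp: Complex_eq\<close>)
  ultimately have "integral {-L..L} (\<lambda>x. F (Complex x (-c)) - F (Complex x c)) =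
     integral {-L..L} (\<lambda>x. F (Complex x (-c))) - integral {-L..L} (\<lambda>x. F (Complex x c))"
    by (intro Henstock_Kurzweil_Integration.integral_diff integrable_continuous_interval)
  thus ?thesis using * by simp
qed

lemma integral_exp_substitution:
  fixes G :: "real \<Rightarrow> complex"
  assumes G: "continuous_on {0<..} G" and L: "L > 0"
  shows "integral {-L..L} (\<lambda>x. of_real (exp x) * G (exp x)) = integral {exp (-L)..exp L} G"
proof -
  have "((\<lambda>x. exp x *\<^sub>R G (exp x)) has_integral (integral {exp (-L)..exp L} G)) {-L..L}"
    by (rule has_integral_substitution[where c = "exp (-L)" and d = "exp L"])
      (use L in \<open>auto intro!: continuous_on_subset[OF G] derivative_eq_intros intro: order.strict_trans2[OF exp_gt_zero]\<close>)
  thus ?thesis by (simp add: integral_unique scaleR_conv_of_real)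
qed

lemma set_integral_exp_limit:
  fixes G :: "real \<Rightarrow> complex"
  assumes G: "integrable_Ioi G"
  shows "(\<lambda>k. integral {exp (- real k)..exp (real k)} G) \<longlonglongrightarrow> (LBINT n:{0<..}. G n)"
proof -
  have U: "(\<Union>k. {exp (- real k)..exp (real k)}) = {0<..}"
  proof (intro equalityI subsetI)
    fix x :: real assume "x \<in> {0<..}"
    hence x: "x > 0" by simp
    obtain k where k: "\<bar>ln x\<bar> \<le> real k" using real_arch_simple by blast
    have "exp (- real k) \<le> exp (ln x)" "exp (ln x) \<le> exp (real k)" using k by auto
    thus "x \<in> (\<Union>k. {exp (- real k)..exp (real k)})" using x by auto
  qed (auto intro: order.strict_trans2[OF exp_gt_zero])
  have "(\<lambda>k. LBINT n:{exp (- real k)..exp (real k)}. G n) \<longlonglongrightarrow> (LBINT n:(\<Union>k. {exp (- real k)..exp (real k)}). G n)"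
    by (rule set_integral_cont_up) (use G in \<open>auto simp: U incseq_def\<close>)
  moreover have "(LBINT n:{exp (- real k)..exp (real k)}. G n) = integral {exp (- real k)..exp (real k)} G" for k
  proof (rule set_borel_integral_eq_integral)
    show "set_integrable lborel {exp (- real k)..exp (real k)} G"
      by (rule set_integrable_subset[OF G]) (auto intro: order.strict_trans2[OF exp_gt_zero])
  qed
  ultimately show ?thesis by (simp add: U)
qed

lemma strip_side_right:
  assumes L: "L \<ge> 0" and big: "2 * cmod (cbrt2 a) \<le> exp (2 * L / 3)" "2 * cmod (cbrt2 b) \<le> exp (2 * L / 3)" "2 * cmod (cbrt2 c) \<le> exp (2 * L / 3)"
    and co: "continuous_on (closed_segment (Complex L (-(3*pi/2))) (Complex L (3*pi/2))) (\<lambda>z. saddle_int z * strip_kernel a b c z)"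
  shows "cmod (contour_integral (linepath (Complex L (-(3*pi/2))) (Complex L (3*pi/2))) (\<lambda>z. saddle_int z * strip_kernel a b c z))
    \<le> (30 * cosh 4 + 2) * (16 / 3 / exp (2 * L / 3)) * (3 * pi)"
proof -
  have "cmod (contour_integral (linepath (Complex L (-(3*pi/2))) (Complex L (3*pi/2))) (\<lambda>z. saddle_int z * strip_kernel a b c z))
    \<le> (30 * cosh 4 + 2) * (16 / 3 / exp (2 * L / 3)) * cmod (Complex L (3*pi/2) - Complex L (-(3*pi/2)))"
  proof (rule contour_integral_bound_linepath[OF contour_integrable_continuous_linepath[OF co]])
    fix z assume "z \<in> closed_segment (Complex L (-(3*pi/2))) (Complex L (3*pi/2))"
    hence z: "Re z = L" "\<bar>Im z\<bar> \<le> 3 * pi / 2"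
      by (auto simp: closed_segment_same_Re closed_segment_eq_real_ivl split: if_splits)
    have "1 \<le> exp L" using L by simp
    hence "2 / exp L \<le> 2" by (simp add: divide_simps)
    hence 1: "cmod (saddle_int z) \<le> 30 * cosh 4 + 2"
      using saddle_int_bound[OF z(2)] unfolding z(1) by (rule order_trans[OF _ add_left_mono, rotated])
    have 2: "cmod (strip_kernel a b c z) \<le> 16 / 3 / exp (2 * L / 3)"
      using norm_strip_kernel_le[of a z b c] big unfolding norm_cbrt2[of z] z(1) by simp
    show "cmod (saddle_int z * strip_kernel a b c z) \<le> (30 * cosh 4 + 2) * (16 / 3 / exp (2 * L / 3))"
      unfolding norm_mult by (intro mult_mono 1 2) auto
  qed simp
  also have "Complex L (3*pi/2) - Complex L (-(3*pi/2)) = \<i> * of_real (3 * pi)" by (simp add: complex_eq_iff)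
  also have "cmod (\<i> * of_real (3 * pi)) = 3 * pi" by (simp add: norm_mult)
  finally show ?thesis .
qed

lemma strip_side_left:
  assumes L: "L \<ge> 0" and big: "2 * exp (- (2 * L / 3)) \<le> cmod (cbrt2 a)" "2 * exp (- (2 * L / 3)) \<le> cmod (cbrt2 b)" "2 * exp (- (2 * L / 3)) \<le> cmod (cbrt2 c)"
    and co: "continuous_on (closed_segment (Complex (-L) (-(3*pi/2))) (Complex (-L) (3*pi/2))) (\<lambda>z. saddle_int z * strip_kernel a b c z)"
  shows "cmod (contour_integral (linepath (Complex (-L) (-(3*pi/2))) (Complex (-L) (3*pi/2))) (\<lambda>z. saddle_int z * strip_kernel a b c z))
    \<le> (30 * cosh 4 + 2 * exp L) * (16 / 3 * (exp (- (2 * L / 3)))\<^sup>2 / (cmod (cbrt2 a) * cmod (cbrt2 b) * cmod (cbrt2 c))) * (3 * pi)"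
proof -
  have "cmod (contour_integral (linepath (Complex (-L) (-(3*pi/2))) (Complex (-L) (3*pi/2))) (\<lambda>z. saddle_int z * strip_kernel a b c z))
    \<le> (30 * cosh 4 + 2 * exp L) * (16 / 3 * (exp (- (2 * L / 3)))\<^sup>2 / (cmod (cbrt2 a) * cmod (cbrt2 b) * cmod (cbrt2 c))) * cmod (Complex (-L) (3*pi/2) - Complex (-L) (-(3*pi/2)))"
  proof (rule contour_integral_bound_linepath[OF contour_integrable_continuous_linepath[OF co]])
    fix z assume "z \<in> closed_segment (Complex (-L) (-(3*pi/2))) (Complex (-L) (3*pi/2))"
    hence z: "Re z = - L" "\<bar>Im z\<bar> \<le> 3 * pi / 2"
      by (auto simp: closed_segment_same_Re closed_segment_eq_real_ivl split: if_splits)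
    have 1: "cmod (saddle_int z) \<le> 30 * cosh 4 + 2 * exp L"
      using saddle_int_bound[OF z(2)] unfolding z(1) by (simp add: exp_minus field_simps)
    have e: "2 * (- L) / 3 = - (2 * L / 3)" by simp
    have 2: "cmod (strip_kernel a b c z) \<le> 16 / 3 * (exp (- (2 * L / 3)))\<^sup>2 / (cmod (cbrt2 a) * cmod (cbrt2 b) * cmod (cbrt2 c))"
      using norm_strip_kernel_le'[of z a b c] big unfolding norm_cbrt2[of z] z(1) e by simp
    show "cmod (saddle_int z * strip_kernel a b c z) \<le> (30 * cosh 4 + 2 * exp L) * (16 / 3 * (exp (- (2 * L / 3)))\<^sup>2 / (cmod (cbrt2 a) * cmod (cbrt2 b) * cmod (cbrt2 c)))"
      unfolding norm_mult by (intro mult_mono 1 2) auto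
  qed simp
  also have "Complex (-L) (3*pi/2) - Complex (-L) (-(3*pi/2)) = \<i> * of_real (3 * pi)" by (simp add: complex_eq_iff)
  also have "cmod (\<i> * of_real (3 * pi)) = 3 * pi" by (simp add: norm_mult)
  finally show ?thesis .
qed

text \<open>The factor 1 / (3 pi) is (2 i / 3) / (2 pi i), the constant of the edge difference over
  that of the residue theorem. The vertical sides \<open>R\<close> and \<open>M\<close> tend to
  0.\<close>

lemma divided_diff_saddle_int:
  fixes a b c :: complex
  assumes d: "a \<noteq> b" "a \<noteq> c" "b \<noteq> c"
    and im: "\<bar>Im a\<bar> < 3 * pi / 2" "\<bar>Im b\<bar> < 3 * pi / 2" "\<bar>Im c\<bar> < 3 * pi / 2"
  shows "divided_diff saddle_int a b c = 1 / (3 * pi) * (LBINT n:{0<..}. cut_h (of_real n) * disp_kernel a b c n)"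
proof -
  let ?F = "\<lambda>z. saddle_int z * strip_kernel a b c z"
  let ?G = "\<lambda>n. cut_h (of_real n) * disp_kernel a b c n"
  let ?c = "3 * pi / 2"
  define R where "R k = contour_integral (linepath (Complex (real k) (-?c)) (Complex (real k) ?c)) ?F" for k
  define M where "M k = contour_integral (linepath (Complex (-real k) (-?c)) (Complex (-real k) ?c)) ?F" for k
  have Gc: "continuous_on {0<..} ?G"
    using im by (intro continuous_intros continuous_on_cut_h disp_kernel_integrable(2)) auto
  have ev1: "\<forall>\<^sub>F k in sequentially. r < real k" for r
    using filterlim_real_sequentially by (simp add: filterlim_at_top_dense)
  have ev2: "\<forall>\<^sub>F k in sequentially. 2 * cmod (cbrt2 w) \<le> exp (2 * real k / 3)" for w
  proof -
    have "filterlim (\<lambda>k. exp (2 * real k / 3)) at_top sequentially" by real_asymp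
    thus ?thesis by (simp add: filterlim_at_top)
  qed
  have ev3: "\<forall>\<^sub>F k in sequentially. 2 * exp (- (2 * real k / 3)) \<le> cmod (cbrt2 w)" for w
  proof -
    have "(\<lambda>k. 2 * exp (- (2 * real k / 3))) \<longlonglongrightarrow> 0" by real_asymp
    hence "\<forall>\<^sub>F k in sequentially. 2 * exp (- (2 * real k / 3)) < cmod (cbrt2 w)"
      by (rule order_tendstoD) simp
    thus ?thesis by eventually_elim simp
  qed
  have ok: "\<forall>\<^sub>F k in sequentially. \<bar>Re a\<bar> < real k \<and> \<bar>Re b\<bar> < real k \<and> \<bar>Re c\<bar> < real k \<and> 0 < real k \<and>
      2 * cmod (cbrt2 a) \<le> exp (2 * real k / 3) \<and> 2 * cmod (cbrt2 b) \<le> exp (2 * real k / 3) \<and> 2 * cmod (cbrt2 c) \<le> exp (2 * real k / 3) \<and>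
      2 * exp (- (2 * real k / 3)) \<le> cmod (cbrt2 a) \<and> 2 * exp (- (2 * real k / 3)) \<le> cmod (cbrt2 b) \<and> 2 * exp (- (2 * real k / 3)) \<le> cmod (cbrt2 c)"
    using ev1 ev2 ev3 by (intro eventually_conj)
  have split: "\<forall>\<^sub>F k in sequentially. 2 * pi * \<i> * divided_diff saddle_int a b c =
     (2 * \<i> / 3) * integral {exp (- real k)..exp (real k)} ?G + R k - M k"
    using ok
  proof eventually_elim
    case (elim k)
    note st = strip_residue_theorem[OF d im _ _ _ saddle_int_holomorphic, of "real k"]
    have co: "continuous_on (path_image (rectpath (Complex (- real k) (-?c)) (Complex (real k) ?c))) ?F"
      by (rule st(2)) (use elim in auto)
    have "2 * pi * \<i> * divided_diff saddle_int a b c = contour_integral (rectpath (Complex (- real k) (-?c)) (Complex (real k) ?c)) ?F"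
      by (rule st(1)[symmetric]) (use elim in auto)
    also have "\<dots> = integral {- real k..real k} (\<lambda>x. ?F (Complex x (-?c)) - ?F (Complex x ?c)) + R k - M k"
      unfolding R_def M_def by (rule contour_integral_rectpath_split[OF co]) (use elim in auto)
    also have "integral {- real k..real k} (\<lambda>x. ?F (Complex x (-?c)) - ?F (Complex x ?c))
       = (2 * \<i> / 3) * integral {- real k..real k} (\<lambda>x. of_real (exp x) * ?G (exp x))"
      unfolding strip_edge_difference by (rule integral_mult_right)
    also have "integral {- real k..real k} (\<lambda>x. of_real (exp x) * ?G (exp x)) = integral {exp (- real k)..exp (real k)} ?G"
      by (rule integral_exp_substitution[OF Gc]) (use elim in auto)
    finally show ?case .
  qed
  have Rb: "\<forall>\<^sub>F k in sequentially. cmod (R k) \<le> (30 * cosh 4 + 2) * (16 / 3 / exp (2 * real k / 3)) * (3 * pi)"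
    using ok
  proof eventually_elim
    case (elim k)
    note st = strip_residue_theorem[OF d im _ _ _ saddle_int_holomorphic, of "real k"]
    have co: "continuous_on (path_image (rectpath (Complex (- real k) (-?c)) (Complex (real k) ?c))) ?F"
      by (rule st(2)) (use elim in auto)
    have "closed_segment (Complex (real k) (-?c)) (Complex (real k) ?c) \<subseteq> path_image (rectpath (Complex (- real k) (-?c)) (Complex (real k) ?c))"
      by (auto simp: rectpath_def Let_def path_image_join)
    thus ?case unfolding R_def
      by (intro strip_side_right continuous_on_subset[OF co]) (use elim in auto)
  qed
  have Mb: "\<forall>\<^sub>F k in sequentially. cmod (M k) \<le> (30 * cosh 4 + 2 * exp (real k)) * (16 / 3 * (exp (- (2 * real k / 3)))\<^sup>2 / (cmod (cbrt2 a) * cmod (cbrt2 b) * cmod (cbrt2 c))) * (3 * pi)"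
    using ok
  proof eventually_elim
    case (elim k)
    note st = strip_residue_theorem[OF d im _ _ _ saddle_int_holomorphic, of "real k"]
    have co: "continuous_on (path_image (rectpath (Complex (- real k) (-?c)) (Complex (real k) ?c))) ?F"
      by (rule st(2)) (use elim in auto)
    have "closed_segment (Complex (- real k) (-?c)) (Complex (- real k) ?c) \<subseteq> path_image (rectpath (Complex (- real k) (-?c)) (Complex (real k) ?c))"
      by (auto simp: rectpath_def Let_def path_image_join closed_segment_commute)
    thus ?case unfolding M_def
      by (intro strip_side_left continuous_on_subset[OF co]) (use elim in auto)
  qed
  have R0: "R \<longlonglongrightarrow> 0"
  proof (rule Lim_null_comparison[OF Rb])
    have "(\<lambda>k. C * (16 / 3 / exp (2 * real k / 3)) * (3 * pi)) \<longlonglongrightarrow> 0" for C :: real by real_asymp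
    thus "(\<lambda>k. (30 * cosh 4 + 2) * (16 / 3 / exp (2 * real k / 3)) * (3 * pi)) \<longlonglongrightarrow> 0" .
  qed
  have M0: "M \<longlonglongrightarrow> 0"
  proof (rule Lim_null_comparison[OF Mb])
    have lim: "(\<lambda>k. (C + 2 * exp (real k)) * (16 / 3 * (exp (- (2 * real k / 3)))\<^sup>2 / D) * (3 * pi)) \<longlonglongrightarrow> 0"
      if "D > 0" for C D :: real using that by real_asymp
    show "(\<lambda>k. (30 * cosh 4 + 2 * exp (real k)) * (16 / 3 * (exp (- (2 * real k / 3)))\<^sup>2 / (cmod (cbrt2 a) * cmod (cbrt2 b) * cmod (cbrt2 c))) * (3 * pi)) \<longlonglongrightarrow> 0"
      by (rule lim) simp
  qed
  have "(\<lambda>k. (2 * \<i> / 3) * integral {exp (- real k)..exp (real k)} ?G + R k - M k) \<longlonglongrightarrow>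
     (2 * \<i> / 3) * (LBINT n:{0<..}. ?G n) + 0 - 0"
    by (intro tendsto_intros set_integral_exp_limit disp_kernel_integrable(1) im R0 M0)
  moreover have "(\<lambda>k. (2 * \<i> / 3) * integral {exp (- real k)..exp (real k)} ?G + R k - M k) \<longlonglongrightarrow> 2 * pi * \<i> * divided_diff saddle_int a b c"
    by (rule Lim_transform_eventually[OF tendsto_const split])
  ultimately have "2 * pi * \<i> * divided_diff saddle_int a b c = (2 * \<i> / 3) * (LBINT n:{0<..}. ?G n)"
    using LIMSEQ_unique by force
  thus ?thesis by (simp add: field_simps)
qed

text \<open>The Cauchy transform of the jump with a single pole. The contour argument does not
  produce it directly; it is tied to the three-pole kernel by partial fractions.\<close>

definition disp_integral :: "complex \<Rightarrow> complex" where
  "disp_integral a = 1 / (3 * pi) * (LBINT n:{0<..}. cut_h (of_real n) * (of_real (n powr (1/3)) / (of_real (n powr (2/3)) + cbrt2 a)))"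

lemma disp_integrand:
  assumes im: "\<bar>Im a\<bar> < 3 * pi / 2"
  shows "integrable_Ioi (\<lambda>n. cut_h (of_real n) * (of_real (n powr (1/3)) / (of_real (n powr (2/3)) + cbrt2 a)))"
proof -
  have cont: "continuous_on {0<..} (\<lambda>n. of_real (n powr (1/3)) / (of_real (n powr (2/3)) + cbrt2 a))"
    by (intro continuous_intros continuous_on_powr_pos) (use cbrt2_slit im in auto)
  obtain da where da: "da > 0" "\<And>y. y \<ge> 0 \<Longrightarrow> da \<le> cmod (of_real y + cbrt2 a)"
    using cut_slit_lower_bound[OF im(1)] by blast
  have "cmod (of_real (n powr (1/3)) / (of_real (n powr (2/3)) + cbrt2 a)) \<le> 1 / da * n powr (1/3)" if "n > 0" for n
  proof -
    have "n powr (1/3) / cmod (of_real (n powr (2/3)) + cbrt2 a) \<le> n powr (1/3) / da"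
      using da(1) da(2)[of "n powr (2/3)"] cbrt2_slit[OF im(1), of "n powr (2/3)"]
      by (intro divide_left_mono mult_pos_pos) auto
    thus ?thesis by (simp add: norm_divide)
  qed
  from cut_h_times_integrable[OF _ cont _ this, of 1] show ?thesis by simp
qed

text \<open>On the real axis both summands of the denominator are positive, so it is at least
  \<open>cbrt2 x\<close>. The resulting decay at + infinity is what fixes the additive
  constant.\<close>

lemma disp_integral_real_bound: "cmod (disp_integral (of_real x)) \<le> (LBINT n:{0<..}. cmod (cut_h (of_real n) * of_real (n powr (1/3)))) / cmod (cbrt2 (of_real x))"
proof -
  have c: "cbrt2 (of_real x) = of_real (exp (2 * x / 3))" by (simp add: cbrt2_def flip: exp_of_real)
  define X where "X = exp (2 * x / 3)"
  have X: "X > 0" by (simp add: X_def)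
  have i: "integrable_Ioi (\<lambda>n. cut_h (of_real n) * (of_real (n powr (1/3)) / (of_real (n powr (2/3)) + cbrt2 (of_real x))))"
    by (rule disp_integrand) simp
  have i2: "integrable_Ioi (\<lambda>n. cut_h (1 * of_real n) * of_real (n powr (1/3)))"
    by (rule cut_h_times_integrable[where p = "1/3" and C = 1])
      (auto intro!: continuous_intros continuous_on_powr_pos)
  have "cmod (LBINT n:{0<..}. cut_h (of_real n) * (of_real (n powr (1/3)) / (of_real (n powr (2/3)) + cbrt2 (of_real x))))
    \<le> (LBINT n:{0<..}. cmod (cut_h (of_real n) * (of_real (n powr (1/3)) / (of_real (n powr (2/3)) + cbrt2 (of_real x)))))"
    by (rule set_integral_norm_bound[OF i])
  also have "\<dots> \<le> (LBINT n:{0<..}. cmod (cut_h (of_real n) * of_real (n powr (1/3))) / X)"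
  proof (rule set_integral_mono[OF set_integrable_norm[OF i]])
    show "integrable_Ioi (\<lambda>n. cmod (cut_h (of_real n) * of_real (n powr (1/3))) / X)"
      using i2 by (intro set_integrable_divide set_integrable_norm) auto
    fix n :: real assume "n \<in> {0<..}"
    have "cmod (of_real (n powr (2/3)) + cbrt2 (of_real x)) = n powr (2/3) + X"
      using X unfolding c X_def[symmetric] of_real_add[symmetric] norm_of_real by simp
    moreover have "n powr (1/3) / (n powr (2/3) + X) \<le> n powr (1/3) / X"
      using X by (intro divide_left_mono mult_pos_pos add_nonneg_pos) auto
    ultimately show "cmod (cut_h (of_real n) * (of_real (n powr (1/3)) / (of_real (n powr (2/3)) + cbrt2 (of_real x))))
       \<le> cmod (cut_h (of_real n) * of_real (n powr (1/3))) / X"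
      by (simp add: norm_mult norm_divide mult_left_mono flip: times_divide_eq_right)
  qed
  also have "\<dots> = (LBINT n:{0<..}. cmod (cut_h (of_real n) * of_real (n powr (1/3)))) / X"
    by simp
  finally have "cmod (LBINT n:{0<..}. cut_h (of_real n) * (of_real (n powr (1/3)) / (of_real (n powr (2/3)) + cbrt2 (of_real x))))
    \<le> (LBINT n:{0<..}. cmod (cut_h (of_real n) * of_real (n powr (1/3)))) / X" (is "?l \<le> ?r") .
  moreover have "cmod (disp_integral (of_real x)) = 1 / (3 * pi) * ?l"
    by (simp add: disp_integral_def norm_mult norm_divide)
  moreover have "1 / (3 * pi) * ?l \<le> 1 * ?l"
    using pi_gt3 by (intro mult_right_mono) (auto simp: divide_simps)
  ultimately have "cmod (disp_integral (of_real x)) \<le> ?r" by linarith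
  moreover have "cmod (cbrt2 (of_real x)) = X" unfolding c X_def[symmetric] using X by simp
  ultimately show ?thesis by simp
qed

definition disp_rest :: "complex \<Rightarrow> complex" where
  "disp_rest a = saddle_int a * cbrt2 a - disp_integral a"

text \<open>Multiplied by the Vandermonde product \<open>V\<close>, the three-pole kernel splits by
  partial fractions into one-pole kernels. Hence the second divided difference of
  \<open>disp_rest\<close> vanishes, which is to say that \<open>disp_rest\<close> is affine in
  \<open>cbrt2\<close>.\<close>

lemma disp_rest_linear:
  fixes a b c :: complex
  assumes d: "a \<noteq> b" "a \<noteq> c" "b \<noteq> c"
    and im: "\<bar>Im a\<bar> < 3 * pi / 2" "\<bar>Im b\<bar> < 3 * pi / 2" "\<bar>Im c\<bar> < 3 * pi / 2"
  shows "disp_rest a * (cbrt2 b - cbrt2 c) + disp_rest b * (cbrt2 c - cbrt2 a) + disp_rest c * (cbrt2 a - cbrt2 b) = 0"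
proof -
  let ?A = "cbrt2 a" and ?B = "cbrt2 b" and ?C = "cbrt2 c"
  define I where "I w n = cut_h (of_real n) * (of_real (n powr (1/3)) / (of_real (n powr (2/3)) + cbrt2 w))" for w n
  have "\<bar>Im a - Im b\<bar> < 3 * pi" "\<bar>Im a - Im c\<bar> < 3 * pi" "\<bar>Im b - Im c\<bar> < 3 * pi" using im by linarith+
  hence ne: "?A \<noteq> ?B" "?A \<noteq> ?C" "?B \<noteq> ?C" using cbrt2_inj d by blast+
  define V where "V = (?A - ?B) * (?A - ?C) * (?B - ?C)"
  have V: "V \<noteq> 0" using ne by (simp add: V_def)
  have *: "divided_diff saddle_int a b c * V = saddle_int a * ?A * (?B - ?C) + saddle_int b * ?B * (?C - ?A) + saddle_int c * ?C * (?A - ?B)"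
  proof -
    have gen: "(p / ((x - y) * (x - z)) + q / ((y - x) * (y - z)) + r / ((z - x) * (z - y))) * ((x - y) * (x - z) * (y - z))
       = p * (y - z) + q * (z - x) + r * (x - y)" if "x \<noteq> y" "x \<noteq> z" "y \<noteq> z" for p q r x y z :: complex
    proof -
      have nz: "x - y \<noteq> 0" "x - z \<noteq> 0" "y - z \<noteq> 0" "y - x \<noteq> 0" "z - x \<noteq> 0" "z - y \<noteq> 0" using that by auto
      have 1: "p / ((x - y) * (x - z)) * ((x - y) * (x - z) * (y - z)) = p * (y - z)" using nz by simp
      have e: "(x - y) * (x - z) * (y - z) = ((y - x) * (y - z)) * (z - x)"
        "(x - y) * (x - z) * (y - z) = ((z - x) * (z - y)) * (x - y)" by (simp_all add: algebra_simps)
      have 2: "q / ((y - x) * (y - z)) * ((x - y) * (x - z) * (y - z)) = q * (z - x)"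
        by (subst e(1)) (use nz in simp)
      have 3: "r / ((z - x) * (z - y)) * ((x - y) * (x - z) * (y - z)) = r * (x - y)"
        by (subst e(2)) (use nz in simp)
      show ?thesis unfolding distrib_right 1 2 3 ..
    qed
    show ?thesis unfolding divided_diff_def V_def by (rule gen[OF ne])
  qed
  have pt: "I a n * (?B - ?C) + I b n * (?C - ?A) + I c n * (?A - ?B) = V * (cut_h (of_real n) * disp_kernel a b c n)" for n
  proof -
    let ?y = "complex_of_real (n powr (2/3))"
    have nz: "?y + ?A \<noteq> 0" "?y + ?B \<noteq> 0" "?y + ?C \<noteq> 0" using cbrt2_slit im by auto
    have gen: "k / u * (v - w) + k / v * (w - u) + k / w * (u - v) = (u - v) * (u - w) * (v - w) * (k / (u * v * w))"
      if "u \<noteq> 0" "v \<noteq> 0" "w \<noteq> 0" for k u v w :: complex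
      using that by (simp add: divide_simps) (simp add: algebra_simps)
    have "h * (p / u) = (h * p) / u" for h p u :: complex by simp
    thus ?thesis
      using gen[OF nz, of "cut_h (of_real n) * of_real (n powr (1/3))"]
      unfolding I_def disp_kernel_def V_def add_diff_cancel_left by (simp only:)
  qed
  have Ii: "integrable_Ioi (I w)" if "\<bar>Im w\<bar> < 3 * pi / 2" for w
    using disp_integrand[OF that] by (simp add: I_def[abs_def])
  have "(LBINT n:{0<..}. V * (cut_h (of_real n) * disp_kernel a b c n)) =
     (LBINT n:{0<..}. I a n * (?B - ?C) + I b n * (?C - ?A) + I c n * (?A - ?B))"
    unfolding pt ..
  also have "\<dots> = (LBINT n:{0<..}. I a n) * (?B - ?C) + (LBINT n:{0<..}. I b n) * (?C - ?A) + (LBINT n:{0<..}. I c n) * (?A - ?B)"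
    using Ii[OF im(1)] Ii[OF im(2)] Ii[OF im(3)]
    by (subst set_integral_add set_integral_mult_left | intro set_integral_add set_integrable_mult_left | simp)+
  finally have VI: "V * (LBINT n:{0<..}. cut_h (of_real n) * disp_kernel a b c n) = (LBINT n:{0<..}. I a n) * (?B - ?C) + (LBINT n:{0<..}. I b n) * (?C - ?A) + (LBINT n:{0<..}. I c n) * (?A - ?B)"
    by simp
  have dI: "disp_integral w = 1 / (3 * pi) * (LBINT n:{0<..}. I w n)" for w
    by (simp add: disp_integral_def I_def)
  have "1 / (3 * pi) * (V * (LBINT n:{0<..}. cut_h (of_real n) * disp_kernel a b c n)) =
     disp_integral a * (?B - ?C) + disp_integral b * (?C - ?A) + disp_integral c * (?A - ?B)"
    unfolding VI dI by (simp only: distrib_left mult.assoc)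
  also have "1 / (3 * pi) * (V * (LBINT n:{0<..}. cut_h (of_real n) * disp_kernel a b c n)) = divided_diff saddle_int a b c * V"
    unfolding divided_diff_saddle_int[OF d im] by simp
  finally show ?thesis unfolding * disp_rest_def by (simp add: algebra_simps)
qed

text \<open>The third point of \<open>disp_rest_linear\<close> is sent to + infinity after division
  by its \<open>cbrt2\<close>. Boundedness of \<open>saddle_int\<close> times \<open>cbrt2\<close>
  there rules out a slope, and what remains is the difference of the two values.\<close>

lemma disp_rest_const:
  assumes bdd: "\<forall>\<^sub>F x in at_top. cmod (saddle_int (of_real x) * cbrt2 (of_real x)) \<le> K"
    and im: "\<bar>Im a\<bar> < 3 * pi / 2" "\<bar>Im b\<bar> < 3 * pi / 2"
  shows "disp_rest a = disp_rest b"
proof (cases "a = b")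
  case False
  define C where "C = (LBINT n:{0<..}. cmod (cut_h (of_real n) * of_real (n powr (1/3))))"
  have X: "cmod (cbrt2 (of_real x)) = exp (2 * x / 3)" for x by (simp add: norm_cbrt2)
  have gen: "a * (b * inverse X - 1) + c * (1 - d * inverse X) + e / X * (d - b) = (a * (b - X) + c * (X - d) + e * (d - b)) / X"
    if "X \<noteq> 0" for a b c d e X :: complex
    using that by (simp add: field_simps)
  have lim0: "((\<lambda>x. disp_rest (of_real x) / cbrt2 (of_real x)) \<longlongrightarrow> 0) at_top"
  proof (rule Lim_null_comparison)
    show "\<forall>\<^sub>F x in at_top. cmod (disp_rest (of_real x) / cbrt2 (of_real x)) \<le> (K + C / exp (2 * x / 3)) / exp (2 * x / 3)"
      using bdd
    proof eventually_elim
      case (elim x)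
      have "cmod (disp_rest (of_real x)) \<le> cmod (saddle_int (of_real x) * cbrt2 (of_real x)) + cmod (disp_integral (of_real x))"
        unfolding disp_rest_def by (rule norm_triangle_ineq4)
      also have "\<dots> \<le> K + C / exp (2 * x / 3)"
        using elim disp_integral_real_bound[of x] unfolding C_def X by (rule add_mono)
      finally show ?case unfolding norm_divide X by (rule divide_right_mono) simp
    qed
    show "((\<lambda>x. (K + C / exp (2 * x / 3)) / exp (2 * x / 3)) \<longlongrightarrow> 0) at_top" by real_asymp
  qed
  have limX: "((\<lambda>x. inverse (cbrt2 (of_real x))) \<longlongrightarrow> 0) at_top"
  proof (rule Lim_null_comparison)
    show "\<forall>\<^sub>F x in at_top. cmod (inverse (cbrt2 (of_real x))) \<le> exp (- (2 * x / 3))"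
      by (simp add: norm_inverse X exp_minus)
    show "((\<lambda>x::real. exp (- (2 * x / 3))) \<longlongrightarrow> 0) at_top" by real_asymp
  qed
  let ?f = "\<lambda>x. disp_rest a * (cbrt2 b * inverse (cbrt2 (of_real x)) - 1) + disp_rest b * (1 - cbrt2 a * inverse (cbrt2 (of_real x)))
     + disp_rest (of_real x) / cbrt2 (of_real x) * (cbrt2 a - cbrt2 b)"
  have "(?f \<longlongrightarrow> disp_rest a * (cbrt2 b * 0 - 1) + disp_rest b * (1 - cbrt2 a * 0) + 0 * (cbrt2 a - cbrt2 b)) at_top"
    by (intro tendsto_intros lim0 limX)
  moreover have "\<forall>\<^sub>F x in at_top. ?f x = 0"
    using eventually_gt_at_top[of "Re a"] eventually_gt_at_top[of "Re b"]
  proof eventually_elim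
    case (elim x)
    have "a \<noteq> of_real x" "b \<noteq> of_real x" using elim by auto
    with disp_rest_linear[OF False this im] have
      "disp_rest a * (cbrt2 b - cbrt2 (of_real x)) + disp_rest b * (cbrt2 (of_real x) - cbrt2 a) + disp_rest (of_real x) * (cbrt2 a - cbrt2 b) = 0"
      by simp
    moreover have "?f x = (disp_rest a * (cbrt2 b - cbrt2 (of_real x)) + disp_rest b * (cbrt2 (of_real x) - cbrt2 a) + disp_rest (of_real x) * (cbrt2 a - cbrt2 b)) / cbrt2 (of_real x)"
      by (rule gen) simp
    ultimately show ?case by simp
  qed
  ultimately have "((\<lambda>x::real. 0) \<longlongrightarrow> disp_rest a * (cbrt2 b * 0 - 1) + disp_rest b * (1 - cbrt2 a * 0) + 0 * (cbrt2 a - cbrt2 b)) at_top"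
    by (rule Lim_transform_eventually)
  hence "disp_rest a * (cbrt2 b * 0 - 1) + disp_rest b * (1 - cbrt2 a * 0) + 0 * (cbrt2 a - cbrt2 b) = 0"
    by (simp add: tendsto_const_iff)
  thus ?thesis by simp
qed simp

section \<open>Lagrange inversion for formal power series\<close>

lemma lagrange_coefficient:
  fixes v :: "complex fps"
  assumes v0: "fps_nth v 0 = 1" and nN: "n \<le> N"
  defines "\<sigma> \<equiv> fps_X * inverse v"
  shows "fps_nth (\<sigma> ^ n * fps_deriv \<sigma> * v ^ (N + 1)) N = (if n = N then 1 else 0)"
proof -
  define w where "w = inverse v"
  have wv: "w * v = 1" using v0 by (simp add: w_def inverse_mult_eq_1)
  have dw: "fps_deriv w = - fps_deriv v * w\<^sup>2"
    unfolding w_def using v0 by (intro fps_inverse_deriv) simp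
  have d\<sigma>: "fps_deriv \<sigma> = w - fps_X * fps_deriv v * w\<^sup>2"
    unfolding \<sigma>_def w_def[symmetric] by (simp add: dw algebra_simps)
  obtain k where k: "N = n + k" using nN le_Suc_ex by blast
  have wvn: "w ^ n * v ^ n = 1" by (simp add: wv flip: power_mult_distrib)
  have "\<sigma> ^ n * fps_deriv \<sigma> * v ^ (N + 1) = fps_X ^ n * (w ^ n * v ^ n) * (fps_deriv \<sigma> * v ^ (k + 1))"
    unfolding \<sigma>_def w_def[symmetric] k by (simp add: power_mult_distrib power_add algebra_simps)
  also have "\<dots> = fps_X ^ n * (fps_deriv \<sigma> * v ^ (k + 1))" by (simp add: wvn)
  finally have *: "fps_nth (\<sigma> ^ n * fps_deriv \<sigma> * v ^ (N + 1)) N = fps_nth (fps_deriv \<sigma> * v ^ (k + 1)) k"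
    by (simp only: fps_X_power_mult_nth) (simp add: k)
  show ?thesis
  proof (cases k)
    case 0
    thus ?thesis unfolding * unfolding d\<sigma> using v0 by (simp add: k w_def)
  next
    \<comment> \<open>For k > 0 the coefficient is the residue of \<sigma>' / \<sigma>^(k + 1), a
      total derivative, and so it vanishes. With power series this becomes the fact that k v' v^j is
      the derivative of v^k.\<close>
    case (Suc j)
    have "fps_deriv \<sigma> * v ^ (k + 1) = (w * v) * v ^ k - fps_X * fps_deriv v * (w * v)\<^sup>2 * v ^ j"
      unfolding d\<sigma> Suc by (simp add: power2_eq_square algebra_simps)
    also have "\<dots> = v ^ k - fps_X * (fps_deriv v * v ^ j)" by (simp add: wv mult.assoc)
    finally have "fps_nth (fps_deriv \<sigma> * v ^ (k + 1)) k = fps_nth (v ^ k) k - fps_nth (fps_deriv v * v ^ j) j"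
      by (simp add: Suc)
    moreover have "of_nat k * fps_nth (fps_deriv v * v ^ j) j = fps_nth (fps_deriv (v ^ k)) j"
    proof -
      have "fps_deriv (v ^ k) = fps_const (of_nat k) * (fps_deriv v * v ^ j)"
        unfolding fps_deriv_power Suc by (simp add: mult.assoc del: of_nat_Suc power_Suc)
      thus ?thesis by simp
    qed
    moreover have "fps_nth (fps_deriv (v ^ k)) j = of_nat k * fps_nth (v ^ k) k"
      unfolding fps_deriv_nth by (simp only: Suc Suc_eq_plus1)
    ultimately have "fps_nth (fps_deriv \<sigma> * v ^ (k + 1)) k = 0" using Suc by (simp del: of_nat_Suc)
    thus ?thesis unfolding * using Suc k by simp
  qed
qed

text \<open>The coefficient of t^n in f v^(n + 1) is the residue of f / \<sigma>^(n + 1), so f dt is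
  expanded here in powers of \<sigma> times d\<sigma>. For f = sinh and v the cube root of
  \<open>D_base\<close> these coefficients are the D_n(0) of the theorem, which explains their
  form.\<close>

lemma lagrange_expansion:
  fixes f v :: "complex fps"
  assumes v0: "fps_nth v 0 = 1"
  defines "\<sigma> \<equiv> fps_X * inverse v"
  shows "\<exists>g. f = (\<Sum>n<N. fps_const (fps_nth (f * v ^ (n + 1)) n) * (\<sigma> ^ n * fps_deriv \<sigma>)) + fps_X ^ N * g"
proof (induction N)
  case (Suc N)
  define c where "c n = fps_nth (f * v ^ (n + 1)) n" for n
  from Suc obtain g where g: "f = (\<Sum>n<N. fps_const (c n) * (\<sigma> ^ n * fps_deriv \<sigma>)) + fps_X ^ N * g"
    unfolding c_def by blast
  have "c N = fps_nth (((\<Sum>n<N. fps_const (c n) * (\<sigma> ^ n * fps_deriv \<sigma>)) + fps_X ^ N * g) * v ^ (N + 1)) N"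
    unfolding g[symmetric] by (simp add: c_def)
  also have "\<dots> = (\<Sum>n<N. c n * fps_nth (\<sigma> ^ n * fps_deriv \<sigma> * v ^ (N + 1)) N) + fps_nth (fps_X ^ N * (g * v ^ (N + 1))) N"
    by (simp add: distrib_right sum_distrib_right fps_sum_nth mult.assoc)
  also have "(\<Sum>n<N. c n * fps_nth (\<sigma> ^ n * fps_deriv \<sigma> * v ^ (N + 1)) N) = 0"
  proof (intro sum.neutral ballI)
    fix n assume "n \<in> {..<N}"
    hence "fps_nth (\<sigma> ^ n * fps_deriv \<sigma> * v ^ (N + 1)) N = 0"
      unfolding \<sigma>_def by (subst lagrange_coefficient[OF v0]) auto
    thus "c n * fps_nth (\<sigma> ^ n * fps_deriv \<sigma> * v ^ (N + 1)) N = 0" by (simp only: mult_zero_right)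
  qed
  also have "fps_nth (fps_X ^ N * (g * v ^ (N + 1))) N = fps_nth g 0"
    using v0 by (simp add: fps_X_power_mult_nth fps_power_zeroth)
  finally have cN: "c N = fps_nth g 0" by simp
  define g2 where "g2 = g - fps_const (c N) * ((inverse v) ^ N * fps_deriv \<sigma>)"
  have "fps_nth (fps_deriv \<sigma>) 0 = 1" using v0 by (simp add: \<sigma>_def)
  hence "fps_nth g2 0 = 0" using v0 by (simp add: g2_def cN fps_power_zeroth)
  hence "g2 = fps_X * fps_shift 1 g2"
    by (intro fps_ext) auto
  moreover have "fps_X ^ N * g = fps_const (c N) * (\<sigma> ^ N * fps_deriv \<sigma>) + fps_X ^ N * g2"
    by (simp add: g2_def \<sigma>_def power_mult_distrib algebra_simps)
  ultimately have "f = (\<Sum>n<Suc N. fps_const (c n) * (\<sigma> ^ n * fps_deriv \<sigma>)) + fps_X ^ Suc N * fps_shift 1 g2"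
    by (subst g) (simp add: mult_ac)
  thus ?case unfolding c_def by blast
qed (simp add: exI[of _ f])

subsection \<open>Watson expansion and the coefficients\<close>

definition sinh_fps :: "complex fps" where
  "sinh_fps = fps_const (1/2) * (fps_exp 1 - fps_exp (-1))"

lemma sinh_has_fps_expansion: "sinh has_fps_expansion sinh_fps"
proof -
  have "(\<lambda>x::complex. (1/2) * (exp (1 * x) - exp (- 1 * x))) has_fps_expansion sinh_fps"
    unfolding sinh_fps_def by (intro fps_expansion_intros)
  moreover have "(\<lambda>x::complex. (1/2) * (exp (1 * x) - exp (- 1 * x))) = sinh"
    by (auto simp: sinh_field_def)
  ultimately show ?thesis by simp
qed

text \<open>The expansion of sinh t - t starts with t^3 / 6; dividing out t^3 leaves a series with
  nonzero constant term, which can be inverted.\<close>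

lemma D_base_analytic: "D_base analytic_on {0}"
proof -
  have nth: "fps_nth (sinh_fps - fps_X) n = ((1 - (-1) ^ n) / fact n) / 2 - (if n = 1 then 1 else 0)" for n
    by (simp add: sinh_fps_def diff_divide_distrib)
  have e: "(\<lambda>t. sinh t - t :: complex) has_fps_expansion (sinh_fps - fps_X)"
    by (intro fps_expansion_intros sinh_has_fps_expansion)
  have n3: "fps_nth (sinh_fps - fps_X) 3 = 1 / 6"
    unfolding nth by (simp add: fact_numeral)
  have low: "fps_nth (sinh_fps - fps_X) k = 0" if "k < 3" for k
  proof -
    from that have "k = 0 \<or> k = 1 \<or> k = 2" by auto
    thus ?thesis unfolding nth by auto
  qed
  have "3 \<le> subdegree (sinh_fps - fps_X)"
  proof (rule subdegree_geI)
    show "sinh_fps - fps_X \<noteq> 0"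
    proof
      assume "sinh_fps - fps_X = 0"
      hence "fps_nth (sinh_fps - fps_X) 3 = 0" by (simp only: fps_zero_nth)
      thus False unfolding n3 by simp
    qed
  qed (rule low)
  hence "(\<lambda>t. if t = 0 then 1 / 6 else (sinh t - t :: complex) / t ^ 3) has_fps_expansion fps_shift 3 (sinh_fps - fps_X)"
    using n3 by (intro has_fps_expansion_shift[OF e]) auto
  hence "(\<lambda>t. inverse (6 * (if t = 0 then 1 / 6 else (sinh t - t :: complex) / t ^ 3))) has_fps_expansion inverse (6 * fps_shift 3 (sinh_fps - fps_X))"
    by (rule has_fps_expansion_inverse[OF has_fps_expansion_mult[OF has_fps_expansion_numeral]])
      (use n3 in \<open>auto simp: fps_numeral_nth fps_mult_nth\<close>)
  moreover have "(\<lambda>t. inverse (6 * (if t = 0 then 1 / 6 else (sinh t - t :: complex) / t ^ 3))) = D_base"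
    by (auto simp: D_base_def field_simps fun_eq_iff)
  ultimately show ?thesis using has_fps_expansion_imp_analytic_0 by fastforce
qed

text \<open>With the cube root as a single analytic function, the fractional powers (n + 1) / 3 in
  \<open>D0\<close> become the integer powers that Lagrange's formula needs.\<close>

definition D_root :: "complex \<Rightarrow> complex" where
  "D_root t = D_base t powr (1/3)"

lemma D_root_analytic: "D_root analytic_on {0}"
  unfolding D_root_def[abs_def] by (intro analytic_intros D_base_analytic) (auto simp: D_base_def)

lemma D_root_power: "D_root t ^ n = D_base t powr (of_nat n / 3)" if "n > 0"
proof (cases "D_base t = 0")
  case False
  thus ?thesis by (simp add: D_root_def powr_def flip: exp_of_nat_mult)
qed (use that in \<open>simp add: D_root_def\<close>)

lemma D0_eq_fps_nth:
  assumes "D_root has_fps_expansion v"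
  shows "D0 n = fps_nth (sinh_fps * v ^ (n + 1)) n"
proof -
  have "(\<lambda>t. sinh t * D_base t powr ((of_nat n + 1) / 3)) = (\<lambda>t. sinh t * D_root t ^ (n + 1))"
    by (auto simp: D_root_power add.commute simp del: power_Suc)
  moreover have "(\<lambda>t. sinh t * D_root t ^ (n + 1)) has_fps_expansion (sinh_fps * v ^ (n + 1))"
    by (intro fps_expansion_intros sinh_has_fps_expansion assms)
  ultimately show ?thesis
    unfolding D0_def by (simp add: fps_nth_fps_expansion del: power_Suc)
qed

lemma D_base_minus: "D_base (- t) = D_base t"
proof -
  have "sinh (- t) - - t = - (sinh t - t)" "(- t) ^ 3 = - (t ^ 3)" by (simp_all add: power3_eq_cube)
  moreover have "(- a) / (- b) = a / b" for a b :: complex by simp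
  ultimately show ?thesis by (simp only: D_base_def neg_equal_0_iff_equal)
qed

text \<open>The function that is differentiated is odd. Half of the Lagrange terms therefore drop
  out, and only the D_(2n+1)(0) remain.\<close>

lemma D0_even: "D0 (2 * m) = 0"
proof -
  define f where "f t = sinh t * D_base t powr ((of_nat (2 * m) + 1) / 3)" for t
  have "f analytic_on {0}"
    unfolding f_def by (intro analytic_intros D_base_analytic sinh_has_fps_expansion[THEN has_fps_expansion_imp_analytic_0])
      (auto simp: D_base_def)
  then obtain r where r: "r > 0" "f holomorphic_on ball 0 r"
    by (auto simp: analytic_on_def)
  have o: "f (-1 * t) = - f t" for t by (simp add: f_def D_base_minus)
  have "(deriv ^^ (2 * m)) (\<lambda>t. f (-1 * t)) 0 = (-1) ^ (2 * m) * (deriv ^^ (2 * m)) f (-1 * 0)"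
    by (rule higher_deriv_compose_linear[OF r(2), of "ball 0 r"]) (use r in auto)
  moreover have "(deriv ^^ (2 * m)) (\<lambda>t. f (-1 * t)) 0 = - (deriv ^^ (2 * m)) f 0"
    unfolding o using higher_deriv_uminus[OF r(2)] r(1) by simp
  ultimately have "(deriv ^^ (2 * m)) f 0 = 0" by simp
  thus ?thesis unfolding D0_def f_def by simp
qed

text \<open>The series \<sigma> = t / v of the Lagrange expansion as a function: the analytic cube
  root of 6 (sinh t - t) that behaves like t at 0, hence a local coordinate at the degenerate
  saddle.\<close>

definition cube_root_phase :: "complex \<Rightarrow> complex" where
  "cube_root_phase t = t / D_root t"

text \<open>The formal Lagrange expansion read as an identity of functions near 0. The remaining
  series X^N g belongs to a function analytic at 0, so g converges as well and is bounded near
  0.\<close>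

lemma sinh_expansion_complex:
  obtains C \<delta> where "\<delta> > 0" "\<And>t. cmod t < \<delta> \<Longrightarrow>
    cmod (sinh t - (\<Sum>n<N. D0 n * (cube_root_phase t ^ n * deriv cube_root_phase t))) \<le> C * cmod t ^ N"
proof -
  define v where "v = fps_expansion D_root 0"
  have v: "D_root has_fps_expansion v"
    unfolding v_def by (rule analytic_at_imp_has_fps_expansion_0[OF D_root_analytic])
  have v0: "fps_nth v 0 = 1"
    using has_fps_expansion_imp_0_eq_fps_nth_0[OF v] by (simp add: D_root_def D_base_def)
  define \<sigma> where "\<sigma> = fps_X * inverse v"
  have s: "cube_root_phase has_fps_expansion \<sigma>"
    unfolding \<sigma>_def cube_root_phase_def[abs_def] divide_inverse
    by (intro fps_expansion_intros v) (simp add: v0)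
  obtain g where g: "sinh_fps = (\<Sum>n<N. fps_const (D0 n) * (\<sigma> ^ n * fps_deriv \<sigma>)) + fps_X ^ N * g"
    using lagrange_expansion[OF v0, of sinh_fps N] unfolding D0_eq_fps_nth[OF v] \<sigma>_def by blast
  have "(\<lambda>t. sinh t - (\<Sum>n<N. D0 n * (cube_root_phase t ^ n * deriv cube_root_phase t))) has_fps_expansion
     (sinh_fps - (\<Sum>n<N. fps_const (D0 n) * (\<sigma> ^ n * fps_deriv \<sigma>)))"
    by (intro fps_expansion_intros sinh_has_fps_expansion s)
  hence E: "(\<lambda>t. sinh t - (\<Sum>n<N. D0 n * (cube_root_phase t ^ n * deriv cube_root_phase t))) has_fps_expansion (fps_X ^ N * g)"
    (is "?E has_fps_expansion _")
    by (subst (asm) g) simp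
  hence rad: "fps_conv_radius (fps_X ^ N * g) > 0" by (simp add: has_fps_expansion_def)
  have "g = fps_shift N (fps_X ^ N * g)" by (simp add: fps_shift_times_fps_X_power mult.commute)
  hence "fps_conv_radius g > 0" using rad by (metis fps_conv_radius_shift)
  hence eg: "eval_fps g has_fps_expansion g" by (rule eval_fps_has_fps_expansion)
  have "(\<lambda>t. t ^ N * eval_fps g t) has_fps_expansion (fps_X ^ N * g)"
    by (intro fps_expansion_intros eg)
  with E have ev: "\<forall>\<^sub>F t in nhds 0. ?E t = t ^ N * eval_fps g t"
    unfolding has_fps_expansion_def by (auto elim: eventually_elim2)
  have "isCont (eval_fps g) 0" using has_fps_expansion_imp_continuous[OF eg] by (simp add: continuous_within)
  hence "(eval_fps g \<longlongrightarrow> eval_fps g 0) (nhds 0)"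
    by (simp add: isCont_def tendsto_nhds_iff)
  hence "\<forall>\<^sub>F t in nhds 0. dist (eval_fps g t) (eval_fps g 0) < 1"
    by (rule tendstoD) simp
  with ev have "\<forall>\<^sub>F t in nhds 0. cmod (?E t) \<le> (cmod (eval_fps g 0) + 1) * cmod t ^ N"
  proof eventually_elim
    case (elim t)
    have "cmod (eval_fps g t) \<le> cmod (eval_fps g 0) + 1"
      using elim(2) norm_triangle_sub[of "eval_fps g t" "eval_fps g 0"] by (simp add: dist_norm)
    hence "cmod t ^ N * cmod (eval_fps g t) \<le> cmod t ^ N * (cmod (eval_fps g 0) + 1)"
      by (intro mult_left_mono) auto
    thus ?case unfolding elim(1) norm_mult norm_power by (simp only: mult.commute)
  qed
  then obtain \<delta> where "\<delta> > 0" "\<And>t. dist t 0 < \<delta> \<Longrightarrow> cmod (?E t) \<le> (cmod (eval_fps g 0) + 1) * cmod t ^ N"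
    unfolding eventually_nhds_metric by blast
  thus ?thesis using that by auto
qed

lemma cube_root_phase_analytic: "cube_root_phase analytic_on {0}"
  unfolding cube_root_phase_def[abs_def]
  by (intro analytic_intros D_root_analytic) (simp add: D_root_def D_base_def)

lemma cube_root_phase_cubed: "cube_root_phase t ^ 3 = 6 * phase t" 
proof (cases "t = 0 \<or> phase t = 0")
  case False
  have "D_root t ^ 3 = D_base t" using D_root_power[of 3 t] False by (simp add: D_base_def phase_def)
  thus ?thesis using False by (simp add: cube_root_phase_def power_divide D_base_def phase_def)
qed (auto simp: cube_root_phase_def phase_def D_root_def D_base_def)

lemma cube_root_phase_deriv:
  "\<forall>\<^sub>F t in nhds 0. (cube_root_phase t)\<^sup>2 * deriv cube_root_phase t = 2 * (cosh t - 1)"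
proof -
  obtain r where r: "r > 0" "cube_root_phase holomorphic_on ball 0 r"
    using cube_root_phase_analytic by (auto simp: analytic_on_def)
  have "(cube_root_phase t)\<^sup>2 * deriv cube_root_phase t = 2 * (cosh t - 1)" if "t \<in> ball 0 r" for t
  proof -
    have "((\<lambda>t. cube_root_phase t ^ 3) has_field_derivative 3 * (cube_root_phase t)\<^sup>2 * deriv cube_root_phase t) (at t)"
      using holomorphic_derivI[OF r(2) open_ball that] by (auto intro!: derivative_eq_intros)
    moreover have "((\<lambda>t. 6 * phase t) has_field_derivative 6 * (cosh t - 1)) (at t)"
      unfolding phase_def by (auto intro!: derivative_eq_intros)
    ultimately have "3 * (cube_root_phase t)\<^sup>2 * deriv cube_root_phase t = 6 * (cosh t - 1)"
      unfolding cube_root_phase_cubed by (rule DERIV_unique)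
    hence "3 * ((cube_root_phase t)\<^sup>2 * deriv cube_root_phase t) = 3 * (2 * (cosh t - 1))" by (simp add: mult.assoc)
    thus ?thesis by (simp only: mult_cancel_left) simp
  qed
  moreover have "\<forall>\<^sub>F t in nhds (0::complex). t \<in> ball 0 r"
    using r(1) by (intro eventually_nhds_in_open) auto
  ultimately show ?thesis by (auto elim: eventually_mono)
qed

section \<open>Watson's lemma on the positive axis\<close>

definition rphase :: "real \<Rightarrow> real" where
  "rphase x = sinh x - x"

abbreviation rexp :: "real \<Rightarrow> real \<Rightarrow> real" where
  "rexp \<nu> x \<equiv> exp (- (\<nu> * rphase x))"

lemma phase_of_real: "phase (of_real x) = of_real (rphase x)"
  by (simp add: phase_def rphase_def sinh_field_def exp_of_real[symmetric])

lemma cosh_ge_quadratic: "1 + x\<^sup>2 / 2 \<le> cosh x" if "0 \<le> (x::real)"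
proof -
  have "cosh 0 - (1 + 0\<^sup>2 / 2) \<le> cosh x - (1 + x\<^sup>2 / 2)"
  proof (rule DERIV_nonneg_imp_nondecreasing[OF that])
    fix y :: real assume y: "0 \<le> y" "y \<le> x"
    show "\<exists>d. ((\<lambda>x. cosh x - (1 + x\<^sup>2 / 2)) has_real_derivative d) (at y) \<and> 0 \<le> d"
      using sinh_ge_self[OF y(1)] by (auto intro!: exI[of _ "sinh y - y"] derivative_eq_intros)
  qed
  thus ?thesis by simp
qed

lemma rphase_ge: "x ^ 3 / 6 \<le> rphase x" if "0 \<le> (x::real)"
proof -
  have "rphase 0 - 0 ^ 3 / 6 \<le> rphase x - x ^ 3 / 6"
  proof (rule DERIV_nonneg_imp_nondecreasing[OF that])
    fix y :: real assume y: "0 \<le> y" "y \<le> x"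
    show "\<exists>d. ((\<lambda>x. rphase x - x ^ 3 / 6) has_real_derivative d) (at y) \<and> 0 \<le> d"
      unfolding rphase_def using cosh_ge_quadratic[OF y(1)]
      by (auto intro!: exI[of _ "cosh y - 1 - y\<^sup>2 / 2"] derivative_eq_intros)
  qed
  thus ?thesis by (simp add: rphase_def)
qed

lemma rphase_pos: "0 < x \<Longrightarrow> 0 < rphase x"
  using sinh_gt_self by (simp add: rphase_def)

lemma rphase_deriv: "(rphase has_real_derivative cosh x - 1) (at x within A)"
  unfolding rphase_def[abs_def] by (auto intro!: derivative_eq_intros)

lemma rphase_strict_mono: "0 \<le> x \<Longrightarrow> x < y \<Longrightarrow> rphase x < rphase y"
proof -
  assume xy: "0 \<le> x" "x < y"
  show "rphase x < rphase y"
  proof (rule DERIV_pos_imp_increasing_open[OF xy(2)])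
    fix z assume "x < z" "z < y"
    thus "\<exists>d. (rphase has_real_derivative d) (at z) \<and> 0 < d"
      using xy cosh_real_strict_mono[of 0 z] rphase_deriv[of z UNIV] by (auto intro!: exI[of _ "cosh z - 1"])
  qed (auto simp: rphase_def intro!: continuous_intros)
qed

lemma rphase_at_top: "filterlim rphase at_top at_top"
  unfolding rphase_def[abs_def] sinh_field_def by real_asymp

text \<open>The change of variables lives in the Lebesgue completion; the measurability hypothesis
  \<open>m\<close> brings the result back to \<open>lborel\<close>.\<close>

lemma set_integral_change_of_variables:
  fixes f :: "real \<Rightarrow> 'a :: euclidean_space"
  assumes S: "S \<in> sets borel"
    and d: "\<And>x. x \<in> S \<Longrightarrow> (g has_field_derivative h x) (at x within S)"
    and inj: "inj_on g S"
    and f: "f absolutely_integrable_on (g ` S)"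
    and m: "set_borel_measurable borel S (\<lambda>x. \<bar>h x\<bar> *\<^sub>R f (g x))"
  shows "set_integrable lborel S (\<lambda>x. \<bar>h x\<bar> *\<^sub>R f (g x))"
    and "(LBINT x:S. \<bar>h x\<bar> *\<^sub>R f (g x)) = integral (g ` S) f"
proof -
  have *: "(\<lambda>x. \<bar>h x\<bar> *\<^sub>R f (g x)) absolutely_integrable_on S \<and> integral S (\<lambda>x. \<bar>h x\<bar> *\<^sub>R f (g x)) = integral (g ` S) f"
    by (subst has_absolute_integral_change_of_variables_real[OF _ d inj]) (use S f in \<open>auto simp: sets_completionI_sets\<close>)
  thus i: "set_integrable lborel S (\<lambda>x. \<bar>h x\<bar> *\<^sub>R f (g x))"
    using m unfolding set_integrable_def set_borel_measurable_def by (subst (asm) integrable_completion) auto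
  show "(LBINT x:S. \<bar>h x\<bar> *\<^sub>R f (g x)) = integral (g ` S) f"
    using set_borel_integral_eq_integral(2)[OF i] * by simp
qed

text \<open>The substitution t = \<nu> (sinh x - x) turns this into Euler's integral for Gamma
  s.\<close>

lemma phase_power_integral:
  assumes s: "s > (0::real)" and \<nu>: "\<nu> > 0"
  shows "integrable_Ioi (\<lambda>x. rphase x powr (s - 1) * (cosh x - 1) * rexp \<nu> x)"
    and "(LBINT x:{0<..}. rphase x powr (s - 1) * (cosh x - 1) * rexp \<nu> x) = Gamma s / \<nu> powr s"
proof -
  define g where "g x = \<nu> * rphase x" for x
  define f where "f t = t powr (s - 1) / exp t" for t :: real
  have img: "g ` {0<..} = {0<..}"
  proof (intro equalityI subsetI)
    fix y :: real assume y: "y \<in> {0<..}"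
    have "filterlim g at_top at_top" unfolding g_def
      using \<nu> rphase_at_top by (intro filterlim_tendsto_pos_mult_at_top[OF tendsto_const])
    hence "\<forall>\<^sub>F b in at_top. y \<le> g b" by (simp add: filterlim_at_top)
    hence "\<forall>\<^sub>F b in at_top. 0 < b \<and> y \<le> g b"
      by (intro eventually_conj eventually_gt_at_top)
    then obtain b where b: "b > 0" "y \<le> g b"
      using eventually_happens' trivial_limit_at_top_linorder by blast
    have "\<exists>x\<ge>0. x \<le> b \<and> g x = y"
      by (rule IVT') (use y b \<nu> in \<open>auto simp: g_def rphase_def intro!: continuous_intros\<close>)
    then obtain x where x: "0 \<le> x" "g x = y" by auto
    hence "x \<noteq> 0" using y by (auto simp: g_def rphase_def)
    thus "y \<in> g ` {0<..}" using x by auto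
  next
    fix y assume "y \<in> g ` {0<..}"
    then obtain x where "x > 0" "y = g x" by auto
    thus "y \<in> {0<..}" using rphase_pos[of x] \<nu> by (simp add: g_def)
  qed
  have inj: "inj_on g {0<..}"
  proof (rule linorder_inj_onI)
    fix x y :: real assume "x < y" "x \<in> {0<..}" "y \<in> {0<..}"
    hence "rphase x < rphase y" by (intro rphase_strict_mono) auto
    thus "g x \<noteq> g y" using \<nu> by (simp add: g_def)
  qed auto
  have fi: "(f has_integral Gamma s) {0<..}"
  proof -
    have "(f has_integral Gamma s) {0..}" unfolding f_def by (rule Gamma_integral_real[OF s])
    moreover have "negligible {x \<in> {0..} - {0<..}. f x \<noteq> 0}" "negligible {x \<in> {0<..} - {0..}. f x \<noteq> 0}"
    proof -
      have "{x \<in> {0..} - {0<..}. f x \<noteq> 0} \<subseteq> {0}" "{x \<in> {0<..} - {0..}. f x \<noteq> 0} \<subseteq> {0}" by auto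
      thus "negligible {x \<in> {0..} - {0<..}. f x \<noteq> 0}" "negligible {x \<in> {0<..} - {0..}. f x \<noteq> 0}"
        using negligible_subset[OF negligible_sing] by blast+
    qed
    ultimately show ?thesis using has_integral_spike_set_eq[of "{0..}" "{0<..}" f "Gamma s"] by (simp only:)
  qed
  have fa: "f absolutely_integrable_on g ` {0<..}"
    unfolding img using fi by (intro nonnegative_absolutely_integrable_1) (auto simp: f_def has_integral_integrable_integral)
  have eq: "\<bar>\<nu> * (cosh x - 1)\<bar> *\<^sub>R f (g x) = \<nu> powr s * (rphase x powr (s - 1) * (cosh x - 1) * rexp \<nu> x)" if "x > 0" for x
  proof -
    have "f (g x) = \<nu> powr (s - 1) * rphase x powr (s - 1) * rexp \<nu> x"
      using \<nu> rphase_pos[OF that] by (simp add: f_def g_def powr_mult exp_minus field_simps)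
    moreover have "\<nu> * \<nu> powr (s - 1) = \<nu> powr s" using \<nu> by (simp add: powr_diff)
    moreover have "\<bar>\<nu> * (cosh x - 1)\<bar> = \<nu> * (cosh x - 1)" using \<nu> cosh_real_ge_1[of x] by simp
    ultimately show ?thesis by (simp add: mult_ac)
  qed
  have cont: "continuous_on {0<..} (\<lambda>x. rphase x powr (s - 1) * (cosh x - 1) * rexp \<nu> x)"
    unfolding rphase_def[abs_def] by (intro continuous_intros) (use sinh_gt_self in force)
  have m: "set_borel_measurable borel {0<..} (\<lambda>x. \<bar>\<nu> * (cosh x - 1)\<bar> *\<^sub>R f (g x))"
  proof -
    have "continuous_on {0<..} (\<lambda>x. \<nu> powr s * (rphase x powr (s - 1) * (cosh x - 1) * rexp \<nu> x))"
      by (intro continuous_intros cont)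
    hence "continuous_on {0<..} (\<lambda>x. \<bar>\<nu> * (cosh x - 1)\<bar> *\<^sub>R f (g x))"
      by (rule continuous_on_eq) (use eq in auto)
    thus ?thesis unfolding set_borel_measurable_def by (rule borel_measurable_continuous_on_indicator[rotated]) simp
  qed
  note cv = set_integral_change_of_variables[of "{0<..}" g "\<lambda>x. \<nu> * (cosh x - 1)" f, OF _ _ inj fa m]
  have d: "(g has_field_derivative \<nu> * (cosh x - 1)) (at x within {0<..})" for x
    unfolding g_def[abs_def] by (auto intro!: derivative_eq_intros rphase_deriv)
  have "integrable_Ioi (\<lambda>x. \<bar>\<nu> * (cosh x - 1)\<bar> *\<^sub>R f (g x))" by (rule cv(1)) (use d in auto)
  also have "?this \<longleftrightarrow> integrable_Ioi (\<lambda>x. \<nu> powr s * (rphase x powr (s - 1) * (cosh x - 1) * rexp \<nu> x))"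
    by (rule set_integrable_cong) (use eq in auto)
  finally show i: "integrable_Ioi (\<lambda>x. rphase x powr (s - 1) * (cosh x - 1) * rexp \<nu> x)"
    using \<nu> by (subst (asm) set_integrable_mult_right_iff) auto
  have "(LBINT x:{0<..}. \<bar>\<nu> * (cosh x - 1)\<bar> *\<^sub>R f (g x)) = integral (g ` {0<..}) f" by (rule cv(2)) (use d in auto)
  also have "(LBINT x:{0<..}. \<bar>\<nu> * (cosh x - 1)\<bar> *\<^sub>R f (g x)) = (LBINT x:{0<..}. \<nu> powr s * (rphase x powr (s - 1) * (cosh x - 1) * rexp \<nu> x))"
    by (rule set_lebesgue_integral_cong) (use eq in auto)
  also have "integral (g ` {0<..}) f = Gamma s" unfolding img using fi by (rule integral_unique)
  finally have "\<nu> powr s * (LBINT x:{0<..}. rphase x powr (s - 1) * (cosh x - 1) * rexp \<nu> x) = Gamma s"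
    by (simp only: set_integral_mult_right)
  moreover have "l = G / a" if "a * l = G" "a > 0" for a l G :: real
    using that by (simp add: field_simps)
  moreover have "\<nu> powr s > 0" using \<nu> by simp
  ultimately show "(LBINT x:{0<..}. rphase x powr (s - 1) * (cosh x - 1) * rexp \<nu> x) = Gamma s / \<nu> powr s"
    by blast
qed

lemma sum_odd_split: "(\<Sum>n<2 * M + 1. f n) = f 0 + (\<Sum>m<M. f (2 * m + 1) + f (2 * m + 2 :: nat))"
  for f :: "nat \<Rightarrow> 'a::comm_monoid_add"
  by (induction M) (simp_all add: add_ac)

text \<open>This is \<sigma>^(2 m + 1) \<sigma>' on the positive axis, where \<sigma> =
  \<open>cube_root_phase\<close>. From \<sigma>^2 \<sigma>' = 2 (cosh x - 1) and \<sigma> = (6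
  rphase x)^(1/3) the constant is 2 * 6^((2 m - 1) / 3) = 6^((2 m + 2) / 3) / 3.\<close>

definition watson_term :: "nat \<Rightarrow> real \<Rightarrow> real" where
  "watson_term m x = 1 / 3 * 6 powr (expo m) * (rphase x powr (expo_pred m) * (cosh x - 1))"

lemma cube_root_phase_of_real:
  assumes x: "x > 0"
  shows "cube_root_phase (of_real x) = of_real ((6 * rphase x) powr (1/3))"
proof -
  have w: "rphase x > 0" by (rule rphase_pos[OF x])
  have "D_base (of_real x) = of_real (x ^ 3 / (6 * rphase x))"
    using x phase_of_real[of x] by (simp add: D_base_def phase_def)
  hence "D_root (of_real x) = of_real ((x ^ 3 / (6 * rphase x)) powr (1/3))"
    unfolding D_root_def using x w powr_of_real[of "x ^ 3 / (6 * rphase x)" "1/3"] by simp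
  also have "(x ^ 3 / (6 * rphase x)) powr (1/3) = x / (6 * rphase x) powr (1/3)"
  proof -
    have "x ^ 3 = x powr 3" using x by simp
    hence "(x ^ 3) powr (1/3) = x" using x by (simp only: powr_powr) simp
    thus ?thesis using x w by (simp add: powr_divide)
  qed
  finally show ?thesis using x w by (simp add: cube_root_phase_def)
qed

lemma sinh_expansion_real:
  obtains C \<delta> where "\<delta> > 0" "\<And>x. 0 < x \<Longrightarrow> x < \<delta> \<Longrightarrow>
    cmod (of_real (sinh x) - (\<Sum>m<M. D0 (2 * m + 1) * of_real (watson_term m x))) \<le> C * x ^ (2 * M + 1)"
proof -
  \<comment> \<open>The first 2 M + 1 Lagrange terms contain exactly M odd ones. Including the
    vanishing term of index 2 M raises the order of the error to 2 M + 1.\<close>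
  obtain C \<delta>1 where 1: "\<delta>1 > 0" "\<And>t. cmod t < \<delta>1 \<Longrightarrow>
    cmod (sinh t - (\<Sum>n<2 * M + 1. D0 n * (cube_root_phase t ^ n * deriv cube_root_phase t))) \<le> C * cmod t ^ (2 * M + 1)"
    using sinh_expansion_complex[of "2 * M + 1"] by blast
  obtain \<delta>2 where 2: "\<delta>2 > 0" "\<And>t. dist t 0 < \<delta>2 \<Longrightarrow> (cube_root_phase t)\<^sup>2 * deriv cube_root_phase t = 2 * (cosh t - 1)"
    using cube_root_phase_deriv unfolding eventually_nhds_metric by blast
  show ?thesis
  proof (rule that[of "min \<delta>1 \<delta>2"])
    fix x :: real assume x: "0 < x" "x < min \<delta>1 \<delta>2"
    define r where "r = (6 * rphase x) powr (1/3)"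
    have w: "rphase x > 0" by (rule rphase_pos[OF x(1)])
    have r: "r > 0" using w by (simp add: r_def)
    have c: "cube_root_phase (of_real x) = of_real r" unfolding r_def by (rule cube_root_phase_of_real[OF x(1)])
    have ch: "cosh (complex_of_real x) = of_real (cosh x)" "sinh (complex_of_real x) = of_real (sinh x)"
      by (simp_all add: cosh_field_def sinh_field_def exp_of_real[symmetric])
    have *: "(of_real r)\<^sup>2 * deriv cube_root_phase (of_real x) = 2 * (of_real (cosh x) - 1)"
      using 2(2)[of "of_real x"] x by (simp add: c ch)
    have d: "deriv cube_root_phase (of_real x) = of_real (2 * (cosh x - 1) / r\<^sup>2)"
    proof -
      have gen: "b = k / a" if "a * b = k" "a \<noteq> 0" for a b k :: complex
        using that(2) unfolding that(1)[symmetric] by simp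
      have "deriv cube_root_phase (of_real x) = 2 * (of_real (cosh x) - 1) / (of_real r)\<^sup>2"
        by (rule gen[OF *]) (use r in simp)
      thus ?thesis by (simp only: of_real_divide of_real_mult of_real_diff of_real_power of_real_1 of_real_numeral)
    qed
    have t: "cube_root_phase (of_real x) ^ (2 * m + 1) * deriv cube_root_phase (of_real x) = of_real (watson_term m x)" for m
    proof -
      have "r ^ (2 * m + 1) * (2 * (cosh x - 1) / r\<^sup>2) = watson_term m x"
      proof -
        have "r ^ (2 * m + 1) / r\<^sup>2 = r powr (2 * real m + 1 - 2)"
        proof -
          have "r ^ (2 * m + 1) = r powr real (2 * m + 1)" "r\<^sup>2 = r powr real 2"
            by (rule powr_realpow[OF r, symmetric])+
          hence "r ^ (2 * m + 1) / r\<^sup>2 = r powr (real (2 * m + 1) - real 2)"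
            by (simp only: powr_diff)
          thus ?thesis by simp
        qed
        also have "\<dots> = (6 * rphase x) powr (expo_pred m)"
          unfolding r_def powr_powr by (rule arg_cong[where f = "\<lambda>p. (6 * rphase x) powr p"]) (simp add: field_simps)
        also have "\<dots> = 6 powr (expo_pred m) * rphase x powr (expo_pred m)"
          using w by (simp add: powr_mult)
        also have "6 powr (expo_pred m) = 6 powr (expo m - 1)"
          by (rule arg_cong[where f = "\<lambda>p. 6 powr p"]) (simp add: field_simps)
        also have "\<dots> = 6 powr (expo m) / 6" by (simp add: powr_diff)
        finally have e: "r ^ (2 * m + 1) / r\<^sup>2 = 6 powr (expo m) / 6 * rphase x powr (expo_pred m)" .
        have "r ^ (2 * m + 1) * (2 * (cosh x - 1) / r\<^sup>2) = r ^ (2 * m + 1) / r\<^sup>2 * (2 * (cosh x - 1))"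
          by (simp only: times_divide_eq_right times_divide_eq_left)
        also have "\<dots> = watson_term m x"
        proof -
          have "a / 6 * b * (2 * c) = 1 / 3 * a * (b * c)" for a b c :: real by simp
          thus ?thesis unfolding e watson_term_def .
        qed
        finally show ?thesis .
      qed
      thus ?thesis unfolding c d by (metis of_real_mult of_real_power)
    qed
    have "(\<Sum>n<2 * M + 1. D0 n * (cube_root_phase (of_real x) ^ n * deriv cube_root_phase (of_real x))) =
       (\<Sum>m<M. D0 (2 * m + 1) * of_real (watson_term m x))"
      unfolding sum_odd_split using D0_even[of 0] D0_even[of "Suc _"] t by simp
    thus "cmod (of_real (sinh x) - (\<Sum>m<M. D0 (2 * m + 1) * of_real (watson_term m x))) \<le> C * x ^ (2 * M + 1)"
      using 1(2)[of "of_real x"] x by (simp add: ch)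
  qed (use 1 2 in simp)
qed

lemma saddle_int_real:
  assumes \<nu>: "\<nu> > 0"
  shows "integrable_Ioi (\<lambda>x. sinh x * rexp \<nu> x)"
    and "saddle_int (of_real (ln \<nu>)) = of_real (LBINT x:{0<..}. sinh x * rexp \<nu> x)"
proof -
  define \<zeta> where "\<zeta> = complex_of_real (ln \<nu>)"
  have e: "exp \<zeta> = of_real \<nu>" using \<nu> by (simp add: \<zeta>_def exp_of_real)
  have k: "kern (of_real \<nu>) (of_real x) = of_real (sinh x * rexp \<nu> x)" for x
    unfolding kern_def phase_of_real by (simp add: sinh_field_def exp_of_real[symmetric])
  have l: "((\<lambda>X. Re (prim (of_real \<nu>) (of_real X))) \<longlongrightarrow> Re (saddle_int \<zeta>)) at_top"
    using tendsto_Re[OF saddle_int_lim[of \<zeta>]] unfolding e by (simp add: \<zeta>_def)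
  have d: "((\<lambda>X. Re (prim (of_real \<nu>) (of_real X))) has_real_derivative sinh x * rexp \<nu> x) (at x)" for x
  proof -
    have "((\<lambda>X. complex_of_real X) has_vector_derivative 1) (at x)"
      by (auto intro!: derivative_eq_intros)
    from bounded_linear.has_vector_derivative[OF bounded_linear_Re prim_of_real_deriv[OF this, of "of_real \<nu>"]]
    show ?thesis unfolding has_real_derivative_iff_has_vector_derivative k by simp
  qed
  have c1: "continuous_on {0..} (\<lambda>X. Re (prim (of_real \<nu>) (of_real X)))" by (intro continuous_intros)
  have c2: "continuous_on {0<..} (\<lambda>x. sinh x * rexp \<nu> x)"
    unfolding rphase_def by (intro continuous_intros)
  have nn: "0 \<le> sinh x * rexp \<nu> x" if "x > 0" for x using that by simp
  note F = set_integral_FTC_nonneg[OF c1 c2 d nn l]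
  show "integrable_Ioi (\<lambda>x. sinh x * rexp \<nu> x)" by (rule F(1))
  have "cnj (saddle_int \<zeta>) = saddle_int \<zeta>" using saddle_int_cnj[of \<zeta>] by (simp add: \<zeta>_def)
  hence "Im (saddle_int \<zeta>) = 0" by (metis Reals_cnj_iff complex_is_Real_iff)
  thus "saddle_int (of_real (ln \<nu>)) = of_real (LBINT x:{0<..}. sinh x * rexp \<nu> x)"
    using F(2) unfolding \<zeta>_def by (simp add: complex_eq_iff)
qed

lemma set_integrable_of_real:
  assumes "set_integrable M A f"
  shows "set_integrable M A (\<lambda>x. complex_of_real (f x))"
proof -
  have "(\<lambda>x. indicator A x *\<^sub>R complex_of_real (f x)) = (\<lambda>x. of_real (indicator A x *\<^sub>R f x))"
    by (simp add: scaleR_conv_of_real)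
  thus ?thesis using assms unfolding set_integrable_def by (simp only: integrable_of_real)
qed

lemma set_integral_finite_sum:
  fixes f :: "'i \<Rightarrow> 'a \<Rightarrow> 'b :: {banach, second_countable_topology}"
  assumes "\<And>i. i \<in> I \<Longrightarrow> set_integrable M A (f i)"
  shows "set_integrable M A (\<lambda>x. \<Sum>i\<in>I. f i x)"
    and "(LINT x:A|M. (\<Sum>i\<in>I. f i x)) = (\<Sum>i\<in>I. LINT x:A|M. f i x)"
  using assms unfolding set_integrable_def set_lebesgue_integral_def
  by (simp_all add: scaleR_sum_right)

definition watson_coeff :: "nat \<Rightarrow> real" where
  "watson_coeff m = 1 / 3 * 6 powr (expo m) * Gamma (expo m)"

lemma watson_term_integral:
  assumes "\<nu> > 0"
  shows "integrable_Ioi (\<lambda>x. watson_term m x * rexp \<nu> x)"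
    and "(LBINT x:{0<..}. watson_term m x * rexp \<nu> x) = watson_coeff m / \<nu> powr (expo m)"
proof -
  define s where "s = expo m"
  have s: "s > 0" by (simp add: s_def)
  have e: "expo_pred m = s - 1" by (simp add: s_def field_simps)
  have t: "watson_term m x * rexp \<nu> x = 1 / 3 * 6 powr s * (rphase x powr (s - 1) * (cosh x - 1) * rexp \<nu> x)" for x
    unfolding watson_term_def e s_def[symmetric] by (simp only: mult.assoc)
  show "integrable_Ioi (\<lambda>x. watson_term m x * rexp \<nu> x)"
    unfolding t by (intro set_integrable_mult_right phase_power_integral(1) s assms)
  have "(LBINT x:{0<..}. watson_term m x * rexp \<nu> x) =
    1 / 3 * 6 powr s * (LBINT x:{0<..}. rphase x powr (s - 1) * (cosh x - 1) * rexp \<nu> x)"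
    unfolding t by (rule set_integral_mult_right)
  thus "(LBINT x:{0<..}. watson_term m x * rexp \<nu> x) = watson_coeff m / \<nu> powr (expo m)"
    unfolding phase_power_integral(2)[OF s assms] watson_coeff_def s_def[symmetric] by simp
qed

text \<open>Converts the Taylor error into a multiple of the next Watson term, whose integral is
  known exactly. It rests on x^3 / 6 \<le> rphase x and x^2 / 2 \<le> cosh x - 1; for M \<ge> 1 the
  exponent of \<open>rphase x\<close> is nonnegative, so the first inequality may be raised to that
  power.\<close>

lemma power_le_watson_term:
  assumes x: "x > 0" and M: "M \<ge> 1"
  shows "x ^ (2 * M + 1) \<le> 2 * 6 powr (expo_pred M) * (rphase x powr (expo_pred M) * (cosh x - 1))"
proof -
  define p where "p = expo_pred M"
  have p: "p \<ge> 0" using M by (simp add: p_def)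
  have "(x ^ 3 / 6) powr p \<le> rphase x powr p" using x p by (intro powr_mono2 rphase_ge) auto
  hence "6 powr p * (x ^ 3 / 6) powr p \<le> 6 powr p * rphase x powr p" by (intro mult_left_mono) auto
  moreover have "6 powr p * (x ^ 3 / 6) powr p = x ^ (2 * M - 1)"
  proof -
    have "6 powr p * (x ^ 3 / 6) powr p = (x ^ 3) powr p" using x by (simp flip: powr_mult)
    also have "(x ^ 3) powr p = (x powr real 3) powr p" by (simp only: powr_realpow[OF x])
    also have "(x powr real 3) powr p = x powr real (2 * M - 1)"
      unfolding powr_powr using M by (intro arg_cong[where f = "\<lambda>p. x powr p"]) (simp add: p_def of_nat_diff)
    also have "\<dots> = x ^ (2 * M - 1)" by (rule powr_realpow[OF x])
    finally show ?thesis .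
  qed
  ultimately have 1: "x ^ (2 * M - 1) \<le> 6 powr p * rphase x powr p" by simp
  have 2: "x\<^sup>2 \<le> 2 * (cosh x - 1)" using cosh_ge_quadratic[of x] x by simp
  have "x ^ (2 * M + 1) = x ^ (2 * M - 1) * x\<^sup>2"
    unfolding power_add[symmetric] using M by (intro arg_cong[where f = "\<lambda>k. x ^ k"]) simp
  also have "\<dots> \<le> (6 powr p * rphase x powr p) * (2 * (cosh x - 1))"
    by (intro mult_mono 1 2) auto
  finally show ?thesis unfolding p_def by (simp only: mult_ac)
qed

text \<open>Near 0 this is the Taylor estimate. For x \<ge> \<delta> every single term is dominated
  by the next Watson term, because \<open>rphase x\<close> stays away from 0. An estimate on the
  whole axis yields the error of the expansion for every \<nu> > 0, not only for large
  \<nu>.\<close>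

lemma sinh_expansion_global:
  assumes M: "M \<ge> 1"
  obtains K where "\<And>x. x > 0 \<Longrightarrow> cmod (of_real (sinh x) - (\<Sum>m<M. D0 (2 * m + 1) * of_real (watson_term m x)))
     \<le> K * (rphase x powr (expo_pred M) * (cosh x - 1))"
proof -
  define p where "p = expo_pred M"
  have p: "p \<ge> 0" using M by (simp add: p_def)
  define E where "E x = cmod (of_real (sinh x) - (\<Sum>m<M. D0 (2 * m + 1) * of_real (watson_term m x)))" for x
  obtain C \<delta> where 1: "\<delta> > 0" "\<And>x. 0 < x \<Longrightarrow> x < \<delta> \<Longrightarrow> E x \<le> C * x ^ (2 * M + 1)"
    unfolding E_def by (rule sinh_expansion_real[of M]) blast
  define C' where "C' = max C 0"
  have small: "E x \<le> C' * (2 * 6 powr p) * (rphase x powr p * (cosh x - 1))" if "0 < x" "x < \<delta>" for x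
  proof -
    have "E x \<le> C' * x ^ (2 * M + 1)"
      using 1(2)[OF that] that by (auto simp: C'_def intro: order_trans mult_right_mono)
    also have "\<dots> \<le> C' * (2 * 6 powr p * (rphase x powr p * (cosh x - 1)))"
      using power_le_watson_term[OF that(1) M] unfolding p_def by (intro mult_left_mono) (auto simp: C'_def)
    finally show ?thesis by (simp only: mult.assoc)
  qed
  define w where "w = rphase \<delta>"
  have w: "w > 0" unfolding w_def by (rule rphase_pos[OF 1(1)])
  \<comment> \<open>For m < M the exponent of the power of w is negative, so w, the smallest value
    of \<open>rphase\<close> on x \<ge> \<delta>, gives the largest value of that power.\<close>
  define B where "B m = cmod (D0 (2 * m + 1)) * (1 / 3 * 6 powr (expo m) * w powr (expo_pred m - p))" for m
  define S where "S = sinh \<delta> / (cosh \<delta> - 1) / w powr p"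
  have cd: "cosh \<delta> - 1 > 0" using cosh_real_strict_mono[of 0 \<delta>] 1(1) by simp
  have large: "E x \<le> (S + (\<Sum>m<M. B m)) * (rphase x powr p * (cosh x - 1))" if x: "\<delta> \<le> x" for x
  proof -
    have x0: "x > 0" using x 1(1) by linarith
    have cx: "cosh x - 1 > 0" using cosh_real_strict_mono[of 0 x] x0 by simp
    have wx: "w \<le> rphase x" unfolding w_def using rphase_strict_mono[of \<delta> x] x 1(1) by (cases "\<delta> = x") auto
    \<comment> \<open>The quotient is coth (x / 2), hence decreasing; the proof uses that sinh is
      superadditive.\<close>
    have "sinh x / (cosh x - 1) \<le> sinh \<delta> / (cosh \<delta> - 1)"
    proof -
      have "sinh x * (cosh \<delta> - 1) - sinh \<delta> * (cosh x - 1) = sinh \<delta> - sinh x + sinh (x - \<delta>)"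
        by (simp add: sinh_diff algebra_simps)
      moreover have "sinh (x - \<delta>) \<le> sinh x - sinh \<delta>"
      proof -
        have "sinh x = sinh (x - \<delta>) * cosh \<delta> + cosh (x - \<delta>) * sinh \<delta>" using sinh_add[of "x - \<delta>" \<delta>] by simp
        moreover have "sinh (x - \<delta>) * 1 \<le> sinh (x - \<delta>) * cosh \<delta>" using x by (intro mult_left_mono) (auto simp: cosh_real_ge_1)
        moreover have "1 * sinh \<delta> \<le> cosh (x - \<delta>) * sinh \<delta>" using 1(1) by (intro mult_right_mono) (auto simp: cosh_real_ge_1)
        ultimately show ?thesis by linarith
      qed
      ultimately have "sinh x * (cosh \<delta> - 1) \<le> sinh \<delta> * (cosh x - 1)" by linarith
      thus ?thesis using cd cx by (simp add: divide_simps)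
    qed
    hence "sinh x \<le> sinh \<delta> / (cosh \<delta> - 1) * (cosh x - 1)" using cx by (simp add: pos_divide_le_eq)
    also have "\<dots> = S * (w powr p * (cosh x - 1))" using w by (simp add: S_def)
    also have "\<dots> \<le> S * (rphase x powr p * (cosh x - 1))"
      using wx w p cx 1(1) cd unfolding S_def by (intro mult_left_mono mult_right_mono powr_mono2) auto
    finally have a: "sinh x \<le> S * (rphase x powr p * (cosh x - 1))" .
    have b: "cmod (D0 (2 * m + 1) * of_real (watson_term m x)) \<le> B m * (rphase x powr p * (cosh x - 1))" if m: "m < M" for m
    proof -
      define q where "q = expo_pred m"
      have q: "q \<le> p" using m by (simp add: q_def p_def)
      have "rphase x powr q = rphase x powr p * rphase x powr (q - p)" by (simp flip: powr_add)
      also have "\<dots> \<le> rphase x powr p * w powr (q - p)"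
        using wx w q by (intro mult_left_mono powr_mono2') auto
      finally have "rphase x powr q \<le> w powr (q - p) * rphase x powr p" by (simp only: mult.commute)
      hence "cmod (D0 (2 * m + 1)) * (1 / 3 * 6 powr (expo m) * (rphase x powr q * (cosh x - 1)))
         \<le> cmod (D0 (2 * m + 1)) * (1 / 3 * 6 powr (expo m) * ((w powr (q - p) * rphase x powr p) * (cosh x - 1)))"
        using cx by (intro mult_left_mono mult_right_mono) auto
      moreover have "cmod (D0 (2 * m + 1) * of_real (watson_term m x)) = cmod (D0 (2 * m + 1)) * (1 / 3 * 6 powr (expo m) * (rphase x powr q * (cosh x - 1)))"
        unfolding norm_mult norm_of_real watson_term_def q_def using cx by (simp add: abs_mult)
      ultimately show ?thesis unfolding B_def q_def by (simp only: mult.assoc)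
    qed
    have "E x \<le> cmod (of_real (sinh x)) + cmod (\<Sum>m<M. D0 (2 * m + 1) * of_real (watson_term m x))"
      unfolding E_def by (rule norm_triangle_ineq4)
    also have "cmod (of_real (sinh x)) = sinh x" using x0 by simp
    also have "cmod (\<Sum>m<M. D0 (2 * m + 1) * of_real (watson_term m x)) \<le> (\<Sum>m<M. B m * (rphase x powr p * (cosh x - 1)))"
      by (rule sum_norm_le) (use b in auto)
    finally have "E x \<le> S * (rphase x powr p * (cosh x - 1)) + (\<Sum>m<M. B m * (rphase x powr p * (cosh x - 1)))" using a by linarith
    thus ?thesis by (simp only: distrib_right sum_distrib_right)
  qed
  show ?thesis
  proof (rule that[of "max (C' * (2 * 6 powr p)) (S + (\<Sum>m<M. B m))"])
    fix x :: real assume x: "x > 0"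
    have nn: "0 \<le> rphase x powr p * (cosh x - 1)" using cosh_real_ge_1[of x] by simp
    have "E x \<le> max (C' * (2 * 6 powr p)) (S + (\<Sum>m<M. B m)) * (rphase x powr p * (cosh x - 1))"
    proof (cases "x < \<delta>")
      case True
      show ?thesis by (rule order_trans[OF small[OF x True] mult_right_mono[OF max.cobounded1 nn]])
    next
      case False
      thus ?thesis using order_trans[OF large mult_right_mono[OF max.cobounded2 nn]] by simp
    qed
    thus "cmod (of_real (sinh x) - (\<Sum>m<M. D0 (2 * m + 1) * of_real (watson_term m x)))
     \<le> max (C' * (2 * 6 powr p)) (S + (\<Sum>m<M. B m)) * (rphase x powr (expo_pred M) * (cosh x - 1))"
      by (simp only: E_def p_def)
  qed
qed

lemma saddle_int_watson:
  assumes M: "M \<ge> 1"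
  obtains K where "\<And>\<nu>. \<nu> > 0 \<Longrightarrow> cmod (saddle_int (of_real (ln \<nu>)) -
     (\<Sum>m<M. D0 (2 * m + 1) * of_real (watson_coeff m) / of_real (\<nu> powr (expo m)))) \<le> K / \<nu> powr (expo M)"
proof -
  obtain K where K: "\<And>x. x > 0 \<Longrightarrow> cmod (of_real (sinh x) - (\<Sum>m<M. D0 (2 * m + 1) * of_real (watson_term m x)))
     \<le> K * (rphase x powr (expo_pred M) * (cosh x - 1))"
    using sinh_expansion_global[OF M] by blast
  define s where "s = expo M"
  have s: "s > 0" by (simp add: s_def)
  have se: "expo_pred M = s - 1" by (simp add: s_def field_simps)
  show ?thesis
  proof (rule that[of "K * Gamma s"])
    fix \<nu> :: real assume \<nu>: "\<nu> > 0"
    define e where "e x = rexp \<nu> x" for x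
    have i1: "integrable_Ioi (\<lambda>x. complex_of_real (sinh x * e x))"
      using saddle_int_real(1)[OF \<nu>] unfolding e_def by (rule set_integrable_of_real)
    have i2: "integrable_Ioi (\<lambda>x. D0 (2 * m + 1) * complex_of_real (watson_term m x * e x))" for m
      using watson_term_integral(1)[OF \<nu>] unfolding e_def by (intro set_integrable_mult_right set_integrable_of_real)
    have i3: "integrable_Ioi (\<lambda>x. \<Sum>m<M. D0 (2 * m + 1) * complex_of_real (watson_term m x * e x))"
      by (rule set_integral_finite_sum(1)) (rule i2)
    have i4: "integrable_Ioi (\<lambda>x. K * (rphase x powr (s - 1) * (cosh x - 1) * e x))"
      unfolding e_def by (intro set_integrable_mult_right phase_power_integral(1) s \<nu>)
    have v2: "(LBINT x:{0<..}. D0 (2 * m + 1) * complex_of_real (watson_term m x * e x)) =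
      D0 (2 * m + 1) * of_real (watson_coeff m) / of_real (\<nu> powr (expo m))" for m
    proof -
      have "(LBINT x:{0<..}. D0 (2 * m + 1) * complex_of_real (watson_term m x * e x)) =
        D0 (2 * m + 1) * of_real (LBINT x:{0<..}. watson_term m x * e x)"
        by (simp only: set_integral_mult_right set_integral_complex_of_real)
      thus ?thesis unfolding e_def watson_term_integral(2)[OF \<nu>] by (simp only: of_real_divide times_divide_eq_right)
    qed
    have "saddle_int (of_real (ln \<nu>)) - (\<Sum>m<M. D0 (2 * m + 1) * of_real (watson_coeff m) / of_real (\<nu> powr (expo m)))
      = (LBINT x:{0<..}. complex_of_real (sinh x * e x)) - (\<Sum>m<M. LBINT x:{0<..}. D0 (2 * m + 1) * complex_of_real (watson_term m x * e x))"
      unfolding v2 unfolding saddle_int_real(2)[OF \<nu>] e_def by (simp only: set_integral_complex_of_real)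
    also have "(\<Sum>m<M. LBINT x:{0<..}. D0 (2 * m + 1) * complex_of_real (watson_term m x * e x)) =
      (LBINT x:{0<..}. \<Sum>m<M. D0 (2 * m + 1) * complex_of_real (watson_term m x * e x))"
      by (rule set_integral_finite_sum(2)[symmetric]) (rule i2)
    also have "(LBINT x:{0<..}. complex_of_real (sinh x * e x)) - \<dots> =
      (LBINT x:{0<..}. complex_of_real (sinh x * e x) - (\<Sum>m<M. D0 (2 * m + 1) * complex_of_real (watson_term m x * e x)))"
      by (rule set_integral_diff(2)[OF i1 i3, symmetric])
    also have "cmod \<dots> \<le> (LBINT x:{0<..}. cmod (complex_of_real (sinh x * e x) - (\<Sum>m<M. D0 (2 * m + 1) * complex_of_real (watson_term m x * e x))))"
      by (rule set_integral_norm_bound[OF set_integral_diff(1)[OF i1 i3]])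
    also have "\<dots> \<le> (LBINT x:{0<..}. K * (rphase x powr (s - 1) * (cosh x - 1) * e x))"
    proof (rule set_integral_mono[OF set_integrable_norm[OF set_integral_diff(1)[OF i1 i3]] i4])
      fix x :: real assume "x \<in> {0<..}"
      hence x: "x > 0" by simp
      have "complex_of_real (sinh x * e x) - (\<Sum>m<M. D0 (2 * m + 1) * complex_of_real (watson_term m x * e x))
        = (of_real (sinh x) - (\<Sum>m<M. D0 (2 * m + 1) * of_real (watson_term m x))) * of_real (e x)"
        by (simp add: left_diff_distrib sum_distrib_right mult.assoc)
      hence "cmod (complex_of_real (sinh x * e x) - (\<Sum>m<M. D0 (2 * m + 1) * complex_of_real (watson_term m x * e x)))
         = cmod (of_real (sinh x) - (\<Sum>m<M. D0 (2 * m + 1) * of_real (watson_term m x))) * e x"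
        by (simp add: norm_mult e_def)
      also have "\<dots> \<le> (K * (rphase x powr (s - 1) * (cosh x - 1))) * e x"
        using K[OF x] unfolding se by (rule mult_right_mono) (simp add: e_def)
      finally show "cmod (complex_of_real (sinh x * e x) - (\<Sum>m<M. D0 (2 * m + 1) * complex_of_real (watson_term m x * e x)))
         \<le> K * (rphase x powr (s - 1) * (cosh x - 1) * e x)" by (simp only: mult.assoc)
    qed
    also have "\<dots> = K * (LBINT x:{0<..}. rphase x powr (s - 1) * (cosh x - 1) * e x)"
      by (rule set_integral_mult_right)
    also have "\<dots> = K * Gamma s / \<nu> powr s"
      unfolding e_def phase_power_integral(2)[OF s \<nu>] by simp
    finally show "cmod (saddle_int (of_real (ln \<nu>)) -
     (\<Sum>m<M. D0 (2 * m + 1) * of_real (watson_coeff m) / of_real (\<nu> powr (expo m)))) \<le> K * Gamma s / \<nu> powr (expo M)"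
      by (simp only: s_def)
  qed
qed

section \<open>Comparison of the two expansions\<close>

lemma asymptotic_coeffs_unique:
  fixes c :: "nat \<Rightarrow> complex"
  assumes "\<And>y. y > 0 \<Longrightarrow> cmod (\<Sum>m<M. c m * of_real y ^ m) \<le> K * y ^ M" and "m < M"
  shows "c m = 0"
  using assms
proof (induction M arbitrary: c m)
  case (Suc M)
  have sum: "(\<Sum>m<Suc M. c m * of_real y ^ m) = c 0 + of_real y * (\<Sum>m<M. c (Suc m) * of_real y ^ m)" for y :: real
    by (simp add: sum.lessThan_Suc_shift sum_distrib_left mult_ac del: sum.lessThan_Suc)
  have c0: "c 0 = 0"
  proof -
    have "((\<lambda>y. \<Sum>m<Suc M. c m * of_real y ^ m) \<longlongrightarrow> (\<Sum>m<Suc M. c m * of_real 0 ^ m)) (at_right (0::real))"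
      by (intro tendsto_intros)
    moreover have "((\<lambda>y. \<Sum>m<Suc M. c m * of_real y ^ m) \<longlongrightarrow> 0) (at_right (0::real))"
    proof (rule Lim_null_comparison)
      show "\<forall>\<^sub>F y in at_right 0. cmod (\<Sum>m<Suc M. c m * of_real y ^ m) \<le> K * y ^ Suc M"
        using eventually_at_right_less[of "0::real"] by eventually_elim (rule Suc.prems(1))
      have "((\<lambda>y::real. K * y ^ Suc M) \<longlongrightarrow> K * 0 ^ Suc M) (at_right 0)" by (intro tendsto_intros)
      thus "((\<lambda>y::real. K * y ^ Suc M) \<longlongrightarrow> 0) (at_right 0)" by simp
    qed
    ultimately have "(\<Sum>m<Suc M. c m * of_real 0 ^ m) = 0"
      using tendsto_unique trivial_limit_at_right_real by blast
    thus ?thesis using sum[of 0] by simp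
  qed
  have "cmod (\<Sum>m<M. c (Suc m) * of_real y ^ m) \<le> K * y ^ M" if y: "y > 0" for y
  proof -
    have "y * cmod (\<Sum>m<M. c (Suc m) * of_real y ^ m) \<le> y * (K * y ^ M)"
      using Suc.prems(1)[OF y] y unfolding sum c0 by (simp add: norm_mult mult_ac)
    thus ?thesis using y by simp
  qed
  hence "c (Suc m) = 0" if "m < M" for m using Suc.IH[of "\<lambda>m. c (Suc m)"] that by blast
  thus ?case using c0 Suc.prems(2) by (cases m) auto
qed simp

definition moment :: "nat \<Rightarrow> real" where
  "moment m = (LBINT n:{0<..}. cut_hr n * n powr (expo_pred m))"

lemma D0_1: "D0 1 = 1"
proof -
  define v where "v = fps_expansion D_root 0"
  have v: "D_root has_fps_expansion v"
    unfolding v_def by (rule analytic_at_imp_has_fps_expansion_0[OF D_root_analytic])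
  have v0: "fps_nth v 0 = 1"
    using has_fps_expansion_imp_0_eq_fps_nth_0[OF v] by (simp add: D_root_def D_base_def)
  have "fps_nth sinh_fps 0 = 0" "fps_nth sinh_fps 1 = 1" by (simp_all add: sinh_fps_def)
  thus ?thesis unfolding D0_eq_fps_nth[OF v] using v0 by (simp add: fps_mult_nth numeral_2_eq_2)
qed

lemma cbrt2_ln: "\<nu> > 0 \<Longrightarrow> cbrt2 (of_real (ln \<nu>)) = of_real (\<nu> powr (2/3))"
  by (simp add: cbrt2_def powr_def flip: exp_of_real)

text \<open>Along the real axis towards + infinity the Watson expansion gives the limit of
  \<open>saddle_int\<close> times \<open>cbrt2\<close>, while \<open>disp_integral\<close> tends to
  0. The constant \<open>disp_rest\<close> is therefore the leading Watson coefficient.\<close>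

lemma disp_rest_eq:
  assumes "\<bar>Im a\<bar> < 3 * pi / 2"
  shows "disp_rest a = of_real (watson_coeff 0)"
proof -
  obtain K where K: "\<And>\<nu>. \<nu> > 0 \<Longrightarrow> cmod (saddle_int (of_real (ln \<nu>)) -
     (\<Sum>m<1. D0 (2 * m + 1) * of_real (watson_coeff m) / of_real (\<nu> powr (expo m)))) \<le> K / \<nu> powr (expo 1)"
    using saddle_int_watson[of 1] by auto
  have X: "cbrt2 (of_real x) = of_real (exp (2 * x / 3))" for x by (simp add: cbrt2_def flip: exp_of_real)
  have b: "cmod (saddle_int (of_real x) * cbrt2 (of_real x) - of_real (watson_coeff 0)) \<le> K * exp (- (2 * x / 3))" for x
  proof -
    have p: "exp x powr (2 / 3) = exp (2 * x / 3)" "exp x powr (4 / 3) = exp (4 * x / 3)" by (simp_all add: powr_def)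
    have "cmod (saddle_int (of_real x) - of_real (watson_coeff 0) / of_real (exp (2 * x / 3))) \<le> K / exp (4 * x / 3)"
      using K[of "exp x"] D0_1 by (simp add: p)
    hence "exp (2 * x / 3) * cmod (saddle_int (of_real x) - of_real (watson_coeff 0) / of_real (exp (2 * x / 3))) \<le> exp (2 * x / 3) * (K / exp (4 * x / 3))"
      by (rule mult_left_mono) simp
    also have "exp (2 * x / 3) * (K / exp (4 * x / 3)) = K * exp (2 * x / 3 - 4 * x / 3)" by (simp only: exp_diff) simp
    also have "2 * x / 3 - 4 * x / 3 = - (2 * x / 3)" by simp
    also have "exp (2 * x / 3) * cmod (saddle_int (of_real x) - of_real (watson_coeff 0) / of_real (exp (2 * x / 3)))
       = cmod (of_real (exp (2 * x / 3)) * (saddle_int (of_real x) - of_real (watson_coeff 0) / of_real (exp (2 * x / 3))))"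
      unfolding norm_mult norm_of_real by simp
    also have "of_real (exp (2 * x / 3)) * (saddle_int (of_real x) - of_real (watson_coeff 0) / of_real (exp (2 * x / 3)))
       = saddle_int (of_real x) * cbrt2 (of_real x) - of_real (watson_coeff 0)"
      unfolding X by (simp add: right_diff_distrib mult.commute del: of_real_exp)
    finally show ?thesis .
  qed
  have lim: "((\<lambda>x. saddle_int (of_real x) * cbrt2 (of_real x)) \<longlongrightarrow> of_real (watson_coeff 0)) at_top"
  proof (rule Lim_transform2[OF tendsto_const], rule Lim_null_comparison)
    show "\<forall>\<^sub>F x in at_top. cmod (of_real (watson_coeff 0) - saddle_int (of_real x) * cbrt2 (of_real x)) \<le> K * exp (- (2 * x / 3))"
      using b by (simp add: norm_minus_commute)
    show "((\<lambda>x. K * exp (- (2 * x / 3))) \<longlongrightarrow> 0) at_top" by real_asymp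
  qed
  have "\<forall>\<^sub>F x in at_top. cmod (saddle_int (of_real x) * cbrt2 (of_real x)) < cmod (complex_of_real (watson_coeff 0)) + 1"
    by (rule order_tendstoD(2)[OF tendsto_norm[OF lim]]) simp
  hence bdd: "\<forall>\<^sub>F x in at_top. cmod (saddle_int (of_real x) * cbrt2 (of_real x)) \<le> cmod (complex_of_real (watson_coeff 0)) + 1"
    by (rule eventually_mono) simp
  define C where "C = (LBINT n:{0<..}. cmod (cut_h (of_real n) * of_real (n powr (1/3))))"
  have "((\<lambda>x. disp_integral (of_real x)) \<longlongrightarrow> 0) at_top"
  proof (rule Lim_null_comparison)
    show "\<forall>\<^sub>F x in at_top. cmod (disp_integral (of_real x)) \<le> C * exp (- (2 * x / 3))"
      using disp_integral_real_bound by (simp add: C_def norm_cbrt2 exp_minus field_simps)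
    show "((\<lambda>x. C * exp (- (2 * x / 3))) \<longlongrightarrow> 0) at_top" by real_asymp
  qed
  from tendsto_diff[OF lim this] have "((\<lambda>x. disp_rest (of_real x)) \<longlongrightarrow> of_real (watson_coeff 0)) at_top"
    by (simp add: disp_rest_def)
  moreover have "disp_rest (of_real x) = disp_rest a" for x
    by (rule disp_rest_const[OF bdd]) (use assms in auto)
  ultimately have "((\<lambda>x::real. disp_rest a) \<longlongrightarrow> of_real (watson_coeff 0)) at_top" by (simp only:)
  thus ?thesis by (simp add: tendsto_const_iff)
qed

lemma saddle_int_dispersion:
  assumes "\<bar>Im a\<bar> < 3 * pi / 2"
  shows "saddle_int a * cbrt2 a = of_real (watson_coeff 0) + disp_integral a"
  using disp_rest_eq[OF assms] by (simp add: disp_rest_def algebra_simps)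

lemma moment_integrable:
  assumes "m \<ge> 1"
  shows "integrable_Ioi (\<lambda>n. cut_hr n * n powr (expo_pred m))"
    and "integrable_Ioi (\<lambda>n. cut_h (of_real n) * of_real (n powr (expo_pred m)))"
    and "(LBINT n:{0<..}. cut_h (of_real n) * of_real (n powr (expo_pred m))) = of_real (moment m)"
proof -
  have "integrable_Ioi (\<lambda>n. cut_h (1 * of_real n) * of_real (n powr (expo_pred m)))"
    by (rule cut_h_times_integrable[where p = "expo_pred m" and C = 1])
      (use assms in \<open>auto intro!: continuous_intros continuous_on_powr_pos\<close>)
  thus i: "integrable_Ioi (\<lambda>n. cut_h (of_real n) * of_real (n powr (expo_pred m)))" by simp
  have e: "cut_h (of_real n) * of_real (n powr (expo_pred m)) = of_real (cut_hr n * n powr (expo_pred m))" for n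
    by (simp add: cut_h_of_real)
  show "(LBINT n:{0<..}. cut_h (of_real n) * of_real (n powr (expo_pred m))) = of_real (moment m)"
    unfolding e moment_def by (rule set_integral_complex_of_real)
  have "integrable_Ioi (\<lambda>n. Re (of_real (cut_hr n * n powr (expo_pred m))))"
    using i unfolding e set_integrable_def by (drule_tac integrable_Re) simp
  thus "integrable_Ioi (\<lambda>n. cut_hr n * n powr (expo_pred m))" by simp
qed

lemma moment_pos: "0 < moment m" if "m \<ge> 1"
  unfolding moment_def by (rule set_integral_pos[OF moment_integrable(1)[OF that]]) (simp add: cut_hr_pos)

lemma geometric_remainder:
  fixes u X :: "'a::field"
  assumes "X \<noteq> 0" "u + X \<noteq> 0"
  shows "1 / (u + X) = (\<Sum>j<k. (-1) ^ j * u ^ j / X ^ Suc j) + (-1) ^ k * u ^ k / (X ^ k * (u + X))"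
proof (induction k)
  case (Suc k)
  have "(-1) ^ k * u ^ k / (X ^ k * (u + X)) = (-1) ^ k * u ^ k / X ^ Suc k + (-1) ^ Suc k * u ^ Suc k / (X ^ Suc k * (u + X))"
    using assms by (simp add: divide_simps) (simp add: algebra_simps)
  thus ?case using Suc by simp
qed simp

text \<open>For positive u and X the geometric series of 1 / (u + X) has a remainder of modulus at
  most u^k / X^(k + 1), so the error is at most the first omitted moment.\<close>

lemma disp_integral_expansion:
  assumes \<nu>: "\<nu> > 0"
  shows "cmod (disp_integral (of_real (ln \<nu>)) - (\<Sum>j<k. of_real ((-1) ^ j * moment (Suc j) / (3 * pi)) / of_real (\<nu> powr (2/3)) ^ Suc j))
     \<le> moment (Suc k) / (3 * pi) / (\<nu> powr (2/3)) ^ Suc k"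
proof -
  define X where "X = \<nu> powr (2/3)"
  have X: "X > 0" using \<nu> by (simp add: X_def)
  define f where "f m n = cut_h (of_real n) * complex_of_real (n powr (expo_pred m))" for m n
  define g where "g n = cut_h (of_real n) * (of_real (n powr (1/3)) / (of_real (n powr (2/3)) + cbrt2 (of_real (ln \<nu>))))" for n
  have fi: "integrable_Ioi (f (Suc j))" "(LBINT n:{0<..}. f (Suc j) n) = of_real (moment (Suc j))" for j
    unfolding f_def by (rule moment_integrable(2,3), simp)+
  have gi: "integrable_Ioi g" unfolding g_def by (rule disp_integrand) simp
  have fp: "f (Suc j) n = cut_h (of_real n) * of_real (n powr (1/3) * (n powr (2/3)) ^ j)" if "n > 0" for j n
  proof -
    have "n powr ((2 * real (Suc j) - 1) / 3) = n powr (1/3) * n powr (2/3 * real j)"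
      unfolding powr_add[symmetric] by (intro arg_cong[where f = "\<lambda>p. n powr p"]) (simp add: field_simps)
    also have "n powr (2/3 * real j) = (n powr (2/3)) powr real j" by (simp add: powr_powr)
    also have "\<dots> = (n powr (2/3)) ^ j" using that by (simp add: powr_realpow)
    finally show ?thesis unfolding f_def by (simp only:)
  qed
  have pt: "cmod (g n - (\<Sum>j<k. of_real ((-1) ^ j / X ^ Suc j) * f (Suc j) n)) \<le> cut_hr n * n powr ((2 * real (Suc k) - 1) / 3) / X ^ Suc k"
    if n: "n > 0" for n
  proof -
    define u where "u = n powr (2/3)"
    have u: "u > 0" using n by (simp add: u_def)
    have g: "g n = cut_h (of_real n) * of_real (n powr (1/3) * (1 / (u + X)))"
      unfolding g_def cbrt2_ln[OF \<nu>] u_def X_def by (simp only: of_real_mult of_real_divide of_real_add of_real_1 times_divide_eq_right mult_1_right)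
    have "g n - (\<Sum>j<k. of_real ((-1) ^ j / X ^ Suc j) * f (Suc j) n)
      = cut_h (of_real n) * of_real (n powr (1/3) * (1 / (u + X)) - (\<Sum>j<k. (-1) ^ j / X ^ Suc j * (n powr (1/3) * u ^ j)))"
      unfolding g fp[OF n] u_def[symmetric] of_real_diff of_real_sum right_diff_distrib sum_distrib_left
      by (intro arg_cong2[where f = minus] refl sum.cong) (simp only: of_real_mult mult_ac)
    also have "n powr (1/3) * (1 / (u + X)) - (\<Sum>j<k. (-1) ^ j / X ^ Suc j * (n powr (1/3) * u ^ j))
       = n powr (1/3) * ((-1) ^ k * u ^ k / (X ^ k * (u + X)))"
    proof -
      have "(\<Sum>j<k. (-1) ^ j / X ^ Suc j * (n powr (1/3) * u ^ j)) = n powr (1/3) * (\<Sum>j<k. (-1) ^ j * u ^ j / X ^ Suc j)"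
        unfolding sum_distrib_left by (intro sum.cong refl) (simp only: times_divide_eq_left times_divide_eq_right mult_ac)
      thus ?thesis
        using geometric_remainder[of X u k] X u by (simp add: right_diff_distrib[symmetric] del: power_Suc)
    qed
    also have "cmod (cut_h (of_real n) * of_real (n powr (1/3) * ((-1) ^ k * u ^ k / (X ^ k * (u + X))))) =
       cut_hr n * (n powr (1/3) * u ^ k / (X ^ k * (u + X)))"
      using cut_hr_pos[OF n] u X unfolding norm_mult norm_of_real cut_h_of_real by (simp add: abs_mult power_abs)
    also have "\<dots> \<le> cut_hr n * (n powr (1/3) * u ^ k / (X ^ k * X))"
      using cut_hr_pos[OF n] u X by (intro mult_left_mono divide_left_mono) (auto intro!: mult_pos_pos mult_left_mono add_pos_pos)
    also have "n powr (1/3) * u ^ k = n powr ((2 * real (Suc k) - 1) / 3)"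
    proof -
      have "u ^ k = n powr (2/3 * real k)" using n by (simp add: u_def powr_realpow[symmetric] powr_powr)
      hence "n powr (1/3) * u ^ k = n powr (1/3 + 2/3 * real k)" by (simp only: powr_add)
      also have "1/3 + 2/3 * real k = (2 * real (Suc k) - 1) / 3" by (simp add: field_simps)
      finally show ?thesis .
    qed
    finally show ?thesis by (simp add: mult.commute)
  qed
  have si: "integrable_Ioi (\<lambda>n. \<Sum>j<k. of_real ((-1) ^ j / X ^ Suc j) * f (Suc j) n)"
    by (rule set_integral_finite_sum(1)) (rule set_integrable_mult_right, rule fi)
  have sv: "(LBINT n:{0<..}. (\<Sum>j<k. of_real ((-1) ^ j / X ^ Suc j) * f (Suc j) n)) = (\<Sum>j<k. of_real ((-1) ^ j / X ^ Suc j) * of_real (moment (Suc j)))"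
  proof -
    have "(LBINT n:{0<..}. (\<Sum>j<k. of_real ((-1) ^ j / X ^ Suc j) * f (Suc j) n)) = (\<Sum>j<k. LBINT n:{0<..}. of_real ((-1) ^ j / X ^ Suc j) * f (Suc j) n)"
      by (rule set_integral_finite_sum(2)) (rule set_integrable_mult_right, rule fi)
    thus ?thesis unfolding set_integral_mult_right fi(2) .
  qed
  have "cmod ((LBINT n:{0<..}. g n) - (\<Sum>j<k. of_real ((-1) ^ j / X ^ Suc j) * of_real (moment (Suc j)))) =
     cmod (LBINT n:{0<..}. g n - (\<Sum>j<k. of_real ((-1) ^ j / X ^ Suc j) * f (Suc j) n))"
    unfolding set_integral_diff(2)[OF gi si] sv ..
  also have "\<dots> \<le> (LBINT n:{0<..}. cmod (g n - (\<Sum>j<k. of_real ((-1) ^ j / X ^ Suc j) * f (Suc j) n)))"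
    by (rule set_integral_norm_bound[OF set_integral_diff(1)[OF gi si]])
  also have "\<dots> \<le> (LBINT n:{0<..}. cut_hr n * n powr ((2 * real (Suc k) - 1) / 3) / X ^ Suc k)"
    by (rule set_integral_mono[OF set_integrable_norm[OF set_integral_diff(1)[OF gi si]]])
      (use moment_integrable(1)[of "Suc k"] pt in \<open>auto intro!: set_integrable_divide simp del: power_Suc of_nat_Suc\<close>)
  also have "\<dots> = moment (Suc k) / X ^ Suc k" unfolding moment_def by (rule set_integral_divide_zero)
  finally have main: "cmod ((LBINT n:{0<..}. g n) - (\<Sum>j<k. of_real ((-1) ^ j / X ^ Suc j) * of_real (moment (Suc j)))) \<le> moment (Suc k) / X ^ Suc k" .
  have "disp_integral (of_real (ln \<nu>)) - (\<Sum>j<k. of_real ((-1) ^ j * moment (Suc j) / (3 * pi)) / of_real X ^ Suc j)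
    = of_real (1 / (3 * pi)) * ((LBINT n:{0<..}. g n) - (\<Sum>j<k. of_real ((-1) ^ j / X ^ Suc j) * of_real (moment (Suc j))))"
    unfolding right_diff_distrib disp_integral_def g_def sum_distrib_left
    by (intro arg_cong2[where f = minus] sum.cong refl) (simp_all add: field_simps)
  hence "cmod (disp_integral (of_real (ln \<nu>)) - (\<Sum>j<k. of_real ((-1) ^ j * moment (Suc j) / (3 * pi)) / of_real X ^ Suc j))
    \<le> 1 / (3 * pi) * (moment (Suc k) / X ^ Suc k)"
    using main by (simp only: norm_mult norm_of_real) (intro mult_mono, auto)
  thus ?thesis unfolding X_def by (simp add: field_simps)
qed

definition disp_coeff :: "nat \<Rightarrow> real" where
  "disp_coeff m = (if m = 0 then watson_coeff 0 else (-1) ^ (m - 1) * moment m / (3 * pi))"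

text \<open>Multiplied by X = \<nu>^(2/3), both expansions are polynomials in y = 1 / X up to a
  multiple of y^M, so their coefficients agree. As a consequence the D_(2m+1)(0) are real and
  alternate in sign from m = 1 on.\<close>

lemma D0_watson_eq: "D0 (2 * m + 1) * of_real (watson_coeff m) = of_real (disp_coeff m)"
proof -
  define M where "M = Suc m"
  obtain K where K: "\<And>\<nu>. \<nu> > 0 \<Longrightarrow> cmod (saddle_int (of_real (ln \<nu>)) -
     (\<Sum>m<M. D0 (2 * m + 1) * of_real (watson_coeff m) / of_real (\<nu> powr (expo m)))) \<le> K / \<nu> powr (expo M)"
    using saddle_int_watson[of M] by (auto simp: M_def)
  have "cmod (\<Sum>i<M. (D0 (2 * i + 1) * of_real (watson_coeff i) - of_real (disp_coeff i)) * of_real y ^ i) \<le> (K + moment M / (3 * pi)) * y ^ M"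
    if y: "y > 0" for y :: real
  proof -
    define X where "X = 1 / y"
    define \<nu> where "\<nu> = X powr (3/2)"
    have X: "X > 0" and \<nu>: "\<nu> > 0" using y by (auto simp: X_def \<nu>_def)
    have X\<nu>: "\<nu> powr (2/3) = X" using X by (simp add: \<nu>_def powr_powr)
    have pw: "\<nu> powr (expo i) = X ^ Suc i" for i
    proof -
      have "\<nu> powr (expo i) = (\<nu> powr (2/3)) powr real (Suc i)"
        unfolding powr_powr by (intro arg_cong[where f = "\<lambda>p. \<nu> powr p"]) (simp add: field_simps)
      thus ?thesis unfolding X\<nu> powr_realpow[OF X] .
    qed
    have yX: "y = 1 / X" by (simp add: X_def)
    define P where "P = saddle_int (of_real (ln \<nu>))"
    have 1: "cmod (P * of_real X - (\<Sum>i<M. D0 (2 * i + 1) * of_real (watson_coeff i) * of_real y ^ i)) \<le> K * y ^ M"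
    proof -
      have "P * of_real X - (\<Sum>i<M. D0 (2 * i + 1) * of_real (watson_coeff i) * of_real y ^ i)
        = (P - (\<Sum>i<M. D0 (2 * i + 1) * of_real (watson_coeff i) / of_real (X ^ Suc i))) * of_real X"
        unfolding left_diff_distrib sum_distrib_right yX using X
        by (intro arg_cong2[where f = minus] sum.cong refl) (simp add: power_one_over field_simps)
      also have "cmod \<dots> \<le> (K / X ^ Suc M) * X"
      proof -
        have "cmod (complex_of_real X) = X" using X by simp
        thus ?thesis
          using K[OF \<nu>] X unfolding pw P_def[symmetric] norm_mult by (simp only:) (rule mult_right_mono, simp_all)
      qed
      also have "\<dots> = K * y ^ M" using X by (simp add: yX power_one_over)
      finally show ?thesis .
    qed
    have 2: "cmod (P * of_real X - (\<Sum>i<M. of_real (disp_coeff i) * of_real y ^ i)) \<le> moment M / (3 * pi) * y ^ M"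
    proof -
      have "P * of_real X = of_real (watson_coeff 0) + disp_integral (of_real (ln \<nu>))"
        using saddle_int_dispersion[of "of_real (ln \<nu>)"] unfolding cbrt2_ln[OF \<nu>] X\<nu> P_def by simp
      moreover have "(\<Sum>i<M. of_real (disp_coeff i) * of_real y ^ i) = complex_of_real (watson_coeff 0) +
          (\<Sum>j<m. of_real ((-1) ^ j * moment (Suc j) / (3 * pi)) / of_real X ^ Suc j)"
        unfolding M_def sum.lessThan_Suc_shift
        by (intro arg_cong2[where f = plus] sum.cong refl) (simp_all add: disp_coeff_def yX power_one_over)
      ultimately have "cmod (P * of_real X - (\<Sum>i<M. of_real (disp_coeff i) * of_real y ^ i)) \<le> moment (Suc m) / (3 * pi) / X ^ Suc m"
        using disp_integral_expansion[OF \<nu>, of m] unfolding X\<nu> by simp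
      also have "\<dots> = moment M / (3 * pi) * y ^ M" by (simp add: M_def yX power_one_over)
      finally show ?thesis .
    qed
    have "(\<Sum>i<M. (D0 (2 * i + 1) * of_real (watson_coeff i) - of_real (disp_coeff i)) * of_real y ^ i)
       = (P * of_real X - (\<Sum>i<M. of_real (disp_coeff i) * of_real y ^ i)) - (P * of_real X - (\<Sum>i<M. D0 (2 * i + 1) * of_real (watson_coeff i) * of_real y ^ i))"
      by (simp add: left_diff_distrib sum_subtractf)
    also have "cmod \<dots> \<le> moment M / (3 * pi) * y ^ M + K * y ^ M"
      by (rule order_trans[OF norm_triangle_ineq4 add_mono[OF 2 1]])
    finally show ?thesis by (simp add: algebra_simps)
  qed
  hence "D0 (2 * m + 1) * of_real (watson_coeff m) - of_real (disp_coeff m) = 0"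
    by (rule asymptotic_coeffs_unique[where M = M and m = m and c = "\<lambda>i. D0 (2 * i + 1) * of_real (watson_coeff i) - of_real (disp_coeff i)"])
      (simp_all add: M_def)
  thus ?thesis by simp
qed

text \<open>\<open>d_coeff\<close> lacks the factor 1 / 3 of \<open>watson_coeff\<close>; this
  cancels the 3 in the denominator of \<open>disp_coeff\<close>.\<close>

lemma d_coeff_eq:
  assumes "m \<ge> 1"
  shows "d_coeff m \<nu> = moment m / pi / cmod \<nu> powr (expo m)"
proof -
  define s where "s = expo m"
  have "Gamma s > 0" by (rule Gamma_real_pos) (simp add: s_def)
  hence w: "watson_coeff m > 0" unfolding watson_coeff_def s_def[symmetric] by simp
  have "cmod (D0 (2 * m + 1)) * watson_coeff m = \<bar>disp_coeff m\<bar>"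
    using arg_cong[OF D0_watson_eq[of m], of cmod] w unfolding norm_mult norm_of_real by simp
  also have "\<dots> = moment m / (3 * pi)"
    using assms moment_pos[OF assms] by (simp add: disp_coeff_def abs_mult power_abs)
  finally have "3 * (cmod (D0 (2 * m + 1)) * watson_coeff m) = moment m / pi" by simp
  hence "6 powr s * cmod (D0 (2 * m + 1)) * Gamma s = moment m / pi"
    unfolding watson_coeff_def s_def[symmetric] by (simp add: mult_ac)
  thus ?thesis unfolding d_coeff_def s_def[symmetric] by simp
qed

subsection \<open>Integral representations of Bessel functions\<close>

definition loop_int :: "complex \<Rightarrow> complex \<Rightarrow> complex" where
  "loop_int s R = (LBINT \<phi>:{-pi..pi}. exp (R * cis \<phi> + \<i> * of_real \<phi> * (1 - s)))"

abbreviation loop_exp :: "complex \<Rightarrow> complex \<Rightarrow> real \<Rightarrow> complex" where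
  "loop_exp s R t \<equiv> exp (- (R * of_real (exp t)) + (1 - s) * of_real t)"

definition tail_int :: "complex \<Rightarrow> complex \<Rightarrow> complex" where
  "tail_int s R = (LBINT t:{0..}. loop_exp s R t)"

lemma linear_minus_exp_le: "a * t - c * exp t \<le> a\<^sup>2 / c" if "c > 0" "t \<ge> 0" for a c t :: real
proof -
  have "t\<^sup>2 / 2 \<le> exp t" using exp_lower_Taylor_quadratic[OF that(2)] that(2) by simp
  hence "c * (t\<^sup>2 / 2) \<le> c * exp t" using that by (intro mult_left_mono) auto
  moreover have "a * t - c * (t\<^sup>2 / 2) \<le> a\<^sup>2 / c"
  proof -
    have "0 \<le> (a - c * t)\<^sup>2 + a\<^sup>2" by simp
    hence "2 * a * (c * t) - (c * t)\<^sup>2 \<le> 2 * a\<^sup>2" by (simp add: power2_eq_square algebra_simps)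
    hence "(2 * a * (c * t) - (c * t)\<^sup>2) / (2 * c) \<le> 2 * a\<^sup>2 / (2 * c)" using that by (intro divide_right_mono) auto
    moreover have "(2 * a * (c * t) - (c * t)\<^sup>2) / (2 * c) = a * t - c * (t\<^sup>2 / 2)"
      using that by (simp add: power2_eq_square field_simps)
    ultimately show ?thesis using that by simp
  qed
  ultimately show ?thesis by linarith
qed

lemma tail_bound:
  assumes "Re R \<ge> c" "c > 0" "t \<ge> 0" "Re s \<ge> - a" 
  shows "cmod (loop_exp s R t) \<le> exp ((a + 2)\<^sup>2 / c) * exp (- t)"
proof -
  have "c * exp t \<le> Re R * exp t" using assms by (intro mult_right_mono) auto
  moreover have "(1 - Re s) * t \<le> (1 + a) * t" using assms by (intro mult_right_mono) auto
  moreover have "(a + 2) * t - c * exp t \<le> (a + 2)\<^sup>2 / c" by (rule linear_minus_exp_le) (use assms in auto)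
  moreover have "(a + 2) * t = (1 + a) * t + t" by (simp add: algebra_simps)
  ultimately have "- (Re R * exp t) + (1 - Re s) * t \<le> (a + 2)\<^sup>2 / c + (- t)" by linarith
  thus ?thesis by (simp flip: exp_add)
qed

lemma tail_int_integrable:
  assumes "Re R > 0"
  shows "set_integrable lborel {0..} (\<lambda>t. loop_exp s R t)"
proof (rule set_integrable_continuous_bound)
  show "set_integrable lborel {0..} (\<lambda>t. exp ((\<bar>Re s\<bar> + 2)\<^sup>2 / Re R) * exp (- t))"
    using set_integrable_exp_neg[of 1 0] by (intro set_integrable_mult_right) auto
  show "cmod (loop_exp s R t) \<le> exp ((\<bar>Re s\<bar> + 2)\<^sup>2 / Re R) * exp (- t)" if "0 \<le> t" for t
    by (rule tail_bound) (use assms that in auto)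
qed (auto intro!: continuous_intros)

lemma set_integral_Icc_FTC:
  fixes F f :: "real \<Rightarrow> complex"
  assumes "a \<le> b" "\<And>x. (F has_vector_derivative f x) (at x)" "continuous_on UNIV f"
  shows "set_integrable lborel {a..b} f" "(LBINT x:{a..b}. f x) = F b - F a"
proof -
  show i: "set_integrable lborel {a..b} f"
    using assms(3) by (intro borel_integrable_compact[unfolded set_integrable_def[symmetric]] continuous_on_subset[OF assms(3)]
      borel_integrable_atLeastAtMost') auto
  have "(f has_integral (F b - F a)) {a..b}"
    using assms(1,2) has_vector_derivative_at_within by (intro fundamental_theorem_of_calculus) blast+
  thus "(LBINT x:{a..b}. f x) = F b - F a"
    using set_borel_integral_eq_integral(2)[OF i] by (simp add: integral_unique)
qed

lemma set_integrable_Icc_continuous: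
  fixes f :: "real \<Rightarrow> complex"
  shows "continuous_on UNIV f \<Longrightarrow> set_integrable lborel {a..b} f"
  by (rule borel_integrable_atLeastAtMost') (rule continuous_on_subset, auto)

text \<open>The derivative of exp (R e^(i \<phi>) - i \<phi> s) is integrated over the circle. The
  boundary term comes from the cut along the negative axis; in \<open>hankel_int_deriv\<close> it
  cancels against the one of \<open>tail_int_recursion\<close>.\<close>

lemma loop_int_recursion: "R * loop_int s R - s * loop_int (s + 1) R = - 2 * sin (of_real pi * s) * exp (- R)"
proof -
  define F where "F \<phi> = exp (R * cis \<phi> - \<i> * of_real \<phi> * s)" for \<phi> :: real
  define f where "f \<phi> = (\<i> * R * cis \<phi> - \<i> * s) * F \<phi>" for \<phi> :: real
  have cis_d: "(cis has_vector_derivative \<i> * cis \<phi>) (at \<phi>)" for \<phi>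
    unfolding cis_conv_exp[abs_def]
    by (rule has_vector_derivative_eq_rhs, rule field_vector_diff_chain_at[where g = exp and f = "\<lambda>x. \<i> * complex_of_real x", unfolded o_def])
      (auto intro!: derivative_eq_intros DERIV_exp simp: )
  have d: "(F has_vector_derivative f \<phi>) (at \<phi>)" for \<phi>
  proof -
    have "((\<lambda>\<phi>. R * cis \<phi> - \<i> * of_real \<phi> * s) has_vector_derivative (R * (\<i> * cis \<phi>) - \<i> * 1 * s)) (at \<phi>)"
      by (intro derivative_intros has_vector_derivative_mult_right has_vector_derivative_mult_left cis_d)
        (auto intro!: derivative_eq_intros)
    from field_vector_diff_chain_at[OF this DERIV_exp] show ?thesis
      unfolding F_def[abs_def] f_def o_def by (simp add: algebra_simps)
  qed
  have c: "continuous_on UNIV (\<lambda>\<phi>. exp (R * cis \<phi> + \<i> * of_real \<phi> * (1 - s)))" for s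
    by (intro continuous_intros)
  have "continuous_on UNIV f" unfolding f_def[abs_def] F_def by (intro continuous_intros)
  hence 1: "(LBINT \<phi>:{-pi..pi}. f \<phi>) = F pi - F (- pi)"
    by (intro set_integral_Icc_FTC(2) d) auto
  have e: "f \<phi> = \<i> * R * exp (R * cis \<phi> + \<i> * of_real \<phi> * (1 - s)) - \<i> * s * exp (R * cis \<phi> + \<i> * of_real \<phi> * (1 - (s + 1)))" for \<phi>
  proof -
    have "cis \<phi> * F \<phi> = exp (R * cis \<phi> + \<i> * of_real \<phi> * (1 - s))"
      unfolding F_def cis_conv_exp exp_add[symmetric] by (simp add: algebra_simps)
    moreover have "F \<phi> = exp (R * cis \<phi> + \<i> * of_real \<phi> * (1 - (s + 1)))" by (simp add: F_def)
    moreover have "f \<phi> = \<i> * R * (cis \<phi> * F \<phi>) - \<i> * s * F \<phi>" by (simp add: f_def algebra_simps)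
    ultimately show ?thesis by (simp only:)
  qed
  have i: "set_integrable lborel {-pi..pi} (\<lambda>\<phi>. k * exp (R * cis \<phi> + \<i> * of_real \<phi> * (1 - s)))" for k s
    by (intro set_integrable_mult_right set_integrable_Icc_continuous c)
  have "(LBINT \<phi>:{-pi..pi}. f \<phi>) = \<i> * R * loop_int s R - \<i> * s * loop_int (s + 1) R"
    unfolding e loop_int_def set_integral_diff(2)[OF i i] set_integral_mult_right ..
  moreover have "F pi - F (- pi) = exp (- R) * (exp (- (\<i> * (of_real pi * s))) - exp (\<i> * (of_real pi * s)))"
  proof -
    have "cis (- pi) = - 1" by (simp add: complex_eq_iff)
    thus ?thesis
      by (simp add: F_def exp_diff exp_add exp_minus right_diff_distrib divide_inverse mult_ac)
  qed
  moreover have "exp (- (\<i> * (of_real pi * s))) - exp (\<i> * (of_real pi * s)) = \<i> * (- 2 * sin (of_real pi * s))"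
    by (simp add: sin_exp_eq field_simps)
  ultimately have "\<i> * R * loop_int s R - \<i> * s * loop_int (s + 1) R = exp (- R) * (\<i> * (- 2 * sin (of_real pi * s)))"
    using 1 by (simp only:)
  hence "\<i> * (R * loop_int s R - s * loop_int (s + 1) R) = \<i> * (- 2 * sin (of_real pi * s) * exp (- R))"
    by (simp add: algebra_simps)
  thus ?thesis by (simp only: mult_cancel_left) simp
qed

lemma tail_int_recursion:
  assumes R: "Re R > 0"
  shows "R * tail_int s R + s * tail_int (s + 1) R = exp (- R)"
proof -
  define F where "F t = exp (- (R * of_real (exp t)) - s * of_real t)" for t :: real
  define f where "f t = - (R * loop_exp s R t + s * loop_exp (s + 1) R t)" for t :: real
  have d: "(F has_vector_derivative f t) (at t)" for t
  proof -
    have "((\<lambda>t. - (R * of_real (exp t)) - s * of_real t) has_vector_derivative (- (R * of_real (exp t)) - s * 1)) (at t)"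
      by (auto intro!: derivative_eq_intros has_vector_derivative_of_real simp: has_real_derivative_iff_has_vector_derivative[symmetric])
    from field_vector_diff_chain_at[OF this DERIV_exp]
    have "(F has_vector_derivative (- (R * of_real (exp t)) - s * 1) * exp (- (R * of_real (exp t)) - s * of_real t)) (at t)"
      unfolding F_def[abs_def] o_def .
    moreover have "of_real (exp t) * exp (- (R * of_real (exp t)) - s * of_real t) = loop_exp s R t"
      unfolding exp_of_real[symmetric] exp_add[symmetric] by (simp add: algebra_simps)
    hence "(- (R * of_real (exp t)) - s * 1) * exp (- (R * of_real (exp t)) - s * of_real t) = f t"
      unfolding f_def by (simp add: left_diff_distrib mult.assoc del: of_real_exp)
    ultimately show ?thesis by simp
  qed
  have fi: "set_integrable lborel {0..} f"
  proof -
    have "set_integrable lborel {0..} (\<lambda>t. - 1 * (R * loop_exp s R t + s * loop_exp (s + 1) R t))"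
      using tail_int_integrable[OF R] by (intro set_integral_add set_integrable_mult_right)
    thus ?thesis unfolding f_def by (simp only: mult_minus1)
  qed
  have "(F \<longlongrightarrow> F 0 + (LBINT t:{0..}. f t)) at_top"
    by (rule set_integral_FTC_at_top[OF _ d fi]) (auto simp: F_def intro!: continuous_intros)
  moreover have "(F \<longlongrightarrow> 0) at_top"
  proof (rule Lim_null_comparison)
    show "\<forall>\<^sub>F t in at_top. cmod (F t) \<le> exp ((\<bar>Re (s + 1)\<bar> + 2)\<^sup>2 / Re R) * exp (- t)"
      using eventually_ge_at_top[of 0]
    proof eventually_elim
      case (elim t)
      have "F t = loop_exp (s + 1) R t" by (simp add: F_def)
      thus ?case using tail_bound[of "Re R" R t "\<bar>Re (s + 1)\<bar>" "s + 1"] R elim by simp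
    qed
    show "((\<lambda>t. exp ((\<bar>Re (s + 1)\<bar> + 2)\<^sup>2 / Re R) * exp (- t)) \<longlongrightarrow> 0) at_top" by real_asymp
  qed
  ultimately have "F 0 + (LBINT t:{0..}. f t) = 0"
    using tendsto_unique trivial_limit_at_top_linorder by blast
  moreover have "(LBINT t:{0..}. f t) = - (R * tail_int s R + s * tail_int (s + 1) R)"
  proof -
    have "(LBINT t:{0..}. f t) = - (LBINT t:{0..}. R * loop_exp s R t + s * loop_exp (s + 1) R t)"
    proof -
      have "(LBINT t:{0..}. f t) = (LBINT t:{0..}. - 1 * (R * loop_exp s R t + s * loop_exp (s + 1) R t))"
        unfolding f_def by (simp only: mult_minus1)
      thus ?thesis unfolding set_integral_mult_right by (simp only: mult_minus1)
    qed
    also have "(LBINT t:{0..}. R * loop_exp s R t + s * loop_exp (s + 1) R t)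
      = R * tail_int s R + s * tail_int (s + 1) R"
    proof -
      have i: "set_integrable lborel {0..} (\<lambda>t. k * loop_exp s R t)" for k s
        using tail_int_integrable[OF R] by (intro set_integrable_mult_right)
      show ?thesis unfolding tail_int_def set_integral_add(2)[OF i i] set_integral_mult_right ..
    qed
    finally show ?thesis .
  qed
  ultimately have "F 0 - (R * tail_int s R + s * tail_int (s + 1) R) = 0" by (simp only: diff_conv_add_uminus)
  hence "F 0 = R * tail_int s R + s * tail_int (s + 1) R" by (simp only: right_minus_eq)
  moreover have "F 0 = exp (- R)" by (simp add: F_def)
  ultimately show ?thesis by (simp only:)
qed

lemma loop_int_deriv: "(loop_int s has_field_derivative loop_int (s - 1) R) (at R)"
proof -
  define f where "f R \<phi> = exp (R * cis \<phi> + \<i> * of_real \<phi> * (1 - s))" for R \<phi>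
  have fd: "((\<lambda>R. f R \<phi>) has_field_derivative cis \<phi> * f R \<phi>) (at R)" for R \<phi>
    unfolding f_def by (auto intro!: derivative_eq_intros)
  have e: "cis \<phi> * f R \<phi> = exp (R * cis \<phi> + \<i> * of_real \<phi> * (1 - (s - 1)))" for R \<phi>
    unfolding f_def cis_conv_exp exp_add[symmetric] by (simp add: algebra_simps)
  have "((\<lambda>R. \<integral>\<phi>. indicator {-pi..pi} \<phi> *\<^sub>R f R \<phi> \<partial>lborel) has_field_derivative
     (\<integral>\<phi>. deriv (\<lambda>R. indicator {-pi..pi} \<phi> *\<^sub>R f R \<phi>) R \<partial>lborel)) (at R)"
  proof (rule param_integral_holomorphic)
    show "(\<lambda>R. indicat_real {-pi..pi} \<phi> *\<^sub>R f R \<phi>) holomorphic_on ball R 1" for \<phi>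
      unfolding scaleR_conv_of_real f_def by (intro holomorphic_intros)
    show "(\<lambda>\<phi>. indicat_real {-pi..pi} \<phi> *\<^sub>R f R' \<phi>) \<in> borel_measurable lborel" for R'
      using set_integrable_Icc_continuous[of "f R'" "-pi" pi]
      by (simp add: set_integrable_def f_def[abs_def] continuous_intros)
    show "integrable lborel (\<lambda>\<phi>. indicator {-pi..pi} \<phi> *\<^sub>R exp (cmod R + 1 + pi * \<bar>Im s\<bar>))" by simp
    show "cmod (indicator {-pi..pi} \<phi> *\<^sub>R f R' \<phi>) \<le> indicator {-pi..pi} \<phi> *\<^sub>R exp (cmod R + 1 + pi * \<bar>Im s\<bar>)"
      if "R' \<in> ball R 1" for R' \<phi>
    proof (cases "\<phi> \<in> {-pi..pi}")
      case True
      have "cmod R' \<le> cmod R + 1" using that norm_triangle_sub[of R' R] by (simp add: dist_norm norm_minus_commute)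
      hence "Re (R' * cis \<phi>) \<le> cmod R + 1"
        using complex_Re_le_cmod[of "R' * cis \<phi>"] by (simp add: norm_mult)
      moreover have "\<phi> * Im s \<le> pi * \<bar>Im s\<bar>"
      proof -
        have "\<phi> * Im s \<le> \<bar>\<phi>\<bar> * \<bar>Im s\<bar>" by (metis abs_ge_self abs_mult)
        also have "\<dots> \<le> pi * \<bar>Im s\<bar>" using True by (intro mult_right_mono) auto
        finally show ?thesis .
      qed
      moreover have "Re (R' * cis \<phi> + \<i> * of_real \<phi> * (1 - s)) = Re (R' * cis \<phi>) + \<phi> * Im s" by simp
      ultimately have "Re (R' * cis \<phi> + \<i> * of_real \<phi> * (1 - s)) \<le> cmod R + 1 + pi * \<bar>Im s\<bar>" by linarith
      thus ?thesis using True by (simp add: f_def)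
    qed simp
  qed auto
  moreover have "deriv (\<lambda>R. indicator {-pi..pi} \<phi> *\<^sub>R f R \<phi>) R = indicator {-pi..pi} \<phi> *\<^sub>R (cis \<phi> * f R \<phi>)" for \<phi>
    by (intro DERIV_imp_deriv has_field_derivative_scaleR_right fd)
  ultimately show ?thesis unfolding loop_int_def[abs_def] set_lebesgue_integral_def f_def[symmetric] e[symmetric]
    by (simp only: f_def[symmetric] e[symmetric])
qed

lemma tail_int_deriv:
  assumes "Re R > 0"
  shows "(tail_int s has_field_derivative - tail_int (s - 1) R) (at R)"
proof -
  define f where "f R t = loop_exp s R t" for R and t :: real
  have fd: "((\<lambda>R. f R t) has_field_derivative - of_real (exp t) * f R t) (at R)" for R t
    unfolding f_def by (auto intro!: derivative_eq_intros)
  have e: "of_real (exp t) * f R t = loop_exp (s - 1) R t" for R t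
    unfolding f_def exp_of_real[symmetric] exp_add[symmetric] by (simp add: algebra_simps)
  define r where "r = Re R / 2"
  have r: "r > 0" using assms by (simp add: r_def)
  have re: "r \<le> Re w" if "w \<in> ball R r" for w
  proof -
    have "\<bar>Re (R - w)\<bar> \<le> cmod (R - w)" by (rule abs_Re_le_cmod)
    thus ?thesis using that by (simp add: dist_norm r_def)
  qed
  have "((\<lambda>R. \<integral>t. indicator {0..} t *\<^sub>R f R t \<partial>lborel) has_field_derivative
     (\<integral>t. deriv (\<lambda>R. indicator {0..} t *\<^sub>R f R t) R \<partial>lborel)) (at R)"
  proof (rule param_integral_holomorphic[OF _ _ r])
    show "(\<lambda>R. indicat_real {0..} t *\<^sub>R f R t) holomorphic_on ball R r" for t
      unfolding scaleR_conv_of_real f_def by (intro holomorphic_intros)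
    show "(\<lambda>t. indicat_real {0..} t *\<^sub>R f R' t) \<in> borel_measurable lborel" if "R' \<in> ball R r" for R'
      using tail_int_integrable[of R' s] re[OF that] r by (simp add: set_integrable_def f_def)
    show "integrable lborel (\<lambda>t. indicator {0..} t *\<^sub>R (exp ((\<bar>Re s\<bar> + 2)\<^sup>2 / r) * exp (- t)))"
      using set_integrable_exp_neg[of 1 0] unfolding set_integrable_def[symmetric]
      by (intro set_integrable_mult_right) auto
    show "cmod (indicator {0..} t *\<^sub>R f R' t) \<le> indicator {0..} t *\<^sub>R (exp ((\<bar>Re s\<bar> + 2)\<^sup>2 / r) * exp (- t))"
      if "R' \<in> ball R r" for R' t
      using tail_bound[of r R' t "\<bar>Re s\<bar>" s] re[OF that] r by (cases "t \<ge> 0") (auto simp: f_def)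
  qed
  moreover have "deriv (\<lambda>R. indicator {0..} t *\<^sub>R f R t) R = indicator {0..} t *\<^sub>R (- of_real (exp t) * f R t)" for t
    by (intro DERIV_imp_deriv has_field_derivative_scaleR_right fd)
  moreover have "(\<integral>t. indicator {0..} t *\<^sub>R (- of_real (exp t) * f R t) \<partial>lborel) = - tail_int (s - 1) R"
    unfolding tail_int_def set_lebesgue_integral_def e[symmetric] by simp
  ultimately show ?thesis unfolding tail_int_def[abs_def] set_lebesgue_integral_def f_def[symmetric] by simp
qed

text \<open>Hankel's contour scaled by R: \<open>loop_int\<close> is the circle, and the two sides
  of the cut combine into \<open>tail_int\<close> with the factor sin (pi s). R may be any point of
  the right half-plane, so that it can be z / 2 later on.\<close>

definition hankel_int :: "complex \<Rightarrow> complex \<Rightarrow> complex" where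
  "hankel_int s R = R powr (1 - s) * (loop_int s R / (2 * pi) + sin (of_real pi * s) / pi * tail_int s R)"

lemma sin_pi_minus_1: "sin (of_real pi * (s - 1)) = - sin (of_real pi * s :: complex)"
  by (simp add: right_diff_distrib sin_diff)

lemma mult_powr_minus_1: "z \<noteq> 0 \<Longrightarrow> z * z powr (a - 1) = z powr a" for z a :: complex
  using powr_add[of z "a - 1" 1] by (simp add: mult.commute)

text \<open>Differentiation in R lowers s by 1, and the recursions express R times the derivative of
  the bracket as s - 1 times the bracket. The power R^(1 - s) compensates this exactly, so the value
  does not depend on R and a limit of small R may be taken.\<close>

lemma hankel_int_deriv:
  assumes R: "Re R > 0"
  shows "(hankel_int s has_field_derivative 0) (at R)"
proof -
  have R0: "R \<noteq> 0" "R \<notin> \<real>\<^sub>\<le>\<^sub>0" using R by (auto simp: complex_nonpos_Reals_iff)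
  define G where "G = loop_int s R / (2 * pi) + sin (of_real pi * s) / pi * tail_int s R"
  define G' where "G' = loop_int (s - 1) R / (2 * pi) + sin (of_real pi * s) / pi * - tail_int (s - 1) R"
  have d: "(hankel_int s has_field_derivative ((1 - s) * R powr (1 - s - 1)) * G + G' * R powr (1 - s)) (at R)"
    unfolding hankel_int_def[abs_def] G_def G'_def
    by (intro DERIV_mult DERIV_add DERIV_cdivide DERIV_cmult loop_int_deriv tail_int_deriv R has_field_derivative_powr R0)
  have L: "R * loop_int (s - 1) R = (s - 1) * loop_int s R + 2 * sin (of_real pi * s) * exp (- R)"
    using loop_int_recursion[of R "s - 1"] unfolding sin_pi_minus_1 by (simp add: algebra_simps)
  have T: "R * tail_int (s - 1) R = exp (- R) - (s - 1) * tail_int s R"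
    using tail_int_recursion[OF R, of "s - 1"] by (simp add: algebra_simps)
  have "R * G' = (R * loop_int (s - 1) R) / (2 * pi) - sin (of_real pi * s) / pi * (R * tail_int (s - 1) R)"
    by (simp add: G'_def algebra_simps)
  also have "\<dots> = (s - 1) * G"
    unfolding L T G_def by (simp add: field_simps)
  finally have G': "R * G' = (s - 1) * G" .
  have "R powr (1 - s) = R powr ((1 - s - 1) + 1)" by simp
  also have "\<dots> = R powr (1 - s - 1) * R" using R0 by (simp only: powr_add powr_to_1)
  finally have "R powr (1 - s) = R powr (1 - s - 1) * R" .
  hence "((1 - s) * R powr (1 - s - 1)) * G + G' * R powr (1 - s) = R powr (1 - s - 1) * ((1 - s) * G + R * G')"
    by (simp add: algebra_simps)
  also have "\<dots> = 0" unfolding G' by (simp add: algebra_simps)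
  finally show ?thesis using d by simp
qed

lemma hankel_int_const:
  assumes "Re R > 0" "Re R' > 0"
  shows "hankel_int s R = hankel_int s R'"
proof -
  have "hankel_int s constant_on {z. Re z > 0}"
    using hankel_int_deriv has_field_derivative_at_within
    by (intro has_field_derivative_0_imp_constant_on) (auto intro: convex_connected convex_halfspace_Re_gt open_halfspace_Re_gt)
  thus ?thesis using assms by (auto simp: constant_on_def)
qed

lemma tail_int_real:
  assumes \<rho>: "\<rho> > 0" and s: "Re s < 1"
  shows "of_real \<rho> powr (1 - s) * tail_int s (of_real \<rho>) = integral {\<rho>..} (\<lambda>t. of_real t powr (1 - s - 1) / of_real (exp t))"
proof -
  define f where "f t = complex_of_real t powr (1 - s - 1) / of_real (exp t)" for t
  define g where "g t = \<rho> * exp t" for t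
  have img: "g ` {0..} = {\<rho>..}"
  proof (intro equalityI subsetI)
    fix y assume "y \<in> {\<rho>..}"
    hence y: "\<rho> \<le> y" by simp
    hence "y = g (ln (y / \<rho>))" "0 \<le> ln (y / \<rho>)" using \<rho> by (auto simp: g_def)
    thus "y \<in> g ` {0..}" by auto
  qed (use \<rho> in \<open>auto simp: g_def\<close>)
  have fa: "f absolutely_integrable_on g ` {0..}"
    unfolding img f_def
    by (rule set_integrable_subset[OF absolutely_integrable_Gamma_integral'])
      (use \<rho> s in \<open>auto simp: sets_completionI_sets\<close>)
  have eq: "\<bar>\<rho> * exp t\<bar> *\<^sub>R f (g t) = of_real \<rho> powr (1 - s) * exp (- (of_real \<rho> * of_real (exp t)) + (1 - s) * of_real t)" for t
  proof -
    have p: "of_real (g t) \<noteq> (0::complex)" using \<rho> by (simp add: g_def)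
    have "of_real (g t) * (of_real (g t) powr (1 - s - 1)) = (of_real (g t) powr (1 - s) :: complex)"
      by (rule mult_powr_minus_1[OF p])
    moreover have "of_real (g t) powr (1 - s) = of_real \<rho> powr (1 - s) * exp ((1 - s) * of_real t)"
    proof -
      have "Ln (of_real (g t)) = of_real (ln \<rho> + t)" using \<rho> by (simp add: g_def Ln_of_real ln_mult flip: of_real_mult of_real_exp)
      moreover have "Ln (of_real \<rho>) = of_real (ln \<rho>)" using \<rho> by (simp add: Ln_of_real)
      ultimately show ?thesis using p \<rho> by (simp add: powr_def exp_add[symmetric] algebra_simps)
    qed
    moreover have "\<bar>\<rho> * exp t\<bar> *\<^sub>R f (g t) = of_real (g t) * (of_real (g t) powr (1 - s - 1)) * inverse (of_real (exp (g t)))"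
      using \<rho> by (simp add: f_def g_def scaleR_conv_of_real divide_inverse abs_mult)
    moreover have "inverse (of_real (exp (g t))) = exp (- (complex_of_real \<rho> * of_real (exp t)))"
      by (simp add: g_def exp_minus flip: exp_of_real)
    ultimately show ?thesis unfolding exp_add by (simp only: mult_ac)
  qed
  have m: "set_borel_measurable borel {0..} (\<lambda>t. \<bar>\<rho> * exp t\<bar> *\<^sub>R f (g t))"
    unfolding eq set_borel_measurable_def
    by (rule borel_measurable_continuous_on_indicator) (auto intro!: continuous_intros)
  have inj: "inj_on g {0..}" using \<rho> by (auto simp: inj_on_def g_def)
  have "(LBINT t:{0..}. \<bar>\<rho> * exp t\<bar> *\<^sub>R f (g t)) = integral (g ` {0..}) f"
    by (rule set_integral_change_of_variables(2)[OF _ _ inj fa m])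
      (auto simp: g_def[abs_def] intro!: derivative_eq_intros)
  hence "of_real \<rho> powr (1 - s) * tail_int s (of_real \<rho>) = integral {\<rho>..} f"
    unfolding eq img tail_int_def by (simp only: set_integral_mult_right)
  thus ?thesis by (simp only: f_def[abs_def])
qed

text \<open>For Re s < 1 the circle of radius 1 / (k + 1) disappears in the limit because R^(1 - s)
  tends to 0, while the part along the cut tends to Gamma (1 - s). The reflection formula does the
  rest.\<close>

lemma hankel_int_base:
  assumes R: "Re R > 0" and s: "Re s < 1"
  shows "hankel_int s R = rGamma s"
proof -
  define f where "f t = complex_of_real t powr (1 - s - 1) / of_real (exp t)" for t
  define \<rho> where "\<rho> k = 1 / (real k + 1)" for k
  have \<rho>: "\<rho> k > 0" for k by (simp add: \<rho>_def)
  have fa: "set_integrable lebesgue {0<..} f"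
    unfolding f_def by (rule absolutely_integrable_Gamma_integral') (use s in simp)
  have \<rho>0: "\<rho> \<longlonglongrightarrow> 0" unfolding \<rho>_def[abs_def] by real_asymp
  have U: "(\<Union>k. {\<rho> k..}) = {0<..}"
  proof (intro equalityI subsetI)
    fix x :: real assume "x \<in> {0<..}"
    then obtain k where "\<rho> k < x" using order_tendstoD(2)[OF \<rho>0, of x] by (auto simp: eventually_sequentially)
    thus "x \<in> (\<Union>k. {\<rho> k..})" by (auto intro: less_imp_le)
  qed (use \<rho> in \<open>auto intro: order.strict_trans2\<close>)
  have "(\<lambda>k. LINT x:{\<rho> k..}|lebesgue. f x) \<longlonglongrightarrow> (LINT x:(\<Union>k. {\<rho> k..})|lebesgue. f x)"
  proof (rule set_integral_cont_up)
    show "incseq (\<lambda>k. {\<rho> k..})"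
      unfolding incseq_def
    proof (intro allI impI)
      fix i j :: nat assume "i \<le> j"
      hence "\<rho> j \<le> \<rho> i" unfolding \<rho>_def by (intro frac_le) auto
      thus "{\<rho> i..} \<subseteq> {\<rho> j..}" by simp
    qed
  qed (use fa in \<open>auto simp: U sets_completionI_sets\<close>)
  moreover have "(LINT x:{\<rho> k..}|lebesgue. f x) = integral {\<rho> k..} f" for k
  proof (rule set_lebesgue_integral_eq_integral)
    show "f absolutely_integrable_on {\<rho> k..}"
      by (rule set_integrable_subset[OF fa]) (use \<rho>[of k] in \<open>auto simp: sets_completionI_sets\<close>)
  qed
  moreover have "(LINT x:{0<..}|lebesgue. f x) = Gamma (1 - s)"
    using set_lebesgue_integral_eq_integral(2)[OF fa] Gamma_integral_complex'[of "1 - s"] s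
    by (simp add: f_def[abs_def] integral_unique)
  ultimately have "(\<lambda>k. integral {\<rho> k..} f) \<longlonglongrightarrow> Gamma (1 - s)" unfolding U by simp
  hence t: "(\<lambda>k. of_real (\<rho> k) powr (1 - s) * tail_int s (of_real (\<rho> k))) \<longlonglongrightarrow> Gamma (1 - s)"
    unfolding tail_int_real[OF \<rho> s] f_def .
  have p0: "(\<lambda>k. of_real (\<rho> k) powr (1 - s)) \<longlonglongrightarrow> 0"
  proof (rule Lim_null_comparison)
    show "\<forall>\<^sub>F k in sequentially. cmod (of_real (\<rho> k) powr (1 - s)) \<le> \<rho> k powr (1 - Re s)"
      using \<rho> by (simp add: norm_powr_real_powr less_imp_le)
    have "1 - Re s > 0" using s by simp
    thus "(\<lambda>k. \<rho> k powr (1 - Re s)) \<longlonglongrightarrow> 0" unfolding \<rho>_def by real_asymp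
  qed
  have "(\<lambda>k. loop_int s (of_real (\<rho> k))) \<longlonglongrightarrow> loop_int s (of_real 0)"
    by (rule isCont_tendsto_compose[OF DERIV_isCont[OF loop_int_deriv]]) (intro tendsto_intros \<rho>0)
  hence "(\<lambda>k. of_real (\<rho> k) powr (1 - s) * loop_int s (of_real (\<rho> k)) / (2 * pi) + sin (of_real pi * s) / pi * (of_real (\<rho> k) powr (1 - s) * tail_int s (of_real (\<rho> k))))
     \<longlonglongrightarrow> 0 * loop_int s (of_real 0) / (2 * pi) + sin (of_real pi * s) / pi * Gamma (1 - s)"
    by (intro tendsto_intros p0 t) auto
  moreover have "of_real (\<rho> k) powr (1 - s) * loop_int s (of_real (\<rho> k)) / (2 * pi) + sin (of_real pi * s) / pi * (of_real (\<rho> k) powr (1 - s) * tail_int s (of_real (\<rho> k))) = hankel_int s R" for k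
    using hankel_int_const[OF R, of "of_real (\<rho> k)" s] \<rho>[of k] by (simp add: hankel_int_def algebra_simps)
  ultimately have "hankel_int s R = sin (of_real pi * s) / pi * Gamma (1 - s)"
    using LIMSEQ_const_iff by force
  moreover have "1 - s \<notin> \<int>\<^sub>\<le>\<^sub>0"
  proof
    assume "1 - s \<in> \<int>\<^sub>\<le>\<^sub>0"
    then obtain n where n: "1 - s = of_int n" "n \<le> 0" by (auto elim!: nonpos_Ints_cases)
    have "Re (1 - s) = real_of_int n" by (subst n(1)) simp
    thus False using s n(2) by simp
  qed
  hence "rGamma s * rGamma (1 - s) * Gamma (1 - s) = rGamma s"
    by (simp add: rGamma_inverse_Gamma Gamma_eq_zero_iff)
  ultimately show ?thesis using rGamma_reflection_complex[of s] by simp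
qed

lemma hankel_int_recursion:
  assumes R: "Re R > 0"
  shows "hankel_int (s - 1) R = (s - 1) * hankel_int s R"
proof -
  have R0: "R \<noteq> 0" using R by auto
  have L: "R * loop_int (s - 1) R = (s - 1) * loop_int s R + 2 * sin (of_real pi * s) * exp (- R)"
    using loop_int_recursion[of R "s - 1"] unfolding sin_pi_minus_1 by (simp add: algebra_simps)
  have T: "R * tail_int (s - 1) R = exp (- R) - (s - 1) * tail_int s R"
    using tail_int_recursion[OF R, of "s - 1"] by (simp add: algebra_simps)
  have "R powr (1 - (s - 1)) = R powr ((1 - s) + 1)" by (simp add: algebra_simps)
  also have "\<dots> = R powr (1 - s) * R" using R0 by (simp only: powr_add powr_to_1)
  finally have e: "R powr (1 - (s - 1)) = R powr (1 - s) * R" .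
  have gen1: "(p * R) * (a / c + (- S) / d * b) = p * (R * a / c - S / d * (R * b))" for p R a b c d S :: complex
    by (simp add: algebra_simps)
  have gen2: "p * ((k * L + 2 * S * E) / c2 - S / c * (E - k * T)) = k * (p * (L / c2 + S / c * T))" if "c \<noteq> 0" "c2 = 2 * c"
    for p k L S E T c c2 :: complex
    using that by (simp add: field_simps)
  have "hankel_int (s - 1) R = R powr (1 - s) * (R * loop_int (s - 1) R / (2 * pi) - sin (of_real pi * s) / pi * (R * tail_int (s - 1) R))"
    unfolding hankel_int_def sin_pi_minus_1 e by (rule gen1)
  thus ?thesis unfolding L T unfolding hankel_int_def by (simp only:) (rule gen2, simp_all)
qed

text \<open>The recursion extends the half-plane Re s < 1 to the right one unit at a time. Each step
  divides by s - 1, which is nonzero for non-integer s.\<close>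

lemma hankel_int_eq_rGamma:
  assumes R: "Re R > 0" and s: "s \<notin> \<int>"
  shows "hankel_int s R = rGamma s"
proof -
  have "Re s < real n + 1 \<Longrightarrow> s \<notin> \<int> \<Longrightarrow> hankel_int s R = rGamma s" for n
  proof (induction n arbitrary: s)
    case 0
    thus ?case using hankel_int_base[OF R, of s] by simp
  next
    case (Suc n)
    have "s - 1 \<notin> \<int>" using Suc.prems(2) by (metis Ints_1 Ints_add diff_add_cancel)
    hence "hankel_int (s - 1) R = rGamma (s - 1)" using Suc by (intro Suc.IH) auto
    moreover have "rGamma (s - 1) = (s - 1) * rGamma s" using rGamma_plus1[of "s - 1"] by simp
    moreover have "s - 1 \<noteq> 0" using Suc.prems(2) by auto
    ultimately show ?case unfolding hankel_int_recursion[OF R] by simp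
  qed
  moreover obtain n where "Re s < real n" using reals_Archimedean2 by blast
  ultimately show ?thesis using s by (metis less_add_one order_less_trans)
qed

section \<open>Schlaefli's integrals for J and Y\<close>

lemma exp_series_integral:
  fixes g w :: "real \<Rightarrow> complex"
  assumes g: "set_integrable lborel A g" and A: "A \<in> sets borel"
    and w: "continuous_on UNIV w" and w1: "\<And>t. t \<in> A \<Longrightarrow> cmod (w t) \<le> 1"
  shows "(\<lambda>k. c ^ k / fact k * (LBINT t:A. g t * w t ^ k)) sums (LBINT t:A. g t * exp (c * w t))"
proof -
  define f where "f k t = indicator A t *\<^sub>R (c ^ k / fact k * (g t * w t ^ k))" for k t
  have gm: "(\<lambda>t. indicator A t *\<^sub>R g t) \<in> borel_measurable lborel"
    using g by (simp add: set_integrable_def)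
  have wm: "w \<in> borel_measurable lborel" using borel_measurable_continuous_onI[OF w] by simp
  have f_eq: "f k t = c ^ k / fact k * ((indicator A t *\<^sub>R g t) * w t ^ k)" for k t by (simp add: f_def)
  have nb: "cmod (f k t) \<le> cmod c ^ k / fact k * cmod (indicator A t *\<^sub>R g t)" for k t
  proof (cases "t \<in> A")
    case True
    have "cmod (w t) ^ k \<le> 1" using w1[OF True] by (simp add: power_le_one)
    hence "cmod (g t) * cmod (w t) ^ k \<le> cmod (g t)" by (simp add: mult_left_le)
    thus ?thesis using True by (simp add: f_def norm_mult norm_divide norm_power mult_left_mono divide_right_mono)
  qed (simp add: f_def)
  have fi: "integrable lborel (f k)" for k
  proof (rule Bochner_Integration.integrable_bound)
    show "integrable lborel (\<lambda>t. cmod c ^ k / fact k * cmod (indicator A t *\<^sub>R g t))"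
      by (rule integrable_mult_right[OF integrable_norm[OF g[unfolded set_integrable_def]]])
    show "f k \<in> borel_measurable lborel" unfolding f_eq[abs_def] using gm wm by measurable
  qed (use nb in \<open>auto intro!: AE_I2 order_trans[OF nb]\<close>)
  have sm: "summable (\<lambda>k. cmod c ^ k / fact k)"
    using summable_exp[of "cmod c"] by (simp add: field_simps)
  have "(\<lambda>k. integral\<^sup>L lborel (f k)) sums (\<integral>t. (\<Sum>k. f k t) \<partial>lborel)"
  proof (rule sums_integral[OF fi])
    show "AE t in lborel. summable (\<lambda>k. norm (f k t))"
    proof (rule AE_I2)
      fix t
      show "summable (\<lambda>k. norm (f k t))"
        by (rule summable_comparison_test'[OF summable_mult2[OF sm, of "cmod (indicator A t *\<^sub>R g t)"]])
          (use nb in auto)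
    qed
    show "summable (\<lambda>k. \<integral>t. norm (f k t) \<partial>lborel)"
    proof (rule summable_comparison_test'[OF summable_mult2[OF sm, of "\<integral>t. cmod (indicator A t *\<^sub>R g t) \<partial>lborel"]])
      fix k
      have "(\<integral>t. norm (f k t) \<partial>lborel) \<le> (\<integral>t. cmod c ^ k / fact k * cmod (indicator A t *\<^sub>R g t) \<partial>lborel)"
        by (rule integral_mono[OF integrable_norm[OF fi] integrable_mult_right[OF integrable_norm[OF g[unfolded set_integrable_def]]]])
          (rule nb)
      thus "norm (\<integral>t. norm (f k t) \<partial>lborel) \<le> cmod c ^ k / fact k * (\<integral>t. cmod (indicator A t *\<^sub>R g t) \<partial>lborel)"
        by simp
    qed
  qed
  moreover have "(\<Sum>k. f k t) = indicator A t *\<^sub>R (g t * exp (c * w t))" for t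
  proof -
    have "(\<lambda>k. (indicator A t *\<^sub>R g t) * ((c * w t) ^ k /\<^sub>R fact k)) sums ((indicator A t *\<^sub>R g t) * exp (c * w t))"
      by (intro sums_mult exp_converges)
    also have "(\<lambda>k. (indicator A t *\<^sub>R g t) * ((c * w t) ^ k /\<^sub>R fact k)) = (\<lambda>k. f k t)"
      by (simp add: f_eq power_mult_distrib scaleR_conv_of_real field_simps)
    finally show ?thesis by (simp add: sums_iff)
  qed
  moreover have "integral\<^sup>L lborel (f k) = c ^ k / fact k * (LBINT t:A. g t * w t ^ k)" for k
    unfolding f_def[abs_def] using set_integral_mult_right[of lborel A "c ^ k / fact k" "\<lambda>t. g t * w t ^ k"]
    by (simp only: set_lebesgue_integral_def)
  ultimately show ?thesis by (simp add: set_lebesgue_integral_def)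
qed

definition bessel_loop :: "complex \<Rightarrow> complex \<Rightarrow> complex" where
  "bessel_loop \<mu> z = (LBINT \<phi>:{-pi..pi}. exp (\<i> * (z * of_real (sin \<phi>) - \<mu> * of_real \<phi>)))"

definition bessel_tail :: "complex \<Rightarrow> complex \<Rightarrow> complex" where
  "bessel_tail \<mu> z = (LBINT t:{0..}. exp (- (z * of_real (sinh t)) - \<mu> * of_real t))"

text \<open>All reciprocal Gamma values of the power series are represented with the same radius R =
  z / 2. The sum over k is then an exponential series in - R e^(- i \<phi>), and R e^(i \<phi>) - R
  e^(- i \<phi>) = i z sin \<phi>.\<close>

lemma loop_series:
  "(\<lambda>k. (- R) ^ k / fact k * loop_int (\<mu> + of_nat k + 1) R) sums bessel_loop \<mu> (2 * R)"
proof -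
  define g where "g \<phi> = exp (R * cis \<phi> - \<i> * of_real \<phi> * \<mu>)" for \<phi> :: real
  have "(\<lambda>k. (- R) ^ k / fact k * (LBINT \<phi>:{-pi..pi}. g \<phi> * cis (- \<phi>) ^ k)) sums (LBINT \<phi>:{-pi..pi}. g \<phi> * exp (- R * cis (- \<phi>)))"
  proof (rule exp_series_integral)
    show "set_integrable lborel {-pi..pi} g"
      unfolding g_def by (intro set_integrable_Icc_continuous continuous_intros)
  qed (auto intro!: continuous_intros)
  moreover have "g \<phi> * cis (- \<phi>) ^ k = exp (R * cis \<phi> + \<i> * of_real \<phi> * (1 - (\<mu> + of_nat k + 1)))" for \<phi> k
  proof -
    have "cis (- \<phi>) ^ k = exp (- (\<i> * of_real \<phi> * of_nat k))"
      by (simp only: Complex.DeMoivre) (simp add: cis_conv_exp mult_ac)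
    thus ?thesis unfolding g_def by (simp add: exp_add[symmetric] algebra_simps)
  qed
  moreover have "g \<phi> * exp (- R * cis (- \<phi>)) = exp (\<i> * (2 * R * of_real (sin \<phi>) - \<mu> * of_real \<phi>))" for \<phi>
  proof -
    have "cis \<phi> - cis (- \<phi>) = 2 * \<i> * of_real (sin \<phi>)" by (simp add: complex_eq_iff)
    hence "R * cis \<phi> = R * cis (- \<phi>) + R * (2 * \<i> * of_real (sin \<phi>))"
      by (metis add.commute diff_add_cancel distrib_left)
    thus ?thesis unfolding g_def by (simp add: exp_add[symmetric] algebra_simps)
  qed
  ultimately show ?thesis unfolding loop_int_def bessel_loop_def by (simp only:)
qed

lemma tail_series:
  assumes R: "Re R > 0"
  shows "(\<lambda>k. R ^ k / fact k * tail_int (\<mu> + of_nat k + 1) R) sums bessel_tail \<mu> (2 * R)"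
proof -
  define g where "g t = loop_exp (\<mu> + 1) R t" for t :: real
  have "(\<lambda>k. R ^ k / fact k * (LBINT t:{0..}. g t * of_real (exp (- t)) ^ k)) sums (LBINT t:{0..}. g t * exp (R * of_real (exp (- t))))"
  proof (rule exp_series_integral)
    show "set_integrable lborel {0..} g" unfolding g_def by (rule tail_int_integrable[OF R])
  qed (auto intro!: continuous_intros simp del: of_real_exp)
  moreover have "g t * of_real (exp (- t)) ^ k = loop_exp (\<mu> + of_nat k + 1) R t" for t k
  proof -
    have "complex_of_real (exp (- t)) ^ k = exp (- (of_nat k * of_real t))"
      by (simp add: exp_of_real[symmetric] exp_of_nat_mult[symmetric])
    thus ?thesis unfolding g_def by (simp only: exp_add[symmetric]) (simp add: algebra_simps)
  qed
  moreover have "g t * exp (R * of_real (exp (- t))) = exp (- (2 * R * of_real (sinh t)) - \<mu> * of_real t)" for t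
  proof -
    have "2 * complex_of_real (sinh t) = of_real (exp t) - of_real (exp (- t))"
      by (simp add: sinh_field_def)
    hence "2 * R * complex_of_real (sinh t) = R * (of_real (exp t) - of_real (exp (- t)))" by (metis mult.assoc mult.commute)
    thus ?thesis unfolding g_def by (simp only: exp_add[symmetric]) (simp add: algebra_simps del: of_real_exp)
  qed
  ultimately show ?thesis unfolding tail_int_def bessel_tail_def by (simp only:)
qed

lemma bessel_J_integral:
  assumes z: "Re z > 0" and \<mu>: "\<mu> \<notin> \<int>"
  shows "bessel_J \<mu> z = bessel_loop \<mu> z / (2 * pi) - sin (of_real pi * \<mu>) / pi * bessel_tail \<mu> z"
proof -
  define R where "R = z / 2"
  have R: "Re R > 0" "R \<noteq> 0" using z by (auto simp: R_def)
  have z2: "z = 2 * R" by (simp add: R_def)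
  let ?S = "sin (of_real pi * \<mu>)"
  have trm: "R powr \<mu> * ((-1) ^ k * R ^ (2 * k) * rGamma (\<mu> + of_nat k + 1) / fact k) =
    (- R) ^ k / fact k * loop_int (\<mu> + of_nat k + 1) R / (2 * pi) - ?S / pi * (R ^ k / fact k * tail_int (\<mu> + of_nat k + 1) R)" for k
  proof -
    have "\<mu> + of_nat k + 1 \<notin> \<int>"
    proof
      assume "\<mu> + of_nat k + 1 \<in> \<int>"
      hence "\<mu> + of_nat k + 1 - of_nat (Suc k) \<in> \<int>" by (rule Ints_diff) simp
      thus False using \<mu> by simp
    qed
    hence "rGamma (\<mu> + of_nat k + 1) = hankel_int (\<mu> + of_nat k + 1) R"
      using hankel_int_eq_rGamma[OF R(1)] by simp
    \<comment> \<open>This sign (-1)^k cancels the one of the Bessel series. That is why the tail is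
      summed with powers of R and the loop with powers of - R.\<close>
    also have "sin (of_real pi * (\<mu> + of_nat k + 1)) = (-1) ^ Suc k * ?S"
    proof (induction k)
      case 0
      show ?case by (simp add: distrib_left sin_add)
    next
      case (Suc k)
      have "of_real pi * (\<mu> + of_nat (Suc k) + 1) = of_real pi * (\<mu> + of_nat k + 1) + of_real pi" by (simp add: algebra_simps)
      thus ?case using Suc by (simp add: sin_add)
    qed
    hence "hankel_int (\<mu> + of_nat k + 1) R = R powr (- \<mu> - of_nat k) * (loop_int (\<mu> + of_nat k + 1) R / (2 * pi) - (-1) ^ k * ?S / pi * tail_int (\<mu> + of_nat k + 1) R)"
      unfolding hankel_int_def by (simp add: algebra_simps)
    finally have r: "rGamma (\<mu> + of_nat k + 1) = R powr (- \<mu> - of_nat k) * (loop_int (\<mu> + of_nat k + 1) R / (2 * pi) - (-1) ^ k * ?S / pi * tail_int (\<mu> + of_nat k + 1) R)" .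
    have p: "R powr \<mu> * (R ^ (2 * k) * R powr (- \<mu> - of_nat k)) = R ^ k"
    proof -
      have "R powr \<mu> * R powr (- \<mu> - of_nat k) = R powr (- of_nat k)"
        using R by (simp flip: powr_add)
      also have "\<dots> = inverse (R ^ k)" using R by (simp add: powr_minus powr_nat)
      finally have "R ^ (2 * k) * (R powr \<mu> * R powr (- \<mu> - of_nat k)) = R ^ (k + k) * inverse (R ^ k)" by (simp add: mult_2)
      thus ?thesis using R by (simp add: power_add mult_ac)
    qed
    have "R powr \<mu> * ((-1) ^ k * R ^ (2 * k) * rGamma (\<mu> + of_nat k + 1) / fact k) =
      (-1) ^ k / fact k * (R powr \<mu> * (R ^ (2 * k) * R powr (- \<mu> - of_nat k))) * (loop_int (\<mu> + of_nat k + 1) R / (2 * pi) - (-1) ^ k * ?S / pi * tail_int (\<mu> + of_nat k + 1) R)"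
      unfolding r by (simp only: mult_ac times_divide_eq_right times_divide_eq_left)
    also have "\<dots> = (-1) ^ k * R ^ k / fact k * loop_int (\<mu> + of_nat k + 1) R / (2 * pi) - ((-1) ^ k * (-1) ^ k) * ?S / pi * (R ^ k / fact k * tail_int (\<mu> + of_nat k + 1) R)"
      unfolding p by (simp add: algebra_simps)
    also have "(-1) ^ k * (-1) ^ k = (1 :: complex)" by (simp flip: power_mult_distrib)
    also have "(-1) ^ k * R ^ k = (- R) ^ k" by (simp flip: power_mult_distrib)
    finally show ?thesis by simp
  qed
  have "(\<lambda>k. (- R) ^ k / fact k * loop_int (\<mu> + of_nat k + 1) R / (2 * pi) - ?S / pi * (R ^ k / fact k * tail_int (\<mu> + of_nat k + 1) R))
     sums (bessel_loop \<mu> z / (2 * pi) - ?S / pi * bessel_tail \<mu> z)"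
    unfolding z2 by (intro sums_diff sums_mult sums_divide loop_series tail_series R)
  hence s: "(\<lambda>k. R powr \<mu> * ((-1) ^ k * R ^ (2 * k) * rGamma (\<mu> + of_nat k + 1) / fact k)) sums (bessel_loop \<mu> z / (2 * pi) - ?S / pi * bessel_tail \<mu> z)"
    unfolding trm .
  have "R powr \<mu> \<noteq> 0" using R by simp
  hence "summable (\<lambda>k. (-1) ^ k * R ^ (2 * k) * rGamma (\<mu> + of_nat k + 1) / fact k)"
    by (rule summable_mult_D[OF sums_summable[OF s]])
  from suminf_mult[OF this, of "R powr \<mu>"] show ?thesis
    using s unfolding bessel_J_def R_def[symmetric] by (simp add: sums_iff)
qed

definition bessel_sin :: "complex \<Rightarrow> complex \<Rightarrow> complex" where
  "bessel_sin \<mu> z = (LBINT \<phi>:{0..pi}. sin (z * of_real (sin \<phi>) - \<mu> * of_real \<phi>))"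

definition bessel_cos :: "complex \<Rightarrow> complex \<Rightarrow> complex" where
  "bessel_cos \<mu> z = (LBINT \<phi>:{0..pi}. cos (z * of_real (sin \<phi>) - \<mu> * of_real \<phi>))"

lemma set_integral_Icc_eq_integral:
  fixes f :: "real \<Rightarrow> complex"
  shows "continuous_on UNIV f \<Longrightarrow> (LBINT x:{a..b}. f x) = integral {a..b} f"
  using set_borel_integral_eq_integral(2)[OF set_integrable_Icc_continuous] by blast

lemma bessel_loop_eq: "bessel_loop \<mu> z = 2 * bessel_cos \<mu> z"
proof -
  define f where "f \<phi> = exp (\<i> * (z * of_real (sin \<phi>) - \<mu> * of_real \<phi>))" for \<phi> :: real
  have c: "continuous_on A f" for A unfolding f_def by (intro continuous_intros)
  have i: "f integrable_on {a..b}" for a b using c integrable_continuous_interval by blast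
  have "bessel_loop \<mu> z = integral {-pi..pi} f"
    unfolding bessel_loop_def f_def[symmetric] by (rule set_integral_Icc_eq_integral[OF c])
  also have "\<dots> = integral {-pi..0} f + integral {0..pi} f"
    by (rule Henstock_Kurzweil_Integration.integral_combine[symmetric]) (auto intro: i)
  also have "integral {-pi..0} f = integral {0..pi} (\<lambda>x. f (- x))"
    using Henstock_Kurzweil_Integration.integral_reflect_real[of pi 0 "\<lambda>x. f (- x)"] by simp
  also have "integral {0..pi} (\<lambda>x. f (- x)) + integral {0..pi} f = integral {0..pi} (\<lambda>x. f (- x) + f x)"
    by (intro Henstock_Kurzweil_Integration.integral_add[symmetric] i integrable_continuous_interval)
      (auto simp: f_def intro!: continuous_intros)
  also have "(\<lambda>x. f (- x) + f x) = (\<lambda>x. 2 * cos (z * of_real (sin x) - \<mu> * of_real x))"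
    by (auto simp: f_def cos_exp_eq algebra_simps)
  also have "integral {0..pi} (\<lambda>x. 2 * cos (z * of_real (sin x) - \<mu> * of_real x)) = 2 * bessel_cos \<mu> z"
    unfolding bessel_cos_def
    by (subst set_integral_Icc_eq_integral) (auto intro!: continuous_intros)
  finally show ?thesis .
qed

text \<open>The reflection of \<phi> to pi - \<phi> shifts the phase by pi \<mu>. It brings in the
  sine integral, which is what survives in Y.\<close>

lemma bessel_cos_minus:
  "bessel_cos (- \<mu>) z = cos (of_real pi * \<mu>) * bessel_cos \<mu> z - sin (of_real pi * \<mu>) * bessel_sin \<mu> z"
proof -
  define f where "f \<phi> = cos (z * of_real (sin \<phi>) - (- \<mu>) * of_real \<phi>)" for \<phi> :: real
  have c: "continuous_on UNIV f" unfolding f_def by (intro continuous_intros)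
  have "bessel_cos (- \<mu>) z = integral {0..pi} f"
    unfolding bessel_cos_def f_def[symmetric] by (rule set_integral_Icc_eq_integral[OF c])
  also have "\<dots> = integral {0 - pi..pi - pi} (\<lambda>x. f (x + pi))"
    by (rule integral_shift_real_ivl[symmetric])
  also have "\<dots> = integral {0..pi} (\<lambda>x. f (- x + pi))"
    using Henstock_Kurzweil_Integration.integral_reflect_real[of pi 0 "\<lambda>x. f (- x + pi)"] by simp
  also have "(\<lambda>x. f (- x + pi)) = (\<lambda>x. cos (of_real pi * \<mu>) * cos (z * of_real (sin x) - \<mu> * of_real x) - sin (of_real pi * \<mu>) * sin (z * of_real (sin x) - \<mu> * of_real x))"
  proof
    fix x
    have "z * of_real (sin (- x + pi)) - (- \<mu>) * of_real (- x + pi) = (z * of_real (sin x) - \<mu> * of_real x) + of_real pi * \<mu>"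
      by (simp add: sin_add algebra_simps)
    thus "f (- x + pi) = cos (of_real pi * \<mu>) * cos (z * of_real (sin x) - \<mu> * of_real x) - sin (of_real pi * \<mu>) * sin (z * of_real (sin x) - \<mu> * of_real x)"
      unfolding f_def by (simp only: cos_add mult.commute)
  qed
  also have "integral {0..pi} \<dots> = cos (of_real pi * \<mu>) * integral {0..pi} (\<lambda>x. cos (z * of_real (sin x) - \<mu> * of_real x)) - sin (of_real pi * \<mu>) * integral {0..pi} (\<lambda>x. sin (z * of_real (sin x) - \<mu> * of_real x))"
    by (subst Henstock_Kurzweil_Integration.integral_diff)
      (auto intro!: integrable_continuous_interval continuous_intros)
  finally show ?thesis
    unfolding bessel_cos_def bessel_sin_def
    by (subst (1 2) set_integral_Icc_eq_integral) (auto intro!: continuous_intros)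
qed

text \<open>The quotient that defines Y with the division by sin (pi \<mu>) carried out, so that it
  makes sense at integer orders too.\<close>

definition bessel_Y_int :: "complex \<Rightarrow> complex \<Rightarrow> complex" where
  "bessel_Y_int \<mu> z = (bessel_sin \<mu> z - cos (of_real pi * \<mu>) * bessel_tail \<mu> z - bessel_tail (- \<mu>) z) / pi"

lemma sin_pi_mult_nonzero: "sin (of_real pi * \<mu>) \<noteq> 0" if \<mu>: "\<mu> \<notin> \<int>" for \<mu> :: complex
proof
  assume "sin (of_real pi * \<mu>) = 0"
  then obtain n :: int where "of_real pi * \<mu> = of_real (n * pi)" unfolding sin_eq_0 by blast
  hence "\<mu> = of_int n" by (simp add: mult.commute)
  thus False using \<mu> by simp
qed

text \<open>In the combination of J of orders \<mu> and - \<mu> the cosine integrals cancel, and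
  everything left carries the factor sin (pi \<mu>).\<close>

lemma bessel_Y_nonint_eq:
  assumes z: "Re z > 0" and \<mu>: "\<mu> \<notin> \<int>"
  shows "bessel_Y_nonint \<mu> z = bessel_Y_int \<mu> z"
proof -
  have \<mu>': "- \<mu> \<notin> \<int>" using \<mu> by simp
  have s: "sin (of_real pi * \<mu>) \<noteq> 0" by (rule sin_pi_mult_nonzero[OF \<mu>])
  have l: "bessel_loop m z / of_real (2 * pi) = bessel_cos m z / pi" for m
    by (simp add: bessel_loop_eq)
  have J: "bessel_J \<mu> z = bessel_cos \<mu> z / pi - sin (of_real pi * \<mu>) / pi * bessel_tail \<mu> z"
    using bessel_J_integral[OF z \<mu>] unfolding l .
  have J': "bessel_J (- \<mu>) z = (cos (of_real pi * \<mu>) * bessel_cos \<mu> z - sin (of_real pi * \<mu>) * bessel_sin \<mu> z) / pi + sin (of_real pi * \<mu>) / pi * bessel_tail (- \<mu>) z"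
    using bessel_J_integral[OF z \<mu>'] unfolding l bessel_cos_minus by simp
  have "((c / p - S / p * T) * C - ((C * c - S * B) / p + S / p * T')) / S = (B - C * T - T') / p"
    if "S \<noteq> 0" "p \<noteq> 0" for c p S T C B T' :: complex
    using that by (simp add: field_simps)
  from this[OF s] show ?thesis unfolding bessel_Y_nonint_def J J' bessel_Y_int_def by simp
qed

lemma bessel_tail_exp_bound:
  assumes "c > 0" "Re z \<ge> c" "Re \<mu> \<ge> - K" "t \<ge> 0" "K \<ge> 0"
  shows "cmod (exp (- (z * of_real (sinh t)) - \<mu> * of_real t)) \<le> exp (c / 2 + 2 * (K + 1)\<^sup>2 / c) * exp (- t)"
proof -
  have gen: "- zs - mt \<le> (c2 + Q') + (- t)"
    if "cs \<le> zs" "- Re \<mu> * t \<le> kt" "e1 \<le> e2" "k1 - e \<le> Q" "Q = Q'" "e1 = e - c2" "e2 = cs" "k1 = kt + t" "mt = Re \<mu> * t"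
    for zs mt c2 Q Q' t cs kt e1 e2 k1 e :: real using that by simp
  have "c * sinh t \<le> Re z * sinh t" using assms by (intro mult_right_mono) auto
  moreover have "- Re \<mu> * t \<le> K * t" using assms by (intro mult_right_mono) auto
  moreover have "exp t - 1 \<le> 2 * sinh t" using assms by (simp add: sinh_field_def)
  hence "c / 2 * (exp t - 1) \<le> c / 2 * (2 * sinh t)" using assms by (intro mult_left_mono) auto
  moreover have "(K + 1) * t - c / 2 * exp t \<le> (K + 1)\<^sup>2 / (c / 2)" by (rule linear_minus_exp_le) (use assms in auto)
  moreover have "(K + 1)\<^sup>2 / (c / 2) = 2 * (K + 1)\<^sup>2 / c" by simp
  moreover have "c / 2 * (exp t - 1) = c / 2 * exp t - c / 2" by (simp only: right_diff_distrib mult_1_right)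
  moreover have "c / 2 * (2 * sinh t) = c * sinh t" by simp
  moreover have "(K + 1) * t = K * t + t" by (simp only: distrib_right mult_1_left)
  moreover have "Re \<mu> * t = Re \<mu> * t" ..
  ultimately have "- (Re z * sinh t) - Re \<mu> * t \<le> (c / 2 + 2 * (K + 1)\<^sup>2 / c) + (- t)"
    by (rule gen)
  thus ?thesis by (simp flip: exp_add)
qed

lemma bessel_tail_integrable:
  assumes "Re z > 0"
  shows "set_integrable lborel {0..} (\<lambda>t. exp (- (z * of_real (sinh t)) - \<mu> * of_real t))"
proof (rule set_integrable_continuous_bound)
  show "set_integrable lborel {0..} (\<lambda>t. exp (Re z / 2 + 2 * (\<bar>Re \<mu>\<bar> + 1)\<^sup>2 / Re z) * exp (- t))"
    using set_integrable_exp_neg[of 1 0] by (intro set_integrable_mult_right) auto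
  show "cmod (exp (- (z * of_real (sinh t)) - \<mu> * of_real t)) \<le> exp (Re z / 2 + 2 * (\<bar>Re \<mu>\<bar> + 1)\<^sup>2 / Re z) * exp (- t)" if "0 \<le> t" for t
    by (rule bessel_tail_exp_bound) (use assms that in auto)
qed (auto intro!: continuous_intros)

text \<open>A derivative in an arbitrary direction (a, b) of order and argument serves two purposes:
  (1, 0) gives continuity in the order and (0, 1) the derivative in the argument.\<close>

lemma bessel_tail_deriv:
  assumes z: "Re z > 0"
  shows "((\<lambda>w. bessel_tail (\<mu> + a * w) (z + b * w)) has_field_derivative
    (LBINT t:{0..}. (- (b * of_real (sinh t)) - a * of_real t) * exp (- (z * of_real (sinh t)) - \<mu> * of_real t))) (at 0)"
proof -
  define f where "f w t = exp (- ((z + b * w) * of_real (sinh t)) - (\<mu> + a * w) * of_real t)" for w and t :: real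
  have fd: "((\<lambda>w. f w t) has_field_derivative (- (b * of_real (sinh t)) - a * of_real t) * f w t) (at w)" for w t
    unfolding f_def by (auto intro!: derivative_eq_intros simp: algebra_simps)
  \<comment> \<open>This radius keeps Re (z + b w) above Re z / 2 and the change of the order below
    |a|.\<close>
  define r where "r = min 1 (Re z / 2 / (cmod b + 1))"
  have r: "r > 0" using z by (simp add: r_def add_nonneg_pos)
  have re: "Re z / 2 \<le> Re (z + b * w)" "- (cmod \<mu> + cmod a) \<le> Re (\<mu> + a * w)" if "w \<in> ball 0 r" for w
  proof -
    have w: "cmod w < r" using that by simp
    have "cmod (b * w) \<le> (cmod b + 1) * (Re z / 2 / (cmod b + 1))"
      unfolding norm_mult using w z by (intro mult_mono) (auto simp: r_def)
    also have "p * (q / p) = q" if "p > 0" for p q :: real using that by simp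
    hence "(cmod b + 1) * (Re z / 2 / (cmod b + 1)) = Re z / 2" by (simp only: add_nonneg_pos norm_ge_zero zero_less_one)
    finally show "Re z / 2 \<le> Re (z + b * w)" using abs_Re_le_cmod[of "b * w"] by simp
    have "cmod (a * w) \<le> cmod a * 1" unfolding norm_mult using w by (intro mult_left_mono) (auto simp: r_def)
    thus "- (cmod \<mu> + cmod a) \<le> Re (\<mu> + a * w)" using abs_Re_le_cmod[of "\<mu> + a * w"] norm_triangle_ineq[of \<mu> "a * w"] by simp
  qed
  define C where "C = exp (Re z / 2 / 2 + 2 * ((cmod \<mu> + cmod a) + 1)\<^sup>2 / (Re z / 2))"
  have "((\<lambda>w. \<integral>t. indicator {0..} t *\<^sub>R f w t \<partial>lborel) has_field_derivative
     (\<integral>t. deriv (\<lambda>w. indicator {0..} t *\<^sub>R f w t) 0 \<partial>lborel)) (at 0)"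
  proof (rule param_integral_holomorphic[OF _ _ r])
    show "(\<lambda>w. indicat_real {0..} t *\<^sub>R f w t) holomorphic_on ball 0 r" for t
      unfolding scaleR_conv_of_real f_def by (intro holomorphic_intros)
    show "(\<lambda>t. indicat_real {0..} t *\<^sub>R f w t) \<in> borel_measurable lborel" if "w \<in> ball 0 r" for w
      using bessel_tail_integrable[of "z + b * w" "\<mu> + a * w"] re[OF that] z by (simp add: set_integrable_def f_def)
    show "integrable lborel (\<lambda>t. indicator {0..} t *\<^sub>R (C * exp (- t)))"
      using set_integrable_exp_neg[of 1 0] unfolding set_integrable_def[symmetric]
      by (intro set_integrable_mult_right) auto
    show "cmod (indicator {0..} t *\<^sub>R f w t) \<le> indicator {0..} t *\<^sub>R (C * exp (- t))" if "w \<in> ball 0 r" for w t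
    proof (cases "t \<ge> 0")
      case True
      have "cmod (f w t) \<le> C * exp (- t)"
        unfolding f_def C_def by (rule bessel_tail_exp_bound) (use re[OF that] z True in auto)
      thus ?thesis using True by simp
    qed simp
  qed
  moreover have "deriv (\<lambda>w. indicator {0..} t *\<^sub>R f w t) 0 = indicator {0..} t *\<^sub>R ((- (b * of_real (sinh t)) - a * of_real t) * f 0 t)" for t
    by (intro DERIV_imp_deriv has_field_derivative_scaleR_right fd)
  ultimately show ?thesis unfolding bessel_tail_def set_lebesgue_integral_def f_def by simp
qed

lemma norm_sin_le_exp: "cmod (sin X) \<le> exp (cmod X)"
proof -
  have "cmod (exp (\<i> * X) - exp (- (\<i> * X))) \<le> exp (cmod X) + exp (cmod X)"
  proof (rule order_trans[OF norm_triangle_ineq4 add_mono])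
    show "cmod (exp (\<i> * X)) \<le> exp (cmod X)" "cmod (exp (- (\<i> * X))) \<le> exp (cmod X)"
      using abs_Im_le_cmod[of X] by auto
  qed
  thus ?thesis by (simp add: sin_exp_eq norm_divide norm_mult)
qed

lemma bessel_sin_deriv:
  "((\<lambda>w. bessel_sin (\<mu> + a * w) (z + b * w)) has_field_derivative
    (LBINT \<phi>:{0..pi}. (b * of_real (sin \<phi>) - a * of_real \<phi>) * cos (z * of_real (sin \<phi>) - \<mu> * of_real \<phi>))) (at 0)"
proof -
  define f where "f w \<phi> = sin ((z + b * w) * of_real (sin \<phi>) - (\<mu> + a * w) * of_real \<phi>)" for w and \<phi> :: real
  have fd: "((\<lambda>w. f w \<phi>) has_field_derivative (b * of_real (sin \<phi>) - a * of_real \<phi>) * cos ((z + b * w) * of_real (sin \<phi>) - (\<mu> + a * w) * of_real \<phi>)) (at w)" for w \<phi>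
    unfolding f_def by (auto intro!: derivative_eq_intros simp: algebra_simps)
  define C where "C = exp ((cmod z + cmod b) + (cmod \<mu> + cmod a) * pi)"
  have "((\<lambda>w. \<integral>\<phi>. indicator {0..pi} \<phi> *\<^sub>R f w \<phi> \<partial>lborel) has_field_derivative
     (\<integral>\<phi>. deriv (\<lambda>w. indicator {0..pi} \<phi> *\<^sub>R f w \<phi>) 0 \<partial>lborel)) (at 0)"
  proof (rule param_integral_holomorphic)
    show "(\<lambda>w. indicat_real {0..pi} \<phi> *\<^sub>R f w \<phi>) holomorphic_on ball 0 1" for \<phi>
      unfolding scaleR_conv_of_real f_def by (intro holomorphic_intros)
    show "(\<lambda>\<phi>. indicat_real {0..pi} \<phi> *\<^sub>R f w \<phi>) \<in> borel_measurable lborel" for w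
      using set_integrable_Icc_continuous[of "f w" 0 pi]
      by (simp add: set_integrable_def f_def[abs_def] continuous_intros)
    show "integrable lborel (\<lambda>\<phi>. indicator {0..pi} \<phi> *\<^sub>R C)" by simp
    show "cmod (indicator {0..pi} \<phi> *\<^sub>R f w \<phi>) \<le> indicator {0..pi} \<phi> *\<^sub>R C" if "w \<in> ball 0 1" for w \<phi>
    proof (cases "\<phi> \<in> {0..pi}")
      case True
      have w: "cmod w \<le> 1" using that by simp
      have n: "cmod (p + q * w) \<le> cmod p + cmod q" for p q
      proof -
        have "cmod (q * w) \<le> cmod q * 1" unfolding norm_mult using w by (intro mult_left_mono) auto
        thus ?thesis using norm_triangle_ineq[of p "q * w"] by simp
      qed
      have "cmod ((z + b * w) * of_real (sin \<phi>) - (\<mu> + a * w) * of_real \<phi>) \<le> cmod ((z + b * w) * of_real (sin \<phi>)) + cmod ((\<mu> + a * w) * of_real \<phi>)"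
        by (rule norm_triangle_ineq4)
      also have "\<dots> \<le> (cmod z + cmod b) * 1 + (cmod \<mu> + cmod a) * pi"
        unfolding norm_mult norm_of_real using True by (intro add_mono mult_mono n) auto
      finally have "exp (cmod ((z + b * w) * of_real (sin \<phi>) - (\<mu> + a * w) * of_real \<phi>)) \<le> C"
        unfolding C_def by simp
      thus ?thesis using True norm_sin_le_exp unfolding f_def by (force intro: order_trans)
    qed simp
  qed auto
  moreover have "deriv (\<lambda>w. indicator {0..pi} \<phi> *\<^sub>R f w \<phi>) 0 = indicator {0..pi} \<phi> *\<^sub>R ((b * of_real (sin \<phi>) - a * of_real \<phi>) * cos ((z + b * 0) * of_real (sin \<phi>) - (\<mu> + a * 0) * of_real \<phi>))" for \<phi>
    by (intro DERIV_imp_deriv has_field_derivative_scaleR_right fd)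
  ultimately show ?thesis unfolding bessel_sin_def set_lebesgue_integral_def f_def by simp
qed

lemma deriv_shift_to_0:
  "((\<lambda>w. f (c + w)) has_field_derivative D) (at 0) \<Longrightarrow> (f has_field_derivative D) (at (c :: complex))"
  using DERIV_shift[of f D 0 c] by (simp add: add.commute)

lemma isCont_bessel_Y_int: "isCont (\<lambda>\<mu>. bessel_Y_int \<mu> z) \<mu>" if z: "Re z > 0"
proof -
  have s: "isCont (\<lambda>\<mu>. bessel_sin \<mu> z) \<mu>"
    using bessel_sin_deriv[of \<mu> 1 z 0] by (intro DERIV_isCont[OF deriv_shift_to_0]) simp
  have t: "isCont (\<lambda>\<mu>. bessel_tail \<mu> z) \<mu>" for \<mu>
    using bessel_tail_deriv[OF z, of \<mu> 1 0] by (intro DERIV_isCont[OF deriv_shift_to_0]) simp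
  have "isCont (\<lambda>\<mu>. bessel_tail (- \<mu>) z) \<mu>"
    by (rule isCont_o2[OF _ t]) (intro continuous_intros)
  thus ?thesis unfolding bessel_Y_int_def by (intro continuous_intros s t) auto
qed

lemma eventually_not_Ints: "\<forall>\<^sub>F \<mu>' in at (\<mu> :: complex). \<mu>' \<notin> \<int>" if "\<mu> \<in> \<int>"
proof -
  have "\<mu>' \<notin> \<int>" if "\<mu>' \<noteq> \<mu>" "dist \<mu>' \<mu> < 1" for \<mu>'
  proof
    assume "\<mu>' \<in> \<int>"
    hence "\<mu>' - \<mu> \<in> \<int>" using \<open>\<mu> \<in> \<int>\<close> by (rule Ints_diff)
    then obtain n where n: "\<mu>' - \<mu> = of_int n" by (auto elim: Ints_cases)
    hence "cmod (of_int n) < 1" using that(2) by (metis dist_norm)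
    hence "n = 0" by (simp add: norm_of_int)
    thus False using n that(1) by simp
  qed
  thus ?thesis unfolding eventually_at by (intro exI[of _ 1]) auto
qed

text \<open>At integer order the limit in the definition is evaluated by continuity of
  \<open>bessel_Y_int\<close> in the order, as orders close to an integer and different from it are
  not integers.\<close>

lemma bessel_Y_eq: "bessel_Y \<mu> z = bessel_Y_int \<mu> z" if z: "Re z > 0"
proof (cases "\<mu> \<in> \<int>")
  case True
  have "((\<lambda>\<mu>'. bessel_Y_int \<mu>' z) \<longlongrightarrow> bessel_Y_int \<mu> z) (at \<mu>)"
    using isCont_bessel_Y_int[OF z] by (simp add: isCont_def)
  hence "((\<lambda>\<mu>'. bessel_Y_nonint \<mu>' z) \<longlongrightarrow> bessel_Y_int \<mu> z) (at \<mu>)"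
  proof (rule Lim_transform_eventually)
    show "\<forall>\<^sub>F \<mu>' in at \<mu>. bessel_Y_int \<mu>' z = bessel_Y_nonint \<mu>' z"
      using eventually_not_Ints[OF True] by eventually_elim (simp add: bessel_Y_nonint_eq[OF z])
  qed
  thus ?thesis using True by (simp add: bessel_Y_def tendsto_Lim)
qed (simp add: bessel_Y_def bessel_Y_nonint_eq[OF z])

lemma bessel_Y'_integral:
  assumes \<nu>: "Re \<nu> > 0"
  shows "bessel_Y' \<nu> = ((LBINT \<phi>:{0..pi}. of_real (sin \<phi>) * cos (\<nu> * of_real (sin \<phi>) - \<nu> * of_real \<phi>))
     + cos (of_real pi * \<nu>) * (LBINT t:{0..}. of_real (sinh t) * exp (- (\<nu> * of_real (sinh t)) - \<nu> * of_real t))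
     + (LBINT t:{0..}. of_real (sinh t) * exp (- (\<nu> * of_real (sinh t)) - (- \<nu>) * of_real t))) / pi"
proof -
  let ?S = "LBINT \<phi>:{0..pi}. of_real (sin \<phi>) * cos (\<nu> * of_real (sin \<phi>) - \<nu> * of_real \<phi>)"
    and ?T = "LBINT t:{0..}. of_real (sinh t) * exp (- (\<nu> * of_real (sinh t)) - \<nu> * of_real t)"
    and ?U = "LBINT t:{0..}. of_real (sinh t) * exp (- (\<nu> * of_real (sinh t)) - (- \<nu>) * of_real t)"
  have neg: "(LBINT t:{0..}. - of_real (sinh t) * g t) = - (LBINT t:{0..}. of_real (sinh t) * g t)" for g :: "real \<Rightarrow> complex"
  proof -
    have "(LBINT t:{0..}. - of_real (sinh t) * g t) = (LBINT t:{0..}. - 1 * (of_real (sinh t) * g t))"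
      by (intro arg_cong[where f = "set_lebesgue_integral lborel {0..}"]) auto
    thus ?thesis unfolding set_integral_mult_right by simp
  qed
  have t: "(bessel_tail \<mu> has_field_derivative - (LBINT t:{0..}. of_real (sinh t) * exp (- (\<nu> * of_real (sinh t)) - \<mu> * of_real t))) (at \<nu>)" for \<mu>
    by (rule deriv_shift_to_0)
       (use bessel_tail_deriv[OF \<nu>, of \<mu> 0 1] in \<open>simp only: mult_1_left mult_zero_left diff_0_right add_0_right neg\<close>)
  have s: "(bessel_sin \<nu> has_field_derivative ?S) (at \<nu>)"
    by (rule deriv_shift_to_0)
       (use bessel_sin_deriv[of \<nu> 0 \<nu> 1] in \<open>simp only: mult_1_left mult_zero_left diff_0_right add_0_right\<close>)
  have "((\<lambda>z. bessel_Y_int \<nu> z) has_field_derivative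
     (?S
     - cos (of_real pi * \<nu>) * - ?T
     - - ?U) / pi) (at \<nu>)"
    unfolding bessel_Y_int_def
    by (intro DERIV_cdivide DERIV_diff DERIV_cmult s t)
  hence "deriv (bessel_Y_int \<nu>) \<nu> = (?S
     + cos (of_real pi * \<nu>) * ?T
     + ?U) / pi"
    by (intro DERIV_imp_deriv) (simp only: mult_minus_right diff_minus_eq_add)
  moreover have "deriv (bessel_Y \<nu>) \<nu> = deriv (bessel_Y_int \<nu>) \<nu>"
  proof (rule deriv_cong_ev[OF _ refl])
    have "\<forall>\<^sub>F z in nhds \<nu>. z \<in> {z. Re z > 0}"
      using \<nu> by (intro eventually_nhds_in_open open_halfspace_Re_gt) auto
    thus "\<forall>\<^sub>F z in nhds \<nu>. bessel_Y \<nu> z = bessel_Y_int \<nu> z"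
      by eventually_elim (simp add: bessel_Y_eq)
  qed
  ultimately show ?thesis unfolding bessel_Y'_def by simp
qed

text \<open>At \<zeta> = ln \<nu> + i pi the kernel has parameter - \<nu>. The path from 0 to - i pi
  gives the oscillating integral over [0, pi]; on the line Im t = - pi the function sinh changes
  sign, which gives the decaying integral with the factor exp (i pi \<nu>).\<close>

lemma saddle_int_negative_axis:
  assumes \<nu>: "\<nu> > 0"
  defines "\<zeta> \<equiv> Complex (ln \<nu>) pi"
  shows "saddle_int \<zeta> = - ((LBINT y:{0..pi}. of_real (sin y) * exp (- (\<i> * of_real (\<nu> * sin y - \<nu> * y))))
     + exp (\<i> * of_real (pi * \<nu>)) * (LBINT t:{0..}. of_real (sinh t) * exp (- (of_real \<nu> * of_real (sinh t)) - of_real \<nu> * of_real t)))"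
proof -
  have e: "exp \<zeta> = - of_real \<nu>" using \<nu> by (simp add: \<zeta>_def exp_eq_polar exp_of_real complex_eq_iff)
  have im: "Im \<zeta> = pi" by (simp add: \<zeta>_def)
  have re: "exp (Re \<zeta>) = \<nu>" using \<nu> by (simp add: \<zeta>_def)
  have k: "kern (exp \<zeta>) (of_real x - \<i> * of_real pi) = - exp (\<i> * of_real (pi * \<nu>)) * (of_real (sinh x) * exp (- (of_real \<nu> * of_real (sinh x)) - of_real \<nu> * of_real x))" for x
  proof -
    have s: "sinh (of_real x - \<i> * of_real pi) = - complex_of_real (sinh x)"
      by (simp add: complex_eq_iff sinh_field_def Re_exp Im_exp field_simps)
    show ?thesis unfolding kern_def phase_def s e
      by (simp add: exp_add[symmetric] exp_diff[symmetric] algebra_simps)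
  qed
  have i: "set_integrable lborel {0..} (\<lambda>x. kern (exp \<zeta>) (horiz \<zeta> x))"
  proof (rule set_integrable_continuous_bound[OF _ cosh_exp_sinh_integral(1)[of "\<nu> / 2"]])
    fix x :: real assume x: "0 \<le> x"
    have "sinh x / 2 \<le> Re (cis (Im \<zeta>) * phase (horiz \<zeta> x))"
      unfolding Re_cis_phase im using x by (simp add: add_nonneg_nonneg)
    from kern_bound[OF this] show "cmod (kern (exp \<zeta>) (horiz \<zeta> x)) \<le> cosh x * exp (- (\<nu> / 2 * sinh x))"
      unfolding re by simp
  qed (use \<nu> in \<open>auto intro!: continuous_intros\<close>)
  have "prim (exp \<zeta>) (- (\<i> * of_real pi)) = (LBINT y:{0..pi}. kern (exp \<zeta>) (- (\<i> * of_real y)) * (- \<i>))"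
  proof -
    have "(LBINT y:{0..pi}. kern (exp \<zeta>) (- (\<i> * of_real y)) * (- \<i>)) = prim (exp \<zeta>) (- (\<i> * of_real pi)) - prim (exp \<zeta>) (- (\<i> * of_real 0))"
    proof (rule set_integral_Icc_FTC(2))
      show "((\<lambda>y. prim (exp \<zeta>) (- (\<i> * of_real y))) has_vector_derivative kern (exp \<zeta>) (- (\<i> * of_real y)) * - \<i>) (at y)" for y
        by (rule prim_of_real_deriv) (auto intro!: derivative_eq_intros)
    qed (auto intro!: continuous_intros)
    thus ?thesis by simp
  qed
  also have "(\<lambda>y. kern (exp \<zeta>) (- (\<i> * of_real y)) * (- \<i>)) = (\<lambda>y. - 1 * (of_real (sin y) * exp (- (\<i> * of_real (\<nu> * sin y - \<nu> * y)))))"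
  proof
    fix y
    have "sinh (- (\<i> * of_real y)) = - \<i> * of_real (sin y)"
      by (simp add: sinh_field_def complex_eq_iff Re_exp Im_exp)
    thus "kern (exp \<zeta>) (- (\<i> * of_real y)) * (- \<i>) = - 1 * (of_real (sin y) * exp (- (\<i> * of_real (\<nu> * sin y - \<nu> * y))))"
      unfolding kern_def phase_def e by (simp add: algebra_simps)
  qed
  also have "(LBINT y:{0..pi}. - 1 * (of_real (sin y) * exp (- (\<i> * of_real (\<nu> * sin y - \<nu> * y))))) = - 1 * (LBINT y:{0..pi}. of_real (sin y) * exp (- (\<i> * of_real (\<nu> * sin y - \<nu> * y))))"
    by (rule set_integral_mult_right)
  finally have p: "prim (exp \<zeta>) (- (\<i> * of_real pi)) = - (LBINT y:{0..pi}. of_real (sin y) * exp (- (\<i> * of_real (\<nu> * sin y - \<nu> * y))))" by simp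
  show ?thesis
    using saddle_int_eq_horizontal[OF i] p unfolding im k set_integral_mult_right by simp
qed

lemma set_integral_cnj: "(LINT x:A|M. cnj (f x)) = cnj (LINT x:A|M. f x)"
  unfolding set_lebesgue_integral_def Bochner_Integration.integral_cnj[symmetric] by (intro Bochner_Integration.integral_cong) auto

text \<open>Adding the conjugate values at \<plusminus> i pi turns the exponentials into cosines and
  yields two of the three integrals of \<open>bessel_Y'_integral\<close>. The third, with exponent -
  \<nu> sinh t + \<nu> t, is \<open>saddle_int\<close> at ln \<nu>.\<close>

lemma bessel_Y'_saddle_int:
  assumes \<nu>: "\<nu> > 0"
  shows "bessel_Y' (of_real \<nu>) = (saddle_int (of_real (ln \<nu>))
     - (saddle_int (Complex (ln \<nu>) pi) + saddle_int (Complex (ln \<nu>) (- pi))) / 2) / pi"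
proof -
  define A where "A = (LBINT y:{0..pi}. of_real (sin y) * exp (- (\<i> * of_real (\<nu> * sin y - \<nu> * y))))"
  define B where "B = (LBINT t:{0..}. complex_of_real (sinh t) * exp (- (of_real \<nu> * of_real (sinh t)) - of_real \<nu> * of_real t))"
  have P: "saddle_int (Complex (ln \<nu>) pi) = - (A + exp (\<i> * of_real (pi * \<nu>)) * B)"
    unfolding A_def B_def by (rule saddle_int_negative_axis[OF \<nu>])
  have "saddle_int (Complex (ln \<nu>) (- pi)) = cnj (saddle_int (Complex (ln \<nu>) pi))"
    by (simp add: saddle_int_cnj[symmetric] complex_cnj)
  also have "\<dots> = - (cnj A + exp (- (\<i> * of_real (pi * \<nu>))) * cnj B)"
    unfolding P by (simp add: exp_cnj)
  also have "cnj B = B"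
    unfolding B_def set_integral_cnj[symmetric] by (simp add: exp_cnj)
  finally have P': "saddle_int (Complex (ln \<nu>) (- pi)) = - (cnj A + exp (- (\<i> * of_real (pi * \<nu>))) * B)" .
  have c: "continuous_on UNIV (\<lambda>y. complex_of_real (sin y) * exp (- (\<i> * of_real (\<nu> * sin y - \<nu> * y))))"
    "continuous_on UNIV (\<lambda>y. cnj (complex_of_real (sin y) * exp (- (\<i> * of_real (\<nu> * sin y - \<nu> * y)))))"
    by (intro continuous_intros)+
  have "A + cnj A = (LBINT y:{0..pi}. of_real (sin y) * exp (- (\<i> * of_real (\<nu> * sin y - \<nu> * y))) + cnj (of_real (sin y) * exp (- (\<i> * of_real (\<nu> * sin y - \<nu> * y)))))"
    unfolding A_def set_integral_cnj[symmetric]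
    by (rule set_integral_add(2)[symmetric]) (intro set_integrable_Icc_continuous c)+
  also have "(\<lambda>y. of_real (sin y) * exp (- (\<i> * of_real (\<nu> * sin y - \<nu> * y))) + cnj (of_real (sin y) * exp (- (\<i> * of_real (\<nu> * sin y - \<nu> * y)))))
     = (\<lambda>y. 2 * (of_real (sin y) * cos (of_real \<nu> * of_real (sin y) - of_real \<nu> * of_real y)))"
    by (auto simp: exp_cnj cos_exp_eq algebra_simps)
  finally have AA: "A + cnj A = 2 * (LBINT y:{0..pi}. of_real (sin y) * cos (of_real \<nu> * of_real (sin y) - of_real \<nu> * of_real y))"
    unfolding set_integral_mult_right .
  have EE: "exp (\<i> * of_real (pi * \<nu>)) + exp (- (\<i> * of_real (pi * \<nu>))) = 2 * cos (of_real pi * of_real \<nu>)"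
    by (simp add: cos_exp_eq)
  have gen: "s = - (2 * X + 2 * Y * B) \<Longrightarrow> - s / 2 = X + Y * B" for s X Y :: complex
    by (simp del: minus_add_distrib add: add_divide_distrib)
  have "saddle_int (Complex (ln \<nu>) pi) + saddle_int (Complex (ln \<nu>) (- pi)) = - ((A + cnj A) + (exp (\<i> * of_real (pi * \<nu>)) + exp (- (\<i> * of_real (pi * \<nu>)))) * B)"
    unfolding P P' by (simp add: algebra_simps)
  hence S: "- (saddle_int (Complex (ln \<nu>) pi) + saddle_int (Complex (ln \<nu>) (- pi))) / 2 =
     (LBINT y:{0..pi}. of_real (sin y) * cos (of_real \<nu> * of_real (sin y) - of_real \<nu> * of_real y)) + cos (of_real pi * of_real \<nu>) * B"
    unfolding AA EE by (rule gen)
  have "saddle_int (of_real (ln \<nu>)) = (LBINT t:{0..}. of_real (sinh t) * exp (- (of_real \<nu> * of_real (sinh t)) - (- of_real \<nu>) * of_real t))"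
  proof -
    have "(LBINT t:{0..}. complex_of_real (sinh t) * exp (- (of_real \<nu> * of_real (sinh t)) - (- of_real \<nu>) * of_real t)) = (LBINT t:{0..}. of_real (sinh t * rexp \<nu> t))"
      by (intro arg_cong[where f = "set_lebesgue_integral lborel {0..}"]) (auto simp: rphase_def exp_of_real[symmetric] algebra_simps)
    thus ?thesis unfolding saddle_int_real(2)[OF \<nu>] set_integral_complex_of_real set_integral_Ici_eq by simp
  qed
  thus ?thesis
    using bessel_Y'_integral[of "of_real \<nu>"] \<nu> unfolding B_def[symmetric] S[symmetric]
    by (simp add: algebra_simps diff_divide_distrib add_divide_distrib)
qed

section \<open>Joint analyticity in the order and the argument\<close>

lemma rGamma_shift_bound:
  obtains C where "C > 0" "\<And>\<mu> k. cmod \<mu> \<le> real K \<Longrightarrow> cmod (rGamma (\<mu> + of_nat k + 1)) \<le> C"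
proof -
  have "compact (rGamma ` cball (0::complex) (2 * K + 2))"
    by (intro compact_continuous_image compact_cball holomorphic_on_imp_continuous_on holomorphic_rGamma)
  then obtain C where C: "C > 0" "\<And>x. x \<in> cball (0::complex) (2 * K + 2) \<Longrightarrow> cmod (rGamma x) \<le> C"
    by (auto dest!: compact_imp_bounded simp: bounded_pos)
  have "cmod (rGamma (\<mu> + of_nat k + 1)) \<le> C" if \<mu>: "cmod \<mu> \<le> real K" for \<mu> k
  proof (induction k)
    case 0
    have "cmod (\<mu> + 1) \<le> cmod \<mu> + 1" using norm_triangle_ineq[of \<mu> 1] by simp
    thus ?case using \<mu> by (intro C(2)) simp
  next
    case (Suc k)
    show ?case
    proof (cases "k \<le> K")
      case True
      have "cmod (\<mu> + of_nat (Suc k) + 1) \<le> cmod \<mu> + cmod (of_nat (k + 2))"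
        using norm_triangle_ineq[of \<mu> "of_nat (k + 2)"] by (simp add: algebra_simps)
      also have "\<dots> \<le> 2 * K + 2" using \<mu> True unfolding norm_of_nat by simp
      finally show ?thesis by (intro C(2)) simp
    next
      case False
      \<comment> \<open>For k > K the factor \<mu> + k + 1 has modulus at least 1, so by the
        functional equation the values no longer increase in modulus. The arguments for smaller k
        lie in a fixed compact disc.\<close>
      have "1 \<le> Re (\<mu> + of_nat k + 1)" using False \<mu> abs_Re_le_cmod[of \<mu>] by simp
      hence 1: "1 \<le> cmod (\<mu> + of_nat k + 1)" using complex_Re_le_cmod order_trans by blast
      have "1 * cmod (rGamma (\<mu> + of_nat (Suc k) + 1)) \<le> cmod (\<mu> + of_nat k + 1) * cmod (rGamma (\<mu> + of_nat (Suc k) + 1))"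
        using 1 by (intro mult_right_mono) auto
      also have "\<dots> = cmod (rGamma (\<mu> + of_nat k + 1))"
        using rGamma_plus1[of "\<mu> + of_nat k + 1"] by (simp flip: norm_mult add: algebra_simps)
      finally show ?thesis using Suc by simp
    qed
  qed
  thus ?thesis using that C(1) by blast
qed

definition bessel_coeff :: "complex \<Rightarrow> nat \<Rightarrow> complex" where
  "bessel_coeff \<mu> k = (-1) ^ k * rGamma (\<mu> + of_nat k + 1) / fact k"

text \<open>J without its branched factor. It is analytic in the order as well as in y, so both may
  vary together in Y'_\<nu>(\<nu>).\<close>

definition bessel_E :: "complex \<Rightarrow> complex \<Rightarrow> complex" where
  "bessel_E \<mu> y = (\<Sum>k. bessel_coeff \<mu> k * y ^ k)"

lemma bessel_J_eq_bessel_E: "bessel_J \<mu> z = (z / 2) powr \<mu> * bessel_E \<mu> ((z / 2)\<^sup>2)"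
  unfolding bessel_J_def bessel_E_def bessel_coeff_def power_mult
  by (intro arg_cong2[where f = times] suminf_cong) (auto simp: mult_ac)

lemma bessel_coeff_bound:
  assumes "cmod (rGamma (\<mu> + of_nat k + 1)) \<le> C" "cmod y \<le> Y" "C \<ge> 0"
  shows "cmod (bessel_coeff \<mu> k * y ^ k) \<le> C * (Y ^ k / fact k)"
proof -
  have "cmod (bessel_coeff \<mu> k * y ^ k) = cmod (rGamma (\<mu> + of_nat k + 1)) * (cmod y ^ k / fact k)"
    by (simp add: bessel_coeff_def norm_mult norm_divide norm_power)
  also have "\<dots> \<le> C * (Y ^ k / fact k)"
    using assms by (intro mult_mono divide_right_mono power_mono) auto
  finally show ?thesis .
qed

lemma summable_bessel_coeff: "summable (\<lambda>k. bessel_coeff \<mu> k * y ^ k)"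
proof -
  obtain K :: nat where K: "cmod \<mu> \<le> real K" using real_arch_simple by blast
  obtain C where "C > 0" "\<And>\<mu> k. cmod \<mu> \<le> real K \<Longrightarrow> cmod (rGamma (\<mu> + of_nat k + 1)) \<le> C"
    using rGamma_shift_bound[of K] by blast
  hence b: "cmod (bessel_coeff \<mu> k * y ^ k) \<le> C * (cmod y ^ k / fact k)" for k
    using K by (intro bessel_coeff_bound) auto
  have "summable (\<lambda>k. C * (cmod y ^ k / fact k))"
    using summable_exp[of "cmod y"] by (intro summable_mult) (simp add: field_simps)
  thus ?thesis by (rule summable_comparison_test'[of _ 0, OF _ b])
qed

text \<open>The classical rule that the derivative of z^(-\<mu>) J_\<mu> is - z^(-\<mu>)
  J_(\<mu>+1), in the variable y = (z / 2)^2.\<close>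

lemma bessel_E_deriv: "(bessel_E \<mu> has_field_derivative - bessel_E (\<mu> + 1) y) (at y)"
proof -
  have "diffs (bessel_coeff \<mu>) k * y ^ k = - (bessel_coeff (\<mu> + 1) k * y ^ k)" for k
  proof -
    have "bessel_coeff \<mu> (Suc k) = - ((-1) ^ k * rGamma (\<mu> + 1 + of_nat k + 1)) / (of_nat (Suc k) * fact k)"
      by (simp add: bessel_coeff_def algebra_simps)
    hence "of_nat (Suc k) * bessel_coeff \<mu> (Suc k) = - ((-1) ^ k * rGamma (\<mu> + 1 + of_nat k + 1)) / fact k"
      by (simp del: of_nat_Suc)
    thus ?thesis by (simp add: diffs_def bessel_coeff_def)
  qed
  hence "(\<Sum>k. diffs (bessel_coeff \<mu>) k * y ^ k) = - bessel_E (\<mu> + 1) y"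
    unfolding bessel_E_def by (simp add: suminf_minus summable_bessel_coeff)
  thus ?thesis
    using termdiffs_strong_converges_everywhere[of "bessel_coeff \<mu>" y, OF summable_bessel_coeff]
    by (simp add: bessel_E_def[abs_def])
qed

text \<open>Near each point the terms are dominated by C Y^n / n!, where C is uniform in the order
  by \<open>rGamma_shift_bound\<close>; a locally uniform limit of analytic functions is
  analytic.\<close>

lemma bessel_E_holomorphic:
  assumes "p holomorphic_on S" "q holomorphic_on S" "open S"
  shows "(\<lambda>w. bessel_E (p w) (q w)) holomorphic_on S"
proof -
  have tg: "\<exists>d h. 0 < d \<and> summable h \<and> range h \<subseteq> \<real>\<^sub>\<ge>\<^sub>0 \<and> (\<forall>\<^sub>F n in sequentially. \<forall>w\<in>ball x d \<inter> S. cmod (bessel_coeff (p w) n * q w ^ n) \<le> cmod (h n))"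
    if x: "x \<in> S" for x
  proof -
    obtain K :: nat where K: "cmod (p x) + 1 \<le> real K" using real_arch_simple by blast
    obtain C where C: "C > 0" "\<And>\<mu> k. cmod \<mu> \<le> real K \<Longrightarrow> cmod (rGamma (\<mu> + of_nat k + 1)) \<le> C"
      using rGamma_shift_bound[of K] by blast
    have c: "continuous_on S p" "continuous_on S q" using assms by (auto intro: holomorphic_on_imp_continuous_on)
    obtain d1 where d1: "d1 > 0" "\<And>w. w \<in> S \<Longrightarrow> dist w x < d1 \<Longrightarrow> dist (p w) (p x) < 1"
      using c(1) x unfolding continuous_on_iff by (meson zero_less_one)
    obtain d2 where d2: "d2 > 0" "\<And>w. w \<in> S \<Longrightarrow> dist w x < d2 \<Longrightarrow> dist (q w) (q x) < 1"
      using c(2) x unfolding continuous_on_iff by (meson zero_less_one)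
    define Y where "Y = cmod (q x) + 1"
    define h where "h k = complex_of_real (C * (Y ^ k / fact k))" for k
    have Y: "Y > 0" by (simp add: Y_def add_nonneg_pos)
    have "summable (\<lambda>k. C * (Y ^ k / fact k))"
      using summable_exp[of Y] by (intro summable_mult) (simp add: field_simps)
    hence "summable h" unfolding h_def by (rule summable_of_real)
    moreover have "range h \<subseteq> \<real>\<^sub>\<ge>\<^sub>0" unfolding h_def using C(1) Y by (simp only: image_subset_iff nonneg_Reals_of_real_iff) simp
    moreover have "cmod (bessel_coeff (p w) n * q w ^ n) \<le> cmod (h n)" if w: "w \<in> ball x (min d1 d2) \<inter> S" for w n
    proof -
      have "cmod (p w) \<le> cmod (p x) + 1" "cmod (q w) \<le> Y"
        using d1(2)[of w] d2(2)[of w] w norm_triangle_sub[of "p w" "p x"] norm_triangle_sub[of "q w" "q x"]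
        by (auto simp: Y_def dist_norm norm_minus_commute)
      hence "cmod (bessel_coeff (p w) n * q w ^ n) \<le> C * (Y ^ n / fact n)"
        using C K by (intro bessel_coeff_bound) auto
      thus ?thesis using C(1) Y by (simp add: h_def norm_mult norm_divide norm_power)
    qed
    ultimately show ?thesis using d1(1) d2(1)
      by (intro exI[of _ "min d1 d2"] exI[of _ h] conjI always_eventually allI ballI) auto
  qed
  have fd: "(\<lambda>w. bessel_coeff (p w) n * q w ^ n) field_differentiable (at x)" if "x \<in> S" for n x
  proof -
    have "(\<lambda>w. bessel_coeff (p w) n * q w ^ n) holomorphic_on S"
      unfolding bessel_coeff_def by (intro holomorphic_intros assms) auto
    thus ?thesis using that assms(3) by (simp add: holomorphic_on_imp_differentiable_at)
  qed
  obtain g where g: "\<forall>x\<in>S. (\<lambda>n. bessel_coeff (p x) n * q x ^ n) sums g x \<and> g field_differentiable (at x)"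
    by (rule series_differentiable_comparison_complex[where f = "\<lambda>n w. bessel_coeff (p w) n * q w ^ n", OF assms(3) fd tg])
  hence "g holomorphic_on S" by (auto simp: holomorphic_on_def intro: field_differentiable_at_within)
  thus ?thesis
    by (rule holomorphic_transform) (use g in \<open>simp add: bessel_E_def sums_iff\<close>)
qed

lemma bessel_J_deriv:
  assumes z: "z \<notin> \<real>\<^sub>\<le>\<^sub>0"
  shows "(bessel_J \<mu> has_field_derivative (z / 2) powr \<mu> * (\<mu> / z * bessel_E \<mu> ((z / 2)\<^sup>2) - z / 2 * bessel_E (\<mu> + 1) ((z / 2)\<^sup>2))) (at z)"
proof -
  have z2: "z / 2 \<notin> \<real>\<^sub>\<le>\<^sub>0" "z \<noteq> 0" using z by (auto simp: complex_nonpos_Reals_iff)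
  have q: "((\<lambda>z. (z / 2)\<^sup>2) has_field_derivative z / 2) (at z)"
    by (auto intro!: derivative_eq_intros)
  have E: "((\<lambda>z. bessel_E \<mu> ((z / 2)\<^sup>2)) has_field_derivative - bessel_E (\<mu> + 1) ((z / 2)\<^sup>2) * (z / 2)) (at z)"
    by (rule DERIV_chain2[OF bessel_E_deriv q])
  have w: "((\<lambda>w. w powr \<mu>) has_field_derivative \<mu> * (z / 2) powr (\<mu> - 1)) (at (z / 2))"
    by (rule has_field_derivative_powr[OF z2(1)])
  have "((\<lambda>z. (z / 2) powr \<mu>) has_field_derivative \<mu> * (z / 2) powr (\<mu> - 1) * (1 / 2)) (at z)"
    by (rule DERIV_chain2[where f = "\<lambda>w. w powr \<mu>" and g = "\<lambda>z. z / 2" and x = z, OF w]) (auto intro!: derivative_eq_intros)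
  also have "\<mu> * (z / 2) powr (\<mu> - 1) * (1 / 2) = (z / 2) powr \<mu> * (\<mu> / z)"
    using z2 by (simp add: powr_diff)
  finally have P: "((\<lambda>z. (z / 2) powr \<mu>) has_field_derivative (z / 2) powr \<mu> * (\<mu> / z)) (at z)" .
  show ?thesis unfolding bessel_J_eq_bessel_E[abs_def]
    using DERIV_mult[OF P E] by (simp add: algebra_simps)
qed

text \<open>Differentiating J at fixed order first and then setting the order equal to the argument
  leaves an explicit formula with denominator sin (pi \<nu>), analytic where that does not
  vanish.\<close>

lemma bessel_Y'_holomorphic: "bessel_Y' holomorphic_on {\<nu>. \<nu> \<notin> \<real>\<^sub>\<le>\<^sub>0 \<and> \<nu> \<notin> \<int>}"
proof -
  define S where "S = {\<nu> :: complex. \<nu> \<notin> \<real>\<^sub>\<le>\<^sub>0 \<and> \<nu> \<notin> \<int>}"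
  define J' where "J' \<mu> z = (z / 2) powr \<mu> * (\<mu> / z * bessel_E \<mu> ((z / 2)\<^sup>2) - z / 2 * bessel_E (\<mu> + 1) ((z / 2)\<^sup>2))" for \<mu> z
  have "S = - \<real>\<^sub>\<le>\<^sub>0 \<inter> - \<int>" by (auto simp: S_def)
  hence S: "open S" by (simp add: open_Compl open_Int closed_nonpos_Reals_complex closed_Ints)
  have z2: "\<nu> / 2 \<notin> \<real>\<^sub>\<le>\<^sub>0" "\<nu> \<noteq> 0" if "\<nu> \<in> S" for \<nu> using that by (auto simp: S_def complex_nonpos_Reals_iff)
  have s: "sin (of_real pi * \<nu>) \<noteq> 0" if "\<nu> \<in> S" for \<nu>
    by (rule sin_pi_mult_nonzero) (use that in \<open>simp add: S_def\<close>)
  have eq: "bessel_Y' \<nu> = (J' \<nu> \<nu> * cos (of_real pi * \<nu>) - J' (- \<nu>) \<nu>) / sin (of_real pi * \<nu>)" if \<nu>: "\<nu> \<in> S" for \<nu>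
  proof -
    have J: "(bessel_J \<mu> has_field_derivative J' \<mu> \<nu>) (at \<nu>)" for \<mu>
      unfolding J'_def using \<nu> by (intro bessel_J_deriv) (auto simp: S_def)
    have "(bessel_Y_nonint \<nu> has_field_derivative (J' \<nu> \<nu> * cos (of_real pi * \<nu>) - J' (- \<nu>) \<nu>) / sin (of_real pi * \<nu>)) (at \<nu>)"
      unfolding bessel_Y_nonint_def by (intro DERIV_cdivide DERIV_diff DERIV_cmult_right J)
    moreover have "bessel_Y \<nu> = bessel_Y_nonint \<nu>" using \<nu> by (auto simp: bessel_Y_def S_def)
    ultimately show ?thesis unfolding bessel_Y'_def using DERIV_imp_deriv by simp
  qed
  have "(\<lambda>\<nu>. (J' \<nu> \<nu> * cos (of_real pi * \<nu>) - J' (- \<nu>) \<nu>) / sin (of_real pi * \<nu>)) holomorphic_on S"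
    unfolding J'_def by (intro holomorphic_intros bessel_E_holomorphic S) (use z2 s in auto)
  thus ?thesis unfolding S_def[symmetric] by (rule holomorphic_transform) (simp add: eq)
qed

subsection \<open>The remainder as an integral\<close>

text \<open>
  The index \<open>j\<close> is \<open>N mod 3\<close> for the remainder itself; any other value isolates a single term
  \<open>x ^ (N + 1) / (1 + x ^ 3)\<close>, which can then be rotated on its own.
\<close>

definition disp_num :: "nat \<Rightarrow> 'a::field \<Rightarrow> 'a" where
  "disp_num j x = (if j = 0 then 1 - x else if j = 1 then 1 + x\<^sup>2 else if j = 2 then x\<^sup>2 - x else 1)"

definition disp_ratio :: "nat \<Rightarrow> nat \<Rightarrow> 'a::field \<Rightarrow> 'a" where
  "disp_ratio j N x = (-1) ^ (N + 1) * x ^ (N + 1) * (disp_num j x / (1 + x ^ 3))"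

lemma disp_num_bound: "cmod (disp_num j x) \<le> 2 * (1 + cmod x ^ 3)"
proof -
  define r where "r = cmod x"
  have r: "r \<ge> 0" by (simp add: r_def)
  have "r \<le> 1 + r ^ 3 \<and> r\<^sup>2 \<le> 1 + r ^ 3"
  proof (cases "r \<le> 1")
    case True
    hence "r\<^sup>2 \<le> 1" using r by (simp add: power_le_one)
    thus ?thesis using True r by (simp add: add_increasing2)
  next
    case False
    hence "r ^ 1 \<le> r ^ 3" "r\<^sup>2 \<le> r ^ 3" by (intro power_increasing; simp)+
    thus ?thesis by simp
  qed
  hence X: "r \<le> 1 + r ^ 3" "r\<^sup>2 \<le> 1 + r ^ 3" "1 \<le> 1 + r ^ 3" using r by auto
  have n: "cmod (1 - x) \<le> 1 + r" "cmod (1 + x\<^sup>2) \<le> 1 + r\<^sup>2" "cmod (x\<^sup>2 - x) \<le> r\<^sup>2 + r"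
    using norm_triangle_ineq4[of 1 x] norm_triangle_ineq[of 1 "x\<^sup>2"] norm_triangle_ineq4[of "x\<^sup>2" x]
    by (simp_all add: r_def norm_power)
  have gen: "a \<le> p + q \<Longrightarrow> p \<le> X \<Longrightarrow> q \<le> X \<Longrightarrow> a \<le> 2 * X" for a p q X :: real by linarith
  show ?thesis unfolding disp_num_def r_def[symmetric]
    using gen[OF n(1) X(3,1)] gen[OF n(2) X(3,2)] gen[OF n(3) X(2,1)] X(3) by simp
qed

lemma disp_ratio_bound:
  assumes k: "k > 0" and le: "k * (1 + cmod x ^ 3) \<le> cmod (1 + x ^ 3)"
  shows "cmod (disp_ratio j N x) \<le> 2 / k * cmod x ^ (N + 1)"
proof -
  have "0 < 1 + cmod x ^ 3" by (simp add: add_pos_nonneg)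
  hence "0 < k * (1 + cmod x ^ 3)" using k by simp
  hence pos: "0 < cmod (1 + x ^ 3)" using le by linarith
  have "k * cmod (disp_num j x) \<le> k * (2 * (1 + cmod x ^ 3))" using k disp_num_bound by (intro mult_left_mono) auto
  also have "\<dots> = 2 * (k * (1 + cmod x ^ 3))" by (rule mult.left_commute)
  also have "\<dots> \<le> 2 * cmod (1 + x ^ 3)" using le by (intro mult_left_mono) auto
  finally have "cmod (disp_num j x) / cmod (1 + x ^ 3) \<le> 2 / k"
    using k pos by (simp add: divide_simps mult.commute)
  hence "cmod (disp_num j x) / cmod (1 + x ^ 3) * cmod x ^ (N + 1) \<le> 2 / k * cmod x ^ (N + 1)"
    by (intro mult_right_mono) auto
  thus ?thesis by (simp add: disp_ratio_def norm_mult norm_divide norm_power mult_ac)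
qed

text \<open>With w = a + i b one has |w|^2 |1 + w^2|^2 = (a (1 + |w|^2))^2 + (b (1 - |w|^2))^2, and
  the last square is dropped. It is applied to w = n / \<mu>, where w^2 = x^3, and keeps 1 + x^3
  away from 0 for \<mu> in the right half-plane.\<close>

lemma norm_one_plus_square:
  assumes "Re w > 0"
  shows "Re w / cmod w * (1 + (cmod w)\<^sup>2) \<le> cmod (1 + w\<^sup>2)"
proof -
  define a b where "a = Re w" and "b = Im w"
  have w: "w = Complex a b" by (simp add: a_def b_def)
  have r2: "(cmod w)\<^sup>2 = a\<^sup>2 + b\<^sup>2" by (simp add: cmod_power2 a_def b_def)
  have "(cmod (1 + w\<^sup>2))\<^sup>2 = (1 + (a\<^sup>2 - b\<^sup>2))\<^sup>2 + (2 * a * b)\<^sup>2"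
    unfolding cmod_power2 by (simp add: a_def b_def power2_eq_square)
  hence "(cmod w * cmod (1 + w\<^sup>2))\<^sup>2 = (a\<^sup>2 + b\<^sup>2) * ((1 + (a\<^sup>2 - b\<^sup>2))\<^sup>2 + (2 * a * b)\<^sup>2)"
    by (simp add: power_mult_distrib r2)
  also have "\<dots> = (a * (1 + (a\<^sup>2 + b\<^sup>2)))\<^sup>2 + (b * (1 - (a\<^sup>2 + b\<^sup>2)))\<^sup>2"
    by (simp add: power2_eq_square algebra_simps)
  finally have "(a * (1 + (cmod w)\<^sup>2))\<^sup>2 \<le> (cmod w * cmod (1 + w\<^sup>2))\<^sup>2"
    unfolding r2 by simp
  hence "a * (1 + (cmod w)\<^sup>2) \<le> cmod w * cmod (1 + w\<^sup>2)"
    by (rule power2_le_imp_le) simp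
  moreover have "cmod w > 0" using assms by auto
  ultimately show ?thesis unfolding a_def by (simp add: divide_simps mult.commute)
qed

text \<open>The variable x = (n / \<mu>)^(2/3), with the powers of n and \<mu> taken separately so
  that it is analytic in \<mu> off the cut.\<close>

definition disp_arg :: "complex \<Rightarrow> real \<Rightarrow> complex" where
  "disp_arg \<mu> n = of_real (n powr (2/3)) * \<mu> powr (- (2/3))"

lemma disp_arg_cube:
  assumes "n > 0" "\<mu> \<noteq> 0"
  shows "disp_arg \<mu> n ^ 3 = (of_real n / \<mu>)\<^sup>2"
proof -
  have "(\<mu> powr (- (2/3))) ^ 3 = exp (of_nat 3 * (- (2/3) * Ln \<mu>))"
    using assms by (simp only: powr_def exp_of_nat_mult[symmetric] if_False)
  also have "of_nat 3 * (- (2/3) * Ln \<mu>) = - (of_nat 2 * Ln \<mu>)" by simp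
  also have "exp (- (of_nat 2 * Ln \<mu>)) = 1 / \<mu>\<^sup>2"
    using assms by (simp only: exp_minus exp_of_nat_mult exp_Ln) (simp add: divide_inverse)
  finally have 1: "(\<mu> powr (- (2/3))) ^ 3 = 1 / \<mu>\<^sup>2" .
  have "(n powr (2/3)) ^ 3 = n\<^sup>2"
    using assms by (simp add: powr_power powr_numeral)
  hence "complex_of_real (n powr (2/3)) ^ 3 = of_real n ^ 2" by (simp flip: of_real_power)
  with 1 show ?thesis by (simp add: disp_arg_def power_mult_distrib power_divide)
qed

lemma norm_disp_arg: "n \<ge> 0 \<Longrightarrow> cmod (disp_arg \<mu> n) = n powr (2/3) * cmod \<mu> powr (- (2/3))"
  using norm_powr_real_powr'[of "- (2/3)" \<mu>] by (simp add: disp_arg_def norm_mult)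

lemma norm_disp_arg_power: "n > 0 \<Longrightarrow> \<mu> \<noteq> 0 \<Longrightarrow> cmod (disp_arg \<mu> n) ^ (N + 1) = n powr (expo N) * cmod \<mu> powr (- (expo N))"
proof -
  assume n: "n > 0" "\<mu> \<noteq> 0"
  have e: "(y powr a) ^ (N + 1) = y powr (a * (real N + 1))" if "y > 0" for y a :: real
    using that by (simp add: powr_power mult.commute add.commute del: power_Suc)
  have p: "2 / 3 * (real N + 1) = expo N" "- (2 / 3) * (real N + 1) = - (expo N)" by simp_all
  show ?thesis unfolding norm_disp_arg[OF less_imp_le[OF n(1)]] power_mult_distrib
    using e[OF n(1), of "2 / 3"] e[of "cmod \<mu>" "- (2 / 3)"] n(2) unfolding p by simp
qed

lemma disp_arg_sector:
  assumes n: "n > 0" and \<mu>: "Re \<mu> > 0"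
  shows "Re \<mu> / cmod \<mu> * (1 + cmod (disp_arg \<mu> n) ^ 3) \<le> cmod (1 + disp_arg \<mu> n ^ 3)"
proof -
  have \<mu>0: "\<mu> \<noteq> 0" using \<mu> by auto
  define w where "w = of_real n / \<mu>"
  have re: "Re w = n * Re \<mu> / (cmod \<mu>)\<^sup>2" by (simp add: w_def Re_divide cmod_power2)
  have nw: "cmod w = n / cmod \<mu>" using n by (simp add: w_def norm_divide)
  have "Re w > 0" unfolding re using n \<mu> \<mu>0 by simp
  moreover have "Re w / cmod w = Re \<mu> / cmod \<mu>" unfolding re nw using n \<mu>0 by (simp add: power2_eq_square)
  ultimately show ?thesis
    using norm_one_plus_square[of w] unfolding norm_power[symmetric] disp_arg_cube[OF n \<mu>0] w_def[symmetric] by simp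
qed

lemma one_plus_disp_arg_cube_nz: "n > 0 \<Longrightarrow> Re \<mu> > 0 \<Longrightarrow> 1 + disp_arg \<mu> n ^ 3 \<noteq> 0"
proof
  assume a: "n > 0" "Re \<mu> > 0" "1 + disp_arg \<mu> n ^ 3 = 0"
  have "0 < Re \<mu> / cmod \<mu> * (1 + cmod (disp_arg \<mu> n) ^ 3)"
    using a by (intro mult_pos_pos divide_pos_pos add_pos_nonneg) auto
  thus False using disp_arg_sector[OF a(1,2)] a(3) by simp
qed

definition disp_kern :: "nat \<Rightarrow> nat \<Rightarrow> complex \<Rightarrow> complex \<Rightarrow> real \<Rightarrow> complex" where
  "disp_kern j N c \<mu> n = cut_h (c * of_real n) * (disp_ratio j N (disp_arg \<mu> n) / of_real n)"

abbreviation disp_int :: "nat \<Rightarrow> nat \<Rightarrow> complex \<Rightarrow> complex \<Rightarrow> complex" where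
  "disp_int j N c \<mu> \<equiv> LBINT n:{0<..}. disp_kern j N c \<mu> n"

text \<open>The bound is uniform for c in a half-plane and for \<mu> in a sector away from 0. It
  gives integrability for fixed parameters and also the majorant for differentiation in
  them.\<close>

lemma disp_kern_bound:
  assumes "0 < c0" "c0 \<le> Re c" "0 < k" "k \<le> Re \<mu> / cmod \<mu>" "0 < m" "m \<le> cmod \<mu>" "n > 0"
  shows "cmod (disp_kern j N c \<mu> n) \<le> 2 / k * m powr (- (expo N)) * (cut_hr (c0 * n) * n powr (expo_pred N))"
proof -
  have \<mu>0: "\<mu> \<noteq> 0" using assms by auto
  have "0 < Re \<mu> / cmod \<mu>" using assms by linarith
  hence re: "Re \<mu> > 0" using \<mu>0 by (simp add: zero_less_divide_iff)
  have "k * (1 + cmod (disp_arg \<mu> n) ^ 3) \<le> Re \<mu> / cmod \<mu> * (1 + cmod (disp_arg \<mu> n) ^ 3)"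
    using assms by (intro mult_right_mono) auto
  also have "\<dots> \<le> cmod (1 + disp_arg \<mu> n ^ 3)" using assms re by (intro disp_arg_sector)
  finally have "cmod (disp_ratio j N (disp_arg \<mu> n)) \<le> 2 / k * cmod (disp_arg \<mu> n) ^ (N + 1)"
    by (rule disp_ratio_bound[OF assms(3)])
  also have "\<dots> = 2 / k * (n powr (expo N) * cmod \<mu> powr (- (expo N)))"
    using norm_disp_arg_power[OF assms(7) \<mu>0, of N] by simp
  also have "\<dots> \<le> 2 / k * (n powr (expo N) * m powr (- (expo N)))"
    using assms by (intro mult_left_mono powr_mono2') auto
  finally have r: "cmod (disp_ratio j N (disp_arg \<mu> n)) \<le> 2 / k * (n powr (expo N) * m powr (- (expo N)))" .
  have "c0 * n \<le> Re (c * of_real n)" "0 < c0 * n" using assms by (auto intro: mult_right_mono)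
  hence h: "cmod (cut_h (c * of_real n)) \<le> cut_hr (c0 * n)"
    using norm_cut_h_le[of "c * of_real n"] cut_hr_antimono[of "c0 * n" "Re (c * of_real n)"] by linarith
  have e: "expo N = expo_pred N + 1" by (simp add: field_simps)
  have "cmod (disp_kern j N c \<mu> n) = cmod (cut_h (c * of_real n)) * (cmod (disp_ratio j N (disp_arg \<mu> n)) / n)"
    using assms by (simp add: disp_kern_def norm_mult norm_divide)
  also have "\<dots> \<le> cut_hr (c0 * n) * (2 / k * (n powr (expo N) * m powr (- (expo N))) / n)"
    using assms cut_hr_pos[of "c0 * n"] by (intro mult_mono h divide_right_mono r) auto
  also have "n powr (expo N) = n powr (expo_pred N) * n"
    unfolding e powr_add using assms by simp
  also have "cut_hr (c0 * n) * (2 / k * (n powr (expo_pred N) * n * m powr (- (expo N))) / n)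
    = 2 / k * m powr (- (expo N)) * (cut_hr (c0 * n) * n powr (expo_pred N))"
    using assms by simp
  finally show ?thesis .
qed

lemma cut_hr_scaled_integrable:
  assumes "\<rho> > 0" "N \<ge> 1"
  shows "integrable_Ioi (\<lambda>n. cut_hr (\<rho> * n) * n powr (expo_pred N))"
proof -
  have "integrable_Ioi (\<lambda>n. cut_h (of_real \<rho> * of_real n) * of_real (n powr (expo_pred N)))"
    by (rule cut_h_times_integrable[where p = "expo_pred N" and C = 1])
      (use assms in \<open>auto intro!: continuous_intros continuous_on_powr_pos\<close>)
  hence "integrable_Ioi (\<lambda>n. cmod (cut_h (of_real \<rho> * of_real n) * of_real (n powr (expo_pred N))))"
    by (rule set_integrable_norm)
  also have "?this \<longleftrightarrow> ?thesis"
    using assms cut_hr_pos by (intro set_integrable_cong) (auto simp: cut_h_of_real norm_mult abs_of_pos simp flip: of_real_mult)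
  finally show ?thesis .
qed

lemma continuous_on_disp_kern:
  assumes "Re c > 0" "Re \<mu> > 0"
  shows "continuous_on {0<..} (disp_kern j N c \<mu>)"
proof -
  have a: "continuous_on {0<..} (disp_arg \<mu>)"
    unfolding disp_arg_def by (intro continuous_intros continuous_on_powr_pos) auto
  have "continuous_on {0<..} (\<lambda>n. disp_ratio j N (disp_arg \<mu> n))"
    unfolding disp_ratio_def disp_num_def
    by (cases "j = 0"; cases "j = 1"; cases "j = 2") (auto intro!: continuous_intros a simp: one_plus_disp_arg_cube_nz assms)
  thus ?thesis unfolding disp_kern_def
    by (intro continuous_intros continuous_on_cut_h) (use assms in auto)
qed

lemma disp_kern_integrable:
  assumes "Re c > 0" "Re \<mu> > 0" "N \<ge> 1"
  shows "integrable_Ioi (disp_kern j N c \<mu>)"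
proof (rule set_integrable_continuous_bound_Ioi[OF continuous_on_disp_kern[OF assms(1,2)]])
  have \<mu>: "cmod \<mu> > 0" using assms by auto
  show "integrable_Ioi (\<lambda>n. 2 / (Re \<mu> / cmod \<mu>) * cmod \<mu> powr (- (expo N)) * (cut_hr (Re c * n) * n powr (expo_pred N)))"
    by (intro set_integrable_mult_right cut_hr_scaled_integrable assms)
  show "cmod (disp_kern j N c \<mu> n) \<le> 2 / (Re \<mu> / cmod \<mu>) * cmod \<mu> powr (- (expo N)) * (cut_hr (Re c * n) * n powr (expo_pred N))"
    if "n > 0" for n by (rule disp_kern_bound) (use assms \<mu> that in auto)
qed

lemma disp_kern_holomorphic_param:
  assumes p: "p holomorphic_on S" "\<And>w. w \<in> S \<Longrightarrow> Re (p w) > 0"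
    and q: "q holomorphic_on S" "\<And>w. w \<in> S \<Longrightarrow> Re (q w) > 0" and n: "n > 0"
  shows "(\<lambda>w. disp_kern j N (p w) (q w) n) holomorphic_on S"
proof -
  have "q w \<notin> \<real>\<^sub>\<le>\<^sub>0" if "w \<in> S" for w using q(2)[OF that] by (auto simp: complex_nonpos_Reals_iff)
  hence "(\<lambda>w. disp_arg (q w) n) holomorphic_on S"
    unfolding disp_arg_def by (intro holomorphic_intros q)
  moreover have "(\<lambda>w. cut_h (p w * of_real n)) holomorphic_on S"
    by (intro cut_h_holomorphic holomorphic_intros p) (use p(2) n in simp)
  ultimately show ?thesis unfolding disp_kern_def disp_ratio_def disp_num_def
    by (cases "j = 0"; cases "j = 1"; cases "j = 2")
      (auto intro!: holomorphic_intros simp: one_plus_disp_arg_cube_nz q n)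
qed

text \<open>Near w0 the real parts of p and q stay above half their values and |q| below |q w0| + 1.
  This confines the parameters to a region where \<open>disp_kern_bound\<close> gives a single
  majorant.\<close>

lemma disp_kern_integral_holomorphic:
  assumes S: "open S" and p: "p holomorphic_on S" "\<And>w. w \<in> S \<Longrightarrow> Re (p w) > 0"
    and q: "q holomorphic_on S" "\<And>w. w \<in> S \<Longrightarrow> Re (q w) > 0" and N: "N \<ge> 1"
  shows "(\<lambda>w. LBINT n:{0<..}. disp_kern j N (p w) (q w) n) holomorphic_on S"
  unfolding holomorphic_on_def field_differentiable_def
proof
  fix w0 assume w0: "w0 \<in> S"
  have c: "isCont p w0" "isCont q w0"
    using p(1) q(1) S w0 holomorphic_on_imp_continuous_on continuous_on_eq_continuous_at by blast+
  define c0 where "c0 = Re (p w0) / 2"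
  define m where "m = Re (q w0) / 2"
  define M where "M = cmod (q w0) + 1"
  have pos: "c0 > 0" "m > 0" "M > 0" using p(2)[OF w0] q(2)[OF w0] by (auto simp: c0_def m_def M_def add_nonneg_pos)
  have "\<forall>\<^sub>F w in nhds w0. w \<in> S \<and> c0 < Re (p w) \<and> m < Re (q w) \<and> cmod (q w) < M"
  proof (intro eventually_conj)
    have l: "((\<lambda>w. Re (p w)) \<longlongrightarrow> Re (p w0)) (nhds w0)" "((\<lambda>w. Re (q w)) \<longlongrightarrow> Re (q w0)) (nhds w0)"
      "((\<lambda>w. cmod (q w)) \<longlongrightarrow> cmod (q w0)) (nhds w0)"
      using c by (auto intro!: tendsto_intros simp: isCont_def tendsto_nhds_iff)
    have "c0 < Re (p w0)" "m < Re (q w0)" "cmod (q w0) < M" using pos by (simp_all add: c0_def m_def M_def)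
    thus "\<forall>\<^sub>F w in nhds w0. c0 < Re (p w)" "\<forall>\<^sub>F w in nhds w0. m < Re (q w)" "\<forall>\<^sub>F w in nhds w0. cmod (q w) < M"
      using order_tendstoD(1)[OF l(1)] order_tendstoD(1)[OF l(2)] order_tendstoD(2)[OF l(3)] by simp_all
  qed (rule eventually_nhds_in_open[OF S w0])
  then obtain r where r: "r > 0" and sub: "\<And>w. w \<in> ball w0 r \<Longrightarrow> w \<in> S \<and> c0 < Re (p w) \<and> m < Re (q w) \<and> cmod (q w) < M"
    by (auto simp: eventually_nhds_metric dist_commute)
  define g where "g n = 2 / (m / M) * m powr (- (expo N)) * (cut_hr (c0 * n) * n powr (expo_pred N))" for n
  have "((\<lambda>w. \<integral>n. indicator {0<..} n *\<^sub>R disp_kern j N (p w) (q w) n \<partial>lborel) has_field_derivative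
     (\<integral>n. deriv (\<lambda>w. indicator {0<..} n *\<^sub>R disp_kern j N (p w) (q w) n) w0 \<partial>lborel)) (at w0)"
  proof (rule param_integral_holomorphic[OF _ _ r])
    show "(\<lambda>w. indicat_real {0<..} n *\<^sub>R disp_kern j N (p w) (q w) n) holomorphic_on ball w0 r" for n
    proof (cases "n > 0")
      case True
      have "(\<lambda>w. disp_kern j N (p w) (q w) n) holomorphic_on S"
        by (rule disp_kern_holomorphic_param[OF p q True])
      thus ?thesis using True sub by (auto intro: holomorphic_on_subset)
    qed simp
    show "(\<lambda>n. indicat_real {0<..} n *\<^sub>R disp_kern j N (p w) (q w) n) \<in> borel_measurable lborel" if "w \<in> ball w0 r" for w
      using disp_kern_integrable[of "p w" "q w" N] sub[OF that] N p q by (simp add: set_integrable_def)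
    show "integrable lborel (\<lambda>n. indicator {0<..} n *\<^sub>R g n)"
      unfolding set_integrable_def[symmetric] g_def
      by (intro set_integrable_mult_right cut_hr_scaled_integrable pos N)
    show "cmod (indicator {0<..} n *\<^sub>R disp_kern j N (p w) (q w) n) \<le> indicator {0<..} n *\<^sub>R g n" if w: "w \<in> ball w0 r" for w n
    proof (cases "n > 0")
      case True
      have q': "m < Re (q w)" "cmod (q w) < M" and p': "c0 < Re (p w)" using sub[OF w] by auto
      have qm: "m \<le> cmod (q w)" using q' complex_Re_le_cmod[of "q w"] by linarith
      have "m / M \<le> Re (q w) / cmod (q w)" using q' pos qm by (intro frac_le) auto
      hence "cmod (disp_kern j N (p w) (q w) n) \<le> g n"
        unfolding g_def using pos qm p' True by (intro disp_kern_bound) auto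
      thus ?thesis using True by simp
    qed simp
  qed
  thus "\<exists>D. ((\<lambda>w. LBINT n:{0<..}. disp_kern j N (p w) (q w) n) has_field_derivative D) (at w0 within S)"
    unfolding set_lebesgue_integral_def by (blast intro: has_field_derivative_at_within)
qed

section \<open>The remainder for positive \<nu>\<close>

lemma sin_square_thirds: "(sin ((2 * real n + 2) * pi / 3))\<^sup>2 = (if n mod 3 = 2 then 0 else 3 / 4)"
proof -
  define k r where "k = n div 3" and "r = n mod 3"
  have n: "n = 3 * k + r" by (simp add: k_def r_def)
  have "(2 * real n + 2) * pi / 3 = (2 * real r + 2) * pi / 3 + 2 * real k * pi"
    unfolding n by (simp add: field_simps)
  hence s: "sin ((2 * real n + 2) * pi / 3) = sin ((2 * real r + 2) * pi / 3)"
    by (simp only: sin_add sin_2npi cos_2npi mult_zero_right mult_1_right add_0_right)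
  have s3: "sin (2 * pi / 3) = sqrt 3 / 2"
    using sin_pi_minus[of "pi / 3"] sin_60 by (simp add: field_simps)
  have s4: "sin (4 * pi / 3) = - sin (pi / 3)"
    using sin_add[of pi "pi / 3"] by (simp add: field_simps)
  have q: "(sqrt 3 / 2)\<^sup>2 = 3 / (4 :: real)" by (simp add: power_divide)
  have "(sin (2 * pi / 3))\<^sup>2 = 3 / 4" "(sin (4 * pi / 3))\<^sup>2 = 3 / 4" unfolding s3 s4 sin_60 power2_minus q by simp_all
  moreover have "r < 3" by (simp add: r_def)
  hence "r = 0 \<or> r = 1 \<or> r = 2" by linarith
  ultimately show ?thesis unfolding s r_def[symmetric] by auto
qed

text \<open>The number 9 / 4 is 3 * (3 / 4): the 3 undoes the 1 / 3 in \<open>watson_coeff\<close>,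
  and 3 / 4 is the squared sine.\<close>

lemma remainder_term:
  "of_real (6 powr (expo n)) * D0 (2 * n + 1) * of_real ((sin ((2 * real n + 2) * pi / 3))\<^sup>2)
     * of_real (Gamma (expo n)) = complex_of_real ((if n mod 3 = 2 then 0 else 9 / 4) * disp_coeff n)"
proof -
  have gen: "a * d * s * g = 3 * s * (d * (1 / 3 * a * g))" for a d s g :: complex by simp
  show ?thesis
    unfolding gen using D0_watson_eq[of n] unfolding sin_square_thirds watson_coeff_def by simp
qed

lemma remainder_Y'_Suc:
  assumes "N \<ge> 1"
  shows "remainder_Y' (Suc N) \<nu> = remainder_Y' N \<nu>
     - of_real ((if N mod 3 = 2 then 0 else (-1) ^ (N - 1)) * moment N / (2 * pi\<^sup>2)) / \<nu> powr ((2 * of_nat N + 2) / 3)"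
proof -
  have "remainder_Y' (Suc N) \<nu> = remainder_Y' N \<nu>
     - 2 / (3 * of_real pi) * (of_real ((if N mod 3 = 2 then 0 else 9 / 4) * disp_coeff N) / \<nu> powr ((2 * of_nat N + 2) / 3))"
    unfolding remainder_Y'_def sum.lessThan_Suc remainder_term by (simp only: distrib_left diff_diff_eq)
  also have "2 / (3 * of_real pi) * (of_real ((if N mod 3 = 2 then 0 else 9 / 4) * disp_coeff N) / \<nu> powr ((2 * of_nat N + 2) / 3))
    = of_real (2 / (3 * pi) * ((if N mod 3 = 2 then 0 else 9 / 4) * disp_coeff N)) / \<nu> powr ((2 * of_nat N + 2) / 3)" by simp
  also have "2 / (3 * pi) * ((if N mod 3 = 2 then 0 else 9 / 4) * disp_coeff N) = (if N mod 3 = 2 then 0 else (-1) ^ (N - 1)) * moment N / (2 * pi\<^sup>2)"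
    using assms by (simp add: disp_coeff_def power2_eq_square)
  finally show ?thesis .
qed

text \<open>Here w is a root of w^2 + w + 1, in the application a primitive cube root of unity, and
  - 1 - w is its square. U, w U and w^2 U are the values of \<open>cbrt2\<close> at ln \<nu> and ln
  \<nu> \<plusminus> i pi, and the common denominator is (v + U) (v + w U) (v + w^2 U) = v^3 + U^3.
  The relation \<open>t * m = v\<^sup>2\<close> stands for n^(1/3) n = n^(4/3).\<close>

lemma base_kernel_identity:
  fixes v U w t m :: "'a::field_char_0"
  assumes w: "w\<^sup>2 = - 1 - w" and nz: "v + U \<noteq> 0" "v + w * U \<noteq> 0" "v + (- 1 - w) * U \<noteq> 0" "U \<noteq> 0" "m \<noteq> 0"
    and t: "t * m = v\<^sup>2"
  shows "(t / (v + U) - ((- 1 - w) * (t / (v + w * U)) + w * (t / (v + (- 1 - w) * U))) / 2) / (3 * U)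
    = 1 / 2 * (disp_ratio 1 1 (v / U) / m)"
proof -
  define A B Q where "A = v + w * U" and "B = v + (- 1 - w) * U" and "Q = v\<^sup>2 - v * U + U\<^sup>2"
  have Q: "A * B = Q"
  proof -
    have "A * B = v\<^sup>2 - v * U - (w\<^sup>2 + w) * U\<^sup>2" by (simp add: A_def B_def power2_eq_square algebra_simps)
    thus ?thesis by (simp add: w Q_def)
  qed
  have S: "(- 1 - w) * B + w * A = - (v + U)"
  proof -
    have "(- 1 - w) * B + w * A = - v + (1 + 2 * (w\<^sup>2 + w)) * U" by (simp add: A_def B_def power2_eq_square algebra_simps)
    thus ?thesis by (simp add: w)
  qed
  have AB: "A \<noteq> 0" "B \<noteq> 0" "Q \<noteq> 0" using nz Q unfolding A_def[symmetric] B_def[symmetric] by auto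
  have "(- 1 - w) * (t / A) + w * (t / B) = t * ((- 1 - w) * B + w * A) / (A * B)"
    using AB by (simp add: divide_simps) (simp add: algebra_simps)
  also have "\<dots> = - (t * (v + U) / Q)" unfolding Q S by (simp only: mult_minus_right minus_divide_left)
  finally have "t / (v + U) - ((- 1 - w) * (t / A) + w * (t / B)) / 2 = t / (v + U) + t * (v + U) / (2 * Q)" by simp
  also have "\<dots> = t * (2 * Q + (v + U)\<^sup>2) / (2 * ((v + U) * Q))"
    using AB nz by (simp add: divide_simps power2_eq_square) (simp add: algebra_simps)
  also have "2 * Q + (v + U)\<^sup>2 = 3 * (v\<^sup>2 + U\<^sup>2)" by (simp add: Q_def power2_eq_square algebra_simps)
  also have "(v + U) * Q = v ^ 3 + U ^ 3" by (simp add: Q_def power2_eq_square power3_eq_cube algebra_simps)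
  finally have L: "t / (v + U) - ((- 1 - w) * (t / A) + w * (t / B)) / 2 = t * (3 * (v\<^sup>2 + U\<^sup>2)) / (2 * (v ^ 3 + U ^ 3))" .
  have c: "v ^ 3 + U ^ 3 \<noteq> 0"
    using nz AB \<open>(v + U) * Q = v ^ 3 + U ^ 3\<close> by (metis no_zero_divisors)
  have "1 + (v / U)\<^sup>2 = (v\<^sup>2 + U\<^sup>2) / U\<^sup>2" "1 + (v / U) ^ 3 = (v ^ 3 + U ^ 3) / U ^ 3"
    using nz by (simp_all add: power_divide field_simps)
  moreover have "disp_ratio 1 1 y = y\<^sup>2 * ((1 + y\<^sup>2) / (1 + y ^ 3))" for y :: 'a
    by (simp add: disp_ratio_def disp_num_def power2_eq_square)
  ultimately have "disp_ratio 1 1 (v / U) = v\<^sup>2 / U\<^sup>2 * (((v\<^sup>2 + U\<^sup>2) / U\<^sup>2) / ((v ^ 3 + U ^ 3) / U ^ 3))"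
    by (simp only: power_divide)
  also have "\<dots> = v\<^sup>2 * (v\<^sup>2 + U\<^sup>2) / (U * (v ^ 3 + U ^ 3))"
    using nz c by (simp add: divide_simps) (simp add: power2_eq_square power3_eq_cube power4_eq_xxxx)
  also have "v\<^sup>2 = t * m" by (simp add: t)
  also have "t * m * (t * m + U\<^sup>2) = m * (t * (v\<^sup>2 + U\<^sup>2))" by (simp add: t[symmetric] mult_ac)
  finally have R: "disp_ratio 1 1 (v / U) / m = t * (v\<^sup>2 + U\<^sup>2) / (U * (v ^ 3 + U ^ 3))" using nz by simp
  have fin: "t * (3 * a) / (2 * b) / (3 * U) = 1 / 2 * (t * a / (U * b))" if "b \<noteq> 0" for a b using that nz by simp
  show ?thesis unfolding A_def[symmetric] B_def[symmetric] L R by (rule fin[OF c])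
qed

lemma disp_arg_of_real: "\<nu> > 0 \<Longrightarrow> disp_arg (of_real \<nu>) n = of_real (n powr (2/3) / \<nu> powr (2/3))"
  using powr_of_real[of \<nu> "- (2/3)"] by (simp add: disp_arg_def powr_minus_divide)

lemma remainder_Y'_1_real:
  assumes \<nu>: "\<nu> > 0"
  shows "remainder_Y' 1 (of_real \<nu>) = 1 / (2 * of_real pi ^ 2) * (disp_int 1 1 1 (of_real \<nu>))"
proof -
  define U where "U = complex_of_real (\<nu> powr (2/3))"
  define w where "w = cis (2 * pi / 3)"
  define w0 where "w0 = complex_of_real (watson_coeff 0)"
  define I where "I z n = cut_h (of_real n) * (of_real (n powr (1/3)) / (of_real (n powr (2/3)) + cbrt2 z))" for z n
  define a1 a2 a3 where "a1 = complex_of_real (ln \<nu>)" and "a2 = Complex (ln \<nu>) pi" and "a3 = Complex (ln \<nu>) (- pi)"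
  note as = a1_def a2_def a3_def
  have w: "w = Complex (- 1 / 2) (sqrt 3 / 2)"
  proof -
    have "cos (2 * pi / 3) = - 1 / 2" "sin (2 * pi / 3) = sqrt 3 / 2"
      using sin_pi_minus[of "pi / 3"] cos_pi_minus[of "pi / 3"] sin_60 cos_60 by (simp_all add: field_simps)
    thus ?thesis by (simp add: w_def cis.code)
  qed
  have w2: "w\<^sup>2 = - 1 - w" by (simp add: w power2_eq_square complex_eq_iff)
  have w'0: "w \<noteq> 0" "- 1 - w \<noteq> 0" by (auto simp: w complex_eq_iff)
  have "w * (- 1 - w) = - w - w\<^sup>2" by (simp add: power2_eq_square algebra_simps)
  hence ww: "w * (- 1 - w) = 1" by (simp add: w2)
  have U0: "U \<noteq> 0" using \<nu> by (simp add: U_def)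
  have c: "cbrt2 a1 = U" "cbrt2 a2 = w * U" "cbrt2 a3 = (- 1 - w) * U"
  proof -
    show "cbrt2 a1 = U" using cbrt2_ln[OF \<nu>] by (simp add: as U_def)
    have U: "U = exp (of_real (2 * ln \<nu> / 3))" using \<nu> by (simp add: U_def powr_def flip: exp_of_real)
    have "2 * a2 / 3 = of_real (2 * ln \<nu> / 3) + \<i> * of_real (2 * pi / 3)" by (simp add: as complex_eq_iff)
    thus "cbrt2 a2 = w * U" unfolding cbrt2_def U w_def cis_conv_exp by (simp only: exp_add mult.commute)
    have "2 * a3 / 3 = of_real (2 * ln \<nu> / 3) + \<i> * of_real (- (2 * pi / 3))" by (simp add: as complex_eq_iff)
    moreover have "- 1 - w = cis (- (2 * pi / 3))"
      using arg_cong[OF w, of cnj] by (simp add: w cis_cnj[symmetric] w_def[symmetric] complex_eq_iff)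
    ultimately show "cbrt2 a3 = (- 1 - w) * U" unfolding cbrt2_def U cis_conv_exp by (simp only: exp_add mult.commute)
  qed
  have im: "\<bar>Im a1\<bar> < 3 * pi / 2" "\<bar>Im a2\<bar> < 3 * pi / 2" "\<bar>Im a3\<bar> < 3 * pi / 2" by (simp_all add: as)
  have int: "integrable_Ioi (I a1)" "integrable_Ioi (I a2)" "integrable_Ioi (I a3)"
    unfolding I_def by (intro disp_integrand im)+
  have P: "saddle_int a1 = (w0 + disp_integral a1) / U" "saddle_int a2 = (- 1 - w) * (w0 + disp_integral a2) / U" "saddle_int a3 = w * (w0 + disp_integral a3) / U"
  proof -
    show "saddle_int a1 = (w0 + disp_integral a1) / U"
      using saddle_int_dispersion[OF im(1)] U0 unfolding c w0_def[symmetric] by (simp add: field_simps)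
    have "saddle_int a2 * (w * U) = w * (- 1 - w) * (w0 + disp_integral a2)"
      using saddle_int_dispersion[OF im(2)] unfolding c w0_def[symmetric] ww by simp
    hence "w * (saddle_int a2 * U) = w * ((- 1 - w) * (w0 + disp_integral a2))" by (simp only: mult_ac)
    hence "saddle_int a2 * U = (- 1 - w) * (w0 + disp_integral a2)" using w'0 by (simp only: mult_cancel_left) simp
    thus "saddle_int a2 = (- 1 - w) * (w0 + disp_integral a2) / U"
      by (rule iffD2[OF nonzero_eq_divide_eq[OF U0]])
    have "saddle_int a3 * ((- 1 - w) * U) = w * (- 1 - w) * (w0 + disp_integral a3)"
      using saddle_int_dispersion[OF im(3)] unfolding c w0_def[symmetric] ww by simp
    hence "(- 1 - w) * (saddle_int a3 * U) = (- 1 - w) * (w * (w0 + disp_integral a3))" by (simp only: mult_ac)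
    hence "saddle_int a3 * U = w * (w0 + disp_integral a3)" using w'0 by (simp only: mult_cancel_left) simp
    thus "saddle_int a3 = w * (w0 + disp_integral a3) / U"
      by (rule iffD2[OF nonzero_eq_divide_eq[OF U0]])
  qed
  \<comment> \<open>The leading constant enters with weight 1 - (w + w^2) / 2 = 3 / 2, which is
    exactly the n = 0 term of the expansion. So for N = 1 the remainder is a pure integral, the base
    of the induction in \<open>remainder_Y'_real\<close>.\<close>
  have gen: "(x + d1) / U - ((- 1 - w) * (x + d2) / U + w * (x + d3) / U) / 2
    = (3 / 2 * x + (d1 - ((- 1 - w) * d2 + w * d3) / 2)) / U" for x d1 d2 d3
    using U0 by (simp add: divide_simps) (simp add: algebra_simps)
  have "remainder_Y' 1 (of_real \<nu>) = bessel_Y' (of_real \<nu>) - 3 / 2 * w0 / U / of_real pi"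
  proof -
    have "remainder_Y' 1 (of_real \<nu>) = bessel_Y' (of_real \<nu>) - 2 / (3 * of_real pi) * (of_real (9 / 4 * disp_coeff 0) / U)"
      unfolding remainder_Y'_def remainder_term using powr_of_real[of \<nu> "2 / 3"] \<nu> by (simp add: U_def)
    thus ?thesis by (simp add: disp_coeff_def w0_def)
  qed
  also have "bessel_Y' (of_real \<nu>) = (3 / 2 * w0 + (disp_integral a1 - ((- 1 - w) * disp_integral a2 + w * disp_integral a3) / 2)) / U / of_real pi"
    unfolding bessel_Y'_saddle_int[OF \<nu>] as[symmetric] P gen ..
  also have "\<dots> - 3 / 2 * w0 / U / of_real pi = (disp_integral a1 - ((- 1 - w) * disp_integral a2 + w * disp_integral a3) / 2) / U / of_real pi"
    by (simp add: add_divide_distrib)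
  also have "\<dots> = 1 / of_real pi ^ 2 * (((LBINT n:{0<..}. I a1 n) - ((- 1 - w) * (LBINT n:{0<..}. I a2 n) + w * (LBINT n:{0<..}. I a3 n)) / 2) / (3 * U))"
    unfolding disp_integral_def I_def[symmetric] using U0 by (simp add: divide_simps power2_eq_square)
  also have "((LBINT n:{0<..}. I a1 n) - ((- 1 - w) * (LBINT n:{0<..}. I a2 n) + w * (LBINT n:{0<..}. I a3 n)) / 2) / (3 * U)
    = (LBINT n:{0<..}. (I a1 n - ((- 1 - w) * I a2 n + w * I a3 n) / 2) / (3 * U))"
    using int by (simp add: set_integral_diff set_integral_add set_integral_divide_zero)
  also have "\<dots> = (LBINT n:{0<..}. 1 / 2 * disp_kern 1 1 1 (of_real \<nu>) n)"
  proof (rule set_lebesgue_integral_cong, simp, intro allI impI)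
    fix n :: real assume "n \<in> {0<..}"
    hence n: "n > 0" by simp
    define v t where "v = complex_of_real (n powr (2/3))" and "t = complex_of_real (n powr (1/3))"
    have tv: "t * of_real n = v\<^sup>2"
    proof -
      have "n powr (1/3) * n powr 1 = (n powr (2/3)) * n powr (2/3)" using n by (simp only: powr_add[symmetric]) simp
      hence "n powr (1/3) * n = (n powr (2/3)) * n powr (2/3)" using n by simp
      thus ?thesis by (simp add: v_def t_def power2_eq_square flip: of_real_mult)
    qed
    have nz: "v + U \<noteq> 0" "v + w * U \<noteq> 0" "v + (- 1 - w) * U \<noteq> 0"
      using cbrt2_slit[OF im(1), of "n powr (2/3)"] cbrt2_slit[OF im(2), of "n powr (2/3)"] cbrt2_slit[OF im(3), of "n powr (2/3)"]
      unfolding c v_def[symmetric] by simp_all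
    have "(I a1 n - ((- 1 - w) * I a2 n + w * I a3 n) / 2) / (3 * U)
      = cut_h (of_real n) * ((t / (v + U) - ((- 1 - w) * (t / (v + w * U)) + w * (t / (v + (- 1 - w) * U))) / 2) / (3 * U))"
      unfolding I_def c v_def[symmetric] t_def[symmetric] by (simp add: algebra_simps diff_divide_distrib add_divide_distrib)
    also have "\<dots> = cut_h (of_real n) * (1 / 2 * (disp_ratio 1 1 (v / U) / of_real n))"
      by (subst base_kernel_identity[OF w2 nz U0 _ tv]) (use n in simp_all)
    also have "\<dots> = 1 / 2 * disp_kern 1 1 1 (of_real \<nu>) n"
      using disp_arg_of_real[OF \<nu>, of n] by (simp add: disp_kern_def v_def U_def)
    finally show "(I a1 n - ((- 1 - w) * I a2 n + w * I a3 n) / 2) / (3 * U) = 1 / 2 * disp_kern 1 1 1 (of_real \<nu>) n" .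
  qed
  finally show ?thesis unfolding set_integral_mult_right by simp
qed

text \<open>Taking off one term changes the numerator cyclically: - x times the next numerator is
  the present one minus 1 + x^3, or the present one itself for N = 2 mod 3, where the series has no
  term.\<close>

lemma disp_ratio_Suc:
  assumes "1 + x ^ 3 \<noteq> 0" "N \<ge> 1"
  shows "disp_ratio (Suc N mod 3) (Suc N) x = disp_ratio (N mod 3) N x - (if N mod 3 = 2 then 0 else (-1) ^ (N - 1)) * x ^ (N + 1)"
proof -
  define s where "s = (if N mod 3 = 2 then 0 else 1 :: 'a)"
  have c: "- x * disp_num (Suc N mod 3) x = disp_num (N mod 3) x - s * (1 + x ^ 3)"
  proof -
    have "N mod 3 < 3" by simp
    then consider "N mod 3 = 0" | "N mod 3 = 1" | "N mod 3 = 2" by linarith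
    thus ?thesis
    proof cases
      case 1
      hence "Suc N mod 3 = 1" by presburger
      with 1 show ?thesis by (simp add: disp_num_def s_def power2_eq_square power3_eq_cube algebra_simps)
    next
      case 2
      hence "Suc N mod 3 = 2" by presburger
      with 2 show ?thesis by (simp add: disp_num_def s_def power2_eq_square power3_eq_cube algebra_simps)
    next
      case 3
      hence "Suc N mod 3 = 0" by presburger
      with 3 show ?thesis by (simp add: disp_num_def s_def power2_eq_square algebra_simps)
    qed
  qed
  have "disp_ratio (Suc N mod 3) (Suc N) x = (-1) ^ (N + 1) * x ^ (N + 1) * ((- x * disp_num (Suc N mod 3) x) / (1 + x ^ 3))"
    by (simp add: disp_ratio_def)
  also have "(- x * disp_num (Suc N mod 3) x) / (1 + x ^ 3) = disp_num (N mod 3) x / (1 + x ^ 3) - s"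
    unfolding c using assms by (simp add: diff_divide_distrib)
  also have "(-1) ^ (N + 1) * x ^ (N + 1) * (disp_num (N mod 3) x / (1 + x ^ 3) - s) = disp_ratio (N mod 3) N x - (-1) ^ (N + 1) * s * x ^ (N + 1)"
    unfolding disp_ratio_def by (simp only: right_diff_distrib mult_ac)
  also have "(-1) ^ (N + 1) * s = (if N mod 3 = 2 then 0 else (-1) ^ (N - 1))"
    using assms(2) by (cases N) (simp_all add: s_def)
  finally show ?thesis .
qed

text \<open>Induction from N = 1. The power of x split off by \<open>disp_ratio_Suc\<close>
  integrates to a moment, and this is the term by which consecutive remainders differ.\<close>

lemma remainder_Y'_real:
  assumes \<nu>: "\<nu> > 0" and N: "N \<ge> 1"
  shows "remainder_Y' N (of_real \<nu>) = 1 / (2 * of_real pi ^ 2) * (disp_int (N mod 3) N 1 (of_real \<nu>))"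
  using N
proof (induction N rule: dec_induct)
  case base
  show ?case using remainder_Y'_1_real[OF \<nu>] by simp
next
  case (step N)
  define s where "s = (if N mod 3 = 2 then 0 else (-1) ^ (N - 1) :: complex)"
  define V where "V = complex_of_real \<nu> powr ((2 * of_nat N + 2) / 3)"
  have V: "V = of_real (\<nu> powr (expo N))"
    using powr_of_real[of \<nu> "expo N"] \<nu> by (simp add: V_def)
  have e: "expo N = expo_pred N + 1" by (simp add: field_simps)
  have k: "disp_kern (Suc N mod 3) (Suc N) 1 (of_real \<nu>) n = disp_kern (N mod 3) N 1 (of_real \<nu>) n - s / V * (cut_h (of_real n) * of_real (n powr (expo_pred N)))"
    if n: "n > 0" for n
  proof -
    define x where "x = disp_arg (of_real \<nu>) n"
    have "x ^ (N + 1) = of_real (cmod x ^ (N + 1))"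
      using n \<nu> by (simp add: x_def disp_arg_of_real norm_divide)
    also have "cmod x ^ (N + 1) = n powr (expo N) * cmod (of_real \<nu>) powr (- (expo N))"
      unfolding x_def using n \<nu> by (intro norm_disp_arg_power) auto
    also have "n powr (expo N) = n powr (expo_pred N) * n"
      unfolding e powr_add using n by simp
    finally have x: "x ^ (N + 1) = of_real (n powr (expo_pred N)) * of_real n / V"
      using \<nu> by (simp add: V powr_minus_divide)
    have "disp_ratio (Suc N mod 3) (Suc N) x = disp_ratio (N mod 3) N x - s * x ^ (N + 1)"
      unfolding s_def x_def by (rule disp_ratio_Suc) (use one_plus_disp_arg_cube_nz[OF n] \<nu> step in auto)
    hence E: "disp_ratio (Suc N mod 3) (Suc N) x / of_real n = disp_ratio (N mod 3) N x / of_real n - s / V * of_real (n powr (expo_pred N))"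
      unfolding x using n by (simp add: diff_divide_distrib)
    show ?thesis unfolding disp_kern_def x_def[symmetric] E mult_1_left right_diff_distrib by (simp only: mult_ac)
  qed
  have "(disp_int (Suc N mod 3) (Suc N) 1 (of_real \<nu>)) = (LBINT n:{0<..}. disp_kern (N mod 3) N 1 (of_real \<nu>) n - s / V * (cut_h (of_real n) * of_real (n powr (expo_pred N))))"
    by (rule set_lebesgue_integral_cong) (simp_all add: k)
  also have "\<dots> = (disp_int (N mod 3) N 1 (of_real \<nu>)) - s / V * (LBINT n:{0<..}. cut_h (of_real n) * of_real (n powr (expo_pred N)))"
    unfolding set_integral_mult_right[symmetric]
    by (intro set_integral_diff(2) set_integrable_mult_right moment_integrable(2) disp_kern_integrable) (use \<nu> step in auto)
  also have "(LBINT n:{0<..}. cut_h (of_real n) * of_real (n powr (expo_pred N))) = of_real (moment N)"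
    using step by (intro moment_integrable(3)) auto
  finally have K: "(disp_int (Suc N mod 3) (Suc N) 1 (of_real \<nu>))
    = (disp_int (N mod 3) N 1 (of_real \<nu>)) - s / V * of_real (moment N)" .
  have E: "complex_of_real ((if N mod 3 = 2 then 0 else (-1) ^ (N - 1)) * moment N / (2 * pi\<^sup>2)) = 1 / (2 * of_real pi ^ 2) * (s * of_real (moment N))"
    by (simp add: s_def)
  have gen: "c * L - c * (s * m) / V = c * (L - s / V * m)" for c L m by (simp add: algebra_simps)
  show ?case unfolding remainder_Y'_Suc[OF step(1)] step.IH V_def[symmetric] K E by (rule gen)
qed

section \<open>Scaling and rotation of the ray of integration\<close>

lemma disp_kern_integral_scale:
  assumes c: "c > 0" and \<mu>: "\<mu> > 0"
  shows "(disp_int j N (of_real c) (of_real \<mu>)) = (disp_int j N 1 (of_real (c * \<mu>)))"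
proof -
  have e: "indicator {0<..} n *\<^sub>R disp_kern j N (of_real c) (of_real \<mu>) n = c *\<^sub>R (indicator {0<..} (0 + c * n) *\<^sub>R disp_kern j N 1 (of_real (c * \<mu>)) (0 + c * n))" for n
  proof (cases "n > 0")
    case True
    have "disp_arg (of_real (c * \<mu>)) (c * n) = disp_arg (of_real \<mu>) n"
      using c \<mu> True disp_arg_of_real[of "c * \<mu>" "c * n"] disp_arg_of_real[of \<mu> n] by (simp add: powr_mult)
    hence "disp_kern j N 1 (of_real (c * \<mu>)) (c * n) * of_real c = disp_kern j N (of_real c) (of_real \<mu>) n"
      using c by (simp add: disp_kern_def)
    thus ?thesis using True c by (simp add: scaleR_conv_of_real mult.commute)
  next
    case False
    thus ?thesis using c by (simp add: zero_less_mult_iff)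
  qed
  show ?thesis unfolding set_lebesgue_integral_def e
    using lborel_integral_real_affine[of c "\<lambda>n. indicator {0<..} n *\<^sub>R disp_kern j N 1 (of_real (c * \<mu>)) n" 0] c
    by (simp only: integral_scaleR_right abs_of_pos less_imp_neq[THEN not_sym] not_False_eq_True simp_thms)
qed

lemma remainder_Y'_real_scaled:
  assumes "c > 0" "\<mu> > 0" "N \<ge> 1"
  shows "remainder_Y' N (of_real (c * \<mu>)) = 1 / (2 * of_real pi ^ 2) * (disp_int (N mod 3) N (of_real c) (of_real \<mu>))"
  unfolding disp_kern_integral_scale[OF assms(1,2)] using assms by (intro remainder_Y'_real) auto

lemma right_half_plane_mult_not_nonpos:
  assumes "Re a > 0" "Re b > 0"
  shows "a * b \<notin> \<real>\<^sub>\<le>\<^sub>0"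
proof
  assume "a * b \<in> \<real>\<^sub>\<le>\<^sub>0"
  then obtain s where s: "a * b = of_real s" "s \<le> 0" by (auto elim: nonpos_Reals_cases)
  have "(cmod a)\<^sup>2 * Re b = Re (cnj a * (a * b))"
    unfolding cmod_power2 by (simp add: power2_eq_square algebra_simps)
  also have "\<dots> = s * Re a" unfolding s(1) by simp
  also have "\<dots> \<le> 0" using assms s by (simp add: mult_nonpos_nonneg)
  finally have "(cmod a)\<^sup>2 * Re b \<le> 0" .
  moreover have "(cmod a)\<^sup>2 * Re b > 0" using assms by (intro mult_pos_pos) auto
  ultimately show False by linarith
qed

lemma remainder_Y'_holomorphic: "remainder_Y' N holomorphic_on {\<nu>. \<nu> \<notin> \<real>\<^sub>\<le>\<^sub>0 \<and> \<nu> \<notin> \<int>}"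
  unfolding remainder_Y'_def by (intro holomorphic_intros bessel_Y'_holomorphic) auto

lemma countable_exp_Ints:
  assumes "r \<noteq> 0" "\<theta> \<noteq> 0"
  shows "countable {w :: complex. r * exp (\<theta> * w) \<in> \<int>}"
proof -
  have "{w. r * exp (\<theta> * w) \<in> \<int>} \<subseteq> (\<lambda>(k, m). (Ln (of_int k / r) + (of_int (2 * m) * pi) * \<i>) / \<theta>) ` (UNIV :: (int \<times> int) set)"
  proof
    fix w assume "w \<in> {w. r * exp (\<theta> * w) \<in> \<int>}"
    then obtain k where k: "r * exp (\<theta> * w) = of_int k" by (auto elim: Ints_cases)
    hence e: "exp (\<theta> * w) = of_int k / r" using assms by (simp add: field_simps)
    hence "of_int k / r \<noteq> 0" by (metis exp_not_eq_zero)
    hence "exp (\<theta> * w) = exp (Ln (of_int k / r))" using e by simp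
    then obtain m where "\<theta> * w = Ln (of_int k / r) + (of_int (2 * m) * pi) * \<i>" by (auto simp only: exp_eq)
    hence "w = (Ln (of_int k / r) + (of_int (2 * m) * pi) * \<i>) / \<theta>"
      using assms by (metis nonzero_mult_div_cancel_left)
    thus "w \<in> (\<lambda>(k, m). (Ln (of_int k / r) + (of_int (2 * m) * pi) * \<i>) / \<theta>) ` (UNIV :: (int \<times> int) set)"
      by (intro image_eqI[of _ _ "(k, m)"]) auto
  qed
  thus ?thesis by (rule countable_subset) simp
qed

definition strip :: "real \<Rightarrow> complex set" where
  "strip \<delta> = {w. - \<delta> < Re w} \<inter> {w. Re w < \<delta>}"

lemma open_strip: "open (strip \<delta>)" and convex_strip: "convex (strip \<delta>)"
  unfolding strip_def by (auto intro!: open_Int open_halfspace_Re_gt open_halfspace_Re_lt convex_Int convex_halfspace_Re_gt convex_halfspace_Re_lt)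

definition turn :: "real \<Rightarrow> complex \<Rightarrow> complex" where
  "turn a w = exp (\<i> * of_real a * w)"

lemma turn_holomorphic: "turn a holomorphic_on A"
  unfolding turn_def by (intro holomorphic_intros)

lemma turn_add: "turn (a + b) w = turn a w * turn b w"
  by (simp add: turn_def ring_distribs exp_add)

lemma turn_imag: "turn a (\<i> * of_real t) = of_real (exp (- (a * t)))"
proof -
  have "\<i> * of_real a * (\<i> * of_real t) = of_real (- (a * t))" by (simp add: complex_eq_iff)
  thus ?thesis by (simp only: turn_def exp_of_real)
qed

lemma turn_1: "turn a 1 = cis a"
  by (simp add: turn_def cis_conv_exp)

lemma Re_turn_pos:
  assumes "w \<in> strip (pi / 2 / M)" "\<bar>a\<bar> \<le> M" "M > 0"
  shows "Re (turn a w) > 0"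
proof -
  have "\<bar>a * Re w\<bar> \<le> M * \<bar>Re w\<bar>" unfolding abs_mult using assms by (intro mult_right_mono) auto
  also have "\<dots> < M * (pi / 2 / M)" using assms by (intro mult_strict_left_mono) (auto simp: strip_def)
  finally have "cos (a * Re w) > 0" using assms by (intro cos_gt_zero_pi) auto
  thus ?thesis by (simp add: Re_exp turn_def)
qed

text \<open>G is analytic only off the points where r e^(i \<theta> w) is an integer. These form a
  closed countable set, so the rest of the strip is open and connected. On the part of the imaginary
  axis with r e^(- \<theta> t) \<le> 1 / 2 there are no such points, which gives zeros of G
  accumulating at t0. The target w = 1 lies in the domain because \<delta> > 1 and sin \<theta> is
  nonzero.\<close>

lemma continuation_from_imaginary_axis:
  assumes r: "r > 0" and \<theta>: "\<theta> \<noteq> 0" "\<bar>\<theta>\<bar> < pi" and \<delta>: "\<delta> > 1"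
    and G: "G holomorphic_on strip \<delta> - {w. of_real r * turn \<theta> w \<in> \<int>}"
    and Gi: "\<And>t. G (\<i> * of_real t) = 0"
  shows "G 1 = 0"
proof -
  define f where "f w = of_real r * turn \<theta> w" for w
  define T where "T = strip \<delta> - {w. f w \<in> \<int>}"
  have fi: "f (\<i> * of_real t) = of_real (r * exp (- (\<theta> * t)))" for t
    by (simp add: f_def turn_imag)
  have "closed {w. f w \<in> \<int>}"
    using continuous_closed_vimage[of \<int> f] closed_Ints unfolding f_def turn_def by (simp add: vimage_def)
  hence T: "open T" unfolding T_def by (intro open_Diff open_strip)
  have "countable {w. f w \<in> \<int>}" unfolding f_def turn_def using r \<theta> by (intro countable_exp_Ints) simp_all
  hence Tc: "connected T"
    unfolding T_def using open_strip convex_strip by (intro connected_open_diff_countable convex_connected) auto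
  define t0 where "t0 = ln (2 * r) / \<theta>"
  define U where "U = {w. Re w = 0 \<and> f w \<notin> \<int>}"
  have small: "\<i> * of_real t \<in> U" if "\<theta> * t \<ge> ln (2 * r)" for t
  proof -
    have "exp (ln (2 * r)) \<le> exp (\<theta> * t)" using that by simp
    hence "r < exp (\<theta> * t)" using r by simp
    hence "r * exp (- (\<theta> * t)) < 1" by (simp add: exp_minus field_simps)
    moreover have "complex_of_real x \<notin> \<int>" if x: "0 < x" "x < 1" for x
    proof
      assume "complex_of_real x \<in> \<int>"
      then obtain k where "complex_of_real x = of_int k" by (auto elim: Ints_cases)
      hence "x = of_int k" by (metis of_real_eq_iff of_real_of_int_eq)
      thus False using x by simp
    qed
    ultimately have "f (\<i> * of_real t) \<notin> \<int>" unfolding fi using r by (metis exp_gt_zero mult_pos_pos)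
    thus ?thesis by (simp add: U_def)
  qed
  have lim: "(\<i> * of_real t0) islimpt U"
    unfolding islimpt_approachable
  proof (intro allI impI)
    fix e :: real assume e: "e > 0"
    define t where "t = t0 + sgn \<theta> * (e / 2)"
    have "\<theta> * t = ln (2 * r) + \<bar>\<theta>\<bar> * (e / 2)"
      using \<theta> by (simp add: t_def t0_def distrib_left abs_sgn mult.assoc)
    hence "\<i> * of_real t \<in> U" using e by (intro small) simp
    moreover have "\<i> * of_real t \<noteq> \<i> * of_real t0" using e \<theta> by (simp add: t_def sgn_0_0)
    moreover have "dist (\<i> * of_real t) (\<i> * of_real t0) < e"
    proof -
      have "\<i> * of_real t - \<i> * of_real t0 = \<i> * of_real (t - t0)" by (simp add: algebra_simps)
      hence "dist (\<i> * of_real t) (\<i> * of_real t0) = \<bar>t - t0\<bar>"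
        by (simp only: dist_norm norm_mult norm_ii norm_of_real mult_1_left)
      thus ?thesis using e \<theta> by (simp add: t_def abs_mult abs_sgn_eq)
    qed
    ultimately show "\<exists>x'\<in>U. x' \<noteq> \<i> * of_real t0 \<and> dist x' (\<i> * of_real t0) < e" by blast
  qed
  have UT: "U \<subseteq> T" using \<delta> by (auto simp: U_def T_def strip_def)
  have "\<i> * of_real t0 \<in> U" using \<theta> by (intro small) (simp add: t0_def)
  hence 0: "\<i> * of_real t0 \<in> T" using UT by blast
  have GU: "G w = 0" if "w \<in> U" for w
  proof -
    have "w = \<i> * of_real (Im w)" using that by (simp add: U_def complex_eq_iff)
    thus ?thesis using Gi by metis
  qed
  have "f 1 \<notin> \<int>"
  proof
    assume "f 1 \<in> \<int>"
    hence "Im (f 1) = 0" by (auto elim!: Ints_cases)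
    hence "sin \<theta> = 0" using r by (simp add: f_def turn_1)
    thus False using \<theta> sin_eq_0_pi[of \<theta>] by (simp add: abs_less_iff)
  qed
  hence 1: "1 \<in> T" using \<delta> by (simp add: T_def strip_def)
  have "G holomorphic_on T" using G by (simp add: T_def f_def)
  from analytic_continuation[OF this T Tc UT 0 lim GU 1] show ?thesis .
qed

text \<open>
  With \<open>c(w) = exp (\<i> \<alpha> w)\<close> and \<open>\<mu>(w) = r exp (\<i> \<beta> w)\<close>, the integral of \<open>disp_kern j N c \<mu>\<close> is analytic
  in \<open>w\<close>; on the imaginary axis \<open>c\<close> and \<open>\<mu>\<close> are positive and a substitution applies. The value
  wanted is at \<open>w = 1\<close>.
\<close>

lemma disp_kern_integral_turn_holomorphic:
  assumes "r > 0" "\<bar>\<alpha>\<bar> \<le> M" "\<bar>\<beta>\<bar> \<le> M" "M > 0" "N \<ge> 1"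
  shows "(\<lambda>w. LBINT n:{0<..}. disp_kern j N (turn \<alpha> w) (of_real r * turn \<beta> w) n) holomorphic_on strip (pi / 2 / M)"
  by (rule disp_kern_integral_holomorphic[OF open_strip turn_holomorphic])
    (use assms Re_turn_pos in \<open>auto intro!: holomorphic_intros turn_holomorphic\<close>)

text \<open>Lets each piece of an integral be turned by its own angle while the total argument
  \<alpha> + \<beta> is kept. On the imaginary axis of w both sides depend only on the product of
  the two parameters.\<close>

lemma disp_kern_integral_rotate:
  assumes r: "r > 0" and \<alpha>: "\<bar>\<alpha>\<bar> < pi / 2" "\<bar>\<alpha>'\<bar> < pi / 2" and \<beta>: "\<bar>\<beta>\<bar> < pi / 2" "\<bar>\<beta>'\<bar> < pi / 2"
    and eq: "\<alpha> + \<beta> = \<alpha>' + \<beta>'" and ne: "\<alpha> + \<beta> \<noteq> 0" and N: "N \<ge> 1"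
  shows "(disp_int j N (cis \<alpha>) (of_real r * cis \<beta>)) = (disp_int j N (cis \<alpha>') (of_real r * cis \<beta>'))"
proof -
  define I where "I a b w = (disp_int j N (turn a w) (of_real r * turn b w))" for a b w
  \<comment> \<open>All angles lie below pi / 2, so the strip on which the turned parameters stay in
    the right half-plane has half-width pi / (2 M) > 1 and contains w = 1.\<close>
  define M where "M = max (max \<bar>\<alpha>\<bar> \<bar>\<beta>\<bar>) (max \<bar>\<alpha>'\<bar> \<bar>\<beta>'\<bar>)"
  have "\<alpha> \<noteq> 0 \<or> \<beta> \<noteq> 0" using ne by auto
  hence "M > 0" unfolding M_def less_max_iff_disj by auto
  moreover have "M < pi / 2" unfolding M_def max_less_iff_conj using \<alpha> \<beta> by blast
  ultimately have M: "M > 0" "M < pi / 2" by auto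
  have le: "\<bar>\<alpha>\<bar> \<le> M" "\<bar>\<beta>\<bar> \<le> M" "\<bar>\<alpha>'\<bar> \<le> M" "\<bar>\<beta>'\<bar> \<le> M" unfolding M_def le_max_iff_disj by blast+
  have Ii: "I a b (\<i> * of_real t) = (disp_int j N 1 (of_real (r * exp (- ((a + b) * t)))))" for a b t
  proof -
    have "exp (- (a * t)) * (r * exp (- (b * t))) = r * exp (- ((a + b) * t))"
      by (simp add: exp_add[symmetric] algebra_simps)
    note e = this
    have "I a b (\<i> * of_real t) = (disp_int j N 1 (of_real (exp (- (a * t)) * (r * exp (- (b * t))))))"
      unfolding I_def turn_imag of_real_mult[symmetric] by (rule disp_kern_integral_scale) (use r in simp_all)
    thus ?thesis unfolding e .
  qed
  have "(\<lambda>w. I \<alpha> \<beta> w - I \<alpha>' \<beta>' w) holomorphic_on strip (pi / 2 / M)"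
    unfolding I_def by (intro holomorphic_on_diff disp_kern_integral_turn_holomorphic le r N M)
  hence G: "(\<lambda>w. I \<alpha> \<beta> w - I \<alpha>' \<beta>' w) holomorphic_on strip (pi / 2 / M) - {w. of_real r * turn (\<alpha> + \<beta>) w \<in> \<int>}"
    by (rule holomorphic_on_subset) auto
  have "I \<alpha> \<beta> 1 - I \<alpha>' \<beta>' 1 = 0"
  proof (rule continuation_from_imaginary_axis[OF r ne _ _ G])
    show "\<bar>\<alpha> + \<beta>\<bar> < pi" using \<alpha> \<beta> by linarith
    show "1 < pi / 2 / M" using M by simp
    show "I \<alpha> \<beta> (\<i> * of_real t) - I \<alpha>' \<beta>' (\<i> * of_real t) = 0" for t
      unfolding Ii eq by simp
  qed
  thus ?thesis by (simp add: I_def turn_1)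
qed

text \<open>On the imaginary axis of w both parameters are positive and the identity is
  \<open>remainder_Y'_real_scaled\<close>. A product of two points of the right half-plane never
  meets the cut, so the remainder is analytic along the way except at integers.\<close>

lemma remainder_Y'_rotated:
  assumes r: "r > 0" and \<alpha>: "\<bar>\<alpha>\<bar> < pi / 2" and \<beta>: "\<bar>\<beta>\<bar> < pi / 2" and ne: "\<alpha> + \<beta> \<noteq> 0" and N: "N \<ge> 1"
  shows "remainder_Y' N (of_real r * cis (\<alpha> + \<beta>)) = 1 / (2 * of_real pi ^ 2) * (disp_int (N mod 3) N (cis \<alpha>) (of_real r * cis \<beta>))"
proof -
  define I where "I w = (disp_int (N mod 3) N (turn \<alpha> w) (of_real r * turn \<beta> w))" for w
  define f where "f w = of_real r * turn (\<alpha> + \<beta>) w" for w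
  define M where "M = max \<bar>\<alpha>\<bar> \<bar>\<beta>\<bar>"
  have "\<alpha> \<noteq> 0 \<or> \<beta> \<noteq> 0" using ne by auto
  hence "M > 0" unfolding M_def less_max_iff_disj by auto
  moreover have "M < pi / 2" unfolding M_def max_less_iff_conj using \<alpha> \<beta> by blast
  ultimately have M: "M > 0" "M < pi / 2" by auto
  have le: "\<bar>\<alpha>\<bar> \<le> M" "\<bar>\<beta>\<bar> \<le> M" unfolding M_def le_max_iff_disj by blast+
  have f: "f w = turn \<alpha> w * (of_real r * turn \<beta> w)" for w by (simp add: f_def turn_add)
  define T where "T = strip (pi / 2 / M) - {w. f w \<in> \<int>}"
  have "f w \<notin> \<real>\<^sub>\<le>\<^sub>0" if "w \<in> strip (pi / 2 / M)" for w
    unfolding f using Re_turn_pos[OF that _ M(1)] le r by (intro right_half_plane_mult_not_nonpos) auto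
  hence "f ` T \<subseteq> {\<nu>. \<nu> \<notin> \<real>\<^sub>\<le>\<^sub>0 \<and> \<nu> \<notin> \<int>}" by (auto simp: T_def)
  moreover have "f holomorphic_on T" unfolding f_def by (intro holomorphic_intros turn_holomorphic)
  ultimately have "(remainder_Y' N \<circ> f) holomorphic_on T"
    using holomorphic_on_compose_gen remainder_Y'_holomorphic by blast
  moreover have "I holomorphic_on T"
    unfolding I_def T_def by (rule holomorphic_on_subset[OF disp_kern_integral_turn_holomorphic[OF r le M(1) N]]) auto
  ultimately have G: "(\<lambda>w. remainder_Y' N (f w) - 1 / (2 * of_real pi ^ 2) * I w) holomorphic_on T"
    by (intro holomorphic_intros) (simp_all add: o_def)
  have "{w. f w \<in> \<int>} = {w. of_real r * turn (\<alpha> + \<beta>) w \<in> \<int>}" by (simp add: f_def)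
  note G' = G[unfolded T_def this]
  have "remainder_Y' N (f 1) - 1 / (2 * of_real pi ^ 2) * I 1 = 0"
  proof (rule continuation_from_imaginary_axis[OF r ne _ _ G'])
    show "\<bar>\<alpha> + \<beta>\<bar> < pi" using \<alpha> \<beta> by linarith
    show "1 < pi / 2 / M" using M by simp
    show "remainder_Y' N (f (\<i> * of_real t)) - 1 / (2 * of_real pi ^ 2) * I (\<i> * of_real t) = 0" for t
      using remainder_Y'_real_scaled[of "exp (- (\<alpha> * t))" "r * exp (- (\<beta> * t))" N] r N
      unfolding f I_def turn_imag of_real_mult[symmetric] by simp
  qed
  thus ?thesis by (simp add: I_def f_def turn_1)
qed

subsection \<open>Bounds\<close>

text \<open>This is sin^2 (2 \<beta>) |1 - x|^2 \<le> |1 + x^3|^2 for x = s e^(- 2 i \<beta> / 3)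
  and c = cos (2 \<beta> / 3), after subtracting sin^2 (2 \<beta>) = (1 - c^2) (4 c^2 - 1)^2 from
  both sides. For s \<le> 2 c the left side is not positive; beyond that one expands in d = s - 2
  c.\<close>

lemma num_bound_poly:
  fixes c s :: real
  assumes c: "1 / 2 \<le> c" "c \<le> 1" and s: "s \<ge> 0"
  shows "(1 - c\<^sup>2) * (4 * c\<^sup>2 - 1)\<^sup>2 * (s\<^sup>2 - 2 * s * c) \<le> (s ^ 3 + (4 * c ^ 3 - 3 * c))\<^sup>2"
proof (cases "s \<le> 2 * c")
  case True
  have "s\<^sup>2 - 2 * s * c = s * (s - 2 * c)" by (simp add: power2_eq_square algebra_simps)
  also have "\<dots> \<le> 0" using True s by (simp add: mult_nonneg_nonpos)
  finally have "(1 - c\<^sup>2) * (4 * c\<^sup>2 - 1)\<^sup>2 * (s\<^sup>2 - 2 * s * c) \<le> 0"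
    using c by (intro mult_nonneg_nonpos mult_nonneg_nonneg) (auto simp: power_le_one)
  also have "\<dots> \<le> (s ^ 3 + (4 * c ^ 3 - 3 * c))\<^sup>2" by simp
  finally show ?thesis .
next
  case False
  define d k where "d = s - 2 * c" and "k = 4 * c\<^sup>2 - 1"
  have d: "d \<ge> 0" and sd: "s = 2 * c + d" using False by (auto simp: d_def)
  have "(1 / 2)\<^sup>2 \<le> c\<^sup>2" using c by (intro power_mono) auto
  hence c2: "1 \<le> 4 * c\<^sup>2" by (simp add: power2_eq_square)
  have "c\<^sup>2 \<le> 1" using c by (simp add: power_le_one)
  hence k: "0 \<le> k" "k \<le> 3" using c2 by (auto simp: k_def)
  have "(1 - c\<^sup>2) * k\<^sup>2 * (s\<^sup>2 - 2 * s * c) \<le> 1 * k\<^sup>2 * (s\<^sup>2 - 2 * s * c)"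
  proof (intro mult_right_mono)
    have "s\<^sup>2 - 2 * s * c = s * d" by (simp add: d_def power2_eq_square algebra_simps)
    thus "0 \<le> s\<^sup>2 - 2 * s * c" using s d by simp
  qed auto
  also have "\<dots> = k * k * (2 * c * d) + k * k * d\<^sup>2" by (simp add: sd power2_eq_square algebra_simps)
  also have "\<dots> \<le> 3 * k * (2 * c * d) + 3 * 3 * d\<^sup>2"
    using k c d by (intro add_mono mult_mono mult_right_mono mult_nonneg_nonneg) auto
  also have "\<dots> \<le> (3 * c * k + 12 * c\<^sup>2 * d)\<^sup>2"
  proof -
    have "3 * k * (2 * c * d) * 1 \<le> 3 * k * (2 * c * d) * (3 * (4 * c\<^sup>2))"
      using k c d c2 by (intro mult_left_mono) auto
    moreover have "9 * d\<^sup>2 * (1 * 1) \<le> 9 * d\<^sup>2 * ((4 * c\<^sup>2) * (4 * c\<^sup>2))"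
      using c2 by (intro mult_left_mono mult_mono) auto
    moreover have "(3 * c * k + 12 * c\<^sup>2 * d)\<^sup>2 = (3 * c * k)\<^sup>2 + 3 * k * (2 * c * d) * (3 * (4 * c\<^sup>2)) + 9 * d\<^sup>2 * ((4 * c\<^sup>2) * (4 * c\<^sup>2))"
      by (simp add: power2_eq_square algebra_simps)
    moreover have "0 \<le> (3 * c * k)\<^sup>2" by simp
    moreover have "p + 3 * 3 * q \<le> T" if "p * 1 \<le> P" "9 * q * (1 * 1) \<le> Q" "T = Z + P + Q" "0 \<le> Z" for p q P Q T Z :: real
      using that by simp
    ultimately show ?thesis by blast
  qed
  also have "\<dots> \<le> (s ^ 3 + (4 * c ^ 3 - 3 * c))\<^sup>2"
  proof (rule power_mono)
    have "s ^ 3 + (4 * c ^ 3 - 3 * c) = 3 * c * k + 12 * c\<^sup>2 * d + (6 * c * d\<^sup>2 + d ^ 3)"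
      by (simp add: sd k_def power2_eq_square power3_eq_cube algebra_simps)
    moreover have "0 \<le> 6 * c * d\<^sup>2 + d ^ 3" using c d by simp
    ultimately show "3 * c * k + 12 * c\<^sup>2 * d \<le> s ^ 3 + (4 * c ^ 3 - 3 * c)" by simp
  qed (use c d k in auto)
  finally show ?thesis by (simp add: k_def)
qed

lemma norm_polar_sum: "(cmod (1 + of_real a * cis t))\<^sup>2 = 1 + 2 * a * cos t + a\<^sup>2"
proof -
  have "(cmod (1 + of_real a * cis t))\<^sup>2 = (1 + a * cos t)\<^sup>2 + (a * sin t)\<^sup>2" unfolding cmod_power2 by simp
  also have "(1 + a * C)\<^sup>2 + (a * S)\<^sup>2 = 1 + 2 * a * C + a\<^sup>2 * (C\<^sup>2 + S\<^sup>2)" for C S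
    by (simp add: power2_eq_square algebra_simps)
  finally show ?thesis by (simp only: sin_cos_squared_add2 mult_1_right)
qed

text \<open>For |\<beta>| \<le> pi / 4 the constant is 1 because cos (2 \<beta>) \<ge> 0 and cos (2
  \<beta> / 3) \<ge> sqrt 3 / 2. Otherwise |1 + x^3|^2 = sin^2 (2 \<beta>) + (s^3 + cos (2
  \<beta>))^2 gives both bounds. Estimating 1 - x as a whole, instead of its two terms, is what
  leaves a single d in the cases N = 0 and N = 2 mod 3.\<close>

lemma c_factor_bounds:
  assumes \<beta>: "\<bar>\<beta>\<bar> < pi / 2" and s: "s \<ge> 0"
  defines "x \<equiv> of_real s * cis (- (2 * \<beta> / 3))"
  shows "1 \<le> c_factor \<beta> * cmod (1 + x ^ 3)" and "cmod (1 - x) \<le> c_factor \<beta> * cmod (1 + x ^ 3)"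
proof -
  define c where "c = cos (2 * \<beta> / 3)"
  have x3: "x ^ 3 = of_real (s ^ 3) * cis (- (2 * \<beta>))"
    using Complex.DeMoivre[of "- (2 * \<beta> / 3)" 3] by (simp add: x_def power_mult_distrib)
  have n3: "(cmod (1 + x ^ 3))\<^sup>2 = 1 + 2 * s ^ 3 * cos (2 * \<beta>) + (s ^ 3)\<^sup>2"
    unfolding x3 norm_polar_sum by simp
  have "1 - x = 1 + of_real (- s) * cis (- (2 * \<beta> / 3))" by (simp add: x_def)
  hence n1: "(cmod (1 - x))\<^sup>2 = 1 - 2 * s * c + s\<^sup>2" by (simp only: norm_polar_sum) (simp add: c_def)
  have le1: "A \<le> B" if "A\<^sup>2 \<le> B\<^sup>2" "B \<ge> 0" for A B :: real using that by (rule power2_le_imp_le)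
  have "1 \<le> c_factor \<beta> * cmod (1 + x ^ 3) \<and> cmod (1 - x) \<le> c_factor \<beta> * cmod (1 + x ^ 3)"
  proof (cases "\<bar>\<beta>\<bar> \<le> pi / 4")
    case True
    have cf: "c_factor \<beta> = 1" using True by (simp add: c_factor_def)
    have "cos (2 * \<beta>) \<ge> 0" using True by (intro cos_ge_zero) auto
    hence nn: "0 \<le> 2 * s ^ 3 * cos (2 * \<beta>)" using s by simp
    have c: "sqrt 3 / 2 \<le> c"
    proof -
      have "cos (pi / 6) \<le> cos \<bar>2 * \<beta> / 3\<bar>" using True by (intro cos_monotone_0_pi_le) auto
      thus ?thesis unfolding cos_abs_real cos_30 c_def .
    qed
    \<comment> \<open>Multiplied by s this is s^2 \<le> sqrt 3 s + s^6; together with 2 c \<ge> sqrt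
      3 it compares the two squared moduli.\<close>
    have "s \<le> sqrt 3 + s ^ 5"
    proof (cases "s \<le> 1")
      case True
      moreover have "1 \<le> sqrt 3" by simp
      moreover have "0 \<le> s ^ 5" using s by simp
      ultimately show ?thesis by linarith
    next
      case False
      hence "s ^ 1 \<le> s ^ 5" by (intro power_increasing) auto
      thus ?thesis by (simp add: add_increasing)
    qed
    hence "s * s \<le> s * (sqrt 3 + s ^ 5)" using s by (intro mult_left_mono)
    moreover have "s * (sqrt 3 / 2) \<le> s * c" using s c by (intro mult_left_mono)
    moreover have "(s ^ 3)\<^sup>2 = s * s ^ 5" by (simp add: power2_eq_square power_add[symmetric] flip: power_Suc)
    ultimately have "s\<^sup>2 \<le> 2 * s * c + (s ^ 3)\<^sup>2" by (simp add: power2_eq_square algebra_simps)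
    hence "(cmod (1 - x))\<^sup>2 \<le> (cmod (1 + x ^ 3))\<^sup>2" unfolding n1 n3 using nn by simp
    moreover have "1\<^sup>2 \<le> (cmod (1 + x ^ 3))\<^sup>2" unfolding n3 using nn by simp
    ultimately show ?thesis unfolding cf mult_1_left by (blast intro: le1 norm_ge_zero)
  next
    case False
    define S where "S = \<bar>sin (2 * \<beta>)\<bar>"
    have cf: "c_factor \<beta> = 1 / S" using False \<beta> by (simp add: c_factor_def csc_def S_def)
    have "sin (2 * \<bar>\<beta>\<bar>) > 0" using False \<beta> by (intro sin_gt_zero) auto
    hence S: "S > 0" by (auto simp: S_def abs_if split: if_splits)
    have S2: "S\<^sup>2 = 1 - (cos (2 * \<beta>))\<^sup>2" by (simp add: S_def sin_squared_eq)
    have c3: "cos (2 * \<beta>) = 4 * c ^ 3 - 3 * c" using cos_treble_cos[of "2 * \<beta> / 3"] by (simp add: c_def)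
    have c: "1 / 2 \<le> c" "c \<le> 1"
    proof -
      have "cos (pi / 3) \<le> cos \<bar>2 * \<beta> / 3\<bar>" using \<beta> by (intro cos_monotone_0_pi_le) auto
      thus "1 / 2 \<le> c" unfolding cos_abs_real cos_60 c_def .
    qed (simp add: c_def)
    have n3': "(cmod (1 + x ^ 3))\<^sup>2 = S\<^sup>2 + (s ^ 3 + cos (2 * \<beta>))\<^sup>2"
      unfolding n3 S2 by (simp add: power2_eq_square algebra_simps)
    have "S\<^sup>2 \<le> (cmod (1 + x ^ 3))\<^sup>2" unfolding n3' by simp
    hence 1: "S \<le> cmod (1 + x ^ 3)" by (rule le1) simp
    have "S\<^sup>2 = (1 - c\<^sup>2) * (4 * c\<^sup>2 - 1)\<^sup>2"
      unfolding S2 c3 by (simp add: power2_eq_square power3_eq_cube algebra_simps)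
    hence "S\<^sup>2 * (s\<^sup>2 - 2 * s * c) \<le> (s ^ 3 + cos (2 * \<beta>))\<^sup>2"
      using num_bound_poly[OF c s] unfolding c3 by simp
    hence "S\<^sup>2 * (1 - 2 * s * c + s\<^sup>2) \<le> S\<^sup>2 + (s ^ 3 + cos (2 * \<beta>))\<^sup>2" by (simp add: algebra_simps)
    hence "(S * cmod (1 - x))\<^sup>2 \<le> (cmod (1 + x ^ 3))\<^sup>2" unfolding n3' power_mult_distrib n1 .
    hence 2: "S * cmod (1 - x) \<le> cmod (1 + x ^ 3)" by (rule le1) simp
    show ?thesis unfolding cf using 1 2 S by (simp add: field_simps)
  qed
  thus "1 \<le> c_factor \<beta> * cmod (1 + x ^ 3)" "cmod (1 - x) \<le> c_factor \<beta> * cmod (1 + x ^ 3)" by auto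
qed

lemma c_factor_nonneg: "c_factor \<beta> \<ge> 0"
  by (simp add: c_factor_def)

lemma c_factor_le_csc: "c_factor \<beta> \<le> \<bar>csc (2 * \<beta>)\<bar>" if "\<beta> \<noteq> 0" "\<bar>\<beta>\<bar> < pi / 2"
proof -
  have "sin (2 * \<bar>\<beta>\<bar>) > 0" using that by (intro sin_gt_zero) auto
  hence "\<bar>sin (2 * \<beta>)\<bar> > 0" by (auto simp: abs_if split: if_splits)
  hence "1 \<le> 1 / \<bar>sin (2 * \<beta>)\<bar>" by (simp add: field_simps)
  thus ?thesis by (simp add: c_factor_def csc_def)
qed

lemma moment_scaled:
  assumes "\<rho> > 0"
  shows "(LBINT n:{0<..}. cut_hr (\<rho> * n) * n powr (expo_pred N)) = \<rho> powr (- (expo N)) * moment N"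
proof -
  define a where "a = expo_pred N"
  have e: "expo N = a + 1" by (simp add: a_def field_simps)
  have "moment N = \<bar>\<rho>\<bar> *\<^sub>R (\<integral>n. indicator {0<..} (0 + \<rho> * n) *\<^sub>R (cut_hr (0 + \<rho> * n) * (0 + \<rho> * n) powr a) \<partial>lborel)"
    unfolding moment_def set_lebesgue_integral_def a_def
    by (rule lborel_integral_real_affine) (use assms in simp)
  also have "\<dots> = \<rho> * (\<integral>n. \<rho> powr a * (indicator {0<..} n *\<^sub>R (cut_hr (\<rho> * n) * n powr a)) \<partial>lborel)"
  proof -
    have "indicator {0<..} (0 + \<rho> * n) *\<^sub>R (cut_hr (0 + \<rho> * n) * (0 + \<rho> * n) powr a)
      = \<rho> powr a * (indicator {0<..} n *\<^sub>R (cut_hr (\<rho> * n) * n powr a))" for n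
      using assms by (cases "n > 0") (auto simp: powr_mult zero_less_mult_iff)
    thus ?thesis using assms by (simp only: real_scaleR_def abs_of_pos)
  qed
  also have "\<dots> = \<rho> powr (a + 1) * (LBINT n:{0<..}. cut_hr (\<rho> * n) * n powr a)"
    using assms by (simp add: set_lebesgue_integral_def powr_add)
  finally have m: "moment N = \<rho> powr (a + 1) * (LBINT n:{0<..}. cut_hr (\<rho> * n) * n powr a)" .
  have "\<rho> powr (a + 1) \<noteq> 0" using assms by simp
  thus ?thesis unfolding e a_def[symmetric] m powr_minus by simp
qed

lemma disp_arg_polar:
  assumes "r > 0" "\<bar>\<beta>\<bar> < pi"
  shows "disp_arg (of_real r * cis \<beta>) n = of_real (n powr (2/3) * r powr (- (2/3))) * cis (- (2 * \<beta> / 3))"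
proof -
  have "of_real r * cis \<beta> = exp (Complex (ln r) \<beta>)" using assms by (simp add: exp_eq_polar)
  hence "Ln (of_real r * cis \<beta>) = Complex (ln r) \<beta>" using assms by (simp add: Ln_exp abs_less_iff)
  hence "(of_real r * cis \<beta>) powr (- (2/3)) = exp (- (2/3) * Complex (ln r) \<beta>)"
    using assms by (simp add: powr_def)
  also have "- (2/3) * Complex (ln r) \<beta> = of_real (- (2/3) * ln r) + \<i> * of_real (- (2 * \<beta> / 3))"
    by (simp add: complex_eq_iff)
  finally have "(of_real r * cis \<beta>) powr (- (2/3)) = exp (of_real (- (2/3) * ln r) + \<i> * of_real (- (2 * \<beta> / 3)))" .
  also have "\<dots> = of_real (exp (- (2/3) * ln r)) * cis (- (2 * \<beta> / 3))"
    by (simp only: exp_add cis_conv_exp exp_of_real)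
  also have "exp (- (2/3) * ln r) = r powr (- (2/3))" using assms by (simp add: powr_def)
  finally show ?thesis by (simp add: disp_arg_def)
qed

text \<open>The Laplace transform at e^(i \<alpha>) n is bounded by its value at n cos \<alpha>, and
  rescaling n by cos \<alpha> produces both the power of cos \<alpha> and the moment behind
  \<open>d_coeff M\<close>. M exceeds N when the numerator contains a factor x, as in x^2 -
  x.\<close>

lemma disp_kern_integral_bound:
  assumes r: "r > 0" and \<alpha>: "\<bar>\<alpha>\<bar> < pi / 2" and \<beta>: "\<bar>\<beta>\<bar> < pi / 2" and N: "N \<ge> 1" "M \<ge> 1"
    and b: "\<And>n. n > 0 \<Longrightarrow> cmod (disp_ratio j N (disp_arg (of_real r * cis \<beta>) n)) \<le> K * cmod (disp_arg (of_real r * cis \<beta>) n) ^ (M + 1)"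
  shows "cmod (1 / (2 * of_real pi ^ 2) * (disp_int j N (cis \<alpha>) (of_real r * cis \<beta>)))
    \<le> K / cos \<alpha> powr (expo M) * (d_coeff M (of_real r * cis (\<alpha> + \<beta>)) / (2 * pi))"
proof -
  define \<mu> where "\<mu> = of_real r * cis \<beta>"
  define a where "a = expo M"
  have ca: "cos \<alpha> > 0" using \<alpha> by (intro cos_gt_zero_pi) auto
  have cb: "cos \<beta> > 0" using \<beta> by (intro cos_gt_zero_pi) auto
  have nm: "cmod \<mu> = r" "\<mu> \<noteq> 0" "Re \<mu> > 0" using r cb by (auto simp: \<mu>_def norm_mult)
  have i: "integrable_Ioi (disp_kern j N (cis \<alpha>) \<mu>)"
    by (rule disp_kern_integrable) (use ca nm N in auto)
  have le: "cmod (disp_kern j N (cis \<alpha>) \<mu> n) \<le> K * r powr (- a) * (cut_hr (cos \<alpha> * n) * n powr (expo_pred M))" if n: "n > 0" for n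
  proof -
    have e: "a = expo_pred M + 1" by (simp add: a_def field_simps)
    have h: "cmod (cut_h (cis \<alpha> * of_real n)) \<le> cut_hr (cos \<alpha> * n)"
      using norm_cut_h_le[of "cis \<alpha> * of_real n"] ca n by simp
    have "cmod (disp_ratio j N (disp_arg \<mu> n)) \<le> K * (n powr a * r powr (- a))"
      using b[OF n] norm_disp_arg_power[OF n nm(2), of M] unfolding \<mu>_def[symmetric] a_def nm(1) by simp
    hence q: "cmod (disp_ratio j N (disp_arg \<mu> n)) / n \<le> K * (n powr a * r powr (- a)) / n"
      using n by (intro divide_right_mono) auto
    have "cmod (disp_kern j N (cis \<alpha>) \<mu> n) = cmod (cut_h (cis \<alpha> * of_real n)) * (cmod (disp_ratio j N (disp_arg \<mu> n)) / n)"
      using n by (simp add: disp_kern_def norm_mult norm_divide)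
    also have "\<dots> \<le> cut_hr (cos \<alpha> * n) * (K * (n powr a * r powr (- a)) / n)"
      using n cut_hr_pos[of "cos \<alpha> * n"] ca by (intro mult_mono h q) auto
    also have "n powr a = n powr (expo_pred M) * n" unfolding e powr_add using n by simp
    finally show ?thesis using n by (simp add: mult_ac)
  qed
  have "cmod (disp_int j N (cis \<alpha>) \<mu>) \<le> (LBINT n:{0<..}. cmod (disp_kern j N (cis \<alpha>) \<mu> n))"
    by (rule set_integral_norm_bound[OF i])
  also have "\<dots> \<le> (LBINT n:{0<..}. K * r powr (- a) * (cut_hr (cos \<alpha> * n) * n powr (expo_pred M)))"
    by (rule set_integral_mono) (use le in \<open>auto intro!: set_integrable_norm i set_integrable_mult_right cut_hr_scaled_integrable ca N\<close>)
  also have "\<dots> = K * r powr (- a) * (cos \<alpha> powr (- a) * moment M)"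
    unfolding set_integral_mult_right moment_scaled[OF ca] a_def ..
  finally have L: "cmod (disp_int j N (cis \<alpha>) \<mu>) \<le> K * r powr (- a) * (cos \<alpha> powr (- a) * moment M)" .
  have "cmod (1 / (2 * of_real pi ^ 2) * (disp_int j N (cis \<alpha>) \<mu>)) = 1 / (2 * pi\<^sup>2) * cmod (disp_int j N (cis \<alpha>) \<mu>)"
    by (simp add: norm_mult norm_divide norm_power)
  also have "\<dots> \<le> 1 / (2 * pi\<^sup>2) * (K * r powr (- a) * (cos \<alpha> powr (- a) * moment M))"
    by (intro mult_left_mono L) simp
  also have "\<dots> = K / cos \<alpha> powr a * (moment M / pi / r powr a / (2 * pi))"
    by (simp add: powr_minus_divide power2_eq_square)
  also have "moment M / pi / r powr a = d_coeff M (of_real r * cis (\<alpha> + \<beta>))"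
    unfolding d_coeff_eq[OF N(2)] using r by (simp add: norm_mult a_def)
  finally show ?thesis unfolding \<mu>_def a_def .
qed

lemma disp_ratio_c_factor:
  assumes r: "r > 0" and \<beta>: "\<bar>\<beta>\<bar> < pi / 2" and n: "n > 0"
  defines "x \<equiv> disp_arg (of_real r * cis \<beta>) n"
  shows "cmod (disp_ratio 0 N x) \<le> c_factor \<beta> * cmod x ^ (N + 1)"
    and "cmod (disp_ratio 2 N x) \<le> c_factor \<beta> * cmod x ^ (Suc N + 1)"
    and "cmod (disp_ratio 3 N x) \<le> c_factor \<beta> * cmod x ^ (N + 1)"
proof -
  define s where "s = n powr (2/3) * r powr (- (2/3))"
  have s: "s \<ge> 0" by (simp add: s_def)
  have x: "x = of_real s * cis (- (2 * \<beta> / 3))"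
    unfolding x_def s_def by (rule disp_arg_polar) (use r \<beta> in auto)
  note B = c_factor_bounds[OF \<beta> s, folded x]
  have pos: "cmod (1 + x ^ 3) > 0" using B(1) by (cases "1 + x ^ 3 = 0") auto
  have 1: "1 / cmod (1 + x ^ 3) \<le> c_factor \<beta>" "cmod (1 - x) / cmod (1 + x ^ 3) \<le> c_factor \<beta>"
    using B pos by (simp_all add: divide_le_eq)
  have f: "cmod (disp_ratio j N x) = cmod (disp_num j x) / cmod (1 + x ^ 3) * cmod x ^ (N + 1)" for j
    by (simp add: disp_ratio_def norm_mult norm_divide norm_power)
  show "cmod (disp_ratio 0 N x) \<le> c_factor \<beta> * cmod x ^ (N + 1)"
    unfolding f using 1(2) by (intro mult_right_mono) (simp_all add: disp_num_def)
  show "cmod (disp_ratio 3 N x) \<le> c_factor \<beta> * cmod x ^ (N + 1)"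
    unfolding f using 1(1) by (intro mult_right_mono) (simp_all add: disp_num_def)
  have "x\<^sup>2 - x = - x * (1 - x)" by (simp add: power2_eq_square algebra_simps)
  hence "cmod (disp_ratio 2 N x) = cmod (1 - x) / cmod (1 + x ^ 3) * cmod x ^ (Suc N + 1)"
    unfolding f by (simp add: disp_num_def norm_mult)
  also have "\<dots> \<le> c_factor \<beta> * cmod x ^ (Suc N + 1)" using 1(2) by (intro mult_right_mono) simp_all
  finally show "cmod (disp_ratio 2 N x) \<le> c_factor \<beta> * cmod x ^ (Suc N + 1)" .
qed

text \<open>For total argument 0 the path of continuation is constant in \<nu> and carries no
  information. There both angles are required to be 0, and the formula for positive \<nu>
  applies.\<close>

lemma remainder_Y'_rep:
  assumes "r > 0" "\<bar>\<alpha>\<bar> < pi / 2" "\<bar>\<beta>\<bar> < pi / 2" "\<alpha> + \<beta> = 0 \<Longrightarrow> \<alpha> = 0" "N \<ge> 1"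
  shows "remainder_Y' N (of_real r * cis (\<alpha> + \<beta>)) = 1 / (2 * of_real pi ^ 2) * (disp_int (N mod 3) N (cis \<alpha>) (of_real r * cis \<beta>))"
proof (cases "\<alpha> + \<beta> = 0")
  case True
  hence "\<alpha> = 0" "\<beta> = 0" using assms by auto
  thus ?thesis using remainder_Y'_real[of r N] assms by simp
next
  case False
  thus ?thesis using assms by (intro remainder_Y'_rotated)
qed

lemma remainder_Y'_bound_0_2:
  assumes "r > 0" "\<bar>\<alpha>\<bar> < pi / 2" "\<bar>\<beta>\<bar> < pi / 2" "\<alpha> + \<beta> = 0 \<Longrightarrow> \<alpha> = 0" "N \<ge> 1"
  defines "\<nu> \<equiv> of_real r * cis (\<alpha> + \<beta>)"
  shows "N mod 3 = 0 \<Longrightarrow> cmod (remainder_Y' N \<nu>) \<le> c_factor \<beta> / cos \<alpha> powr (expo N) * (d_coeff N \<nu> / (2 * pi))"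
    and "N mod 3 = 2 \<Longrightarrow> cmod (remainder_Y' N \<nu>) \<le> c_factor \<beta> / cos \<alpha> powr ((2 * real N + 4) / 3) * (d_coeff (N + 1) \<nu> / (2 * pi))"
proof -
  have rep: "remainder_Y' N \<nu> = 1 / (2 * of_real pi ^ 2) * (disp_int (N mod 3) N (cis \<alpha>) (of_real r * cis \<beta>))"
    unfolding \<nu>_def by (rule remainder_Y'_rep) (use assms in auto)
  show "cmod (remainder_Y' N \<nu>) \<le> c_factor \<beta> / cos \<alpha> powr (expo N) * (d_coeff N \<nu> / (2 * pi))" if "N mod 3 = 0"
    unfolding rep that unfolding \<nu>_def
    by (rule disp_kern_integral_bound[OF assms(1-3,5,5)]) (rule disp_ratio_c_factor(1)[OF assms(1,3)])
  have e: "(2 * real (N + 1) + 2) / 3 = (2 * real N + 4) / 3" by simp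
  show "cmod (remainder_Y' N \<nu>) \<le> c_factor \<beta> / cos \<alpha> powr ((2 * real N + 4) / 3) * (d_coeff (N + 1) \<nu> / (2 * pi))" if "N mod 3 = 2"
    unfolding rep that unfolding \<nu>_def e[symmetric]
    by (rule disp_kern_integral_bound[OF assms(1-3,5)]) (use disp_ratio_c_factor(2)[OF assms(1,3)] in simp_all)
qed

lemma disp_kern_split:
  "disp_kern 0 N c \<mu> n = disp_kern 3 N c \<mu> n + disp_kern 3 (N + 1) c \<mu> n"
  "disp_kern 1 N c \<mu> n = disp_kern 3 N c \<mu> n + disp_kern 3 (N + 2) c \<mu> n"
  "disp_kern 2 N c \<mu> n = disp_kern 3 (N + 1) c \<mu> n + disp_kern 3 (N + 2) c \<mu> n"
  by (simp_all add: disp_kern_def disp_ratio_def disp_num_def add_divide_distrib diff_divide_distrib power2_eq_square algebra_simps)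

text \<open>The numerator 1 + x^2 is split into its two terms. They have different powers of cos in
  their bounds, hence different best rays, and each is rotated on its own; this is why two pairs of
  angles occur.\<close>

lemma remainder_Y'_bound_1:
  assumes r: "r > 0" and a1: "\<bar>\<alpha>\<bar> < pi / 2" "\<bar>\<beta>\<bar> < pi / 2" "\<alpha> + \<beta> = 0 \<Longrightarrow> \<alpha> = 0"
    and a3: "\<bar>\<alpha>'\<bar> < pi / 2" "\<bar>\<beta>'\<bar> < pi / 2" "\<alpha>' + \<beta>' = 0 \<Longrightarrow> \<alpha>' = 0"
    and eq: "\<alpha> + \<beta> = \<theta>" "\<alpha>' + \<beta>' = \<theta>" and N: "N mod 3 = 1"
  defines "\<nu> \<equiv> of_real r * cis \<theta>"
  shows "cmod (remainder_Y' N \<nu>) \<le> c_factor \<beta> / cos \<alpha> powr (expo N) * (d_coeff N \<nu> / (2 * pi))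
     + c_factor \<beta>' / cos \<alpha>' powr ((2 * real N + 6) / 3) * (d_coeff (N + 2) \<nu> / (2 * pi))"
proof -
  have N1: "N \<ge> 1" using N by (cases N) auto
  have i: "integrable_Ioi (disp_kern 3 M (cis \<alpha>) (of_real r * cis \<beta>))" if "M \<ge> 1" for M
    using a1 r that by (intro disp_kern_integrable mult_pos_pos) (auto intro!: mult_pos_pos cos_gt_zero_pi)
  have rot: "(disp_int 3 (N + 2) (cis \<alpha>) (of_real r * cis \<beta>)) = (disp_int 3 (N + 2) (cis \<alpha>') (of_real r * cis \<beta>'))"
  proof (cases "\<theta> = 0")
    case True
    hence "\<alpha> = \<alpha>'" "\<beta> = \<beta>'" using a1(3) a3(3) eq by auto
    thus ?thesis by simp
  next
    case False
    thus ?thesis using a1 a3 eq r by (intro disp_kern_integral_rotate) auto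
  qed
  have "remainder_Y' N \<nu> = 1 / (2 * of_real pi ^ 2) * (disp_int 1 N (cis \<alpha>) (of_real r * cis \<beta>))"
    unfolding \<nu>_def eq(1)[symmetric] N[symmetric] by (rule remainder_Y'_rep) (use r a1 N1 in auto)
  also have "(disp_int 1 N (cis \<alpha>) (of_real r * cis \<beta>)) = (disp_int 3 N (cis \<alpha>) (of_real r * cis \<beta>))
     + (disp_int 3 (N + 2) (cis \<alpha>) (of_real r * cis \<beta>))"
    unfolding disp_kern_split by (intro set_integral_add i) (use N1 in auto)
  finally have R: "remainder_Y' N \<nu> = 1 / (2 * of_real pi ^ 2) * (disp_int 3 N (cis \<alpha>) (of_real r * cis \<beta>))
     + 1 / (2 * of_real pi ^ 2) * (disp_int 3 (N + 2) (cis \<alpha>') (of_real r * cis \<beta>'))"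
    unfolding rot by (simp only: distrib_left)
  have e: "(2 * real (N + 2) + 2) / 3 = (2 * real N + 6) / 3" by simp
  show ?thesis unfolding R
  proof (rule order_trans[OF norm_triangle_ineq add_mono])
    show "cmod (1 / (2 * of_real pi ^ 2) * (disp_int 3 N (cis \<alpha>) (of_real r * cis \<beta>)))
      \<le> c_factor \<beta> / cos \<alpha> powr (expo N) * (d_coeff N \<nu> / (2 * pi))"
      unfolding \<nu>_def eq(1)[symmetric]
      by (rule disp_kern_integral_bound[OF r a1(1,2) N1 N1]) (rule disp_ratio_c_factor(3)[OF r a1(2)])
    show "cmod (1 / (2 * of_real pi ^ 2) * (disp_int 3 (N + 2) (cis \<alpha>') (of_real r * cis \<beta>')))
      \<le> c_factor \<beta>' / cos \<alpha>' powr ((2 * real N + 6) / 3) * (d_coeff (N + 2) \<nu> / (2 * pi))"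
      unfolding \<nu>_def eq(2)[symmetric] e[symmetric]
      by (rule disp_kern_integral_bound[OF r a3(1,2) _ _ disp_ratio_c_factor(3)[OF r a3(2)]]) simp_all
  qed
qed

section \<open>Mean value form for positive \<nu>\<close>

lemma disp_piece_average:
  assumes \<nu>: "\<nu> > 0" and M: "M \<ge> 1"
  obtains \<xi> :: real where "0 < \<xi>" "\<xi> < 1"
    "1 / (2 * of_real pi ^ 2) * (disp_int 3 M 1 (of_real \<nu>)) = of_real ((-1) ^ (M + 1) * (d_coeff M (of_real \<nu>) / (2 * pi) * \<xi>))"
proof -
  define a where "a = expo M"
  define X where "X n = n powr (2/3) / \<nu> powr (2/3)" for n
  define f where "f n = cut_hr n * (X n ^ (M + 1) / (1 + X n ^ 3) / n)" for n
  define g where "g n = \<nu> powr (- a) * (cut_hr n * n powr (expo_pred M))" for n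
  have X: "X n > 0" if "n > 0" for n using that \<nu> by (simp add: X_def)
  have k: "disp_kern 3 M 1 (of_real \<nu>) n = (-1) ^ (M + 1) * of_real (f n)" for n
    unfolding disp_kern_def disp_arg_of_real[OF \<nu>] X_def[symmetric]
    by (simp add: f_def disp_ratio_def disp_num_def cut_h_of_real)
  have "integrable_Ioi (disp_kern 3 M 1 (of_real \<nu>))"
    using \<nu> M by (intro disp_kern_integrable) auto
  hence "integrable_Ioi (\<lambda>n. (-1) ^ (M + 1) * disp_kern 3 M 1 (of_real \<nu>) n)"
    by (rule set_integrable_mult_right)
  moreover have "(-1) ^ (M + 1) * disp_kern 3 M 1 (of_real \<nu>) n = of_real (f n)" for n
    unfolding k mult.assoc[symmetric] by (simp flip: power_add)
  ultimately have "integrable_Ioi (\<lambda>n. complex_of_real (f n))" by simp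
  hence "integrable_Ioi (\<lambda>n. Re (complex_of_real (f n)))"
    unfolding set_integrable_def by (drule_tac integrable_Re) simp
  hence fi: "integrable_Ioi f" by simp
  have gi: "integrable_Ioi g"
    unfolding g_def by (intro set_integrable_mult_right moment_integrable M)
  have G: "(LBINT n:{0<..}. g n) = \<nu> powr (- a) * moment M"
    unfolding g_def set_integral_mult_right moment_def ..
  have gX: "g n = cut_hr n * (X n ^ (M + 1) / n)" if n: "n > 0" for n
  proof -
    have e: "a = expo_pred M + 1" by (simp add: a_def field_simps)
    have "X n ^ (M + 1) = n powr a * \<nu> powr (- a)"
      using norm_disp_arg_power[of n "of_real \<nu>" M] n \<nu> X[OF n]
      unfolding disp_arg_of_real[OF \<nu>] X_def[symmetric] a_def by simp
    also have "n powr a = n powr (expo_pred M) * n" unfolding e powr_add using n by simp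
    finally show ?thesis using n by (simp add: g_def)
  qed
  have fpos: "0 < (LBINT n:{0<..}. f n)"
  proof (rule set_integral_pos[OF fi])
    show "0 < f n" if "0 < n" for n
      unfolding f_def using X[OF that] that cut_hr_pos[OF that]
      by (intro mult_pos_pos divide_pos_pos add_pos_pos zero_less_power) auto
  qed
  have "0 < (LBINT n:{0<..}. g n - f n)"
  proof (rule set_integral_pos[OF set_integral_diff(1)[OF gi fi]])
    fix n :: real assume n: "0 < n"
    have "X n ^ (M + 1) / (1 + X n ^ 3) < X n ^ (M + 1)"
      using X[OF n] by (simp add: divide_less_eq add_pos_pos)
    hence "cut_hr n * (X n ^ (M + 1) / (1 + X n ^ 3) / n) < cut_hr n * (X n ^ (M + 1) / n)"
      using n cut_hr_pos[OF n] by (intro mult_strict_left_mono divide_strict_right_mono) auto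
    thus "0 < g n - f n" unfolding gX[OF n] f_def by simp
  qed
  hence lt: "(LBINT n:{0<..}. f n) < \<nu> powr (- a) * moment M"
    unfolding set_integral_diff(2)[OF gi fi] G by simp
  \<comment> \<open>The ratio lies strictly between 0 and 1 because 1 / (1 + X^3) does, and the
    weight is positive.\<close>
  define \<xi> where "\<xi> = (LBINT n:{0<..}. f n) / (\<nu> powr (- a) * moment M)"
  have gm: "0 < \<nu> powr (- a) * moment M" using \<nu> moment_pos[OF M] by simp
  have d: "d_coeff M (of_real \<nu>) / (2 * pi) * \<xi> = 1 / (2 * pi\<^sup>2) * (LBINT n:{0<..}. f n)"
    unfolding d_coeff_eq[OF M] \<xi>_def using \<nu> moment_pos[OF M]
    by (simp add: a_def powr_minus_divide power2_eq_square)
  have "(disp_int 3 M 1 (of_real \<nu>)) = (-1) ^ (M + 1) * of_real (LBINT n:{0<..}. f n)"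
    unfolding k set_integral_mult_right set_integral_complex_of_real ..
  hence "1 / (2 * of_real pi ^ 2) * (disp_int 3 M 1 (of_real \<nu>))
    = of_real ((-1) ^ (M + 1) * (d_coeff M (of_real \<nu>) / (2 * pi) * \<xi>))"
    unfolding d by simp
  moreover have "0 < \<xi>" "\<xi> < 1" using fpos lt gm by (auto simp: \<xi>_def divide_less_eq)
  ultimately show ?thesis using that by blast
qed

text \<open>A piece with numerator 1 and index M has the sign (-1)^(M + 1). The signs in the three
  cases merely record which two of the indices N, N + 1, N + 2 occur.\<close>

lemma remainder_Y'_real_mean:
  assumes \<nu>: "\<nu> > 0" and N: "N \<ge> 1"
  defines "z \<equiv> complex_of_real \<nu>"
  shows "\<exists>\<Xi>1 \<Xi>2 \<Xi>3 :: real. \<Xi>1 \<in> {0<..<1} \<and> \<Xi>2 \<in> {0<..<1} \<and> \<Xi>3 \<in> {0<..<1} \<and>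
    (N mod 3 = 0 \<longrightarrow> (-1) ^ (N + 1) * remainder_Y' N z = complex_of_real (d_coeff N z / (2 * pi) * \<Xi>1 - d_coeff (N + 1) z / (2 * pi) * \<Xi>2)) \<and>
    (N mod 3 = 1 \<longrightarrow> (-1) ^ (N + 1) * remainder_Y' N z = complex_of_real (d_coeff N z / (2 * pi) * \<Xi>1 + d_coeff (N + 2) z / (2 * pi) * \<Xi>3)) \<and>
    (N mod 3 = 2 \<longrightarrow> (-1) ^ N * remainder_Y' N z = complex_of_real (d_coeff (N + 1) z / (2 * pi) * \<Xi>2 - d_coeff (N + 2) z / (2 * pi) * \<Xi>3))"
proof -
  define J where "J M = 1 / (2 * of_real pi ^ 2) * (disp_int 3 M 1 z)" for M
  obtain \<xi> where \<xi>: "\<And>M. M \<ge> 1 \<Longrightarrow> 0 < \<xi> M \<and> \<xi> M < 1 \<and> J M = of_real ((-1) ^ (M + 1) * (d_coeff M z / (2 * pi) * \<xi> M))"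
  proof -
    have "\<exists>\<xi>. M \<ge> 1 \<longrightarrow> 0 < \<xi> \<and> \<xi> < 1 \<and> J M = of_real ((-1) ^ (M + 1) * (d_coeff M z / (2 * pi) * \<xi>))" for M
      using disp_piece_average[OF \<nu>, of M] unfolding J_def z_def by metis
    thus ?thesis using that by metis
  qed
  have i: "integrable_Ioi (disp_kern 3 M 1 z)" if "M \<ge> 1" for M
    using \<nu> that by (intro disp_kern_integrable) (auto simp: z_def)
  have R: "remainder_Y' N z = 1 / (2 * of_real pi ^ 2) * (disp_int (N mod 3) N 1 z)"
    unfolding z_def by (rule remainder_Y'_real[OF \<nu> N])
  have J: "1 / (2 * of_real pi ^ 2) * (LBINT n:{0<..}. disp_kern 3 M 1 z n + disp_kern 3 M' 1 z n) = J M + J M'" if "M \<ge> 1" "M' \<ge> 1" for M M'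
    unfolding J_def set_integral_add(2)[OF i[OF that(1)] i[OF that(2)]] by (rule distrib_left)
  define E where "E M = complex_of_real (d_coeff M z / (2 * pi) * \<xi> M)" for M
  define p where "p = (-1 :: complex) ^ N"
  have pp: "p * p = 1" by (simp add: p_def flip: power_add)
  have JM: "J N = - p * E N" "J (N + 1) = p * E (N + 1)" "J (N + 2) = - p * E (N + 2)"
    using \<xi>[OF N] \<xi>[of "N + 1"] \<xi>[of "N + 2"] by (simp_all add: E_def p_def)
  have alg: "- p * (- p * a + p * b) = (p * p) * a - (p * p) * b" "- p * (- p * a + - p * b) = (p * p) * a + (p * p) * b"
    "p * (p * a + - p * b) = (p * p) * a - (p * p) * b" for a b by (simp_all add: algebra_simps)
  have 0: "(-1) ^ (N + 1) * remainder_Y' N z = E N - E (N + 1)" if "N mod 3 = 0"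
  proof -
    have "remainder_Y' N z = J N + J (N + 1)" unfolding R that disp_kern_split by (rule J) (use N in auto)
    thus ?thesis using alg(1)[of "E N" "E (N + 1)"] unfolding JM pp by (simp add: p_def)
  qed
  have 1: "(-1) ^ (N + 1) * remainder_Y' N z = E N + E (N + 2)" if "N mod 3 = 1"
  proof -
    have "remainder_Y' N z = J N + J (N + 2)" unfolding R that disp_kern_split by (rule J) (use N in auto)
    thus ?thesis using alg(2)[of "E N" "E (N + 2)"] unfolding JM pp by (simp add: p_def)
  qed
  have 2: "(-1) ^ N * remainder_Y' N z = E (N + 1) - E (N + 2)" if "N mod 3 = 2"
  proof -
    have "remainder_Y' N z = J (N + 1) + J (N + 2)" unfolding R that disp_kern_split by (rule J) (use N in auto)
    thus ?thesis using alg(3)[of "E (N + 1)" "E (N + 2)"] unfolding JM pp by (simp add: p_def)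
  qed
  have "\<xi> N \<in> {0<..<1}" "\<xi> (N + 1) \<in> {0<..<1}" "\<xi> (N + 2) \<in> {0<..<1}" using \<xi> N by auto
  note F = this 0 1 2
  show ?thesis
    by (rule exI[of _ "\<xi> N"], rule exI[of _ "\<xi> (N + 1)"], rule exI[of _ "\<xi> (N + 2)"], intro conjI impI)
      (fact F[unfolded E_def of_real_diff[symmetric] of_real_add[symmetric]])+
qed

text \<open>For N = 1 both terms of the remainder are positive, so Y' exceeds the n = 0 term. Its
  constant is 6^(2/3) / 2 = 3^(2/3) / 2^(1/3) times Gamma (2/3) / pi.\<close>

lemma bessel_Y'_lower_bound:
  assumes \<nu>: "\<nu> > 0"
  shows "bessel_Y' (of_real \<nu>) \<in> \<real>"
    and "Re (bessel_Y' (of_real \<nu>)) > 3 powr (2 / 3) * Gamma (2 / 3) / (2 powr (1 / 3) * pi * \<nu> powr (2 / 3))"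
proof -
  define z where "z = complex_of_real \<nu>"
  obtain \<Xi>1 \<Xi>3 :: real where \<Xi>: "0 < \<Xi>1" "0 < \<Xi>3"
    and R: "(-1) ^ (1 + 1) * remainder_Y' 1 z = complex_of_real (d_coeff 1 z / (2 * pi) * \<Xi>1 + d_coeff (1 + 2) z / (2 * pi) * \<Xi>3)"
    using remainder_Y'_real_mean[OF \<nu>, of 1] unfolding z_def by (force simp del: of_real_add of_real_mult)
  define y where "y = d_coeff 1 z / (2 * pi) * \<Xi>1 + d_coeff (1 + 2) z / (2 * pi) * \<Xi>3"
  have d: "d_coeff m z > 0" if "m \<ge> 1" for m
    unfolding d_coeff_eq[OF that] using moment_pos[OF that] \<nu> by (simp add: z_def)
  have y: "y > 0" unfolding y_def using \<Xi> d by (intro add_pos_pos mult_pos_pos divide_pos_pos) auto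
  have "bessel_Y' z = of_real y + 2 / (3 * of_real pi) * (of_real (9 / 4 * disp_coeff 0) / z powr (2 / 3))"
    using R unfolding y_def[symmetric] remainder_Y'_def remainder_term by (simp add: algebra_simps)
  also have "z powr (2 / 3) = of_real (\<nu> powr (2 / 3))"
    using powr_of_real[of \<nu> "2 / 3"] \<nu> by (simp add: z_def)
  also have "of_real y + 2 / (3 * of_real pi) * (of_real (9 / 4 * disp_coeff 0) / of_real (\<nu> powr (2 / 3)))
    = complex_of_real (y + 2 / (3 * pi) * (9 / 4 * disp_coeff 0 / \<nu> powr (2 / 3)))" by simp
  also have "2 / (3 * pi) * (9 / 4 * disp_coeff 0 / \<nu> powr (2 / 3)) = 3 powr (2 / 3) * Gamma (2 / 3) / (2 powr (1 / 3) * pi * \<nu> powr (2 / 3))"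
  proof -
    have "(2 :: real) powr (2 / 3) * 2 powr (1 / 3) = 2 powr 1" unfolding powr_add[symmetric] by simp
    hence t: "(2 :: real) powr (2 / 3) = 2 / 2 powr (1 / 3)" by (simp add: field_simps)
    have "(6 :: real) powr (2 / 3) = 2 powr (2 / 3) * 3 powr (2 / 3)" using powr_mult[of 2 3 "2 / 3"] by simp
    hence "(6 :: real) powr (2 / 3) = 2 / 2 powr (1 / 3) * 3 powr (2 / 3)" unfolding t .
    thus ?thesis by (simp add: disp_coeff_def watson_coeff_def mult_ac)
  qed
  finally show "bessel_Y' (of_real \<nu>) \<in> \<real>" "Re (bessel_Y' (of_real \<nu>)) > 3 powr (2 / 3) * Gamma (2 / 3) / (2 powr (1 / 3) * pi * \<nu> powr (2 / 3))"
    using y unfolding z_def by (simp_all only: Reals_of_real Re_complex_of_real less_add_same_cancel2)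
qed

section \<open>The optimal rotation angles\<close>

definition saddle_eq :: "real \<Rightarrow> real \<Rightarrow> real \<Rightarrow> real" where
  "saddle_eq M \<theta> \<phi> = 6 * cos \<phi> * cos (2 * (\<theta> - \<phi>)) + M * (sin \<phi> * sin (2 * (\<theta> - \<phi>)))"

text \<open>Stationarity of |csc (2 (\<theta> - \<phi>))| / cos^a \<phi> in \<phi> reads 2 cot (2
  (\<theta> - \<phi>)) + a tan \<phi> = 0. Cleared of denominators and with M = 3 a this is
  \<open>saddle_eq M \<theta> \<phi> = 0\<close>; the three equations of the theorem belong to M = 2
  N + 2, 2 N + 4 and 2 N + 6.\<close>

lemma saddle_eq_iff:
  "(M + 6) * cos (3 * \<phi> - 2 * \<theta>) = (M - 6) * cos (\<phi> - 2 * \<theta>) \<longleftrightarrow> saddle_eq M \<theta> \<phi> = 0"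
proof -
  define \<psi> where "\<psi> = 2 * (\<theta> - \<phi>)"
  have c1: "cos (3 * \<phi> - 2 * \<theta>) = cos \<phi> * cos \<psi> + sin \<phi> * sin \<psi>"
    unfolding cos_diff[symmetric] by (simp add: \<psi>_def algebra_simps)
  have c2: "cos (\<phi> - 2 * \<theta>) = cos (\<phi> + \<psi>)" using cos_minus[of "\<phi> + \<psi>"] by (simp add: \<psi>_def algebra_simps)
  have "(M + 6) * cos (3 * \<phi> - 2 * \<theta>) - (M - 6) * cos (\<phi> - 2 * \<theta>) = 2 * saddle_eq M \<theta> \<phi>"
    unfolding saddle_eq_def \<psi>_def[symmetric] c1 c2 cos_add by (simp add: algebra_simps)
  thus ?thesis by auto
qed

lemma saddle_eq_uminus: "saddle_eq M (- \<theta>) (- \<phi>) = saddle_eq M \<theta> \<phi>"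
proof -
  have "2 * (- \<theta> - - \<phi>) = - (2 * (\<theta> - \<phi>))" by simp
  thus ?thesis unfolding saddle_eq_def by (simp only: cos_minus sin_minus mult_minus_left mult_minus_right minus_minus)
qed

text \<open>The three cases are one condition: 0 < \<phi> < pi / 2 and pi / 4 < \<theta> - \<phi> <
  pi / 2. Both angles are thus admissible, and 2 (\<theta> - \<phi>) is obtuse.\<close>

lemma I_interval_pos:
  assumes "pi / 4 < \<theta>" "\<theta> < pi"
  shows "I_interval \<theta> = {max 0 (\<theta> - pi / 2)<..<min (pi / 2) (\<theta> - pi / 4)}"
proof -
  consider "3 * pi / 4 \<le> \<theta>" | "pi / 2 \<le> \<theta>" "\<theta> < 3 * pi / 4" | "\<theta> < pi / 2" by linarith
  thus ?thesis
  proof cases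
    case 1
    hence "max 0 (\<theta> - pi / 2) = - pi / 2 + \<theta>" "min (pi / 2) (\<theta> - pi / 4) = pi / 2"
      using pi_gt_zero by - arith+
    thus ?thesis using 1 assms by (simp add: I_interval_def)
  next
    case 2
    hence "max 0 (\<theta> - pi / 2) = - pi / 2 + \<theta>" "min (pi / 2) (\<theta> - pi / 4) = - pi / 4 + \<theta>"
      using pi_gt_zero by - arith+
    moreover have "\<not> 3 * pi / 4 \<le> \<theta>" using 2 by linarith
    ultimately show ?thesis using 2 by (simp only: I_interval_def simp_thms if_True if_False)
  next
    case 3
    hence "max 0 (\<theta> - pi / 2) = 0" "min (pi / 2) (\<theta> - pi / 4) = - pi / 4 + \<theta>"
      using pi_gt_zero assms by - arith+
    moreover have "\<not> 3 * pi / 4 \<le> \<theta>" "\<not> pi / 2 \<le> \<theta>" using 3 pi_gt_zero by - linarith+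
    ultimately show ?thesis using 3 assms by (simp only: I_interval_def simp_thms if_True if_False)
  qed
qed

lemma I_interval_neg:
  assumes "pi / 4 < \<theta>" "\<theta> < pi"
  shows "I_interval (- \<theta>) = uminus ` I_interval \<theta>"
proof -
  consider "3 * pi / 4 \<le> \<theta>" | "pi / 2 \<le> \<theta>" "\<theta> < 3 * pi / 4" | "\<theta> < pi / 2" by linarith
  hence "I_interval (- \<theta>) = {- min (pi / 2) (\<theta> - pi / 4)<..<- max 0 (\<theta> - pi / 2)}"
  proof cases
    case 1
    have m: "max 0 (\<theta> - pi / 2) = - (pi / 2 + - \<theta>)" "min (pi / 2) (\<theta> - pi / 4) = - (- pi / 2)"
      using 1 pi_gt_zero by - arith+
    have "\<not> 3 * pi / 4 \<le> - \<theta>" "\<not> pi / 2 \<le> - \<theta>" "\<not> pi / 4 < - \<theta>" "- pi < - \<theta>" "- \<theta> \<le> - 3 * pi / 4"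
      using 1 assms pi_gt_zero by - linarith+
    thus ?thesis unfolding m by (simp only: I_interval_def simp_thms if_True if_False minus_minus)
  next
    case 2
    have m: "max 0 (\<theta> - pi / 2) = - (pi / 2 + - \<theta>)" "min (pi / 2) (\<theta> - pi / 4) = - (pi / 4 + - \<theta>)"
      using 2 pi_gt_zero by - arith+
    have "\<not> 3 * pi / 4 \<le> - \<theta>" "\<not> pi / 2 \<le> - \<theta>" "\<not> pi / 4 < - \<theta>" "\<not> - \<theta> \<le> - 3 * pi / 4" "- 3 * pi / 4 < - \<theta>" "- \<theta> \<le> - pi / 2"
      using 2 assms pi_gt_zero by - linarith+
    thus ?thesis unfolding m by (simp only: I_interval_def simp_thms if_True if_False minus_minus)
  next
    case 3
    have m: "max 0 (\<theta> - pi / 2) = 0" "min (pi / 2) (\<theta> - pi / 4) = - (pi / 4 + - \<theta>)"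
      using 3 assms pi_gt_zero by - arith+
    have "\<not> 3 * pi / 4 \<le> - \<theta>" "\<not> pi / 2 \<le> - \<theta>" "\<not> pi / 4 < - \<theta>" "\<not> - \<theta> \<le> - 3 * pi / 4" "\<not> - \<theta> \<le> - pi / 2" "- pi / 2 < - \<theta>" "- \<theta> < - pi / 4"
      using 3 assms pi_gt_zero by - linarith+
    thus ?thesis unfolding m by (simp only: I_interval_def simp_thms if_True if_False minus_minus minus_zero)
  qed
  thus ?thesis unfolding I_interval_pos[OF assms] by simp
qed

lemma I_interval_range:
  assumes "pi / 4 < \<bar>\<theta>\<bar>" "\<bar>\<theta>\<bar> < pi" "\<phi> \<in> I_interval \<theta>"
  shows "\<bar>\<phi>\<bar> < pi / 2" "\<bar>\<theta> - \<phi>\<bar> < pi / 2" "\<theta> - \<phi> \<noteq> 0"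
proof -
  have pos: "\<bar>\<phi>\<bar> < pi / 2 \<and> \<bar>\<theta> - \<phi>\<bar> < pi / 2 \<and> \<theta> - \<phi> \<noteq> 0" if "pi / 4 < \<theta>" "\<theta> < pi" "\<phi> \<in> I_interval \<theta>" for \<theta> \<phi>
    using that(3) pi_gt_zero unfolding I_interval_pos[OF that(1,2)] by (simp add: abs_less_iff)
  have "\<bar>\<phi>\<bar> < pi / 2 \<and> \<bar>\<theta> - \<phi>\<bar> < pi / 2 \<and> \<theta> - \<phi> \<noteq> 0"
  proof (cases "\<theta> > 0")
    case True
    thus ?thesis using pos[of \<theta> \<phi>] assms by simp
  next
    case False
    hence \<theta>: "pi / 4 < - \<theta>" "- \<theta> < pi" using assms by auto
    have "\<phi> \<in> I_interval (- (- \<theta>))" using assms by simp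
    hence "- \<phi> \<in> I_interval (- \<theta>)" unfolding I_interval_neg[OF \<theta>] by auto
    from pos[OF \<theta> this] show ?thesis by (simp add: abs_minus_commute)
  qed
  thus "\<bar>\<phi>\<bar> < pi / 2" "\<bar>\<theta> - \<phi>\<bar> < pi / 2" "\<theta> - \<phi> \<noteq> 0" by auto
qed

text \<open>Existence follows from opposite signs at the end points. For uniqueness the equation is
  written as M tan \<phi> = 6 tan (2 (\<theta> - \<phi>) - pi / 2), whose left side increases and
  whose right side decreases in \<phi>.\<close>

lemma saddle_eq_unique_pos:
  assumes \<theta>: "pi / 4 < \<theta>" "\<theta> < pi" and M: "M > 0"
  shows "\<exists>!\<phi>. \<phi> \<in> I_interval \<theta> \<and> saddle_eq M \<theta> \<phi> = 0"
proof -
  define L R where "L = max 0 (\<theta> - pi / 2)" and "R = min (pi / 2) (\<theta> - pi / 4)"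
  have I: "I_interval \<theta> = {L<..<R}" unfolding L_def R_def by (rule I_interval_pos[OF \<theta>])
  have LR: "L < R" unfolding L_def R_def using \<theta> pi_gt_zero by (simp add: max_def min_def)
  have "saddle_eq M \<theta> L < 0"
  proof (cases "\<theta> < pi / 2")
    case True
    hence L: "L = 0" by (simp add: L_def)
    have "cos (2 * \<theta>) < 0" using True \<theta> cos_lt_zero_pi[of "2 * \<theta>"] by simp
    thus ?thesis by (simp add: saddle_eq_def L)
  next
    case False
    hence L: "L = \<theta> - pi / 2" by (simp add: L_def)
    have "cos L > 0" using \<theta> False unfolding L by (intro cos_gt_zero_pi) auto
    thus ?thesis by (simp add: saddle_eq_def L)
  qed
  moreover have "saddle_eq M \<theta> R > 0"
  proof (cases "\<theta> \<ge> 3 * pi / 4")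
    case True
    hence R: "R = pi / 2" by (simp add: R_def)
    have "sin (2 * (\<theta> - pi / 2)) > 0" using True \<theta> pi_gt_zero by (intro sin_gt_zero) simp_all
    thus ?thesis using M by (simp add: saddle_eq_def R mult_pos_neg)
  next
    case False
    hence R: "R = \<theta> - pi / 4" by (simp add: R_def)
    have "sin R > 0" using \<theta> False pi_gt_zero unfolding R by (intro sin_gt_zero) auto
    thus ?thesis using M by (simp add: saddle_eq_def R)
  qed
  moreover have "continuous_on {L..R} (saddle_eq M \<theta>)" unfolding saddle_eq_def by (intro continuous_intros)
  ultimately obtain \<phi> where \<phi>: "L \<le> \<phi>" "\<phi> \<le> R" "saddle_eq M \<theta> \<phi> = 0"
    using IVT'[of "saddle_eq M \<theta>" L 0 R] LR by auto
  hence "\<phi> \<noteq> L" "\<phi> \<noteq> R" using \<open>saddle_eq M \<theta> L < 0\<close> \<open>saddle_eq M \<theta> R > 0\<close> by auto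
  hence ex: "\<phi> \<in> I_interval \<theta> \<and> saddle_eq M \<theta> \<phi> = 0" using \<phi> unfolding I by simp
  have tan: "M * tan x = 6 * tan (2 * (\<theta> - x) - pi / 2)" if "x \<in> I_interval \<theta>" "saddle_eq M \<theta> x = 0" for x
  proof -
    have r: "0 < x" "x < pi / 2" "0 < \<theta> - x" "\<theta> - x < pi / 2"
      using that(1) pi_gt_zero \<theta> unfolding I L_def R_def by auto
    have c: "cos x \<noteq> 0" "sin (2 * (\<theta> - x)) \<noteq> 0"
      using cos_gt_zero[of x] sin_gt_zero[of "2 * (\<theta> - x)"] r by auto
    have "tan (2 * (\<theta> - x) - pi / 2) = - cos (2 * (\<theta> - x)) / sin (2 * (\<theta> - x))"
      by (simp add: tan_def sin_diff cos_diff)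
    moreover have "M * (sin x * sin (2 * (\<theta> - x))) = - (6 * cos x * cos (2 * (\<theta> - x)))"
      using that(2) by (simp add: saddle_eq_def)
    moreover have "M * (s / c) = 6 * (- C / S)" if "M * (s * S) = - (6 * c * C)" "c \<noteq> 0" "S \<noteq> 0" for s S c C :: real
      using that by (simp add: field_simps)
    ultimately show ?thesis using c by (simp add: tan_def)
  qed
  have False if x: "x \<in> I_interval \<theta>" "saddle_eq M \<theta> x = 0" and y: "y \<in> I_interval \<theta>" "saddle_eq M \<theta> y = 0" and lt: "x < y" for x y
  proof -
    have r: "0 < x" "y < pi / 2" "0 < \<theta> - y" "\<theta> - x < pi / 2"
      using x(1) y(1) lt pi_gt_zero \<theta> unfolding I L_def R_def by auto
    have "tan x < tan y" using r lt pi_gt_zero by (intro tan_monotone) auto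
    moreover have "tan (2 * (\<theta> - y) - pi / 2) < tan (2 * (\<theta> - x) - pi / 2)" using r lt by (intro tan_monotone) auto
    ultimately have "M * tan x < M * tan y" "6 * tan (2 * (\<theta> - y) - pi / 2) < 6 * tan (2 * (\<theta> - x) - pi / 2)" using M by auto
    thus False unfolding tan[OF x] tan[OF y] by simp
  qed
  hence "x = y" if "x \<in> I_interval \<theta> \<and> saddle_eq M \<theta> x = 0" "y \<in> I_interval \<theta> \<and> saddle_eq M \<theta> y = 0" for x y
    using that by (meson linorder_neqE_linordered_idom)
  with ex show ?thesis by blast
qed

lemma saddle_eq_unique:
  assumes \<theta>: "pi / 4 < \<bar>\<theta>\<bar>" "\<bar>\<theta>\<bar> < pi" and M: "M > 0"
  shows "\<exists>!\<phi>. \<phi> \<in> I_interval \<theta> \<and> saddle_eq M \<theta> \<phi> = 0"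
proof (cases "\<theta> > 0")
  case True
  thus ?thesis using saddle_eq_unique_pos[of \<theta> M] assms by simp
next
  case False
  hence \<theta>': "pi / 4 < - \<theta>" "- \<theta> < pi" using assms by auto
  obtain \<phi> where \<phi>: "\<phi> \<in> I_interval (- \<theta>)" "saddle_eq M (- \<theta>) \<phi> = 0"
    and u: "\<And>y. y \<in> I_interval (- \<theta>) \<Longrightarrow> saddle_eq M (- \<theta>) y = 0 \<Longrightarrow> y = \<phi>"
    using saddle_eq_unique_pos[OF \<theta>' M] by blast
  have I: "y \<in> I_interval \<theta> \<longleftrightarrow> - y \<in> I_interval (- \<theta>)" for y
    using I_interval_neg[OF \<theta>'] by (force simp: image_iff)
  show ?thesis
  proof (rule ex1I[of _ "- \<phi>"])
    show "- \<phi> \<in> I_interval \<theta> \<and> saddle_eq M \<theta> (- \<phi>) = 0"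
      using \<phi> I saddle_eq_uminus[of M "- \<theta>" \<phi>] by simp
    fix y assume "y \<in> I_interval \<theta> \<and> saddle_eq M \<theta> y = 0"
    hence "- y = \<phi>" using I saddle_eq_uminus[of M \<theta> y] by (intro u) auto
    thus "y = - \<phi>" by simp
  qed
qed

lemma is_phi_iff:
  "is_phi1 N \<theta> \<phi> \<longleftrightarrow> \<phi> \<in> I_interval \<theta> \<and> saddle_eq (2 * real N + 2) \<theta> \<phi> = 0"
  "is_phi2 N \<theta> \<phi> \<longleftrightarrow> \<phi> \<in> I_interval \<theta> \<and> saddle_eq (2 * real N + 4) \<theta> \<phi> = 0"
  "is_phi3 N \<theta> \<phi> \<longleftrightarrow> \<phi> \<in> I_interval \<theta> \<and> saddle_eq (2 * real N + 6) \<theta> \<phi> = 0"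
  unfolding is_phi1_def is_phi2_def is_phi3_def saddle_eq_iff[symmetric] by (simp_all add: add.commute)

section \<open>Explicit angles for arguments up to pi / 2\<close>

lemma xlnx_difference_le:
  assumes "0 \<le> u" "u < (1 :: real)"
  shows "(1 + u) * ln (1 + u) - (1 - u) * ln (1 - u) \<le> 2 * u"
proof -
  define h where "h u = 2 * u - (1 + u) * ln (1 + u) + (1 - u) * ln (1 - u)" for u :: real
  have "h 0 \<le> h u"
  proof (rule DERIV_nonneg_imp_nondecreasing[OF assms(1)])
    fix x assume x: "0 \<le> x" "x \<le> u"
    hence x1: "x < 1" using assms by linarith
    have "((\<lambda>u. (1 + u) * ln (1 + u)) has_real_derivative ln (1 + x) + 1) (at x)"
      "((\<lambda>u. (1 - u) * ln (1 - u)) has_real_derivative - ln (1 - x) - 1) (at x)"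
      using x x1 by (auto intro!: derivative_eq_intros)
    from DERIV_add[OF DERIV_diff[OF DERIV_cmult[OF DERIV_ident, of 2] this(1)] this(2)]
    have "(h has_real_derivative - (ln (1 + x) + ln (1 - x))) (at x)"
      unfolding h_def by simp
    moreover have "ln (1 + x) + ln (1 - x) \<le> 0"
    proof -
      have "(1 + x) * (1 - x) \<le> 1" by (simp add: algebra_simps)
      moreover have "ln (1 + x) + ln (1 - x) = ln ((1 + x) * (1 - x))" using x x1 by (simp add: ln_mult)
      moreover have "0 < (1 + x) * (1 - x)" using x x1 by simp
      ultimately show ?thesis by (simp add: ln_le_zero_iff)
    qed
    ultimately show "\<exists>y. (h has_real_derivative y) (at x) \<and> 0 \<le> y" by force
  qed
  thus ?thesis by (simp add: h_def)
qed

text \<open>Both b and b + 1 are measured from their midpoint b + 1 / 2, as (b + 1 / 2) (1 - u) and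
  (b + 1 / 2) (1 + u). The logarithm of the midpoint then separates, and
  \<open>xlnx_difference_le\<close> remains.\<close>

lemma Euler_constant_bound:
  assumes b: "b > (0 :: real)"
  shows "(b + 1) powr (b + 1) / b powr b \<le> exp 1 * (b + 1 / 2)"
proof -
  define u where "u = 1 / (2 * b + 1)"
  have u: "0 < u" "u < 1" using b by (auto simp: u_def)
  have "(1 + u) * ln (1 + u) - (1 - u) * ln (1 - u) \<le> 2 * u" using u by (intro xlnx_difference_le) auto
  moreover have "(1 + u) * X - (1 - u) * Y = u * (2 * ((b + 1) * X - b * Y))" for X Y
  proof -
    have "1 + u = u * (2 * (b + 1))" "1 - u = u * (2 * b)" using b by (auto simp: u_def field_simps)
    thus ?thesis by (simp only: right_diff_distrib mult_ac)
  qed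
  ultimately have "u * (2 * ((b + 1) * ln (1 + u) - b * ln (1 - u))) \<le> u * 2" by (simp only: mult.commute)
  hence 1: "(b + 1) * ln (1 + u) - b * ln (1 - u) \<le> 1" using u by simp
  have "1 + u = (b + 1) / (b + 1 / 2)" "1 - u = b / (b + 1 / 2)" using b by (auto simp: u_def field_simps)
  hence L: "ln (1 + u) = ln (b + 1) - ln (b + 1 / 2)" "ln (1 - u) = ln b - ln (b + 1 / 2)"
    using b by (simp_all add: ln_div)
  have "(b + 1) * (x - l) - b * (y - l) = (b + 1) * x - b * y - l" for x y l by (simp add: algebra_simps)
  with 1 have "(b + 1) * ln (b + 1) - b * ln b - ln (b + 1 / 2) \<le> 1" unfolding L by simp
  hence "(b + 1) * ln (b + 1) - b * ln b \<le> 1 + ln (b + 1 / 2)" by linarith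
  hence "exp ((b + 1) * ln (b + 1) - b * ln b) \<le> exp (1 + ln (b + 1 / 2))" by simp
  thus ?thesis using b by (simp add: exp_diff exp_add powr_def)
qed

text \<open>The common form of all modulus bounds of the theorem: a splitting of \<theta> into a
  rotation \<alpha> of the ray and a remaining argument \<beta>. The clause for \<theta> = 0 mirrors
  the hypothesis of \<open>remainder_Y'_rep\<close>.\<close>

definition rotation_bound :: "real \<Rightarrow> real \<Rightarrow> real \<Rightarrow> bool" where
  "rotation_bound \<theta> a A \<longleftrightarrow> (\<exists>\<alpha> \<beta>. \<alpha> + \<beta> = \<theta> \<and> \<bar>\<alpha>\<bar> < pi / 2 \<and> \<bar>\<beta>\<bar> < pi / 2 \<and> (\<theta> = 0 \<longrightarrow> \<alpha> = 0) \<and> c_factor \<beta> / cos \<alpha> powr a \<le> A)"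

text \<open>Up to pi / 2 - \<phi>0 no rotation is made. Closer to pi / 2 the remaining argument is
  held at pi / 2 - \<phi>0 and only the excess is rotated. Both cases are dominated by \<theta> = pi
  / 2, where the bound is 1 / (sin (2 \<phi>0) cos^a \<phi>0).\<close>

lemma rotation_choice_pos:
  assumes \<theta>: "pi / 4 < \<theta>" "\<theta> \<le> pi / 2" and a: "a > 0"
  shows "rotation_bound \<theta> a (1 / 2 * sqrt (exp 1 * (a + 3 / 2)))"
proof -
  define b where "b = a + 1"
  have b: "b > 1" using a by (simp add: b_def)
  \<comment> \<open>This angle maximises sin (2 \<phi>) cos^a \<phi> = 2 sin \<phi> cos^b \<phi>,
    whose derivative vanishes for tan^2 \<phi> = 1 / b.\<close>
  define \<phi>0 where "\<phi>0 = arctan (1 / sqrt b)"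
  have "0 < \<phi>0" using b by (simp add: \<phi>0_def)
  moreover have "\<phi>0 < pi / 4"
    unfolding \<phi>0_def arctan_one[symmetric] arctan_less_iff using b by simp
  ultimately have \<phi>0: "0 < \<phi>0" "\<phi>0 < pi / 4" by auto
  have "1 + (1 / sqrt b)\<^sup>2 = (b + 1) / b" using b by (simp add: power_divide field_simps)
  hence cs: "cos \<phi>0 = sqrt b / sqrt (b + 1)" "sin \<phi>0 = 1 / sqrt (b + 1)"
    unfolding \<phi>0_def cos_arctan sin_arctan using b by (simp_all add: real_sqrt_divide)
  have cp: "0 < cos \<phi>0" using b by (simp add: cs)
  have S: "0 < sin (2 * \<phi>0)" using \<phi>0 by (intro sin_gt_zero) auto
  have val: "1 / sin (2 * \<phi>0) / cos \<phi>0 powr a = 1 / 2 * sqrt ((b + 1) powr (b + 1) / b powr b)"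
  proof -
    have "cos \<phi>0 = (b / (b + 1)) powr (1 / 2)" using b by (simp add: cs powr_half_sqrt real_sqrt_divide)
    hence "cos \<phi>0 powr a * cos \<phi>0 = (b / (b + 1)) powr (b / 2)"
      using b cp by (simp add: powr_powr b_def flip: powr_add) (simp add: field_simps powr_add[symmetric])
    moreover have "sin (2 * \<phi>0) * cos \<phi>0 powr a = 2 * sin \<phi>0 * (cos \<phi>0 powr a * cos \<phi>0)"
      unfolding sin_double by (simp only: mult_ac)
    ultimately have "sin (2 * \<phi>0) * cos \<phi>0 powr a = 2 * (1 / sqrt (b + 1)) * (b / (b + 1)) powr (b / 2)"
      by (simp only: cs(2))
    also have "\<dots> = 2 / sqrt ((b + 1) powr (b + 1) / b powr b)"
      using b by (simp add: powr_divide powr_add powr_half_sqrt[symmetric] powr_powr powr_mult)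
    finally show ?thesis by (simp add: divide_divide_eq_left)
  qed
  have "(b + 1) powr (b + 1) / b powr b \<le> exp 1 * (b + 1 / 2)" using b by (intro Euler_constant_bound) auto
  hence "sqrt ((b + 1) powr (b + 1) / b powr b) \<le> sqrt (exp 1 * (a + 3 / 2))"
    by (intro real_sqrt_le_mono) (simp add: b_def add.commute)
  hence V: "1 / sin (2 * \<phi>0) / cos \<phi>0 powr a \<le> 1 / 2 * sqrt (exp 1 * (a + 3 / 2))"
    unfolding val by simp
  show ?thesis
  proof (cases "\<theta> \<le> pi / 2 - \<phi>0")
    case True
    have "sin (2 * \<phi>0) \<le> sin (pi - 2 * \<theta>)" using True \<theta> \<phi>0 by (intro sin_monotone_2pi_le) auto
    hence "sin (2 * \<phi>0) \<le> sin (2 * \<theta>)" by simp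
    hence "\<bar>csc (2 * \<theta>)\<bar> \<le> 1 / sin (2 * \<phi>0)" using S by (simp add: csc_def frac_le)
    also have "\<dots> \<le> 1 / sin (2 * \<phi>0) / cos \<phi>0 powr a"
    proof -
      have "cos \<phi>0 powr a \<le> 1 powr a" using cp a by (intro powr_mono2) auto
      hence "1 / sin (2 * \<phi>0) / 1 \<le> 1 / sin (2 * \<phi>0) / cos \<phi>0 powr a" using S cp by (intro divide_left_mono) auto
      thus ?thesis by simp
    qed
    finally have "c_factor \<theta> / cos 0 powr a \<le> 1 / 2 * sqrt (exp 1 * (a + 3 / 2))"
      using V c_factor_le_csc[of \<theta>] True \<phi>0 \<theta> by simp
    thus ?thesis unfolding rotation_bound_def using True \<phi>0 \<theta> by (intro exI[of _ 0] exI[of _ \<theta>]) auto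
  next
    case False
    define \<alpha> where "\<alpha> = \<theta> - (pi / 2 - \<phi>0)"
    have \<alpha>: "0 < \<alpha>" "\<alpha> \<le> \<phi>0" using False \<theta> by (auto simp: \<alpha>_def)
    have "c_factor (pi / 2 - \<phi>0) \<le> \<bar>csc (2 * (pi / 2 - \<phi>0))\<bar>" using \<phi>0 by (intro c_factor_le_csc) auto
    also have "\<dots> = 1 / sin (2 * \<phi>0)" using S by (simp add: csc_def right_diff_distrib)
    finally have c: "c_factor (pi / 2 - \<phi>0) \<le> 1 / sin (2 * \<phi>0)" .
    have "cos \<phi>0 \<le> cos \<alpha>" using \<alpha> \<phi>0 by (intro cos_monotone_0_pi_le) auto
    hence "cos \<phi>0 powr a \<le> cos \<alpha> powr a" using cp a by (intro powr_mono2) auto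
    hence "c_factor (pi / 2 - \<phi>0) / cos \<alpha> powr a \<le> 1 / sin (2 * \<phi>0) / cos \<phi>0 powr a"
      using c c_factor_nonneg S cp by (intro frac_le) auto
    hence "c_factor (pi / 2 - \<phi>0) / cos \<alpha> powr a \<le> 1 / 2 * sqrt (exp 1 * (a + 3 / 2))" using V by linarith
    moreover have "\<theta> \<noteq> 0" using \<theta> pi_gt_zero by auto
    ultimately show ?thesis unfolding rotation_bound_def using \<alpha> \<phi>0
      by (intro exI[of _ \<alpha>] exI[of _ "pi / 2 - \<phi>0"]) (auto simp: \<alpha>_def)
  qed
qed

lemma rotation_bound_abs: "rotation_bound \<bar>\<theta>\<bar> a A \<Longrightarrow> rotation_bound \<theta> a A"
proof (cases "\<theta> \<ge> 0")
  case False
  assume "rotation_bound \<bar>\<theta>\<bar> a A"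
  then obtain \<alpha> \<beta> where "\<alpha> + \<beta> = - \<theta>" "\<bar>\<alpha>\<bar> < pi / 2" "\<bar>\<beta>\<bar> < pi / 2" "c_factor \<beta> / cos \<alpha> powr a \<le> A"
    using False by (auto simp: rotation_bound_def)
  moreover have "c_factor (- \<beta>) = c_factor \<beta>" by (simp add: c_factor_def csc_def)
  ultimately show ?thesis
    unfolding rotation_bound_def using False by (intro exI[of _ "- \<alpha>"] exI[of _ "- \<beta>"]) auto
qed simp

lemma rotation_bound_half_plane:
  assumes "\<bar>\<theta>\<bar> < pi / 2"
  shows "rotation_bound \<theta> a (c_factor \<theta>)"
  unfolding rotation_bound_def using assms by (intro exI[of _ 0] exI[of _ \<theta>]) auto

lemma rotation_bound_I_interval:
  assumes "pi / 4 < \<bar>\<theta>\<bar>" "\<bar>\<theta>\<bar> < pi" "\<phi> \<in> I_interval \<theta>"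
  shows "rotation_bound \<theta> a (\<bar>csc (2 * (\<theta> - \<phi>))\<bar> / cos \<phi> powr a)"
proof -
  note ran = I_interval_range[OF assms]
  have "c_factor (\<theta> - \<phi>) / cos \<phi> powr a \<le> \<bar>csc (2 * (\<theta> - \<phi>))\<bar> / cos \<phi> powr a"
    using c_factor_le_csc[OF ran(3,2)] by (intro divide_right_mono) auto
  moreover have "\<theta> \<noteq> 0" using assms pi_gt_zero by auto
  ultimately show ?thesis unfolding rotation_bound_def using ran by (intro exI[of _ \<phi>] exI[of _ "\<theta> - \<phi>"]) auto
qed

theorem mainTheorem12:
  fixes \<nu> :: complex and N :: nat and \<theta> :: real
  assumes "\<nu> \<noteq> 0" and "\<bar>Arg \<nu>\<bar> < pi" and "N \<ge> 1" and "\<theta> = Arg \<nu>"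
  shows
   "(\<bar>\<theta>\<bar> < pi / 2 \<longrightarrow>
       (N mod 3 = 0 \<longrightarrow>
          cmod (remainder_Y' N \<nu>) \<le> d_coeff N \<nu> / (2 * pi) * c_factor \<theta>) \<and>
       (N mod 3 = 1 \<longrightarrow>
          cmod (remainder_Y' N \<nu>)
            \<le> (d_coeff N \<nu> + d_coeff (N + 2) \<nu>) / (2 * pi) * c_factor \<theta>) \<and>
       (N mod 3 = 2 \<longrightarrow>
          cmod (remainder_Y' N \<nu>) \<le> d_coeff (N + 1) \<nu> / (2 * pi) * c_factor \<theta>))
     \<and>
    (\<nu> \<in> \<real> \<and> Re \<nu> > 0 \<longrightarrow>
       (\<exists>\<Xi>1 \<Xi>2 \<Xi>3 :: real. \<Xi>1 \<in> {0<..<1} \<and> \<Xi>2 \<in> {0<..<1} \<and> \<Xi>3 \<in> {0<..<1} \<and>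
          (N mod 3 = 0 \<longrightarrow>
             (-1) ^ (N + 1) * remainder_Y' N \<nu> = complex_of_real
               (d_coeff N \<nu> / (2 * pi) * \<Xi>1 - d_coeff (N + 1) \<nu> / (2 * pi) * \<Xi>2)) \<and>
          (N mod 3 = 1 \<longrightarrow>
             (-1) ^ (N + 1) * remainder_Y' N \<nu> = complex_of_real
               (d_coeff N \<nu> / (2 * pi) * \<Xi>1 + d_coeff (N + 2) \<nu> / (2 * pi) * \<Xi>3)) \<and>
          (N mod 3 = 2 \<longrightarrow>
             (-1) ^ N * remainder_Y' N \<nu> = complex_of_real
               (d_coeff (N + 1) \<nu> / (2 * pi) * \<Xi>2 - d_coeff (N + 2) \<nu> / (2 * pi) * \<Xi>3))) \<and>
       bessel_Y' \<nu> \<in> \<real> \<and>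
       Re (bessel_Y' \<nu>)
         > 3 powr (2 / 3) * Gamma (2 / 3) / (2 powr (1 / 3) * pi * Re \<nu> powr (2 / 3)))
     \<and>
    (pi / 4 < \<bar>\<theta>\<bar> \<and> \<bar>\<theta>\<bar> < pi \<longrightarrow>
       (\<exists>!\<phi>. is_phi1 N \<theta> \<phi>) \<and> (\<exists>!\<phi>. is_phi2 N \<theta> \<phi>) \<and> (\<exists>!\<phi>. is_phi3 N \<theta> \<phi>) \<and>
       (\<forall>\<phi>1 \<phi>2 \<phi>3. is_phi1 N \<theta> \<phi>1 \<and> is_phi2 N \<theta> \<phi>2 \<and> is_phi3 N \<theta> \<phi>3 \<longrightarrow>
          (N mod 3 = 0 \<longrightarrow>
             cmod (remainder_Y' N \<nu>)
               \<le> \<bar>csc (2 * (\<theta> - \<phi>1))\<bar> / cos \<phi>1 powr ((2 * real N + 2) / 3)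
                   * (d_coeff N \<nu> / (2 * pi))) \<and>
          (N mod 3 = 1 \<longrightarrow>
             cmod (remainder_Y' N \<nu>)
               \<le> \<bar>csc (2 * (\<theta> - \<phi>1))\<bar> / cos \<phi>1 powr ((2 * real N + 2) / 3)
                   * (d_coeff N \<nu> / (2 * pi))
                 + \<bar>csc (2 * (\<theta> - \<phi>3))\<bar> / cos \<phi>3 powr ((2 * real N + 6) / 3)
                   * (d_coeff (N + 2) \<nu> / (2 * pi))) \<and>
          (N mod 3 = 2 \<longrightarrow>
             cmod (remainder_Y' N \<nu>)
               \<le> \<bar>csc (2 * (\<theta> - \<phi>2))\<bar> / cos \<phi>2 powr ((2 * real N + 4) / 3)
                   * (d_coeff (N + 1) \<nu> / (2 * pi)))))
     \<and>
    (pi / 4 < \<bar>\<theta>\<bar> \<and> \<bar>\<theta>\<bar> \<le> pi / 2 \<and> N \<ge> 4 \<longrightarrow>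
       (N mod 3 = 0 \<longrightarrow>
          cmod (remainder_Y' N \<nu>)
            \<le> 1 / 2 * sqrt (exp 1 / 3 * (2 * real N + 13 / 2)) * (d_coeff N \<nu> / (2 * pi))) \<and>
       (N mod 3 = 1 \<longrightarrow>
          cmod (remainder_Y' N \<nu>)
            \<le> 1 / 2 * sqrt (exp 1 / 3 * (2 * real N + 13 / 2)) * (d_coeff N \<nu> / (2 * pi))
              + 1 / 2 * sqrt (exp 1 / 3 * (2 * real N + 21 / 2))
                * (d_coeff (N + 2) \<nu> / (2 * pi))) \<and>
       (N mod 3 = 2 \<longrightarrow>
          cmod (remainder_Y' N \<nu>)
            \<le> 1 / 2 * sqrt (exp 1 / 3 * (2 * real N + 17 / 2))
              * (d_coeff (N + 1) \<nu> / (2 * pi))))"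
proof -
  have r: "cmod \<nu> > 0" using assms(1) by simp
  have \<nu>: "\<nu> = of_real (cmod \<nu>) * cis \<theta>"
    using rcis_cmod_Arg[of \<nu>] assms(4) by (simp add: rcis_def)
  note N = assms(3)
  let ?d = "\<lambda>m. d_coeff m \<nu> / (2 * pi)" and ?R = "cmod (remainder_Y' N \<nu>)"
  have d: "?d m \<ge> 0" if "m \<ge> 1" for m
    unfolding d_coeff_eq[OF that] using moment_pos[OF that] by simp
  \<comment> \<open>One statement serves (i), (iii) and (iv). Only the three constants change, each
    certified by a splitting for its own exponent.\<close>
  have G: "(N mod 3 = 0 \<longrightarrow> ?R \<le> A1 * ?d N) \<and> (N mod 3 = 1 \<longrightarrow> ?R \<le> A1 * ?d N + A3 * ?d (N + 2)) \<and> (N mod 3 = 2 \<longrightarrow> ?R \<le> A2 * ?d (N + 1))"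
    if A: "rotation_bound \<theta> (expo N) A1" "rotation_bound \<theta> ((2 * real N + 4) / 3) A2" "rotation_bound \<theta> ((2 * real N + 6) / 3) A3"
    for A1 A2 A3
  proof -
    obtain \<alpha>1 \<beta>1 where 1: "\<alpha>1 + \<beta>1 = \<theta>" "\<bar>\<alpha>1\<bar> < pi / 2" "\<bar>\<beta>1\<bar> < pi / 2" "\<theta> = 0 \<Longrightarrow> \<alpha>1 = 0" "c_factor \<beta>1 / cos \<alpha>1 powr (expo N) \<le> A1"
      using A(1) unfolding rotation_bound_def by blast
    obtain \<alpha>2 \<beta>2 where 2: "\<alpha>2 + \<beta>2 = \<theta>" "\<bar>\<alpha>2\<bar> < pi / 2" "\<bar>\<beta>2\<bar> < pi / 2" "\<theta> = 0 \<Longrightarrow> \<alpha>2 = 0" "c_factor \<beta>2 / cos \<alpha>2 powr ((2 * real N + 4) / 3) \<le> A2"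
      using A(2) unfolding rotation_bound_def by blast
    obtain \<alpha>3 \<beta>3 where 3: "\<alpha>3 + \<beta>3 = \<theta>" "\<bar>\<alpha>3\<bar> < pi / 2" "\<bar>\<beta>3\<bar> < pi / 2" "\<theta> = 0 \<Longrightarrow> \<alpha>3 = 0" "c_factor \<beta>3 / cos \<alpha>3 powr ((2 * real N + 6) / 3) \<le> A3"
      using A(3) unfolding rotation_bound_def by blast
    note \<nu>1 = \<nu>[folded 1(1)] and \<nu>2 = \<nu>[folded 2(1)]
    have z: "\<alpha>1 + \<beta>1 = 0 \<Longrightarrow> \<alpha>1 = 0" "\<alpha>2 + \<beta>2 = 0 \<Longrightarrow> \<alpha>2 = 0" "\<alpha>3 + \<beta>3 = 0 \<Longrightarrow> \<alpha>3 = 0"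
      using 1 2 3 by auto
    show ?thesis
    proof (intro conjI impI)
      assume "N mod 3 = 0"
      from remainder_Y'_bound_0_2(1)[OF r 1(2,3) z(1) N this, folded \<nu>1]
      show "?R \<le> A1 * ?d N" using mult_right_mono[OF 1(5) d[OF N]] by simp
    next
      assume "N mod 3 = 1"
      from remainder_Y'_bound_1[OF r 1(2,3) z(1) 3(2,3) z(3) 1(1) 3(1) this, folded \<nu>]
      show "?R \<le> A1 * ?d N + A3 * ?d (N + 2)"
        by (rule order_trans[OF _ add_mono[OF mult_right_mono[OF 1(5) d[OF N]] mult_right_mono[OF 3(5) d]]]) simp_all
    next
      assume "N mod 3 = 2"
      from remainder_Y'_bound_0_2(2)[OF r 2(2,3) z(2) N this, folded \<nu>2]
      show "?R \<le> A2 * ?d (N + 1)" using mult_right_mono[OF 2(5) d[of "N + 1"]] by simp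
    qed
  qed
  have i: "(N mod 3 = 0 \<longrightarrow> ?R \<le> ?d N * c_factor \<theta>) \<and>
      (N mod 3 = 1 \<longrightarrow> ?R \<le> (d_coeff N \<nu> + d_coeff (N + 2) \<nu>) / (2 * pi) * c_factor \<theta>) \<and>
      (N mod 3 = 2 \<longrightarrow> ?R \<le> ?d (N + 1) * c_factor \<theta>)" if "\<bar>\<theta>\<bar> < pi / 2"
    using G[OF rotation_bound_half_plane rotation_bound_half_plane rotation_bound_half_plane, OF that that that]
    by (simp only: add_divide_distrib distrib_left mult.commute[of "c_factor \<theta>"] distrib_right)
  \<comment> \<open>The numbers under the roots in (iv) are a + 3 / 2 for the three exponents a,
    with the common denominator 3 taken out.\<close>
  have e: "exp 1 * (expo N + 3 / 2) = exp 1 / 3 * (2 * real N + 13 / 2)"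
    "exp 1 * ((2 * real N + 4) / 3 + 3 / 2) = exp 1 / 3 * (2 * real N + 17 / 2)"
    "exp 1 * ((2 * real N + 6) / 3 + 3 / 2) = exp 1 / 3 * (2 * real N + 21 / 2)" by (simp_all add: field_simps)
  have iv: "rotation_bound \<theta> a (1 / 2 * sqrt (exp 1 * (a + 3 / 2)))" if "pi / 4 < \<bar>\<theta>\<bar>" "\<bar>\<theta>\<bar> \<le> pi / 2" "a > 0" for a
    by (rule rotation_bound_abs[OF rotation_choice_pos[OF that]])
  have iv': "rotation_bound \<theta> (expo N) (1 / 2 * sqrt (exp 1 / 3 * (2 * real N + 13 / 2)))"
    "rotation_bound \<theta> ((2 * real N + 4) / 3) (1 / 2 * sqrt (exp 1 / 3 * (2 * real N + 17 / 2)))"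
    "rotation_bound \<theta> ((2 * real N + 6) / 3) (1 / 2 * sqrt (exp 1 / 3 * (2 * real N + 21 / 2)))"
    if "pi / 4 < \<bar>\<theta>\<bar>" "\<bar>\<theta>\<bar> \<le> pi / 2"
    unfolding e[symmetric] by (rule iv[OF that], simp)+
  have iii: "\<exists>!\<phi>. is_phi1 N \<theta> \<phi>" "\<exists>!\<phi>. is_phi2 N \<theta> \<phi>" "\<exists>!\<phi>. is_phi3 N \<theta> \<phi>"
    if "pi / 4 < \<bar>\<theta>\<bar>" "\<bar>\<theta>\<bar> < pi"
    unfolding is_phi_iff by (rule saddle_eq_unique[OF that], use N in simp)+
  have I: "\<phi>1 \<in> I_interval \<theta>" "\<phi>2 \<in> I_interval \<theta>" "\<phi>3 \<in> I_interval \<theta>" if "is_phi1 N \<theta> \<phi>1 \<and> is_phi2 N \<theta> \<phi>2 \<and> is_phi3 N \<theta> \<phi>3" for \<phi>1 \<phi>2 \<phi>3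
    using that unfolding is_phi_iff by auto
  have ii: "of_real (Re \<nu>) = \<nu>" if "\<nu> \<in> \<real>" using that by (rule of_real_Re)
  show ?thesis
    apply (rule conjI[OF _ conjI[OF _ conjI]]; rule impI)
       apply (erule i)
      apply (erule conjE)
      subgoal premises that
        using remainder_Y'_real_mean[OF that(2) N] bessel_Y'_lower_bound[OF that(2)] unfolding ii[OF that(1)] by blast
     apply (erule conjE, rule conjI, erule (1) iii(1), rule conjI, erule (1) iii(2), rule conjI, erule (1) iii(3))
     apply (intro allI impI G; rule rotation_bound_I_interval; (assumption | erule I))
    apply (elim conjE, rule G; erule (1) iv')
    done
qed

end
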